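(* Set $s^{(2)}_*=-\frac{3}{\sqrt{10}}$ and $s^{(1)}_*=-\frac{1}{\sqrt2}$. For each $i\in\{1,2\}$ there exists a continuous 1-parameter family of forward complete $\mathrm{Spin}(7)$ metrics $$\left\{\gamma^{(i)}_{(s_1,s_2)}\ \middle|\ (s_1,s_2)\in\mathbb{S}^1,\ s_1\geq s^{(i)}_*,\ s_2>0\right\}$$ on $M^{(i)}_{1,1}$. The $\mathrm{Spin}(7)$ metrics $\gamma^{(2)}_{(s_1,s_2)}$ on $M^{(2)}_{1,1}$ and the $\mathrm{Spin}(7)$ metrics $\gamma^{(1)}_{(s_1,s_2)}$ on $M^{(1)}_{1,1}$ have opposite chiralities. For $i\in\{1,2\}$, if $s_1>s^{(i)}_*$ then $\gamma^{(i)}_{(s_1,s_2)}$ has ALC asymptotics with space at infinity an $\mathbb{S}^1$ bundle over the $G_2$ cone over the nearly-K\"ahler $SU(3)/T^2$; if $s_1=s^{(i)}_*$, then $\gamma^{(i)}_{(s_1,s_2)}$ has AC asymptotics with tangent cone at infinity a cone whose base is a homogeneous Einstein metric on $N_{1,1}$.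
   Context: Here $N_{1,1}=SU(3)/U(1)_{1,1}$ with $U(1)_{1,1}=\{\mathrm{diag}(e^{\sqrt{-1}t},e^{\sqrt{-1}t},e^{-2\sqrt{-1}t})\}$. With $E_{pq}$ the matrix units, let $e_1=E_{12}-E_{21}$, $e_2=\sqrt{-1}(E_{12}+E_{21})$, $e_3=E_{13}-E_{31}$, $e_4=\sqrt{-1}(E_{13}+E_{31})$, $e_5=E_{23}-E_{32}$, $e_6=\sqrt{-1}(E_{23}+E_{32})$, $e_7=\sqrt{-1}\,\mathrm{diag}(3,-3,0)$, $e_8=\sqrt{-1}\,\mathrm{diag}(1,1,-2)$, so $e_8$ spans $\mathfrak u(1)_{1,1}$. The spaces $M^{(i)}_{1,1}$. $M^{(i)}_{1,1}$ is the $SU(3)$-cohomogeneity one $\mathbb{R}^4/\mathbb{Z}_{i}$ bundle over $\mathbb{CP}^2$ with principal orbit $N_{1,1}$ and singular orbit $\mathbb{CP}^2=SU(3)/K^{(i)}$, where $K^{(i)}$ is the connected subgroup with Lie algebra $\mathrm{span}\{e_7,e_8\}\oplus\mathfrak p^{(i)}$, with $\mathfrak p^{(2)}=\mathrm{span}\{e_1,e_2\}$ and $\mathfrak p^{(1)}=\mathrm{span}\{e_5,e_6\}$. Metrics. We consider $g=dt^2+g_{N_{1,1}}(t)$, where $g_{N_{1,1}}(t)$ is the $SU(3)$-invariant metric on $N_{1,1}$ for which $e_1,\dots,e_7$ are orthogonal with squared lengths $a^2,a^2,b^2,b^2,c^2,c^2,f^2$, with $a,b,c,f>0$ functions of $t>0$.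 Such $g$ is called a $\mathrm{Spin}(7)$ metric if, for one of the two signs $\epsilon=\pm1$ (the chirality), $$\frac{\dot a}{a}=\frac{b}{ac}+\frac{c}{ab}-\frac{a}{bc}-\frac{\epsilon}{3}\frac{f}{a^2},\quad \frac{\dot b}{b}=\frac{c}{ab}+\frac{a}{bc}-\frac{b}{ac}+\frac{\epsilon}{6}\frac{f}{b^2},\quad \frac{\dot c}{c}=\frac{a}{bc}+\frac{b}{ac}-\frac{c}{ab}+\frac{\epsilon}{6}\frac{f}{c^2},$$ $$\frac{\dot f}{f}=\epsilon\left(\frac13\frac{f}{a^2}-\frac16\frac{f}{b^2}-\frac16\frac{f}{c^2}\right).$$ On $M^{(2)}_{1,1}$ one requires $\lim_{t\to0}(a,b,c,f,\dot a,\dot b,\dot c,\dot f)=(0,a_0,a_0,0,1,0,0,3)$ for some $a_0>0$; on $M^{(1)}_{1,1}$ one requires this limit to be $(c_0,c_0,0,0,0,0,1,6)$ for some $c_0>0$. The metric is forward complete if it is defined for all $t\in(0,\infty)$. The parametrization. Let $\mathrm{tr}L=2\frac{\dot a}{a}+2\frac{\dot b}{b}+2\frac{\dot c}{c}+\frac{\dot f}{f}$, $d\eta=\mathrm{tr}L\,dt$, and $X_1=\frac{\dot a/a}{\mathrm{tr}L}$, $X_2=\frac{\dot b/b}{\mathrm{tr}L}$, $X_3=\frac{\dot c/c}{\mathrm{tr}L}$, $X_4=\frac{\dot f/f}{\mathrm{tr}L}$, $Z_1=\frac{a/(bc)}{\mathrm{tr}L}$, $Z_2=\frac{b/(ac)}{\mathrm{tr}L}$,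 $Z_3=\frac{c/(ab)}{\mathrm{tr}L}$, $Z_4=f\,\mathrm{tr}L$. Then $\gamma^{(i)}_{(s_1,s_2)}$ denotes the $\mathrm{Spin}(7)$ metric (up to homothety) for which, for some $\delta>0$ and a suitable choice of the additive constant in $\eta$, $$(X_1,\dots,X_4,Z_1,\dots,Z_4)(\eta)=P_0^{(i)}+e^{2\eta/3}(s_1v_1+s_2v_2)+O\big(e^{(2/3+\delta)\eta}\big)\quad(\eta\to-\infty),$$ where for $i=2$: $P_0^{(2)}=(\frac13,0,0,\frac13,0,\frac13,\frac13,9)$, $v_1=(2,0,0,-4,0,-1,-1,-54)$, $v_2=(-6,9,9,-24,6,-9,-9,0)$; for $i=1$: $P_0^{(1)}=(0,0,\frac13,\frac13,\frac13,\frac13,0,18)$, $v_1=(0,0,2,-4,-1,-1,0,-108)$, $v_2=(6,3,-3,-12,-3,-6,3,0)$. Asymptotics. ALC with space at infinity an $\mathbb{S}^1$ bundle over the $G_2$ cone over the nearly-K\"ahler $SU(3)/T^2$: as $t\to\infty$, $a,b,c$ grow linearly with $dt^2$ plus the $(a,b,c)$-part of the metric asymptotic to the Riemannian cone (with holonomy $G_2$) over the homogeneous nearly-K\"ahler metric on $SU(3)/T^2$ (the one with $a=b=c$), while $f$ converges to a positive constant. AC (asymptotically conical): as $t\to\infty$ all of $a,b,c,f$ grow linearly and the metric is asymptotic to an 8-dimensional cone $dt^2+t^2g_E$ over $N_{1,1}$. *)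

theory Defs
  imports "HOL-Analysis.Analysis" "HOL-Library.Landau_Symbols"
begin

section \<open>The Lie algebra su(3)\<close>

type_synonym mat3 = "complex^3^3"

definition mat_unit :: "3 \<Rightarrow> 3 \<Rightarrow> mat3" where
  "mat_unit p q = (\<chi> i j. if i = p \<and> j = q then 1 else 0)"

definition cscale :: "complex \<Rightarrow> mat3 \<Rightarrow> mat3" where
  "cscale z A = (\<chi> i j. z * A $ i $ j)"

definition diag3 :: "complex \<Rightarrow> complex \<Rightarrow> complex \<Rightarrow> mat3" where
  "diag3 x y z = cscale x (mat_unit 1 1) + cscale y (mat_unit 2 2) + cscale z (mat_unit 3 3)"

text \<open>The basis is meaningful for the indices 1 to 8 only.\<close>

definition su3_basis :: "nat \<Rightarrow> mat3" where
  "su3_basis k =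
     [mat_unit 1 2 - mat_unit 2 1, cscale \<i> (mat_unit 1 2 + mat_unit 2 1),
      mat_unit 1 3 - mat_unit 3 1, cscale \<i> (mat_unit 1 3 + mat_unit 3 1),
      mat_unit 2 3 - mat_unit 3 2, cscale \<i> (mat_unit 2 3 + mat_unit 3 2),
      cscale \<i> (diag3 3 (-3) 0), cscale \<i> (diag3 1 1 (-2))] ! (k - 1)"

definition su3 :: "mat3 set" where
  "su3 = span (su3_basis ` {1..8})"

definition bracket :: "mat3 \<Rightarrow> mat3 \<Rightarrow> mat3" where
  "bracket A B = A ** B - B ** A"

text \<open>The real inner product of \<^typ>\<open>complex^3^3\<close> is \<open>Re (tr (A\<^sup>* B))\<close>. The basis is orthogonal
  for it, so the following is the coefficient of the k-th basis element.\<close>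

definition coord :: "nat \<Rightarrow> mat3 \<Rightarrow> real" where
  "coord k A = (A \<bullet> su3_basis k) / (su3_basis k \<bullet> su3_basis k)"

section \<open>Invariant metrics on homogeneous spaces of SU(3)\<close>

text \<open>The parameter \<open>n\<close> selects the reductive decomposition of su(3) into the isotropy algebra
  spanned by the basis elements with index greater than \<open>n\<close> and the tangent space spanned by those
  with index at most \<open>n\<close>: \<open>n = 7\<close> is \<open>N\<^sub>1\<^sub>,\<^sub>1 = SU(3)/U(1)\<^sub>1\<^sub>,\<^sub>1\<close> and \<open>n = 6\<close> is the flag manifold
  \<open>SU(3)/T\<^sup>2\<close>. A diagonal metric is given by the squared lengths \<open>q k\<close> of the basis elements.\<close>

definition tangent :: "nat \<Rightarrow> mat3 set" where
  "tangent n = span (su3_basis ` {1..n})"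

definition isotropy :: "nat \<Rightarrow> mat3 set" where
  "isotropy n = span (su3_basis ` {n<..8})"

definition tangent_part :: "nat \<Rightarrow> mat3 \<Rightarrow> mat3" where
  "tangent_part n A = (\<Sum>k=1..n. coord k A *\<^sub>R su3_basis k)"

definition isotropy_part :: "nat \<Rightarrow> mat3 \<Rightarrow> mat3" where
  "isotropy_part n A = (\<Sum>k\<in>{n<..8}. coord k A *\<^sub>R su3_basis k)"

definition metric_ip :: "nat \<Rightarrow> (nat \<Rightarrow> real) \<Rightarrow> mat3 \<Rightarrow> mat3 \<Rightarrow> real" where
  "metric_ip n q A B = (\<Sum>k=1..n. q k * coord k A * coord k B)"

text \<open>Both isotropy groups are connected, so invariance can be stated for the isotropy algebra.\<close>

definition invariant_metric :: "nat \<Rightarrow> (nat \<Rightarrow> real) \<Rightarrow> bool" where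
  "invariant_metric n q \<longleftrightarrow>
     (\<forall>k\<in>{1..n}. q k > 0) \<and>
     (\<forall>A\<in>isotropy n. \<forall>X\<in>tangent n. \<forall>Y\<in>tangent n.
        metric_ip n q (bracket A X) Y + metric_ip n q X (bracket A Y) = 0)"

text \<open>The Levi-Civita connection of an invariant metric, as a linear map from su(3) into the
  endomorphisms of the tangent space (Nomizu; Kobayashi-Nomizu, vol. II, chapter X). On tangent
  vectors it is \<open>A \<mapsto> [A,X]/2 + U(A,X)\<close> (tangential part), where
  \<open>2\<langle>U(A,X),Y\<rangle> = \<langle>[Y,A],X\<rangle> + \<langle>A,[Y,X]\<rangle>\<close>, and on the isotropy algebra it is the isotropy
  representation.\<close>

definition levi_civita :: "nat \<Rightarrow> (nat \<Rightarrow> real) \<Rightarrow> mat3 \<Rightarrow> mat3 \<Rightarrow> mat3" where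
  "levi_civita n q A X =
     (let A' = tangent_part n A in
        (1/2) *\<^sub>R tangent_part n (bracket A' X)
        + (\<Sum>k=1..n. ((metric_ip n q (bracket (su3_basis k) A') X
                       + metric_ip n q A' (bracket (su3_basis k) X)) / (2 * q k)) *\<^sub>R su3_basis k)
        + bracket (isotropy_part n A) X)"

definition curvature :: "nat \<Rightarrow> (nat \<Rightarrow> real) \<Rightarrow> mat3 \<Rightarrow> mat3 \<Rightarrow> mat3 \<Rightarrow> mat3" where
  "curvature n q A B X =
     levi_civita n q A (levi_civita n q B X) - levi_civita n q B (levi_civita n q A X)
     - levi_civita n q (bracket A B) X"

definition ricci :: "nat \<Rightarrow> (nat \<Rightarrow> real) \<Rightarrow> mat3 \<Rightarrow> mat3 \<Rightarrow> real" where
  "ricci n q X Y = (\<Sum>k=1..n. coord k (curvature n q (su3_basis k) X Y))"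

definition homogeneous_einstein :: "nat \<Rightarrow> (nat \<Rightarrow> real) \<Rightarrow> bool" where
  "homogeneous_einstein n q \<longleftrightarrow> invariant_metric n q \<and>
     (\<exists>l. \<forall>X\<in>tangent n. \<forall>Y\<in>tangent n. ricci n q X Y = l * metric_ip n q X Y)"

text \<open>Homogeneous strictly nearly Kaehler structures: an invariant orthogonal almost complex
  structure with \<open>(\<nabla>\<^sub>X J) X = 0\<close> that is not parallel.\<close>

definition homogeneous_nearly_kaehler :: "nat \<Rightarrow> (nat \<Rightarrow> real) \<Rightarrow> bool" where
  "homogeneous_nearly_kaehler n q \<longleftrightarrow> invariant_metric n q \<and>
     (\<exists>J. linear J \<and> J ` tangent n \<subseteq> tangent n
        \<and> (\<forall>X\<in>tangent n. J (J X) = - X)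
        \<and> (\<forall>X\<in>tangent n. \<forall>Y\<in>tangent n. metric_ip n q (J X) (J Y) = metric_ip n q X Y)
        \<and> (\<forall>A\<in>isotropy n. \<forall>X\<in>tangent n. J (bracket A X) = bracket A (J X))
        \<and> (\<forall>X\<in>tangent n. levi_civita n q X (J X) = J (levi_civita n q X X))
        \<and> (\<exists>X\<in>tangent n. \<exists>Y\<in>tangent n. levi_civita n q X (J Y) \<noteq> J (levi_civita n q X Y)))"

section \<open>Holonomy of Riemannian cones over homogeneous spaces\<close>

text \<open>In the cone \<open>dt\<^sup>2 + t\<^sup>2 g\<close>, write \<open>(u, X)\<close> for the tangent vector \<open>u \<partial>\<^sub>t + X/t\<close>. Since
  \<open>\<nabla>\<^sub>A \<partial>\<^sub>t = A/t\<close>, \<open>\<nabla>\<^sub>A (X/t) = (\<nabla>\<^sup>g\<^sub>A X)/t - g(A,X) \<partial>\<^sub>t\<close>, and \<open>\<partial>\<^sub>t\<close>, \<open>X/t\<close> are parallel along rays, the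
  Levi-Civita connection of the cone is the pullback of the following invariant connection on the
  base.\<close>

definition cone_tangent :: "nat \<Rightarrow> (real \<times> mat3) set" where
  "cone_tangent n = UNIV \<times> tangent n"

definition cone_ip :: "nat \<Rightarrow> (nat \<Rightarrow> real) \<Rightarrow> real \<times> mat3 \<Rightarrow> real \<times> mat3 \<Rightarrow> real" where
  "cone_ip n q x y = fst x * fst y + metric_ip n q (snd x) (snd y)"

definition cone_connection ::
    "nat \<Rightarrow> (nat \<Rightarrow> real) \<Rightarrow> mat3 \<Rightarrow> real \<times> mat3 \<Rightarrow> real \<times> mat3" where
  "cone_connection n q A x =
     (- metric_ip n q A (snd x), levi_civita n q A (snd x) + fst x *\<^sub>R tangent_part n A)"

text \<open>The Lie algebra of the holonomy group of an invariant connection is spanned by the curvature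
  endomorphisms and their iterated commutators with the connection (Nomizu-Wang; loc. cit.). Its
  elements matter only through their restriction to \<^const>\<open>cone_tangent\<close>. The spaces here
  are simply connected, so the Lie algebra determines the holonomy group.\<close>

inductive_set cone_holonomy :: "nat \<Rightarrow> (nat \<Rightarrow> real) \<Rightarrow> (real \<times> mat3 \<Rightarrow> real \<times> mat3) set"
  for n :: nat and q :: "nat \<Rightarrow> real" where
  curv: "\<lbrakk>A \<in> su3; B \<in> su3\<rbrakk> \<Longrightarrow>
    (\<lambda>x. cone_connection n q A (cone_connection n q B x)
       - cone_connection n q B (cone_connection n q A x)
       - cone_connection n q (bracket A B) x) \<in> cone_holonomy n q"
| add: "\<lbrakk>S \<in> cone_holonomy n q; T \<in> cone_holonomy n q\<rbrakk> \<Longrightarrow> (\<lambda>x. S x + T x) \<in> cone_holonomy n q"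
| scale: "T \<in> cone_holonomy n q \<Longrightarrow> (\<lambda>x. r *\<^sub>R T x) \<in> cone_holonomy n q"
| commutator: "\<lbrakk>A \<in> su3; T \<in> cone_holonomy n q\<rbrakk> \<Longrightarrow>
    (\<lambda>x. cone_connection n q A (T x) - T (cone_connection n q A x)) \<in> cone_holonomy n q"

definition det_minor ::
    "nat \<Rightarrow> nat \<Rightarrow> nat \<Rightarrow> (nat \<Rightarrow> real) \<Rightarrow> (nat \<Rightarrow> real) \<Rightarrow> (nat \<Rightarrow> real) \<Rightarrow> real" where
  "det_minor i j k x y z =
     x i * (y j * z k - y k * z j) - x j * (y i * z k - y k * z i) + x k * (y i * z j - y j * z i)"

text \<open>The standard 3-form on R\<open>\<^sup>7\<close> whose stabilizer is the compact group \<open>G\<^sub>2\<close>.\<close>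

definition g2_form :: "(nat \<Rightarrow> real) \<Rightarrow> (nat \<Rightarrow> real) \<Rightarrow> (nat \<Rightarrow> real) \<Rightarrow> real" where
  "g2_form x y z =
     det_minor 1 2 3 x y z + det_minor 1 4 5 x y z + det_minor 1 6 7 x y z + det_minor 2 4 6 x y z
     - det_minor 2 5 7 x y z - det_minor 3 4 7 x y z - det_minor 3 5 6 x y z"

text \<open>The cone over the metric \<open>q\<close> on \<open>SU(3)/T\<^sup>2\<close> has holonomy equal to \<open>G\<^sub>2\<close>: in some orthonormal
  frame \<open>F\<close>, the holonomy algebra is the whole stabilizer algebra of the standard form.\<close>

definition cone_has_holonomy_G2 :: "(nat \<Rightarrow> real) \<Rightarrow> bool" where
  "cone_has_holonomy_G2 q \<longleftrightarrow>
     (\<exists>F :: nat \<Rightarrow> real \<times> mat3.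
        (\<forall>i\<in>{1..7}. F i \<in> cone_tangent 6)
      \<and> (\<forall>i\<in>{1..7}. \<forall>j\<in>{1..7}. cone_ip 6 q (F i) (F j) = (if i = j then 1 else 0))
      \<and> (let \<phi> = (\<lambda>x y z. g2_form (\<lambda>i. cone_ip 6 q (F i) x) (\<lambda>i. cone_ip 6 q (F i) y)
                                   (\<lambda>i. cone_ip 6 q (F i) z))
         in \<forall>T. linear T \<and> T ` cone_tangent 6 \<subseteq> cone_tangent 6 \<longrightarrow>
              ((\<exists>S\<in>cone_holonomy 6 q. \<forall>x\<in>cone_tangent 6. S x = T x) \<longleftrightarrow>
               (\<forall>x\<in>cone_tangent 6. \<forall>y\<in>cone_tangent 6. \<forall>z\<in>cone_tangent 6.
                  \<phi> (T x) y z + \<phi> x (T y) z + \<phi> x y (T z) = 0))))"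

section \<open>Cohomogeneity one Spin(7) metrics\<close>

text \<open>The metric \<open>dt\<^sup>2 + g(t)\<close> is given by the tuple of functions \<open>(a, b, c, f)\<close>; their values
  outside the interval \<open>(0, T)\<close> under consideration are irrelevant.\<close>

type_synonym coh1_metric =
  "(real \<Rightarrow> real) \<times> (real \<Rightarrow> real) \<times> (real \<Rightarrow> real) \<times> (real \<Rightarrow> real)"

definition time_interval :: "ereal \<Rightarrow> real set" where
  "time_interval T = {t. 0 < t \<and> ereal t < T}"

fun metric_at :: "coh1_metric \<Rightarrow> real \<Rightarrow> real \<times> real \<times> real \<times> real" where
  "metric_at (a, b, c, f) t = (a t, b t, c t, f t)"

fun sq_length :: "coh1_metric \<Rightarrow> real \<Rightarrow> nat \<Rightarrow> real" where
  "sq_length (a, b, c, f) t k =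
     [(a t)\<^sup>2, (a t)\<^sup>2, (b t)\<^sup>2, (b t)\<^sup>2, (c t)\<^sup>2, (c t)\<^sup>2, (f t)\<^sup>2] ! (k - 1)"

fun jet1 ::
  "coh1_metric \<Rightarrow> real \<Rightarrow> real \<times> real \<times> real \<times> real \<times> real \<times> real \<times> real \<times> real" where
  "jet1 (a, b, c, f) t = (a t, b t, c t, f t, deriv a t, deriv b t, deriv c t, deriv f t)"

text \<open>The 1-jet, continued to the singular orbit \<open>t = 0\<close>.\<close>

definition extended_jet1 ::
  "coh1_metric \<Rightarrow> real \<Rightarrow> real \<times> real \<times> real \<times> real \<times> real \<times> real \<times> real \<times> real" where
  "extended_jet1 g t = (if t = 0 then Lim (at_right 0) (jet1 g) else jet1 g t)"

text \<open>The first-order system defining Spin(7) metrics in this class (it expresses that the invariant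
  Cayley form is parallel). \<open>\<epsilon>\<close> is the chirality, and \<open>T = \<infinity>\<close> expresses forward completeness.\<close>

fun spin7_metric :: "real \<Rightarrow> ereal \<Rightarrow> coh1_metric \<Rightarrow> bool" where
  "spin7_metric \<epsilon> T (a, b, c, f) \<longleftrightarrow> \<epsilon> \<in> {1, -1} \<and>
     (\<forall>t\<in>time_interval T. a t > 0 \<and> b t > 0 \<and> c t > 0 \<and> f t > 0
       \<and> a differentiable (at t) \<and> b differentiable (at t)
       \<and> c differentiable (at t) \<and> f differentiable (at t)
       \<and> deriv a t / a t = b t / (a t * c t) + c t / (a t * b t) - a t / (b t * c t)
                           - \<epsilon> / 3 * (f t / (a t)\<^sup>2)
       \<and> deriv b t / b t = c t / (a t * b t) + a t / (b t * c t) - b t / (a t * c t)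
                           + \<epsilon> / 6 * (f t / (b t)\<^sup>2)
       \<and> deriv c t / c t = a t / (b t * c t) + b t / (a t * c t) - c t / (a t * b t)
                           + \<epsilon> / 6 * (f t / (c t)\<^sup>2)
       \<and> deriv f t / f t = \<epsilon> * (1/3 * (f t / (a t)\<^sup>2) - 1/6 * (f t / (b t)\<^sup>2)
                                - 1/6 * (f t / (c t)\<^sup>2)))"

text \<open>The condition at the singular orbit of \<open>M\<^sup>(\<^sup>i\<^sup>)\<^sub>1\<^sub>,\<^sub>1\<close>, for \<open>i\<close> equal to 1 or 2.\<close>

definition closes_up_on_M :: "nat \<Rightarrow> coh1_metric \<Rightarrow> bool" where
  "closes_up_on_M i g \<longleftrightarrow>
     (\<exists>r>0. (jet1 g \<longlongrightarrow> (if i = 2 then (0, r, r, 0, 1, 0, 0, 3) else (r, r, 0, 0, 0, 0, 1, 6)))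
              (at_right 0))"

fun trL :: "coh1_metric \<Rightarrow> real \<Rightarrow> real" where
  "trL (a, b, c, f) t =
     2 * (deriv a t / a t) + 2 * (deriv b t / b t) + 2 * (deriv c t / c t) + deriv f t / f t"

fun XZ :: "coh1_metric \<Rightarrow> real \<Rightarrow>
    real \<times> real \<times> real \<times> real \<times> real \<times> real \<times> real \<times> real" where
  "XZ (a, b, c, f) t =
     (let L = trL (a, b, c, f) t in
       (deriv a t / a t / L, deriv b t / b t / L, deriv c t / c t / L, deriv f t / f t / L,
        a t / (b t * c t) / L, b t / (a t * c t) / L, c t / (a t * b t) / L, f t * L))"

definition P0 :: "nat \<Rightarrow> real \<times> real \<times> real \<times> real \<times> real \<times> real \<times> real \<times> real" where
  "P0 i = (if i = 2 then (1/3, 0, 0, 1/3, 0, 1/3, 1/3, 9) else (0, 0, 1/3, 1/3, 1/3, 1/3, 0, 18))"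

definition v1 :: "nat \<Rightarrow> real \<times> real \<times> real \<times> real \<times> real \<times> real \<times> real \<times> real" where
  "v1 i = (if i = 2 then (2, 0, 0, -4, 0, -1, -1, -54) else (0, 0, 2, -4, -1, -1, 0, -108))"

definition v2 :: "nat \<Rightarrow> real \<times> real \<times> real \<times> real \<times> real \<times> real \<times> real \<times> real" where
  "v2 i = (if i = 2 then (-6, 9, 9, -24, 6, -9, -9, 0) else (6, 3, -3, -12, -3, -6, 3, 0))"

text \<open>The change of variable \<open>\<eta>\<close> is a primitive of \<^const>\<open>trL\<close>; as it is existentially quantified,
  its additive constant is free. The end \<open>\<eta> \<rightarrow> -\<infinity>\<close> is \<open>t \<rightarrow> 0\<close>.\<close>

definition gamma_expansion :: "nat \<Rightarrow> real \<times> real \<Rightarrow> ereal \<Rightarrow> coh1_metric \<Rightarrow> bool" where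
  "gamma_expansion i s T g \<longleftrightarrow>
     (\<exists>\<eta> \<delta>. \<delta> > 0
        \<and> (\<forall>t\<in>time_interval T. (\<eta> has_real_derivative trL g t) (at t))
        \<and> filterlim \<eta> at_bot (at_right 0)
        \<and> (\<lambda>t. norm (XZ g t - (P0 i + exp (2/3 * \<eta> t) *\<^sub>R (fst s *\<^sub>R v1 i + snd s *\<^sub>R v2 i))))
            \<in> O[at_right 0](\<lambda>t. exp ((2/3 + \<delta>) * \<eta> t)))"

definition is_gamma :: "nat \<Rightarrow> real \<times> real \<Rightarrow> ereal \<Rightarrow> coh1_metric \<Rightarrow> bool" where
  "is_gamma i s T g \<longleftrightarrow>
     (\<exists>\<epsilon>. spin7_metric \<epsilon> T g) \<and> closes_up_on_M i g \<and> gamma_expansion i s T g"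

text \<open>The metric \<open>h\<close> is, on \<open>(0, T)\<close>, a homothetic image of \<open>g\<close>: scaling \<open>dt\<^sup>2 + g(t)\<close> by \<open>\<mu>\<^sup>2\<close>
  rescales the arc length parameter \<open>t\<close> as well.\<close>

definition homothetic_on :: "ereal \<Rightarrow> coh1_metric \<Rightarrow> coh1_metric \<Rightarrow> bool" where
  "homothetic_on T g h \<longleftrightarrow>
     (\<exists>\<mu>>0. \<forall>t\<in>time_interval T. metric_at h t = \<mu> *\<^sub>R metric_at g (t / \<mu>))"

definition s_star :: "nat \<Rightarrow> real" where
  "s_star i = (if i = 2 then - 3 / sqrt 10 else - 1 / sqrt 2)"

definition parameters :: "nat \<Rightarrow> (real \<times> real) set" where
  "parameters i = {(s1, s2). (s1, s2) \<in> sphere 0 1 \<and> s1 \<ge> s_star i \<and> s2 > 0}"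

section \<open>Asymptotics\<close>

text \<open>The part of \<open>dt\<^sup>2 + g(t)\<close> given by \<open>dt\<^sup>2\<close> and the first \<open>n\<close> directions is asymptotic to the
  cone \<open>dt\<^sup>2 + t\<^sup>2 q\<close>. Both are diagonal in the same frame, so the difference tends to 0 in the norm of
  the cone if and only if the quotients of squared lengths tend to 1.\<close>

definition asymptotic_to_cone :: "nat \<Rightarrow> coh1_metric \<Rightarrow> (nat \<Rightarrow> real) \<Rightarrow> bool" where
  "asymptotic_to_cone n g q \<longleftrightarrow>
     (\<forall>k\<in>{1..n}. ((\<lambda>t. sq_length g t k / (t\<^sup>2 * q k)) \<longlongrightarrow> 1) at_top)"

text \<open>The nearly Kaehler metric on \<open>SU(3)/T\<^sup>2\<close> is the one with \<open>a = b = c\<close>; its scale is fixed by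
  the holonomy of the cone.\<close>

definition ALC_nearly_kaehler_flag :: "coh1_metric \<Rightarrow> bool" where
  "ALC_nearly_kaehler_flag g \<longleftrightarrow>
     (\<exists>r>0. homogeneous_nearly_kaehler 6 (\<lambda>_. r) \<and> cone_has_holonomy_G2 (\<lambda>_. r)
        \<and> asymptotic_to_cone 6 g (\<lambda>_. r))
     \<and> (\<exists>l>0. ((\<lambda>t. sqrt (sq_length g t 7)) \<longlongrightarrow> l) at_top)"

definition AC_over :: "coh1_metric \<Rightarrow> (nat \<Rightarrow> real) \<Rightarrow> bool" where
  "AC_over g q \<longleftrightarrow> invariant_metric 7 q \<and> asymptotic_to_cone 7 g q"

end

theory Submission
  imports Defs
begin

text \<open>Dividing out the scale turns the Spin(7) equations into an autonomous polynomial system for quotients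
  of \<open>a, b, c, f\<close>. At the singular orbit this system has an equilibrium with linearisation
  \<open>diag(1, 1, -2)\<close>, and the metrics that close up are the trajectories leaving it. With \<open>D\<close> the
  coordinates at the equilibrium, \<open>ln z\<close> the time of the system and \<open>D = z Y\<close>, such a trajectory solves
  \<open>Y' = G(z, Y) - (0, 0, 3 Y\<^sub>3/z)\<close>, \<open>Y(0) = p\<close>, a Volterra equation that can be solved by contraction,
  continuously in \<open>p\<close>; here \<open>p\<close> is a linear function of \<open>(s\<^sub>1, s\<^sub>2)\<close>. A Gronwall estimate at the
  equilibrium shows that conversely the expansion up to \<open>O(e\<^bsup>(2/3+\<delta>)\<eta>\<^esup>)\<close> determines the trajectory,
  hence the metric up to homothety.

  In both cases the quotient \<open>x\<close> that contains \<open>f\<close> equals 1 initially and stays at most 1 because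
  \<open>s\<^sub>1 \<ge> s\<^sub>*\<close>. For \<open>s\<^sub>1 = s\<^sub>*\<close> it is constant; these are the Bryant-Salamon and the Calabi metric,
  asymptotic to cones over the squashed and the 3-Sasakian Einstein metric on \<open>N\<^sub>1\<^sub>,\<^sub>1\<close>. For
  \<open>s\<^sub>1 > s\<^sub>*\<close> it decays to 0 like a negative power of \<open>z\<close>, so that \<open>a, b, c\<close> become equal while \<open>f\<close>
  increases to a finite limit.\<close>

section \<open>Coordinates on su(3)\<close>

text \<open>The third scaled equation \<open>Y3' + 3 Y3/z = G3\<close> says that
  \<open>z^3 Y3\<close> is the integral of \<open>r^3 G3\<close>. Substituting
  \<open>r = l z\<close> leaves a harmless factor \<open>l^3\<close> under an integral over a fixed
  interval, so the singularity disappears. The contraction needs a bounded, globally Lipschitz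
  field, but the fields are polynomial. They are therefore truncated, and invariant regions for the
  quotients of \<open>a, b, c, f\<close> show that the truncation is never active. The critical
  \<open>s_star\<close> is where the line on which the first component of \<open>p\<close> vanishes
  (\<open>s1 + 3 s2 = 0\<close>, respectively \<open>s1 + s2 = 0\<close>) meets the unit circle;
  beyond it \<open>x\<close> would start above 1. Uniqueness is delicate because the expansion
  leaves open the time function, the chirality and whether \<open>b = c\<close>. The sign of
  \<open>f'\<close> at the singular orbit fixes the chirality, and a monotone quantity gives
  \<open>b = c\<close>. Near the equilibrium, distances grow at a rate at most slightly above 1 in
  the time \<open>ln z\<close>. A difference of order \<open>z^(1+\<delta>)\<close>, as the
  expansion forces, is too small for such growth unless it vanishes.\<close>

definition su3_vec ::
  "real \<Rightarrow> real \<Rightarrow> real \<Rightarrow> real \<Rightarrow> real \<Rightarrow> real \<Rightarrow> real \<Rightarrow> real \<Rightarrow> mat3" where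
  "su3_vec x1 x2 x3 x4 x5 x6 x7 x8 = vector
     [vector [Complex 0 (3 * x7 + x8), Complex x1 x2, Complex x3 x4],
      vector [Complex (- x1) x2, Complex 0 (x8 - 3 * x7), Complex x5 x6],
      vector [Complex (- x3) x4, Complex (- x5) x6, Complex 0 (- 2 * x8)]]"

lemma three_neq: "(1::3) \<noteq> 2" "(2::3) \<noteq> 1" "(1::3) \<noteq> 3" "(3::3) \<noteq> 1" "(2::3) \<noteq> 3" "(3::3) \<noteq> 2"
  by auto

lemma su3_basis_eq:
  "su3_basis (Suc 0) = su3_vec 1 0 0 0 0 0 0 0" "su3_basis 1 = su3_vec 1 0 0 0 0 0 0 0"
  "su3_basis 2 = su3_vec 0 1 0 0 0 0 0 0"
  "su3_basis 3 = su3_vec 0 0 1 0 0 0 0 0" "su3_basis 4 = su3_vec 0 0 0 1 0 0 0 0"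
  "su3_basis 5 = su3_vec 0 0 0 0 1 0 0 0" "su3_basis 6 = su3_vec 0 0 0 0 0 1 0 0"
  "su3_basis 7 = su3_vec 0 0 0 0 0 0 1 0" "su3_basis 8 = su3_vec 0 0 0 0 0 0 0 1"
  by (simp_all add: su3_basis_def su3_vec_def vec_eq_iff forall_3 mat_unit_def cscale_def diag3_def
      three_neq complex_eq_iff)

lemma su3_vec_add: "su3_vec x1 x2 x3 x4 x5 x6 x7 x8 + su3_vec y1 y2 y3 y4 y5 y6 y7 y8 =
    su3_vec (x1+y1) (x2+y2) (x3+y3) (x4+y4) (x5+y5) (x6+y6) (x7+y7) (x8+y8)"
  by (simp add: su3_vec_def vec_eq_iff forall_3 complex_eq_iff)

lemma su3_vec_diff: "su3_vec x1 x2 x3 x4 x5 x6 x7 x8 - su3_vec y1 y2 y3 y4 y5 y6 y7 y8 =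
    su3_vec (x1-y1) (x2-y2) (x3-y3) (x4-y4) (x5-y5) (x6-y6) (x7-y7) (x8-y8)"
  by (simp add: su3_vec_def vec_eq_iff forall_3 complex_eq_iff)

lemma su3_vec_uminus: "- su3_vec x1 x2 x3 x4 x5 x6 x7 x8 =
    su3_vec (-x1) (-x2) (-x3) (-x4) (-x5) (-x6) (-x7) (-x8)"
  by (simp add: su3_vec_def vec_eq_iff forall_3 complex_eq_iff)

lemma su3_vec_scale: "r *\<^sub>R su3_vec x1 x2 x3 x4 x5 x6 x7 x8 =
    su3_vec (r*x1) (r*x2) (r*x3) (r*x4) (r*x5) (r*x6) (r*x7) (r*x8)"
  by (simp add: su3_vec_def vec_eq_iff forall_3 complex_eq_iff algebra_simps)

lemma su3_vec_inner: "su3_vec x1 x2 x3 x4 x5 x6 x7 x8 \<bullet> su3_vec y1 y2 y3 y4 y5 y6 y7 y8 =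
    2*x1*y1 + 2*x2*y2 + 2*x3*y3 + 2*x4*y4 + 2*x5*y5 + 2*x6*y6 + 18*x7*y7 + 6*x8*y8"
  by (simp add: su3_vec_def inner_vec_def sum_3 inner_complex_def algebra_simps)

lemma coord_su3_vec:
  "coord (Suc 0) (su3_vec x1 x2 x3 x4 x5 x6 x7 x8) = x1"
  "coord 1 (su3_vec x1 x2 x3 x4 x5 x6 x7 x8) = x1" "coord 2 (su3_vec x1 x2 x3 x4 x5 x6 x7 x8) = x2"
  "coord 3 (su3_vec x1 x2 x3 x4 x5 x6 x7 x8) = x3" "coord 4 (su3_vec x1 x2 x3 x4 x5 x6 x7 x8) = x4"
  "coord 5 (su3_vec x1 x2 x3 x4 x5 x6 x7 x8) = x5" "coord 6 (su3_vec x1 x2 x3 x4 x5 x6 x7 x8) = x6"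
  "coord 7 (su3_vec x1 x2 x3 x4 x5 x6 x7 x8) = x7" "coord 8 (su3_vec x1 x2 x3 x4 x5 x6 x7 x8) = x8"
  by (simp_all add: coord_def su3_basis_eq su3_vec_inner)

lemma su3_vec_eq_iff: "su3_vec x1 x2 x3 x4 x5 x6 x7 x8 = su3_vec y1 y2 y3 y4 y5 y6 y7 y8 \<longleftrightarrow>
    x1 = y1 \<and> x2 = y2 \<and> x3 = y3 \<and> x4 = y4 \<and> x5 = y5 \<and> x6 = y6 \<and> x7 = y7 \<and> x8 = y8"
  by (metis coord_su3_vec(2-9))

text \<open>With all structure constants in one formula, later connections and curvatures become
  polynomial arithmetic in coordinates. The thirds come from resolving diagonal matrices along
  \<open>e_7\<close> and \<open>e_8\<close>.\<close>

lemma bracket_su3_vec: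
  "bracket (su3_vec x1 x2 x3 x4 x5 x6 x7 x8) (su3_vec y1 y2 y3 y4 y5 y6 y7 y8) = su3_vec
    (6*x2*y7 - x3*y5 - x4*y6 + x5*y3 + x6*y4 - 6*x7*y2)
    (-(6)*x1*y7 + x3*y6 - x4*y5 + x5*y4 - x6*y3 + 6*x7*y1)
    (x1*y5 - x2*y6 + 3*x4*y7 + 3*x4*y8 - x5*y1 + x6*y2 - 3*x7*y4 - 3*x8*y4)
    (x1*y6 + x2*y5 - 3*x3*y7 - 3*x3*y8 - x5*y2 - x6*y1 + 3*x7*y3 + 3*x8*y3)
    (-x1*y3 - x2*y4 + x3*y1 + x4*y2 - 3*x6*y7 + 3*x6*y8 + 3*x7*y6 - 3*x8*y6)
    (-x1*y4 + x2*y3 - x3*y2 + x4*y1 + 3*x5*y7 - 3*x5*y8 - 3*x7*y5 + 3*x8*y5)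
    (2/3*x1*y2 - 2/3*x2*y1 + 1/3*x3*y4 - 1/3*x4*y3 - 1/3*x5*y6 + 1/3*x6*y5)
    (x3*y4 - x4*y3 + x5*y6 - x6*y5)"
  by (simp add: bracket_def su3_vec_def vec_eq_iff forall_3 sum_3 matrix_matrix_mult_def complex_eq_iff
      algebra_simps)

lemma sum_upto_6: "(\<Sum>k=1..6. g k) = g 1 + g 2 + g 3 + g 4 + g 5 + g (6::nat)"
  for g :: "nat \<Rightarrow> 'a::comm_monoid_add"
  by (simp add: numeral_eq_Suc add.assoc)

lemma sum_upto_7: "(\<Sum>k=1..7. g k) = g 1 + g 2 + g 3 + g 4 + g 5 + g 6 + g (7::nat)"
  for g :: "nat \<Rightarrow> 'a::comm_monoid_add"
  by (simp add: numeral_eq_Suc add.assoc)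

lemma atLeast1_atMost_6: "{1..6::nat} = {1,2,3,4,5,6}" by auto
lemma atLeast1_atMost_7: "{1..7::nat} = {1,2,3,4,5,6,7}" by auto
lemma greaterThan_6_atMost_8: "{6<..8::nat} = {7,8}" by auto
lemma greaterThan_7_atMost_8: "{7<..8::nat} = {8}" by auto
lemma atLeast1_atMost_8: "{1..8::nat} = {1,2,3,4,5,6,7,8}" by auto

lemma tangent_part_su3_vec:
  "tangent_part 7 (su3_vec x1 x2 x3 x4 x5 x6 x7 x8) = su3_vec x1 x2 x3 x4 x5 x6 x7 0"
  "tangent_part 6 (su3_vec x1 x2 x3 x4 x5 x6 x7 x8) = su3_vec x1 x2 x3 x4 x5 x6 0 0"
  unfolding tangent_part_def sum_upto_6 sum_upto_7
  by (simp_all add: coord_su3_vec su3_basis_eq su3_vec_scale su3_vec_add)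

lemma isotropy_part_su3_vec:
  "isotropy_part 7 (su3_vec x1 x2 x3 x4 x5 x6 x7 x8) = su3_vec 0 0 0 0 0 0 0 x8"
  "isotropy_part 6 (su3_vec x1 x2 x3 x4 x5 x6 x7 x8) = su3_vec 0 0 0 0 0 0 x7 x8"
  unfolding isotropy_part_def greaterThan_6_atMost_8 greaterThan_7_atMost_8
  by (simp_all add: coord_su3_vec su3_basis_eq su3_vec_scale su3_vec_add)

lemma metric_ip_su3_vec:
  "metric_ip 7 q (su3_vec x1 x2 x3 x4 x5 x6 x7 x8) (su3_vec y1 y2 y3 y4 y5 y6 y7 y8) =
    q 1*x1*y1 + q 2*x2*y2 + q 3*x3*y3 + q 4*x4*y4 + q 5*x5*y5 + q 6*x6*y6 + q 7*x7*y7"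
  "metric_ip 6 q (su3_vec x1 x2 x3 x4 x5 x6 x7 x8) (su3_vec y1 y2 y3 y4 y5 y6 y7 y8) =
    q 1*x1*y1 + q 2*x2*y2 + q 3*x3*y3 + q 4*x4*y4 + q 5*x5*y5 + q 6*x6*y6"
  unfolding metric_ip_def sum_upto_6 sum_upto_7
  by (simp_all add: coord_su3_vec)

text \<open>All spans below are coordinate subspaces. The flags \<open>b1\<close> to
  \<open>b8\<close> mark the coordinates forced to zero, so one closure proof serves
  \<open>su3\<close>, the tangent spaces and the isotropy algebras.\<close>

lemma subspace_su3_vecI:
  assumes "S = {su3_vec x1 x2 x3 x4 x5 x6 x7 x8 | x1 x2 x3 x4 x5 x6 x7 x8.
      (b1 \<longrightarrow> x1 = 0) \<and> (b2 \<longrightarrow> x2 = 0) \<and> (b3 \<longrightarrow> x3 = 0) \<and> (b4 \<longrightarrow> x4 = 0) \<and>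
      (b5 \<longrightarrow> x5 = 0) \<and> (b6 \<longrightarrow> x6 = 0) \<and> (b7 \<longrightarrow> x7 = 0) \<and> (b8 \<longrightarrow> x8 = 0)}"
  shows "subspace S"
proof -
  have zero: "(0::mat3) = su3_vec 0 0 0 0 0 0 0 0"
    by (simp add: su3_vec_def vec_eq_iff forall_3 complex_eq_iff)
  have "0 \<in> S" unfolding assms zero by blast
  moreover have "x + y \<in> S" if "x \<in> S" "y \<in> S" for x y
    using that unfolding assms by (clarsimp simp: su3_vec_add su3_vec_eq_iff)
  moreover have "c *\<^sub>R x \<in> S" if "x \<in> S" for x c
    using that unfolding assms by (clarsimp simp: su3_vec_scale su3_vec_eq_iff)
  ultimately show ?thesis by (auto simp: subspace_def)
qed

lemma su3_vec_eq_sum: "su3_vec x1 x2 x3 x4 x5 x6 x7 x8 =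
    x1 *\<^sub>R su3_basis 1 + x2 *\<^sub>R su3_basis 2 + x3 *\<^sub>R su3_basis 3 + x4 *\<^sub>R su3_basis 4 +
    x5 *\<^sub>R su3_basis 5 + x6 *\<^sub>R su3_basis 6 + x7 *\<^sub>R su3_basis 7 + x8 *\<^sub>R su3_basis 8"
  by (simp add: su3_basis_eq su3_vec_scale su3_vec_add)

lemma su3_vec_in_span:
  assumes "x1 \<noteq> 0 \<longrightarrow> 1 \<in> K" "x2 \<noteq> 0 \<longrightarrow> 2 \<in> K" "x3 \<noteq> 0 \<longrightarrow> 3 \<in> K" "x4 \<noteq> 0 \<longrightarrow> 4 \<in> K"
    "x5 \<noteq> 0 \<longrightarrow> 5 \<in> K" "x6 \<noteq> 0 \<longrightarrow> 6 \<in> K" "x7 \<noteq> 0 \<longrightarrow> 7 \<in> K" "x8 \<noteq> 0 \<longrightarrow> 8 \<in> K"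
  shows "su3_vec x1 x2 x3 x4 x5 x6 x7 x8 \<in> span (su3_basis ` K)"
proof -
  have "x *\<^sub>R su3_basis k \<in> span (su3_basis ` K)" if "x \<noteq> 0 \<longrightarrow> k \<in> K" for x k
    using that by (cases "x = 0") (auto intro: span_scale span_base simp: span_zero)
  then show ?thesis unfolding su3_vec_eq_sum using assms by (intro span_add) auto
qed

lemma su3_eq: "su3 = {su3_vec x1 x2 x3 x4 x5 x6 x7 x8 | x1 x2 x3 x4 x5 x6 x7 x8. True}" (is "_ = ?S")
proof
  have "subspace ?S" by (rule subspace_su3_vecI[of _ False False False False False False False False]) simp
  then show "su3 \<subseteq> ?S" unfolding su3_def atLeast1_atMost_8
    by (intro span_minimal) (auto simp: su3_basis_eq su3_vec_eq_iff)
  show "?S \<subseteq> su3" unfolding su3_def by (auto intro!: su3_vec_in_span)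
qed

lemma tangent_7_eq: "tangent 7 = {su3_vec x1 x2 x3 x4 x5 x6 x7 0 | x1 x2 x3 x4 x5 x6 x7. True}" (is "_ = ?S")
proof
  have "subspace ?S"
    by (rule subspace_su3_vecI[of _ False False False False False False False True]) auto
  then show "tangent 7 \<subseteq> ?S" unfolding tangent_def atLeast1_atMost_7
    by (intro span_minimal) (auto simp: su3_basis_eq su3_vec_eq_iff)
  show "?S \<subseteq> tangent 7" unfolding tangent_def by (auto intro!: su3_vec_in_span)
qed

lemma tangent_6_eq: "tangent 6 = {su3_vec x1 x2 x3 x4 x5 x6 0 0 | x1 x2 x3 x4 x5 x6. True}" (is "_ = ?S")
proof
  have "subspace ?S"
    by (rule subspace_su3_vecI[of _ False False False False False False True True]) auto
  then show "tangent 6 \<subseteq> ?S" unfolding tangent_def atLeast1_atMost_6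
    by (intro span_minimal) (auto simp: su3_basis_eq su3_vec_eq_iff)
  show "?S \<subseteq> tangent 6" unfolding tangent_def by (auto intro!: su3_vec_in_span)
qed

lemma isotropy_7_eq: "isotropy 7 = {su3_vec 0 0 0 0 0 0 0 x8 | x8. True}" (is "_ = ?S")
proof
  have "subspace ?S"
    by (rule subspace_su3_vecI[of _ True True True True True True True False]) auto
  then show "isotropy 7 \<subseteq> ?S" unfolding isotropy_def greaterThan_7_atMost_8
    by (intro span_minimal) (auto simp: su3_basis_eq su3_vec_eq_iff)
  show "?S \<subseteq> isotropy 7" unfolding isotropy_def by (auto intro!: su3_vec_in_span)
qed

lemma isotropy_6_eq: "isotropy 6 = {su3_vec 0 0 0 0 0 0 x7 x8 | x7 x8. True}" (is "_ = ?S")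
proof
  have "subspace ?S"
    by (rule subspace_su3_vecI[of _ True True True True True True False False]) auto
  then show "isotropy 6 \<subseteq> ?S" unfolding isotropy_def greaterThan_6_atMost_8
    by (intro span_minimal) (auto simp: su3_basis_eq su3_vec_eq_iff)
  show "?S \<subseteq> isotropy 6" unfolding isotropy_def by (auto intro!: su3_vec_in_span)
qed

section \<open>Two Einstein metrics on SU(3)/U(1)\<close>

definition squashed_metric :: "nat \<Rightarrow> real" where
  "squashed_metric k = [9/25, 9/25, 9/10, 9/10, 9/10, 9/10, 81/25] ! (k - 1)"

text \<open>Both lists come from stationary points of the reduced systems:
  \<open>x = 1, y = 2/5\<close> with slope \<open>2 - x - y = 3/5\<close> of \<open>a\<close>, and
  \<open>x = 1, u = v = 1/2\<close> with slope 1. Relative to \<open>e_3, ..., e_6\<close>, the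
  squashed metric shrinks the squared lengths of \<open>e_1, e_2, e_7\<close> in the 3-Sasakian one
  by the factor 5.\<close>

definition three_sasakian_metric :: "nat \<Rightarrow> real" where
  "three_sasakian_metric k = [1, 1, 1/2, 1/2, 1/2, 1/2, 9] ! (k - 1)"

lemmas su3_simps = su3_basis_eq su3_vec_add su3_vec_diff su3_vec_uminus su3_vec_scale coord_su3_vec
  bracket_su3_vec tangent_part_su3_vec isotropy_part_su3_vec metric_ip_su3_vec

lemma levi_civita_squashed:
  "levi_civita 7 squashed_metric (su3_vec x1 x2 x3 x4 x5 x6 x7 x8) (su3_vec y1 y2 y3 y4 y5 y6 y7 0) = su3_vec
    (3*x2*y7 - 1/2*x3*y5 - 1/2*x4*y6 + 1/2*x5*y3 + 1/2*x6*y4 - 3*x7*y2)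
    (-(3)*x1*y7 + 1/2*x3*y6 - 1/2*x4*y5 + 1/2*x5*y4 - 1/2*x6*y3 + 3*x7*y1)
    (4/5*x1*y5 - 4/5*x2*y6 + 3/5*x4*y7 - 1/5*x5*y1 + 1/5*x6*y2 - 12/5*x7*y4 - 3*x8*y4)
    (4/5*x1*y6 + 4/5*x2*y5 - 3/5*x3*y7 - 1/5*x5*y2 - 1/5*x6*y1 + 12/5*x7*y3 + 3*x8*y3)
    (-(4/5)*x1*y3 - 4/5*x2*y4 + 1/5*x3*y1 + 1/5*x4*y2 - 3/5*x6*y7 + 12/5*x7*y6 - 3*x8*y6)
    (-(4/5)*x1*y4 + 4/5*x2*y3 - 1/5*x3*y2 + 1/5*x4*y1 + 3/5*x5*y7 - 12/5*x7*y5 + 3*x8*y5)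
    (1/3*x1*y2 - 1/3*x2*y1 + 1/6*x3*y4 - 1/6*x4*y3 - 1/6*x5*y6 + 1/6*x6*y5)
    (0)"
  unfolding levi_civita_def Let_def sum_upto_7
  by (simp add: su3_simps squashed_metric_def su3_vec_eq_iff field_simps)

lemma levi_civita_three_sasakian:
  "levi_civita 7 three_sasakian_metric (su3_vec x1 x2 x3 x4 x5 x6 x7 x8) (su3_vec y1 y2 y3 y4 y5 y6 y7 0) = su3_vec
    (3*x2*y7 - 1/2*x3*y5 - 1/2*x4*y6 + 1/2*x5*y3 + 1/2*x6*y4 - 3*x7*y2)
    (-(3)*x1*y7 + 1/2*x3*y6 - 1/2*x4*y5 + 1/2*x5*y4 - 1/2*x6*y3 + 3*x7*y1)
    (3*x4*y7 - x5*y1 + x6*y2 - 3*x8*y4)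
    (-(3)*x3*y7 - x5*y2 - x6*y1 + 3*x8*y3)
    (x3*y1 + x4*y2 - 3*x6*y7 - 3*x8*y6)
    (-x3*y2 + x4*y1 + 3*x5*y7 + 3*x8*y5)
    (1/3*x1*y2 - 1/3*x2*y1 + 1/6*x3*y4 - 1/6*x4*y3 - 1/6*x5*y6 + 1/6*x6*y5)
    (0)"
  unfolding levi_civita_def Let_def sum_upto_7
  by (simp add: su3_simps three_sasakian_metric_def su3_vec_eq_iff algebra_simps)

lemma levi_civita_flag:
  "levi_civita 6 (\<lambda>_. 1) (su3_vec x1 x2 x3 x4 x5 x6 x7 x8) (su3_vec y1 y2 y3 y4 y5 y6 0 0) = su3_vec
    (-(1/2)*x3*y5 - 1/2*x4*y6 + 1/2*x5*y3 + 1/2*x6*y4 - 6*x7*y2)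
    (1/2*x3*y6 - 1/2*x4*y5 + 1/2*x5*y4 - 1/2*x6*y3 + 6*x7*y1)
    (1/2*x1*y5 - 1/2*x2*y6 - 1/2*x5*y1 + 1/2*x6*y2 - 3*x7*y4 - 3*x8*y4)
    (1/2*x1*y6 + 1/2*x2*y5 - 1/2*x5*y2 - 1/2*x6*y1 + 3*x7*y3 + 3*x8*y3)
    (-(1/2)*x1*y3 - 1/2*x2*y4 + 1/2*x3*y1 + 1/2*x4*y2 + 3*x7*y6 - 3*x8*y6)
    (-(1/2)*x1*y4 + 1/2*x2*y3 - 1/2*x3*y2 + 1/2*x4*y1 - 3*x7*y5 + 3*x8*y5)
    (0)
    (0)"
  unfolding levi_civita_def Let_def sum_upto_6
  by (simp add: su3_simps su3_vec_eq_iff algebra_simps)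

lemma invariant_squashed: "invariant_metric 7 squashed_metric"
  unfolding invariant_metric_def tangent_7_eq isotropy_7_eq atLeast1_atMost_7
  by (auto simp: su3_simps squashed_metric_def algebra_simps)

lemma invariant_three_sasakian: "invariant_metric 7 three_sasakian_metric"
  unfolding invariant_metric_def tangent_7_eq isotropy_7_eq atLeast1_atMost_7
  by (auto simp: su3_simps three_sasakian_metric_def algebra_simps)

text \<open>The Einstein constant 6 is the dimension of the base minus 1, the value at which the
  cone over the metric is Ricci flat, as a Spin(7) cone has to be.\<close>

lemma ricci_squashed:
  "ricci 7 squashed_metric (su3_vec x1 x2 x3 x4 x5 x6 x7 0) (su3_vec y1 y2 y3 y4 y5 y6 y7 0)
    = 6 * metric_ip 7 squashed_metric (su3_vec x1 x2 x3 x4 x5 x6 x7 0) (su3_vec y1 y2 y3 y4 y5 y6 y7 0)"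
  unfolding ricci_def curvature_def sum_upto_7
  by (simp add: su3_simps levi_civita_squashed squashed_metric_def algebra_simps)

lemma ricci_three_sasakian:
  "ricci 7 three_sasakian_metric (su3_vec x1 x2 x3 x4 x5 x6 x7 0) (su3_vec y1 y2 y3 y4 y5 y6 y7 0)
    = 6 * metric_ip 7 three_sasakian_metric (su3_vec x1 x2 x3 x4 x5 x6 x7 0) (su3_vec y1 y2 y3 y4 y5 y6 y7 0)"
  unfolding ricci_def curvature_def sum_upto_7
  by (simp add: su3_simps levi_civita_three_sasakian three_sasakian_metric_def algebra_simps)

lemma einstein_squashed: "homogeneous_einstein 7 squashed_metric"
  unfolding homogeneous_einstein_def
  by (intro conjI invariant_squashed exI[of _ 6]) (auto simp: tangent_7_eq ricci_squashed)

lemma einstein_three_sasakian: "homogeneous_einstein 7 three_sasakian_metric"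
  unfolding homogeneous_einstein_def
  by (intro conjI invariant_three_sasakian exI[of _ 6]) (auto simp: tangent_7_eq ricci_three_sasakian)

section \<open>The cone over the flag manifold\<close>

text \<open>The radial vector comes first. Order and signs of the others are chosen so that
  contracting the standard 3-form with it gives \<open>e12 - e34 + e56\<close>, the fundamental form
  of the almost complex structure \<open>flag_J\<close> below.\<close>

definition flag_frame :: "nat \<Rightarrow> real \<times> mat3" where
  "flag_frame i = [(1, su3_vec 0 0 0 0 0 0 0 0),
     (0, su3_vec 1 0 0 0 0 0 0 0),
     (0, su3_vec 0 1 0 0 0 0 0 0),
     (0, su3_vec 0 0 1 0 0 0 0 0),
     (0, su3_vec 0 0 0 (-1) 0 0 0 0),
     (0, su3_vec 0 0 0 0 0 1 0 0),
     (0, su3_vec 0 0 0 0 (-1) 0 0 0)] ! (i - 1)"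

definition flag_form :: "real \<times> mat3 \<Rightarrow> real \<times> mat3 \<Rightarrow> real \<times> mat3 \<Rightarrow> real" where
  "flag_form x y z = g2_form (\<lambda>i. cone_ip 6 (\<lambda>_. 1) (flag_frame i) x)
     (\<lambda>i. cone_ip 6 (\<lambda>_. 1) (flag_frame i) y) (\<lambda>i. cone_ip 6 (\<lambda>_. 1) (flag_frame i) z)"

lemma cone_tangent_6_eq:
  "cone_tangent 6 = {(x0, su3_vec x1 x2 x3 x4 x5 x6 0 0) | x0 x1 x2 x3 x4 x5 x6. True}"
  by (auto simp: cone_tangent_def tangent_6_eq su3_vec_eq_iff)

lemma cone_tangent_6I: "(x0, su3_vec x1 x2 x3 x4 x5 x6 0 0) \<in> cone_tangent 6"
  unfolding cone_tangent_6_eq by blast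

lemma cone_tangent_6E:
  assumes "x \<in> cone_tangent 6"
  obtains x0 x1 x2 x3 x4 x5 x6 where "x = (x0, su3_vec x1 x2 x3 x4 x5 x6 0 0)"
  using assms unfolding cone_tangent_6_eq by blast

lemma flag_frame_coord:
  fixes x0 :: real
  shows
    "cone_ip 6 (\<lambda>_. 1) (flag_frame (Suc 0)) (x0, su3_vec x1 x2 x3 x4 x5 x6 0 0) = x0"
    "cone_ip 6 (\<lambda>_. 1) (flag_frame 1) (x0, su3_vec x1 x2 x3 x4 x5 x6 0 0) = x0"
    "cone_ip 6 (\<lambda>_. 1) (flag_frame 2) (x0, su3_vec x1 x2 x3 x4 x5 x6 0 0) = x1"
    "cone_ip 6 (\<lambda>_. 1) (flag_frame 3) (x0, su3_vec x1 x2 x3 x4 x5 x6 0 0) = x2"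
    "cone_ip 6 (\<lambda>_. 1) (flag_frame 4) (x0, su3_vec x1 x2 x3 x4 x5 x6 0 0) = x3"
    "cone_ip 6 (\<lambda>_. 1) (flag_frame 5) (x0, su3_vec x1 x2 x3 x4 x5 x6 0 0) = -x4"
    "cone_ip 6 (\<lambda>_. 1) (flag_frame 6) (x0, su3_vec x1 x2 x3 x4 x5 x6 0 0) = x6"
    "cone_ip 6 (\<lambda>_. 1) (flag_frame 7) (x0, su3_vec x1 x2 x3 x4 x5 x6 0 0) = -x5"
  by (simp_all add: flag_frame_def cone_ip_def metric_ip_su3_vec)

lemma flag_form_eq:
  "flag_form (x0, su3_vec x1 x2 x3 x4 x5 x6 0 0) (y0, su3_vec y1 y2 y3 y4 y5 y6 0 0)
     (z0, su3_vec z1 z2 z3 z4 z5 z6 0 0) =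
    0 + (x0*(y1*z2 - y2*z1) - x1*(y0*z2 - y2*z0) + x2*(y0*z1 - y1*z0))
    - (x0*(y3*z4 - y4*z3) - x3*(y0*z4 - y4*z0) + x4*(y0*z3 - y3*z0))
    - (x0*(y6*z5 - y5*z6) - x6*(y0*z5 - y5*z0) + x5*(y0*z6 - y6*z0))
    + (x1*(y3*z6 - y6*z3) - x3*(y1*z6 - y6*z1) + x6*(y1*z3 - y3*z1))
    - (x1*(y4*z5 - y5*z4) - x4*(y1*z5 - y5*z1) + x5*(y1*z4 - y4*z1))
    + (x2*(y3*z5 - y5*z3) - x3*(y2*z5 - y5*z2) + x5*(y2*z3 - y3*z2))
    + (x2*(y4*z6 - y6*z4) - x4*(y2*z6 - y6*z2) + x6*(y2*z4 - y4*z2))"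
  by (simp add: flag_form_def g2_form_def det_minor_def flag_frame_coord algebra_simps)

lemma flag_form_linear:
  "flag_form (x + x') y z = flag_form x y z + flag_form x' y z"
  "flag_form x (y + y') z = flag_form x y z + flag_form x y' z"
  "flag_form x y (z + z') = flag_form x y z + flag_form x y z'"
  "flag_form (x - x') y z = flag_form x y z - flag_form x' y z"
  "flag_form x (y - y') z = flag_form x y z - flag_form x y' z"
  "flag_form x y (z - z') = flag_form x y z - flag_form x y z'"
  "flag_form (r *\<^sub>R x) y z = r * flag_form x y z"
  "flag_form x (r *\<^sub>R y) z = r * flag_form x y z"
  "flag_form x y (r *\<^sub>R z) = r * flag_form x y z"
proof -
  have coord_lin: "coord k (A + B) = coord k A + coord k B" "coord k (A - B) = coord k A - coord k B"
    "coord k (r *\<^sub>R A) = r * coord k A" for k A B r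
    by (simp_all add: coord_def inner_add_left inner_diff_left add_divide_distrib diff_divide_distrib)
  have [simp]: "cone_ip 6 q F (x + y) = cone_ip 6 q F x + cone_ip 6 q F y"
    "cone_ip 6 q F (x - y) = cone_ip 6 q F x - cone_ip 6 q F y"
    "cone_ip 6 q F (r *\<^sub>R x) = r * cone_ip 6 q F x" for q F x y r
    unfolding cone_ip_def metric_ip_def sum_upto_6 by (simp_all add: coord_lin algebra_simps)
  show
    "flag_form (x + x') y z = flag_form x y z + flag_form x' y z"
    "flag_form x (y + y') z = flag_form x y z + flag_form x y' z"
    "flag_form x y (z + z') = flag_form x y z + flag_form x y z'"
    "flag_form (x - x') y z = flag_form x y z - flag_form x' y z"
    "flag_form x (y - y') z = flag_form x y z - flag_form x y' z"
    "flag_form x y (z - z') = flag_form x y z - flag_form x y z'"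
    "flag_form (r *\<^sub>R x) y z = r * flag_form x y z"
    "flag_form x (r *\<^sub>R y) z = r * flag_form x y z"
    "flag_form x y (r *\<^sub>R z) = r * flag_form x y z"
    unfolding flag_form_def g2_form_def det_minor_def by (simp_all add: algebra_simps)
qed

abbreviation "flag_connection \<equiv> cone_connection 6 (\<lambda>_. 1)"

lemma flag_connection_eq:
  "flag_connection (su3_vec x1 x2 x3 x4 x5 x6 x7 x8) (y0, su3_vec y1 y2 y3 y4 y5 y6 0 0) =
    (((-1) * x1*y1 - x2*y2 - x3*y3 - x4*y4 - x5*y5 - x6*y6), su3_vec
      (x1*y0 - 1/2 * x3*y5 - 1/2 * x4*y6 + 1/2 * x5*y3 + 1/2 * x6*y4 - 6 * x7*y2)
      (x2*y0 + 1/2 * x3*y6 - 1/2 * x4*y5 + 1/2 * x5*y4 - 1/2 * x6*y3 + 6 * x7*y1)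
      (1/2 * x1*y5 - 1/2 * x2*y6 + x3*y0 - 1/2 * x5*y1 + 1/2 * x6*y2 - 3 * x7*y4 - 3 * x8*y4)
      (1/2 * x1*y6 + 1/2 * x2*y5 + x4*y0 - 1/2 * x5*y2 - 1/2 * x6*y1 + 3 * x7*y3 + 3 * x8*y3)
      ((-1/2) * x1*y3 - 1/2 * x2*y4 + 1/2 * x3*y1 + 1/2 * x4*y2 + x5*y0 + 3 * x7*y6 - 3 * x8*y6)
      ((-1/2) * x1*y4 + 1/2 * x2*y3 - 1/2 * x3*y2 + 1/2 * x4*y1 + x6*y0 - 3 * x7*y5 + 3 * x8*y5) 0 0)"
  by (simp add: cone_connection_def metric_ip_su3_vec levi_civita_flag su3_simps su3_vec_eq_iff algebra_simps)

text \<open>Elements of \<open>cone_holonomy\<close> matter only on \<open>cone_tangent\<close>, so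
  the infinitesimal symmetry of the form is asked for only there. The stability clause lets the
  identity be applied again to images, as commutators require.\<close>

definition flag_derivation :: "(real \<times> mat3 \<Rightarrow> real \<times> mat3) \<Rightarrow> bool" where
  "flag_derivation S \<longleftrightarrow> S ` cone_tangent 6 \<subseteq> cone_tangent 6 \<and>
     (\<forall>x\<in>cone_tangent 6. \<forall>y\<in>cone_tangent 6. \<forall>z\<in>cone_tangent 6.
        flag_form (S x) y z + flag_form x (S y) z + flag_form x y (S z) = 0)"

lemma flag_derivationD:
  assumes "flag_derivation S" "x \<in> cone_tangent 6"
  shows "S x \<in> cone_tangent 6"
  using assms unfolding flag_derivation_def by (meson image_subset_iff)

lemma cone_tangent_6_closed:
  assumes "x \<in> cone_tangent 6" "y \<in> cone_tangent 6"
  shows "x + y \<in> cone_tangent 6" "x - y \<in> cone_tangent 6" "r *\<^sub>R x \<in> cone_tangent 6"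
  using assms by (auto elim!: cone_tangent_6E simp: cone_tangent_6_eq su3_simps su3_vec_eq_iff)

lemma flag_derivation_add:
  assumes "flag_derivation S" "flag_derivation T"
  shows "flag_derivation (\<lambda>x. S x + T x)"
  unfolding flag_derivation_def
proof (intro conjI ballI)
  show "(\<lambda>x. S x + T x) ` cone_tangent 6 \<subseteq> cone_tangent 6"
    by (intro image_subsetI cone_tangent_6_closed flag_derivationD[OF assms(1)] flag_derivationD[OF assms(2)])
  fix x y z assume *: "x \<in> cone_tangent 6" "y \<in> cone_tangent 6" "z \<in> cone_tangent 6"
  have "flag_form (S x) y z + flag_form x (S y) z + flag_form x y (S z) = 0"
    "flag_form (T x) y z + flag_form x (T y) z + flag_form x y (T z) = 0"
    using assms * unfolding flag_derivation_def by blast+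
  then show "flag_form (S x + T x) y z + flag_form x (S y + T y) z + flag_form x y (S z + T z) = 0"
    by (simp add: flag_form_linear)
qed

lemma flag_derivation_scale:
  assumes "flag_derivation T"
  shows "flag_derivation (\<lambda>x. r *\<^sub>R T x)"
  unfolding flag_derivation_def
proof (intro conjI ballI)
  show "(\<lambda>x. r *\<^sub>R T x) ` cone_tangent 6 \<subseteq> cone_tangent 6"
    by (intro image_subsetI cone_tangent_6_closed flag_derivationD[OF assms])
  fix x y z assume *: "x \<in> cone_tangent 6" "y \<in> cone_tangent 6" "z \<in> cone_tangent 6"
  have "flag_form (T x) y z + flag_form x (T y) z + flag_form x y (T z) = 0"
    using assms * unfolding flag_derivation_def by blast
  then have "r * (flag_form (T x) y z + flag_form x (T y) z + flag_form x y (T z)) = 0" by simp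
  then show "flag_form (r *\<^sub>R T x) y z + flag_form x (r *\<^sub>R T y) z + flag_form x y (r *\<^sub>R T z) = 0"
    by (simp only: flag_form_linear distrib_left)
qed

text \<open>This is the parallelism of the 3-form on the cone, checked for one basis element of
  su(3) at a time; the connection is linear in its algebra argument.\<close>

lemma flag_derivation_connection_basis:
  "flag_derivation (flag_connection (su3_vec 1 0 0 0 0 0 0 0))"
  "flag_derivation (flag_connection (su3_vec 0 1 0 0 0 0 0 0))"
  "flag_derivation (flag_connection (su3_vec 0 0 1 0 0 0 0 0))"
  "flag_derivation (flag_connection (su3_vec 0 0 0 1 0 0 0 0))"
  "flag_derivation (flag_connection (su3_vec 0 0 0 0 1 0 0 0))"
  "flag_derivation (flag_connection (su3_vec 0 0 0 0 0 1 0 0))"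
  "flag_derivation (flag_connection (su3_vec 0 0 0 0 0 0 1 0))"
  "flag_derivation (flag_connection (su3_vec 0 0 0 0 0 0 0 1))"
proof -
  have *: "flag_derivation (flag_connection A)"
    if "\<And>x0 x1 x2 x3 x4 x5 x6. flag_connection A (x0, su3_vec x1 x2 x3 x4 x5 x6 0 0) \<in> cone_tangent 6"
      "\<And>x0 x1 x2 x3 x4 x5 x6 y0 y1 y2 y3 y4 y5 y6 z0 z1 z2 z3 z4 z5 z6.
        flag_form (flag_connection A (x0, su3_vec x1 x2 x3 x4 x5 x6 0 0)) (y0, su3_vec y1 y2 y3 y4 y5 y6 0 0) (z0, su3_vec z1 z2 z3 z4 z5 z6 0 0)
        + flag_form (x0, su3_vec x1 x2 x3 x4 x5 x6 0 0) (flag_connection A (y0, su3_vec y1 y2 y3 y4 y5 y6 0 0)) (z0, su3_vec z1 z2 z3 z4 z5 z6 0 0)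
        + flag_form (x0, su3_vec x1 x2 x3 x4 x5 x6 0 0) (y0, su3_vec y1 y2 y3 y4 y5 y6 0 0) (flag_connection A (z0, su3_vec z1 z2 z3 z4 z5 z6 0 0)) = 0"
    for A
    using that unfolding flag_derivation_def cone_tangent_6_eq by auto
  show
    "flag_derivation (flag_connection (su3_vec 1 0 0 0 0 0 0 0))"
    "flag_derivation (flag_connection (su3_vec 0 1 0 0 0 0 0 0))"
    "flag_derivation (flag_connection (su3_vec 0 0 1 0 0 0 0 0))"
    "flag_derivation (flag_connection (su3_vec 0 0 0 1 0 0 0 0))"
    "flag_derivation (flag_connection (su3_vec 0 0 0 0 1 0 0 0))"
    "flag_derivation (flag_connection (su3_vec 0 0 0 0 0 1 0 0))"
    "flag_derivation (flag_connection (su3_vec 0 0 0 0 0 0 1 0))"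
    "flag_derivation (flag_connection (su3_vec 0 0 0 0 0 0 0 1))"
    by (rule *; simp add: flag_connection_eq flag_form_eq cone_tangent_6I algebra_simps)+
qed

lemma flag_derivation_connection:
  assumes "A \<in> su3"
  shows "flag_derivation (flag_connection A)"
proof -
  obtain a1 a2 a3 a4 a5 a6 a7 a8 where A: "A = su3_vec a1 a2 a3 a4 a5 a6 a7 a8"
    using assms unfolding su3_eq by blast
  define S where "S = (\<lambda>x. a1 *\<^sub>R flag_connection (su3_vec 1 0 0 0 0 0 0 0) x + a2 *\<^sub>R flag_connection (su3_vec 0 1 0 0 0 0 0 0) x + a3 *\<^sub>R flag_connection (su3_vec 0 0 1 0 0 0 0 0) x + a4 *\<^sub>R flag_connection (su3_vec 0 0 0 1 0 0 0 0) x + a5 *\<^sub>R flag_connection (su3_vec 0 0 0 0 1 0 0 0) x + a6 *\<^sub>R flag_connection (su3_vec 0 0 0 0 0 1 0 0) x + a7 *\<^sub>R flag_connection (su3_vec 0 0 0 0 0 0 1 0) x + a8 *\<^sub>R flag_connection (su3_vec 0 0 0 0 0 0 0 1) x)"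
  have "flag_derivation S"
    unfolding S_def by (intro flag_derivation_add flag_derivation_scale flag_derivation_connection_basis)
  moreover have "flag_connection A x = S x" if "x \<in> cone_tangent 6" for x
    using that unfolding A S_def
    by (elim cone_tangent_6E) (simp add: flag_connection_eq su3_simps su3_vec_eq_iff algebra_simps)
  ultimately show ?thesis by (simp add: flag_derivation_def image_subset_iff)
qed

lemma flag_derivation_commutator:
  assumes "flag_derivation S" "flag_derivation T"
  shows "flag_derivation (\<lambda>x. S (T x) - T (S x))"
  unfolding flag_derivation_def
proof (intro conjI ballI)
  have S: "S x \<in> cone_tangent 6" and T: "T x \<in> cone_tangent 6" if "x \<in> cone_tangent 6" for x
    using assms that flag_derivationD by blast+
  then show "(\<lambda>x. S (T x) - T (S x)) ` cone_tangent 6 \<subseteq> cone_tangent 6"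
    by (intro image_subsetI) (simp add: cone_tangent_6_closed)
  fix x y z assume *: "x \<in> cone_tangent 6" "y \<in> cone_tangent 6" "z \<in> cone_tangent 6"
  have dS: "flag_form (S x) y z + flag_form x (S y) z + flag_form x y (S z) = 0"
    and dT: "flag_form (T x) y z + flag_form x (T y) z + flag_form x y (T z) = 0"
    if "x \<in> cone_tangent 6" "y \<in> cone_tangent 6" "z \<in> cone_tangent 6" for x y z
    using assms that unfolding flag_derivation_def by blast+
  show "flag_form (S (T x) - T (S x)) y z + flag_form x (S (T y) - T (S y)) z
      + flag_form x y (S (T z) - T (S z)) = 0"
    using dS[OF T[OF *(1)] *(2,3)] dS[OF *(1) T[OF *(2)] *(3)] dS[OF *(1,2) T[OF *(3)]]
      dT[OF S[OF *(1)] *(2,3)] dT[OF *(1) S[OF *(2)] *(3)] dT[OF *(1,2) S[OF *(3)]]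
    by (simp add: flag_form_linear)
qed

lemma bracket_in_su3: "A \<in> su3 \<Longrightarrow> B \<in> su3 \<Longrightarrow> bracket A B \<in> su3"
  by (auto simp: su3_eq bracket_su3_vec su3_vec_eq_iff)

text \<open>Upper bound for the holonomy: the symmetries of the form contain the connection
  endomorphisms and are closed under linear combinations and commutators, hence they contain the
  curvature and all its derivatives.\<close>

lemma flag_derivation_holonomy:
  assumes "S \<in> cone_holonomy 6 (\<lambda>_. 1)"
  shows "flag_derivation S"
  using assms
proof induction
  case (curv A B)
  have "flag_derivation (\<lambda>x. (flag_connection A (flag_connection B x) - flag_connection B (flag_connection A x))
      + (- 1) *\<^sub>R flag_connection (bracket A B) x)"
    using curv by (intro flag_derivation_add flag_derivation_scale flag_derivation_commutator
        flag_derivation_connection bracket_in_su3)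
  then show ?case by simp
next
  case (commutator A T)
  then show ?case by (intro flag_derivation_commutator flag_derivation_connection)
qed (auto intro: flag_derivation_add flag_derivation_scale)

abbreviation "flag_holonomy \<equiv> cone_holonomy 6 (\<lambda>_. 1)"

definition flag_curvature :: "nat \<Rightarrow> nat \<Rightarrow> real \<times> mat3 \<Rightarrow> real \<times> mat3" where
  "flag_curvature i j x =
     flag_connection (su3_basis i) (flag_connection (su3_basis j) x)
     - flag_connection (su3_basis j) (flag_connection (su3_basis i) x)
     - flag_connection (bracket (su3_basis i) (su3_basis j)) x"

lemma su3_basis_in_su3: "k \<in> {1..8} \<Longrightarrow> su3_basis k \<in> su3"
  by (auto simp: su3_def intro!: span_base)

lemma flag_curvature_holonomy:
  assumes "i \<in> {1..8}" "j \<in> {1..8}"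
  shows "flag_curvature i j \<in> flag_holonomy"
  using cone_holonomy.curv[OF su3_basis_in_su3[OF assms(1)] su3_basis_in_su3[OF assms(2)]]
  by (simp add: flag_curvature_def[abs_def])

text \<open>Curvature endomorphisms of a cone kill the radial vector, so here they stay in the copy
  of su(3) inside the stabilizer algebra that fixes it. Deriving the single endomorphism of
  \<open>(e_1, e_2)\<close> in the six tangent directions moves the radial vector and supplies the
  six missing dimensions.\<close>

definition flag_curvature_derivative :: "nat \<Rightarrow> real \<times> mat3 \<Rightarrow> real \<times> mat3" where
  "flag_curvature_derivative k x =
     flag_connection (su3_basis k) (flag_curvature 1 2 x) - flag_curvature 1 2 (flag_connection (su3_basis k) x)"

lemma flag_curvature_derivative_holonomy:
  assumes "k \<in> {1..8}"
  shows "flag_curvature_derivative k \<in> flag_holonomy"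
  using cone_holonomy.commutator[OF su3_basis_in_su3[OF assms] flag_curvature_holonomy[of 1 2]]
  by (simp add: flag_curvature_derivative_def[abs_def])

lemma flag_curvature_eq:
  fixes y0 :: real
  shows
    "flag_curvature (Suc 0) 2 (y0, su3_vec y1 y2 y3 y4 y5 y6 0 0) =
      (0, su3_vec (3 * y2) (-3 * y1) (3/2 * y4) (-3/2 * y3) (-3/2 * y6) (3/2 * y5) 0 0)"
    "flag_curvature 1 2 (y0, su3_vec y1 y2 y3 y4 y5 y6 0 0) =
      (0, su3_vec (3 * y2) (-3 * y1) (3/2 * y4) (-3/2 * y3) (-3/2 * y6) (3/2 * y5) 0 0)"
    "flag_curvature (Suc 0) 3 (y0, su3_vec y1 y2 y3 y4 y5 y6 0 0) =
      (0, su3_vec (-3/4 * y3) (3/4 * y4) (3/4 * y1) (-3/4 * y2) 0 0 0 0)"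
    "flag_curvature 1 3 (y0, su3_vec y1 y2 y3 y4 y5 y6 0 0) =
      (0, su3_vec (-3/4 * y3) (3/4 * y4) (3/4 * y1) (-3/4 * y2) 0 0 0 0)"
    "flag_curvature (Suc 0) 4 (y0, su3_vec y1 y2 y3 y4 y5 y6 0 0) =
      (0, su3_vec (-3/4 * y4) (-3/4 * y3) (3/4 * y2) (3/4 * y1) 0 0 0 0)"
    "flag_curvature 1 4 (y0, su3_vec y1 y2 y3 y4 y5 y6 0 0) =
      (0, su3_vec (-3/4 * y4) (-3/4 * y3) (3/4 * y2) (3/4 * y1) 0 0 0 0)"
    "flag_curvature (Suc 0) 5 (y0, su3_vec y1 y2 y3 y4 y5 y6 0 0) =
      (0, su3_vec (-3/4 * y5) (-3/4 * y6) 0 0 (3/4 * y1) (3/4 * y2) 0 0)"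
    "flag_curvature 1 5 (y0, su3_vec y1 y2 y3 y4 y5 y6 0 0) =
      (0, su3_vec (-3/4 * y5) (-3/4 * y6) 0 0 (3/4 * y1) (3/4 * y2) 0 0)"
    "flag_curvature (Suc 0) 6 (y0, su3_vec y1 y2 y3 y4 y5 y6 0 0) =
      (0, su3_vec (-3/4 * y6) (3/4 * y5) 0 0 (-3/4 * y2) (3/4 * y1) 0 0)"
    "flag_curvature 1 6 (y0, su3_vec y1 y2 y3 y4 y5 y6 0 0) =
      (0, su3_vec (-3/4 * y6) (3/4 * y5) 0 0 (-3/4 * y2) (3/4 * y1) 0 0)"
    "flag_curvature 3 4 (y0, su3_vec y1 y2 y3 y4 y5 y6 0 0) =
      (0, su3_vec (3/2 * y2) (-3/2 * y1) (3 * y4) (-3 * y3) (3/2 * y6) (-3/2 * y5) 0 0)"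
    "flag_curvature 3 5 (y0, su3_vec y1 y2 y3 y4 y5 y6 0 0) =
      (0, su3_vec 0 0 (-3/4 * y5) (3/4 * y6) (3/4 * y3) (-3/4 * y4) 0 0)"
    "flag_curvature 3 6 (y0, su3_vec y1 y2 y3 y4 y5 y6 0 0) =
      (0, su3_vec 0 0 (-3/4 * y6) (-3/4 * y5) (3/4 * y4) (3/4 * y3) 0 0)"
  by (simp_all add: flag_curvature_def su3_simps flag_connection_eq su3_vec_eq_iff field_simps)

lemma flag_curvature_derivative_eq:
  fixes y0 :: real
  shows
    "flag_curvature_derivative (Suc 0) (y0, su3_vec y1 y2 y3 y4 y5 y6 0 0) =
      ((-3 * y2), su3_vec 0 (3 * y0) (-3/2 * y6) (3/2 * y5) (-3/2 * y4) (3/2 * y3) 0 0)"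
    "flag_curvature_derivative 1 (y0, su3_vec y1 y2 y3 y4 y5 y6 0 0) =
      ((-3 * y2), su3_vec 0 (3 * y0) (-3/2 * y6) (3/2 * y5) (-3/2 * y4) (3/2 * y3) 0 0)"
    "flag_curvature_derivative 2 (y0, su3_vec y1 y2 y3 y4 y5 y6 0 0) =
      ((3 * y1), su3_vec (-3 * y0) 0 (-3/2 * y5) (-3/2 * y6) (3/2 * y3) (3/2 * y4) 0 0)"
    "flag_curvature_derivative 3 (y0, su3_vec y1 y2 y3 y4 y5 y6 0 0) =
      ((-3/2 * y4), su3_vec (-3/4 * y6) (-3/4 * y5) 0 (3/2 * y0) (3/4 * y2) (3/4 * y1) 0 0)"
    "flag_curvature_derivative 4 (y0, su3_vec y1 y2 y3 y4 y5 y6 0 0) =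
      ((3/2 * y3), su3_vec (3/4 * y5) (-3/4 * y6) (-3/2 * y0) 0 (-3/4 * y1) (3/4 * y2) 0 0)"
    "flag_curvature_derivative 5 (y0, su3_vec y1 y2 y3 y4 y5 y6 0 0) =
      ((3/2 * y6), su3_vec (-3/4 * y4) (3/4 * y3) (-3/4 * y2) (3/4 * y1) 0 (-3/2 * y0) 0 0)"
    "flag_curvature_derivative 6 (y0, su3_vec y1 y2 y3 y4 y5 y6 0 0) =
      ((-3/2 * y5), su3_vec (3/4 * y3) (3/4 * y4) (-3/4 * y1) (-3/4 * y2) (3/2 * y0) 0 0 0)"
  by (simp_all add: flag_curvature_derivative_def su3_simps flag_connection_eq flag_curvature_eq su3_vec_eq_iff field_simps)

text \<open>Invariance on the 35 triples of distinct basis vectors gives 35 linear equations for 49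
  matrix entries. They leave \<open>t01\<close> to \<open>t06\<close>, \<open>t12\<close> to
  \<open>t16\<close> and \<open>t34, t35, t36\<close> free: 14 entries, the dimension of the group
  G2.\<close>

lemma flag_stabilizer_relations:
  assumes T: "\<And>x y z. x \<in> cone_tangent 6 \<Longrightarrow> y \<in> cone_tangent 6 \<Longrightarrow> z \<in> cone_tangent 6 \<Longrightarrow>
      flag_form (T x) y z + flag_form x (T y) z + flag_form x y (T z) = 0"
    and cols:
      "T (1, su3_vec 0 0 0 0 0 0 0 0) = (t00, su3_vec t10 t20 t30 t40 t50 t60 0 0)"
      "T (0, su3_vec 1 0 0 0 0 0 0 0) = (t01, su3_vec t11 t21 t31 t41 t51 t61 0 0)"
      "T (0, su3_vec 0 1 0 0 0 0 0 0) = (t02, su3_vec t12 t22 t32 t42 t52 t62 0 0)"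
      "T (0, su3_vec 0 0 1 0 0 0 0 0) = (t03, su3_vec t13 t23 t33 t43 t53 t63 0 0)"
      "T (0, su3_vec 0 0 0 1 0 0 0 0) = (t04, su3_vec t14 t24 t34 t44 t54 t64 0 0)"
      "T (0, su3_vec 0 0 0 0 1 0 0 0) = (t05, su3_vec t15 t25 t35 t45 t55 t65 0 0)"
      "T (0, su3_vec 0 0 0 0 0 1 0 0) = (t06, su3_vec t16 t26 t36 t46 t56 t66 0 0)"
  shows
    "t00 = 0"
    "t10 = - t01"
    "t11 = 0"
    "t20 = - t02"
    "t21 = - t12"
    "t22 = 0"
    "t23 = t06 + t14"
    "t24 = - t05 - t13"
    "t25 = t04 - t16"
    "t26 = - t03 + t15"
    "t30 = - t03"
    "t31 = - t13"
    "t32 = - t06 - t14"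
    "t33 = 0"
    "t40 = - t04"
    "t41 = - t14"
    "t42 = t13 + t05"
    "t43 = - t34"
    "t44 = 0"
    "t45 = - t02 + t36"
    "t46 = - t01 - t35"
    "t50 = - t05"
    "t51 = - t15"
    "t52 = t16 - t04"
    "t53 = - t35"
    "t54 = - t36 + t02"
    "t55 = 0"
    "t56 = - t12 + t34"
    "t60 = - t06"
    "t61 = - t16"
    "t62 = - t15 + t03"
    "t63 = - t36"
    "t64 = t35 + t01"
    "t65 = - t34 + t12"
    "t66 = 0"
proof -
  note [simp] = flag_form_eq cols cone_tangent_6_eq su3_vec_eq_iff
  have e0: "t00 + t11 + t22 = 0"
    using T[of "(1, su3_vec 0 0 0 0 0 0 0 0)" "(0, su3_vec 1 0 0 0 0 0 0 0)" "(0, su3_vec 0 1 0 0 0 0 0 0)"] by simp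
  have e1: "t23 + t41 + t60 = 0"
    using T[of "(1, su3_vec 0 0 0 0 0 0 0 0)" "(0, su3_vec 1 0 0 0 0 0 0 0)" "(0, su3_vec 0 0 1 0 0 0 0 0)"] by simp
  have e2: "t24 - t31 - t50 = 0"
    using T[of "(1, su3_vec 0 0 0 0 0 0 0 0)" "(0, su3_vec 1 0 0 0 0 0 0 0)" "(0, su3_vec 0 0 0 1 0 0 0 0)"] by simp
  have e3: "t25 + t40 - t61 = 0"
    using T[of "(1, su3_vec 0 0 0 0 0 0 0 0)" "(0, su3_vec 1 0 0 0 0 0 0 0)" "(0, su3_vec 0 0 0 0 1 0 0 0)"] by simp
  have e4: "t26 - t30 + t51 = 0"
    using T[of "(1, su3_vec 0 0 0 0 0 0 0 0)" "(0, su3_vec 1 0 0 0 0 0 0 0)" "(0, su3_vec 0 0 0 0 0 1 0 0)"] by simp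
  have e5: "(-1) * t13 + t42 + t50 = 0"
    using T[of "(1, su3_vec 0 0 0 0 0 0 0 0)" "(0, su3_vec 0 1 0 0 0 0 0 0)" "(0, su3_vec 0 0 1 0 0 0 0 0)"] by simp
  have e6: "(-1) * t14 - t32 + t60 = 0"
    using T[of "(1, su3_vec 0 0 0 0 0 0 0 0)" "(0, su3_vec 0 1 0 0 0 0 0 0)" "(0, su3_vec 0 0 0 1 0 0 0 0)"] by simp
  have e7: "(-1) * t15 - t30 - t62 = 0"
    using T[of "(1, su3_vec 0 0 0 0 0 0 0 0)" "(0, su3_vec 0 1 0 0 0 0 0 0)" "(0, su3_vec 0 0 0 0 1 0 0 0)"] by simp
  have e8: "(-1) * t16 - t40 + t52 = 0"
    using T[of "(1, su3_vec 0 0 0 0 0 0 0 0)" "(0, su3_vec 0 1 0 0 0 0 0 0)" "(0, su3_vec 0 0 0 0 0 1 0 0)"] by simp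
  have e9: "(-1) * t00 - t33 - t44 = 0"
    using T[of "(1, su3_vec 0 0 0 0 0 0 0 0)" "(0, su3_vec 0 0 1 0 0 0 0 0)" "(0, su3_vec 0 0 0 1 0 0 0 0)"] by simp
  have e10: "t20 - t45 - t63 = 0"
    using T[of "(1, su3_vec 0 0 0 0 0 0 0 0)" "(0, su3_vec 0 0 1 0 0 0 0 0)" "(0, su3_vec 0 0 0 0 1 0 0 0)"] by simp
  have e11: "t10 - t46 + t53 = 0"
    using T[of "(1, su3_vec 0 0 0 0 0 0 0 0)" "(0, su3_vec 0 0 1 0 0 0 0 0)" "(0, su3_vec 0 0 0 0 0 1 0 0)"] by simp
  have e12: "(-1) * t10 + t35 - t64 = 0"
    using T[of "(1, su3_vec 0 0 0 0 0 0 0 0)" "(0, su3_vec 0 0 0 1 0 0 0 0)" "(0, su3_vec 0 0 0 0 1 0 0 0)"] by simp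
  have e13: "t20 + t36 + t54 = 0"
    using T[of "(1, su3_vec 0 0 0 0 0 0 0 0)" "(0, su3_vec 0 0 0 1 0 0 0 0)" "(0, su3_vec 0 0 0 0 0 1 0 0)"] by simp
  have e14: "t00 + t55 + t66 = 0"
    using T[of "(1, su3_vec 0 0 0 0 0 0 0 0)" "(0, su3_vec 0 0 0 0 1 0 0 0)" "(0, su3_vec 0 0 0 0 0 1 0 0)"] by simp
  have e15: "t03 + t51 - t62 = 0"
    using T[of "(0, su3_vec 1 0 0 0 0 0 0 0)" "(0, su3_vec 0 1 0 0 0 0 0 0)" "(0, su3_vec 0 0 1 0 0 0 0 0)"] by simp
  have e16: "t04 + t52 + t61 = 0"
    using T[of "(0, su3_vec 1 0 0 0 0 0 0 0)" "(0, su3_vec 0 1 0 0 0 0 0 0)" "(0, su3_vec 0 0 0 1 0 0 0 0)"] by simp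
  have e17: "t05 - t31 - t42 = 0"
    using T[of "(0, su3_vec 1 0 0 0 0 0 0 0)" "(0, su3_vec 0 1 0 0 0 0 0 0)" "(0, su3_vec 0 0 0 0 1 0 0 0)"] by simp
  have e18: "t06 + t32 - t41 = 0"
    using T[of "(0, su3_vec 1 0 0 0 0 0 0 0)" "(0, su3_vec 0 1 0 0 0 0 0 0)" "(0, su3_vec 0 0 0 0 0 1 0 0)"] by simp
  have e19: "(-1) * t01 + t53 + t64 = 0"
    using T[of "(0, su3_vec 1 0 0 0 0 0 0 0)" "(0, su3_vec 0 0 1 0 0 0 0 0)" "(0, su3_vec 0 0 0 1 0 0 0 0)"] by simp
  have e20: "t21 - t43 + t65 = 0"
    using T[of "(0, su3_vec 1 0 0 0 0 0 0 0)" "(0, su3_vec 0 0 1 0 0 0 0 0)" "(0, su3_vec 0 0 0 0 1 0 0 0)"] by simp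
  have e21: "t11 + t33 + t66 = 0"
    using T[of "(0, su3_vec 1 0 0 0 0 0 0 0)" "(0, su3_vec 0 0 1 0 0 0 0 0)" "(0, su3_vec 0 0 0 0 0 1 0 0)"] by simp
  have e22: "(-1) * t11 - t44 - t55 = 0"
    using T[of "(0, su3_vec 1 0 0 0 0 0 0 0)" "(0, su3_vec 0 0 0 1 0 0 0 0)" "(0, su3_vec 0 0 0 0 1 0 0 0)"] by simp
  have e23: "t21 + t34 - t56 = 0"
    using T[of "(0, su3_vec 1 0 0 0 0 0 0 0)" "(0, su3_vec 0 0 0 1 0 0 0 0)" "(0, su3_vec 0 0 0 0 0 1 0 0)"] by simp
  have e24: "t01 + t35 + t46 = 0"
    using T[of "(0, su3_vec 1 0 0 0 0 0 0 0)" "(0, su3_vec 0 0 0 0 1 0 0 0)" "(0, su3_vec 0 0 0 0 0 1 0 0)"] by simp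
  have e25: "(-1) * t02 + t54 - t63 = 0"
    using T[of "(0, su3_vec 0 1 0 0 0 0 0 0)" "(0, su3_vec 0 0 1 0 0 0 0 0)" "(0, su3_vec 0 0 0 1 0 0 0 0)"] by simp
  have e26: "t22 + t33 + t55 = 0"
    using T[of "(0, su3_vec 0 1 0 0 0 0 0 0)" "(0, su3_vec 0 0 1 0 0 0 0 0)" "(0, su3_vec 0 0 0 0 1 0 0 0)"] by simp
  have e27: "t12 + t43 + t56 = 0"
    using T[of "(0, su3_vec 0 1 0 0 0 0 0 0)" "(0, su3_vec 0 0 1 0 0 0 0 0)" "(0, su3_vec 0 0 0 0 0 1 0 0)"] by simp
  have e28: "(-1) * t12 + t34 + t65 = 0"
    using T[of "(0, su3_vec 0 1 0 0 0 0 0 0)" "(0, su3_vec 0 0 0 1 0 0 0 0)" "(0, su3_vec 0 0 0 0 1 0 0 0)"] by simp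
  have e29: "t22 + t44 + t66 = 0"
    using T[of "(0, su3_vec 0 1 0 0 0 0 0 0)" "(0, su3_vec 0 0 0 1 0 0 0 0)" "(0, su3_vec 0 0 0 0 0 1 0 0)"] by simp
  have e30: "t02 - t36 + t45 = 0"
    using T[of "(0, su3_vec 0 1 0 0 0 0 0 0)" "(0, su3_vec 0 0 0 0 1 0 0 0)" "(0, su3_vec 0 0 0 0 0 1 0 0)"] by simp
  have e31: "(-1) * t05 - t13 - t24 = 0"
    using T[of "(0, su3_vec 0 0 1 0 0 0 0 0)" "(0, su3_vec 0 0 0 1 0 0 0 0)" "(0, su3_vec 0 0 0 0 1 0 0 0)"] by simp
  have e32: "- t06 - t14 + t23 = 0"
    using T[of "(0, su3_vec 0 0 1 0 0 0 0 0)" "(0, su3_vec 0 0 0 1 0 0 0 0)" "(0, su3_vec 0 0 0 0 0 1 0 0)"] by simp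
  have e33: "t03 - t15 + t26 = 0"
    using T[of "(0, su3_vec 0 0 1 0 0 0 0 0)" "(0, su3_vec 0 0 0 0 1 0 0 0)" "(0, su3_vec 0 0 0 0 0 1 0 0)"] by simp
  have e34: "t04 - t16 - t25 = 0"
    using T[of "(0, su3_vec 0 0 0 1 0 0 0 0)" "(0, su3_vec 0 0 0 0 1 0 0 0)" "(0, su3_vec 0 0 0 0 0 1 0 0)"] by simp
  note eqs = e0 e1 e2 e3 e4 e5 e6 e7 e8 e9 e10 e11 e12 e13 e14 e15 e16 e17 e18 e19 e20 e21 e22 e23 e24 e25 e26 e27 e28 e29 e30 e31 e32 e33 e34
  show
    "t00 = 0"
    "t10 = - t01"
    "t11 = 0"
    "t20 = - t02"
    "t21 = - t12"
    "t22 = 0"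
    "t23 = t06 + t14"
    "t24 = - t05 - t13"
    "t25 = t04 - t16"
    "t26 = - t03 + t15"
    "t30 = - t03"
    "t31 = - t13"
    "t32 = - t06 - t14"
    "t33 = 0"
    "t40 = - t04"
    "t41 = - t14"
    "t42 = t13 + t05"
    "t43 = - t34"
    "t44 = 0"
    "t45 = - t02 + t36"
    "t46 = - t01 - t35"
    "t50 = - t05"
    "t51 = - t15"
    "t52 = t16 - t04"
    "t53 = - t35"
    "t54 = - t36 + t02"
    "t55 = 0"
    "t56 = - t12 + t34"
    "t60 = - t06"
    "t61 = - t16"
    "t62 = - t15 + t03"
    "t63 = - t36"
    "t64 = t35 + t01"
    "t65 = - t34 + t12"
    "t66 = 0"
    using eqs by linarith+
qed

lemma flag_stabilizer_in_holonomy: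
  assumes "linear T" and stable: "T ` cone_tangent 6 \<subseteq> cone_tangent 6"
    and T: "\<And>x y z. x \<in> cone_tangent 6 \<Longrightarrow> y \<in> cone_tangent 6 \<Longrightarrow> z \<in> cone_tangent 6 \<Longrightarrow>
      flag_form (T x) y z + flag_form x (T y) z + flag_form x y (T z) = 0"
  shows "\<exists>S\<in>flag_holonomy. \<forall>x\<in>cone_tangent 6. S x = T x"
proof -
  interpret linear T by fact
  have mem: "(x0, su3_vec x1 x2 x3 x4 x5 x6 0 0) \<in> cone_tangent 6" for x0 x1 x2 x3 x4 x5 x6
    unfolding cone_tangent_6_eq by blast
  have img: "T (x0, su3_vec x1 x2 x3 x4 x5 x6 0 0) \<in> cone_tangent 6" for x0 x1 x2 x3 x4 x5 x6
    using stable mem by blast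
  obtain t00 t10 t20 t30 t40 t50 t60 where
    c0: "T (1, su3_vec 0 0 0 0 0 0 0 0) = (t00, su3_vec t10 t20 t30 t40 t50 t60 0 0)"
    by (rule cone_tangent_6E[OF img])
  obtain t01 t11 t21 t31 t41 t51 t61 where
    c1: "T (0, su3_vec 1 0 0 0 0 0 0 0) = (t01, su3_vec t11 t21 t31 t41 t51 t61 0 0)"
    by (rule cone_tangent_6E[OF img])
  obtain t02 t12 t22 t32 t42 t52 t62 where
    c2: "T (0, su3_vec 0 1 0 0 0 0 0 0) = (t02, su3_vec t12 t22 t32 t42 t52 t62 0 0)"
    by (rule cone_tangent_6E[OF img])
  obtain t03 t13 t23 t33 t43 t53 t63 where
    c3: "T (0, su3_vec 0 0 1 0 0 0 0 0) = (t03, su3_vec t13 t23 t33 t43 t53 t63 0 0)"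
    by (rule cone_tangent_6E[OF img])
  obtain t04 t14 t24 t34 t44 t54 t64 where
    c4: "T (0, su3_vec 0 0 0 1 0 0 0 0) = (t04, su3_vec t14 t24 t34 t44 t54 t64 0 0)"
    by (rule cone_tangent_6E[OF img])
  obtain t05 t15 t25 t35 t45 t55 t65 where
    c5: "T (0, su3_vec 0 0 0 0 1 0 0 0) = (t05, su3_vec t15 t25 t35 t45 t55 t65 0 0)"
    by (rule cone_tangent_6E[OF img])
  obtain t06 t16 t26 t36 t46 t56 t66 where
    c6: "T (0, su3_vec 0 0 0 0 0 1 0 0) = (t06, su3_vec t16 t26 t36 t46 t56 t66 0 0)"
    by (rule cone_tangent_6E[OF img])
  note rels = flag_stabilizer_relations[OF T c0 c1 c2 c3 c4 c5 c6]
  \<comment> \<open>The coefficients invert the map from 8 curvatures and 6 derivatives to the 14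
    free entries. The derivatives alone contribute to the radial row, which determines their
    coefficients; the curvatures correct the remaining entries.\<close>
  define S where "S = (\<lambda>x. (4/9 * t12 - 2/9 * t34) *\<^sub>R flag_curvature 1 2 x
      + ((-2/3) * t05 - 4/3 * t13) *\<^sub>R flag_curvature 1 3 x
      + ((-2/3) * t06 - 4/3 * t14) *\<^sub>R flag_curvature 1 4 x
      + (2/3 * t03 - 4/3 * t15) *\<^sub>R flag_curvature 1 5 x
      + (2/3 * t04 - 4/3 * t16) *\<^sub>R flag_curvature 1 6 x
      + ((-2/9) * t12 + 4/9 * t34) *\<^sub>R flag_curvature 3 4 x
      + ((-2/3) * t01 - 4/3 * t35) *\<^sub>R flag_curvature 3 5 x
      + (2/3 * t02 - 4/3 * t36) *\<^sub>R flag_curvature 3 6 x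
      + (-1/3 * t02) *\<^sub>R flag_curvature_derivative 1 x
      + (1/3 * t01) *\<^sub>R flag_curvature_derivative 2 x
      + (-2/3 * t04) *\<^sub>R flag_curvature_derivative 3 x
      + (2/3 * t03) *\<^sub>R flag_curvature_derivative 4 x
      + (2/3 * t06) *\<^sub>R flag_curvature_derivative 5 x
      + (-2/3 * t05) *\<^sub>R flag_curvature_derivative 6 x)"
  have "S \<in> flag_holonomy"
    unfolding S_def by (intro cone_holonomy.add cone_holonomy.scale flag_curvature_holonomy
        flag_curvature_derivative_holonomy) auto
  moreover have "S x = T x" if x_in: "x \<in> cone_tangent 6" for x
  proof -
    obtain y0 y1 y2 y3 y4 y5 y6 where x: "x = (y0, su3_vec y1 y2 y3 y4 y5 y6 0 0)"
      by (rule cone_tangent_6E[OF x_in])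
    have "x = y0 *\<^sub>R (1, su3_vec 0 0 0 0 0 0 0 0) + y1 *\<^sub>R (0, su3_vec 1 0 0 0 0 0 0 0) + y2 *\<^sub>R (0, su3_vec 0 1 0 0 0 0 0 0) + y3 *\<^sub>R (0, su3_vec 0 0 1 0 0 0 0 0) + y4 *\<^sub>R (0, su3_vec 0 0 0 1 0 0 0 0) + y5 *\<^sub>R (0, su3_vec 0 0 0 0 1 0 0 0) + y6 *\<^sub>R (0, su3_vec 0 0 0 0 0 1 0 0)"
      by (simp add: x su3_simps)
    then have "T x = y0 *\<^sub>R T (1, su3_vec 0 0 0 0 0 0 0 0) + y1 *\<^sub>R T (0, su3_vec 1 0 0 0 0 0 0 0) + y2 *\<^sub>R T (0, su3_vec 0 1 0 0 0 0 0 0) + y3 *\<^sub>R T (0, su3_vec 0 0 1 0 0 0 0 0) + y4 *\<^sub>R T (0, su3_vec 0 0 0 1 0 0 0 0) + y5 *\<^sub>R T (0, su3_vec 0 0 0 0 1 0 0 0) + y6 *\<^sub>R T (0, su3_vec 0 0 0 0 0 1 0 0)"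
      by (metis add scale)
    also have "\<dots> = S x"
      unfolding S_def x
      by (simp add: c0 c1 c2 c3 c4 c5 c6 flag_curvature_eq flag_curvature_derivative_eq su3_simps su3_vec_eq_iff rels field_simps)
    finally show ?thesis by simp
  qed
  ultimately show ?thesis by blast
qed

lemma flag_holonomy_iff:
  assumes T: "linear T" "T ` cone_tangent 6 \<subseteq> cone_tangent 6"
  shows "(\<exists>S\<in>flag_holonomy. \<forall>x\<in>cone_tangent 6. S x = T x) \<longleftrightarrow>
     (\<forall>x\<in>cone_tangent 6. \<forall>y\<in>cone_tangent 6. \<forall>z\<in>cone_tangent 6.
        flag_form (T x) y z + flag_form x (T y) z + flag_form x y (T z) = 0)"
proof
  assume "\<exists>S\<in>flag_holonomy. \<forall>x\<in>cone_tangent 6. S x = T x"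
  then obtain S where "S \<in> flag_holonomy" "\<forall>x\<in>cone_tangent 6. S x = T x" by blast
  then show "\<forall>x\<in>cone_tangent 6. \<forall>y\<in>cone_tangent 6. \<forall>z\<in>cone_tangent 6.
      flag_form (T x) y z + flag_form x (T y) z + flag_form x y (T z) = 0"
    using flag_derivation_holonomy unfolding flag_derivation_def by metis
next
  assume "\<forall>x\<in>cone_tangent 6. \<forall>y\<in>cone_tangent 6. \<forall>z\<in>cone_tangent 6.
    flag_form (T x) y z + flag_form x (T y) z + flag_form x y (T z) = 0"
  then show "\<exists>S\<in>flag_holonomy. \<forall>x\<in>cone_tangent 6. S x = T x"
    using T by (intro flag_stabilizer_in_holonomy) blast+
qed

lemma flag_cone_holonomy: "cone_has_holonomy_G2 (\<lambda>_. 1)"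
  unfolding cone_has_holonomy_G2_def Let_def
proof (intro exI[of _ flag_frame] conjI allI impI)
  show "\<forall>i\<in>{1..7}. flag_frame i \<in> cone_tangent 6"
    unfolding atLeast1_atMost_7 by (simp add: flag_frame_def cone_tangent_6_eq su3_vec_eq_iff)
  show "\<forall>i\<in>{1..7}. \<forall>j\<in>{1..7}. cone_ip 6 (\<lambda>_. 1) (flag_frame i) (flag_frame j) = (if i = j then 1 else 0)"
    unfolding atLeast1_atMost_7 by (simp add: flag_frame_def cone_ip_def metric_ip_su3_vec)
qed (rule flag_holonomy_iff[unfolded flag_form_def]; simp)

text \<open>The structure is reversed on \<open>e_3, e_4\<close>, whose root is the sum of the roots
  of the other two planes. The three chosen roots then add up to zero, which singles out the
  non-integrable invariant structure.\<close>

definition flag_J :: "mat3 \<Rightarrow> mat3" where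
  "flag_J A = su3_vec (- coord 2 A) (coord 1 A) (coord 4 A) (- coord 3 A) (- coord 6 A) (coord 5 A) 0 0"

lemma flag_nearly_kaehler: "homogeneous_nearly_kaehler 6 (\<lambda>_. 1)"
  unfolding homogeneous_nearly_kaehler_def
proof (intro conjI exI[of _ flag_J])
  show "invariant_metric 6 (\<lambda>_. 1)"
    unfolding invariant_metric_def tangent_6_eq isotropy_6_eq
    by (auto simp: su3_simps algebra_simps)
  show "linear flag_J"
    by (rule linearI) (simp_all add: flag_J_def coord_def inner_add_left add_divide_distrib su3_simps su3_vec_eq_iff)
  have ne: "levi_civita 6 (\<lambda>_. 1) (su3_basis 1) (flag_J (su3_basis 3))
      \<noteq> flag_J (levi_civita 6 (\<lambda>_. 1) (su3_basis 1) (su3_basis 3))"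
    by (simp add: flag_J_def su3_simps levi_civita_flag su3_vec_eq_iff)
  have "su3_basis 1 \<in> tangent 6" "su3_basis 3 \<in> tangent 6"
    by (auto simp: tangent_def intro!: span_base)
  with ne show "\<exists>X\<in>tangent 6. \<exists>Y\<in>tangent 6. levi_civita 6 (\<lambda>_. 1) X (flag_J Y)
      \<noteq> flag_J (levi_civita 6 (\<lambda>_. 1) X Y)"
    by blast
qed (auto simp: tangent_6_eq isotropy_6_eq flag_J_def su3_simps levi_civita_flag su3_vec_eq_iff algebra_simps)

section \<open>Singular initial value problems\<close>

type_synonym vec3 = "real \<times> real \<times> real"

definition damp :: "real \<Rightarrow> vec3 \<Rightarrow> vec3" where
  "damp l v = (fst v, fst (snd v), l ^ 3 * snd (snd v))"

lemma norm_vec3: "norm (v :: vec3) = sqrt ((fst v)\<^sup>2 + (fst (snd v))\<^sup>2 + (snd (snd v))\<^sup>2)"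
  by (simp add: norm_prod_def add.assoc)

lemma norm_damp_le:
  assumes "l \<in> {0..1}"
  shows "norm (damp l v) \<le> norm v"
proof -
  have "(l ^ 3)\<^sup>2 \<le> 1" using assms by (simp add: power_le_one flip: power_mult)
  then have "(l ^ 3 * snd (snd v))\<^sup>2 \<le> (snd (snd v))\<^sup>2"
    by (simp add: power_mult_distrib mult_left_le_one_le)
  then show ?thesis by (simp add: norm_vec3 damp_def)
qed

lemma damp_diff: "damp l (u - v) = damp l u - damp l v"
  by (simp add: damp_def algebra_simps prod_eq_iff)

lemma continuous_on_damp [continuous_intros]:
  "continuous_on S f \<Longrightarrow> continuous_on S g \<Longrightarrow> continuous_on S (\<lambda>x. damp (f x) (g x))"
  unfolding damp_def by (intro continuous_intros)

text \<open>In the norm weighted by \<open>e^(-Kz)\<close> the integral operator gains a factor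
  \<open>1/K\<close> on the whole half line, not just on a short interval.\<close>

lemma volterra_contraction_kernel:
  assumes "K > 0" "z \<ge> (0::real)"
  shows "z * exp (- K * z) * integral {0..1} (\<lambda>l. exp (K * (l * z))) \<le> 1 / K"
proof (cases "z = 0")
  case False
  with assms have z: "z > 0" by simp
  have "((\<lambda>l. exp (K * (l * z))) has_integral (exp (K * (1 * z)) / (K * z) - exp (K * (0 * z)) / (K * z))) {0..1}"
    using z assms by (intro fundamental_theorem_of_calculus)
      (auto intro!: derivative_eq_intros simp flip: has_real_derivative_iff_has_vector_derivative)
  then have "z * exp (- K * z) * integral {0..1} (\<lambda>l. exp (K * (l * z))) = (1 - exp (- K * z)) / K"
    using z assms by (simp add: integral_unique field_simps flip: exp_add)
  also have "\<dots> \<le> 1 / K" using assms by (simp add: divide_right_mono)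
  finally show ?thesis .
qed (use assms in simp)

text \<open>The fixed point is \<open>w = e^(-Kz) (Y - p)\<close>, sought among bounded continuous
  functions of the pair \<open>(p, z)\<close>. Treating the initial value as an argument of the
  unknown yields joint continuity in \<open>(p, z)\<close> from completeness of that space.\<close>

lemma volterra_solution:
  fixes G :: "real \<Rightarrow> vec3 \<Rightarrow> vec3"
  assumes cont: "continuous_on UNIV (\<lambda>(z, y). G z y)"
    and lip: "\<And>z u v. norm (G z u - G z v) \<le> L * norm (u - v)"
    and bound: "\<And>z u. norm (G z u) \<le> C"
  obtains Y :: "vec3 \<times> real \<Rightarrow> vec3" where "continuous_on UNIV Y"
    "\<And>p z. z \<ge> 0 \<Longrightarrow> Y (p, z) = p + z *\<^sub>R integral {0..1} (\<lambda>l. damp l (G (l * z) (Y (p, l * z))))"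
proof -
  \<comment> \<open>Twice the Lipschitz constant makes the contraction factor 1/2; the
    \<open>max\<close> keeps \<open>K\<close> positive.\<close>
  define K where "K = 2 * max L 1"
  have K: "K > 0" "2 * max L 1 = K" by (auto simp: K_def)
  have C: "C \<ge> 0" using bound[of 0 0] norm_ge_zero order_trans by blast
  \<comment> \<open>Replacing \<open>z\<close> by \<open>max 0 z\<close> extends the integrand
    constantly to negative \<open>z\<close>, so that the function space lives on all of
    \<open>vec3 \<times> real\<close>.\<close>
  define I where "I = (\<lambda>(w :: vec3 \<times> real \<Rightarrow> vec3) x l. damp l (G (l * max 0 (snd x))
      (fst x + exp (K * (l * max 0 (snd x))) *\<^sub>R w (fst x, l * max 0 (snd x)))))"
  define ker where "ker = (\<lambda>w x. exp (- K * max 0 (snd x)) *\<^sub>R max 0 (snd x) *\<^sub>R integral {0..1} (I w x))"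
  have G_comp: "continuous_on S (\<lambda>x. G (f x) (g x))"
    if "continuous_on S f" "continuous_on S g" for S :: "((vec3 \<times> real) \<times> real) set" and f g
    using continuous_on_compose2[OF cont continuous_on_Pair[OF that]] by simp
  have I_cont: "continuous_on (UNIV \<times> {0..1}) (\<lambda>(x, l). I w x l)" if w: "continuous_on UNIV w" for w
    unfolding I_def split_def
    by (intro continuous_intros G_comp continuous_on_compose2[OF w]) auto
  have I_int: "I w x integrable_on {0..1}" if w: "continuous_on UNIV w" for w x
  proof (rule integrable_continuous_real)
    have "continuous_on {0..1} (\<lambda>l. (\<lambda>(x, l). I w x l) (x, l))"
      by (rule continuous_on_compose2[OF I_cont[OF w]]) (auto intro!: continuous_intros)
    then show "continuous_on {0..1} (I w x)" by simp
  qed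
  have ker_cont: "continuous_on UNIV (ker w)" if w: "continuous_on UNIV w" for w
    unfolding ker_def
    using integral_continuous_on_param[of UNIV 0 1 "I w"] I_cont[OF w]
    by (intro continuous_intros) auto
  have I_bound: "norm (I w x l) \<le> C" if "l \<in> {0..1}" for w x l
    unfolding I_def using norm_damp_le[OF that] bound order_trans by blast
  have ker_bound: "norm (ker w x) \<le> C / K" if w: "continuous_on UNIV w" for w x
  proof -
    have i: "norm (integral {0..1} (I w x)) \<le> C"
      using integral_norm_bound_integral[OF I_int[OF w, of x], of "\<lambda>_. C"] I_bound by (simp add: integrable_const_ivl)
    have "K * max 0 (snd x) \<le> exp (K * max 0 (snd x))"
      using exp_ge_add_one_self[of "K * max 0 (snd x)"] by linarith
    then have "exp (- K * max 0 (snd x)) * max 0 (snd x) \<le> 1 / K"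
      using K by (simp add: exp_minus field_simps)
    then have "exp (- K * max 0 (snd x)) * max 0 (snd x) * norm (integral {0..1} (I w x)) \<le> 1 / K * C"
      using i K by (intro mult_mono) auto
    then show ?thesis unfolding ker_def by (simp add: mult.assoc)
  qed
  have ker_bc: "ker (apply_bcontfun w) \<in> bcontfun" for w
    unfolding bcontfun_def using ker_cont[of w] ker_bound[of w]
    by (auto intro!: boundedI)
  define Phi where "Phi w = Bcontfun (ker (apply_bcontfun w))" for w
  have Phi: "apply_bcontfun (Phi w) = ker (apply_bcontfun w)" for w
    unfolding Phi_def by (simp add: Bcontfun_inverse ker_bc)
  have "dist (Phi w) (Phi w') \<le> 1/2 * dist w w'" for w w'
  proof (rule dist_bound)
    fix x :: "vec3 \<times> real"
    define z where "z = max 0 (snd x)"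
    define d where "d = dist w w'"
    have z: "z \<ge> 0" by (simp add: z_def)
    have cw: "continuous_on UNIV (apply_bcontfun w)" for w :: "(vec3 \<times> real) \<Rightarrow>\<^sub>C vec3" by simp
    have I_lip: "norm (I w x l - I w' x l) \<le> max L 1 * d * exp (K * (l * z))" if l: "l \<in> {0..1}" for l
    proof -
      have "norm (I w x l - I w' x l) \<le> L * norm (exp (K * (l * z)) *\<^sub>R (w (fst x, l * z) - w' (fst x, l * z)))"
        unfolding I_def z_def[symmetric] damp_diff[symmetric]
        by (rule order_trans[OF norm_damp_le[OF l]], rule order_trans[OF lip])
           (simp add: scaleR_diff_right)
      also have "\<dots> = L * (exp (K * (l * z)) * dist (w (fst x, l * z)) (w' (fst x, l * z)))"
        by (simp add: dist_norm)
      also have "\<dots> \<le> max L 1 * (exp (K * (l * z)) * d)"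
        unfolding d_def by (intro mult_mono dist_bounded) auto
      finally show ?thesis by (simp add: mult_ac)
    qed
    have "norm (integral {0..1} (I w x) - integral {0..1} (I w' x))
        \<le> integral {0..1} (\<lambda>l. max L 1 * d * exp (K * (l * z)))"
      unfolding integral_diff[OF I_int[OF cw] I_int[OF cw], symmetric]
      by (intro integral_norm_bound_integral integrable_diff I_int cw I_lip integrable_continuous_real
          continuous_intros)
    also have "\<dots> = max L 1 * d * integral {0..1} (\<lambda>l. exp (K * (l * z)))" by simp
    finally have "exp (- K * z) * z * norm (integral {0..1} (I w x) - integral {0..1} (I w' x))
        \<le> exp (- K * z) * z * (max L 1 * d * integral {0..1} (\<lambda>l. exp (K * (l * z))))"
      using z by (intro mult_left_mono) auto
    also have "\<dots> = max L 1 * d * (z * exp (- K * z) * integral {0..1} (\<lambda>l. exp (K * (l * z))))"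
      by (simp add: mult_ac)
    also have "\<dots> \<le> max L 1 * d * (1 / K)"
      using z K by (intro mult_left_mono volterra_contraction_kernel) (auto simp: d_def)
    also have "\<dots> = 1/2 * d" using K by (simp add: field_simps)
    finally have "norm (exp (- K * z) *\<^sub>R z *\<^sub>R (integral {0..1} (I w x) - integral {0..1} (I w' x))) \<le> 1/2 * d"
      using z by (simp add: mult.assoc)
    then show "dist (Phi w x) (Phi w' x) \<le> 1/2 * dist w w'"
      unfolding Phi ker_def z_def[symmetric] d_def dist_norm by (simp add: scaleR_diff_right)
  qed
  then obtain w where w: "Phi w = w"
    using banach_fix_type[of "1/2" Phi] by auto
  have ker_w: "ker w = apply_bcontfun w" using Phi[of w] w by simp
  define Y where "Y = (\<lambda>x. fst x + exp (K * max 0 (snd x)) *\<^sub>R w x)"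
  have "continuous_on UNIV Y" unfolding Y_def by (intro continuous_intros) auto
  moreover have "Y (p, z) = p + z *\<^sub>R integral {0..1} (\<lambda>l. damp l (G (l * z) (Y (p, l * z))))"
    if z: "z \<ge> 0" for p z
  proof -
    have "I w (p, z) l = damp l (G (l * z) (Y (p, l * z)))" if "l \<in> {0..1}" for l
      using z that by (simp add: I_def Y_def max_def)
    then have "integral {0..1} (I w (p, z)) = integral {0..1} (\<lambda>l. damp l (G (l * z) (Y (p, l * z))))"
      by (rule integral_cong)
    moreover have "Y (p, z) = p + exp (K * z) *\<^sub>R ker w (p, z)"
      using z by (simp add: Y_def ker_w)
    ultimately show ?thesis using z by (simp add: ker_def flip: exp_add)
  qed
  ultimately show thesis by (rule that)
qed

definition clamp3 :: "real \<Rightarrow> vec3 \<Rightarrow> vec3" where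
  "clamp3 m v = (max (- m) (min m (fst v)), max (- m) (min m (fst (snd v))), max (- m) (min m (snd (snd v))))"

lemma norm_clamp3_diff: "norm (clamp3 m u - clamp3 m v) \<le> norm (u - v)"
proof -
  have *: "(max (- m) (min m x) - max (- m) (min m y))\<^sup>2 \<le> (x - y)\<^sup>2" for x y :: real
    by (rule abs_le_square_iff[THEN iffD1]) auto
  show ?thesis unfolding norm_vec3 clamp3_def
    by (intro real_sqrt_le_mono add_mono) (auto simp: *)
qed

lemma norm_clamp3_le:
  assumes "m \<ge> 0"
  shows "norm (clamp3 m v) \<le> 2 * m"
proof -
  have *: "(max (- m) (min m x))\<^sup>2 \<le> m\<^sup>2" for x :: real
    using assms by (intro abs_le_square_iff[THEN iffD1]) auto
  have "norm (clamp3 m v) \<le> sqrt (m\<^sup>2 + m\<^sup>2 + m\<^sup>2)"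
    unfolding norm_vec3 clamp3_def by (intro real_sqrt_le_mono add_mono) (auto simp: *)
  also have "\<dots> \<le> sqrt ((2 * m)\<^sup>2)"
    by (intro real_sqrt_le_mono) (simp add: power_mult_distrib)
  finally show ?thesis using assms by (simp only: real_sqrt_abs)
qed

lemma norm_vec3_components:
  "\<bar>fst v\<bar> \<le> norm (v :: vec3)" "\<bar>fst (snd v)\<bar> \<le> norm v" "\<bar>snd (snd v)\<bar> \<le> norm v"
  unfolding norm_vec3 by (intro real_le_rsqrt; simp)+

lemma clamp3_id: "norm v \<le> m \<Longrightarrow> clamp3 m v = v"
  using norm_vec3_components[of v] by (auto simp: clamp3_def prod_eq_iff max_def min_def)

lemma continuous_on_clamp3 [continuous_intros]:
  "continuous_on S f \<Longrightarrow> continuous_on S g \<Longrightarrow> continuous_on S (\<lambda>x. clamp3 (f x) (g x))"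
  unfolding clamp3_def by (intro continuous_intros)

lemma first_zero:
  fixes g :: "real \<Rightarrow> real"
  assumes "continuous_on {a..b} g" "a \<le> b" "g a > 0" "g b \<le> 0"
  obtains c where "a < c" "c \<le> b" "g c = 0" "\<And>x. a \<le> x \<Longrightarrow> x < c \<Longrightarrow> g x > 0"
proof -
  define S where "S = {x \<in> {a..b}. g x \<le> 0}"
  have "closed S" unfolding S_def
    using continuous_closed_preimage[OF assms(1) closed_atLeastAtMost closed_atMost[of 0]]
    by (simp add: vimage_def Int_def)
  moreover have "b \<in> S" "bdd_below S" using assms by (auto simp: S_def intro!: bdd_belowI[of _ a])
  ultimately have mem: "Inf S \<in> S" by (intro closed_contains_Inf) auto
  have pos: "g x > 0" if "a \<le> x" "x < Inf S" for x
  proof (rule ccontr)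
    assume "\<not> 0 < g x"
    then have "x \<in> S" using that mem by (auto simp: S_def)
    then show False using that cInf_lower[OF _ \<open>bdd_below S\<close>] by force
  qed
  have "a < Inf S" using mem assms by (cases "Inf S = a") (auto simp: S_def)
  moreover have "g (Inf S) = 0"
  proof (rule ccontr)
    assume "g (Inf S) \<noteq> 0"
    with mem have neg: "g (Inf S) < 0" by (auto simp: S_def)
    have "continuous_on {a..Inf S} g"
      by (rule continuous_on_subset[OF assms(1)]) (use mem in \<open>auto simp: S_def\<close>)
    then obtain x where "a \<le> x" "x \<le> Inf S" "g x = 0"
      using IVT2'[of g "Inf S" 0 a] neg assms \<open>a < Inf S\<close> by auto
    then show False using pos[of x] neg by (cases "x = Inf S") auto
  qed
  ultimately show thesis using that mem pos by (auto simp: S_def)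
qed

lemma integral_stretch:
  fixes h :: "real \<Rightarrow> 'a::banach"
  assumes "continuous_on {0..z} h" "z > 0"
  shows "z *\<^sub>R integral {0..1} (\<lambda>l. h (l * z)) = integral {0..z} h"
proof -
  have "((\<lambda>l. h (z * l)) has_integral (1 / \<bar>z\<bar>) *\<^sub>R integral {0..z} h) ((\<lambda>x. x / z) ` {0..z})"
    using assms by (intro has_integral_stretch_real integrable_integral integrable_continuous_real) auto
  moreover have "(\<lambda>x. x / z) ` {0..z} = {0..1}"
    using assms by (simp add: image_divide_atLeastAtMost)
  ultimately have "integral {0..1} (\<lambda>l. h (l * z)) = (1 / z) *\<^sub>R integral {0..z} h"
    using assms by (simp add: integral_unique mult.commute)
  then show ?thesis using assms by simp
qed

text \<open>A trajectory leaving an equilibrium with linearisation \<open>diag(1, 1, -2)\<close> along the unstable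
  directions is written as \<open>z Y(z)\<close> with \<open>z = e\<^sup>s\<close>; then \<open>G z Y\<close> is the nonlinear part of the
  field at \<open>z Y\<close>, divided by \<open>z\<^sup>2\<close>.\<close>

definition scaled_solution :: "(real \<Rightarrow> vec3 \<Rightarrow> vec3) \<Rightarrow> vec3 \<Rightarrow> real \<Rightarrow> (real \<Rightarrow> vec3) \<Rightarrow> bool" where
  "scaled_solution G p Z Y \<longleftrightarrow> continuous_on {0..Z} Y \<and> Y 0 = p \<and>
     (\<forall>z. 0 < z \<and> z < Z \<longrightarrow>
        (Y has_vector_derivative (G z (Y z) - (0, 0, 3 * snd (snd (Y z)) / z))) (at z))"

text \<open>The Lipschitz constant must not depend on \<open>z\<close>. The quadratic terms of the
  field call for a bound on \<open>u\<close>; the terms of higher order carry powers of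
  \<open>z\<close> and call for a bound on \<open>z u\<close> as well.\<close>

locale scaled_field =
  fixes G :: "real \<Rightarrow> vec3 \<Rightarrow> vec3"
  assumes cont: "continuous_on UNIV (\<lambda>(z, y). G z y)"
    and zero: "G z 0 = 0"
    and lip: "\<exists>L. \<forall>z u v. 0 \<le> z \<and> norm u \<le> M \<and> norm v \<le> M \<and> z * norm u \<le> B \<and> z * norm v \<le> B
      \<longrightarrow> norm (G z u - G z v) \<le> L * norm (u - v)"
    and scale: "G 1 (z *\<^sub>R y) = z\<^sup>2 *\<^sub>R G z y"
begin

lemma G_comp [continuous_intros]:
  assumes "continuous_on S f" "continuous_on S g"
  shows "continuous_on S (\<lambda>x. G (f x) (g x))"
  using continuous_on_compose2[OF cont continuous_on_Pair[OF assms]] by simp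

lemma lipE:
  obtains L where "L \<ge> 0" "\<And>z u v. 0 \<le> z \<Longrightarrow> norm u \<le> M \<Longrightarrow> norm v \<le> M \<Longrightarrow> z * norm u \<le> B \<Longrightarrow>
    z * norm v \<le> B \<Longrightarrow> norm (G z u - G z v) \<le> L * norm (u - v)"
proof -
  obtain L where L: "\<forall>z u v. 0 \<le> z \<and> norm u \<le> M \<and> norm v \<le> M \<and> z * norm u \<le> B \<and> z * norm v \<le> B
      \<longrightarrow> norm (G z u - G z v) \<le> L * norm (u - v)" using lip by blast
  show thesis
  proof (rule that[of "max L 0"])
    fix z :: real and u v :: vec3 assume "0 \<le> z" "norm u \<le> M" "norm v \<le> M" "z * norm u \<le> B" "z * norm v \<le> B"
    then have "norm (G z u - G z v) \<le> L * norm (u - v)" using L by blast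
    also have "\<dots> \<le> max L 0 * norm (u - v)" by (intro mult_right_mono) auto
    finally show "norm (G z u - G z v) \<le> max L 0 * norm (u - v)" .
  qed simp
qed

text \<open>With \<open>r = l z\<close> the third component is \<open>z^(-3)\<close> times the
  integral of \<open>r^3 G3\<close>, and differentiating the factor \<open>z^(-3)\<close> produces
  \<open>- 3 Y3 / z\<close>. For a \<open>p\<close> with nonzero third component the formula would
  solve a different equation.\<close>

lemma volterra_imp_scaled_solution:
  assumes Y: "continuous_on {0..Z} Y" and p: "snd (snd p) = 0"
    and eq: "\<And>z. 0 \<le> z \<Longrightarrow> z \<le> Z \<Longrightarrow> Y z = p + z *\<^sub>R integral {0..1} (\<lambda>l. damp l (G (l * z) (Y (l * z))))"
    and Z: "Z > 0"
  shows "scaled_solution G p Z Y"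
  unfolding scaled_solution_def
proof (intro conjI allI impI)
  show "Y 0 = p" using eq[of 0] Z by simp
  define H where "H = (\<lambda>z. G z (Y z))"
  have H: "continuous_on {0..z} H" if "z \<le> Z" for z
    unfolding H_def using that
    by (intro continuous_intros continuous_on_subset[OF Y]) auto
  define H3 where "H3 = (\<lambda>z. z ^ 3 * snd (snd (H z)))"
  have H3: "continuous_on {0..z} H3" if "z \<le> Z" for z
    unfolding H3_def using H[OF that] by (intro continuous_intros)
  have Y_eq: "Y z = p + (integral {0..z} (\<lambda>z. fst (H z)), integral {0..z} (\<lambda>z. fst (snd (H z))), integral {0..z} H3 / z ^ 3)"
    if z: "0 < z" "z \<le> Z" for z
  proof -
    have Hz: "continuous_on {0..1} (\<lambda>l. H (l * z))"
      using z by (intro continuous_on_compose2[OF H[OF z(2)]] continuous_intros) (auto simp: mult_left_le_one_le)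
    have Dint: "(\<lambda>l. damp l (H (l * z))) integrable_on {0..1}"
      by (intro integrable_continuous_real continuous_intros Hz)
    have "fst (integral {0..1} (\<lambda>l. damp l (H (l * z)))) = integral {0..1} (\<lambda>l. fst (damp l (H (l * z))))"
      "snd (integral {0..1} (\<lambda>l. damp l (H (l * z)))) = integral {0..1} (\<lambda>l. snd (damp l (H (l * z))))"
      using integral_linear[OF Dint bounded_linear_fst] integral_linear[OF Dint bounded_linear_snd]
      by (simp_all add: o_def)
    moreover have Dint2: "(\<lambda>l. snd (damp l (H (l * z)))) integrable_on {0..1}"
      using integrable_linear[OF Dint bounded_linear_snd] by (simp add: o_def)
    moreover have "fst (integral {0..1} (\<lambda>l. snd (damp l (H (l * z))))) = integral {0..1} (\<lambda>l. fst (snd (damp l (H (l * z)))))"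
      "snd (integral {0..1} (\<lambda>l. snd (damp l (H (l * z))))) = integral {0..1} (\<lambda>l. snd (snd (damp l (H (l * z)))))"
      using integral_linear[OF Dint2 bounded_linear_fst] integral_linear[OF Dint2 bounded_linear_snd]
      by (simp_all add: o_def)
    moreover have "z * integral {0..1} (\<lambda>l. fst (H (l * z))) = integral {0..z} (\<lambda>z. fst (H z))"
      "z * integral {0..1} (\<lambda>l. fst (snd (H (l * z)))) = integral {0..z} (\<lambda>z. fst (snd (H z)))"
      using integral_stretch[OF continuous_on_fst[OF H[OF z(2)]] z(1)]
        integral_stretch[OF continuous_on_fst[OF continuous_on_snd[OF H[OF z(2)]]] z(1)]
      by simp_all
    moreover have "z * integral {0..1} (\<lambda>l. l ^ 3 * snd (snd (H (l * z)))) = integral {0..z} H3 / z ^ 3"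
    proof -
      have "(\<lambda>l. l ^ 3 * snd (snd (H (l * z)))) = (\<lambda>l. H3 (l * z) / z ^ 3)"
        using z by (simp add: H3_def power_mult_distrib)
      then show ?thesis using integral_stretch[OF H3[OF z(2)] z(1)] z by simp
    qed
    moreover have "Y z = p + z *\<^sub>R integral {0..1} (\<lambda>l. damp l (H (l * z)))"
      using eq[of z] z by (simp add: H_def)
    ultimately show ?thesis
      by (simp add: prod_eq_iff damp_def)
  qed
  show "continuous_on {0..Z} Y" by fact
  fix z assume z: "0 < z \<and> z < Z"
  have at: "at z within {0..Z} = at z" using z by (intro at_within_interior) auto
  have d: "((\<lambda>u. integral {0..u} f) has_real_derivative f z) (at z)" if "continuous_on {0..Z} f" for f
    using integral_has_vector_derivative[OF that, of z] z
    by (simp add: at has_real_derivative_iff_has_vector_derivative)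
  have "((\<lambda>u. integral {0..u} H3 / u ^ 3) has_real_derivative
      (H3 z * z ^ 3 - integral {0..z} H3 * (3 * z ^ 2)) / (z ^ 3 * z ^ 3)) (at z)"
    by (rule derivative_eq_intros d H3 refl | use z in simp)+
  also have "(H3 z * z ^ 3 - integral {0..z} H3 * (3 * z ^ 2)) / (z ^ 3 * z ^ 3)
      = snd (snd (H z)) - 3 * snd (snd (Y z)) / z"
    using z Y_eq[of z] p by (simp add: H3_def field_simps power2_eq_square power3_eq_cube)
  finally have d3: "((\<lambda>u. integral {0..u} H3 / u ^ 3) has_real_derivative
      snd (snd (H z)) - 3 * snd (snd (Y z)) / z) (at z)" .
  have "((\<lambda>z. p + (integral {0..z} (\<lambda>z. fst (H z)), integral {0..z} (\<lambda>z. fst (snd (H z))), integral {0..z} H3 / z ^ 3))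
      has_vector_derivative 0 + (fst (H z), fst (snd (H z)), snd (snd (H z)) - 3 * snd (snd (Y z)) / z)) (at z)"
    using H[OF order_refl]
    by (intro has_vector_derivative_add has_vector_derivative_const has_vector_derivative_Pair d3[THEN has_real_derivative_iff_has_vector_derivative[THEN iffD1]]
       d[THEN has_real_derivative_iff_has_vector_derivative[THEN iffD1]] continuous_intros)
  then have "(Y has_vector_derivative 0 + (fst (H z), fst (snd (H z)), snd (snd (H z)) - 3 * snd (snd (Y z)) / z)) (at z)"
    by (rule has_vector_derivative_transform_within_open[of _ _ _ "{0<..<Z}"])
      (use z Y_eq in auto)
  then show "(Y has_vector_derivative (G z (Y z) - (0, 0, 3 * snd (snd (Y z)) / z))) (at z)"
    by (simp add: H_def minus_prod_def)
qed

text \<open>Continuity method: a solution of the truncated equation solves the true one up to the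
  place where the truncation first becomes active. Reaching such a place contradicts the a priori
  bound or, close to \<open>z = 0\<close>, a crude estimate of the growth of
  \<open>Y\<close>.\<close>

theorem global_scaled_solutions:
  assumes bounded: "bounded P" and P: "\<And>p. p \<in> P \<Longrightarrow> snd (snd p) = 0"
    and a_priori: "\<And>p Z Y. p \<in> P \<Longrightarrow> Z > 0 \<Longrightarrow> scaled_solution G p Z Y \<Longrightarrow> Z * norm (Y Z) < B"
  obtains Y where "continuous_on UNIV Y" "\<And>p Z. p \<in> P \<Longrightarrow> Z > 0 \<Longrightarrow> scaled_solution G p Z (\<lambda>z. Y (p, z))"
proof -
  obtain R where R: "R > 0" "\<And>p. p \<in> P \<Longrightarrow> norm p \<le> R"
    using bounded unfolding bounded_pos by blast
  obtain L1 where L1: "L1 \<ge> 0" "\<And>z u v. 0 \<le> z \<Longrightarrow> norm u \<le> R + 1 \<Longrightarrow> norm v \<le> R + 1 \<Longrightarrow>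
      z * norm u \<le> R + 1 \<Longrightarrow> z * norm v \<le> R + 1 \<Longrightarrow> norm (G z u - G z v) \<le> L1 * norm (u - v)"
    using lipE[of "R + 1" "R + 1"] by metis
  \<comment> \<open>Over a length \<open>h\<close> the integral changes \<open>Y\<close> by less
    than 1, so there \<open>Y\<close> cannot reach norm \<open>R + 1\<close>.\<close>
  define h where "h = 1 / (L1 * (R + 1) + 1)"
  have "L1 * (R + 1) \<ge> 0" using L1 R by simp
  then have h: "0 < h" "h \<le> 1" "h * (L1 * (R + 1)) < 1" by (auto simp: h_def field_simps)
  define B' where "B' = max B 1"
  have B': "B' > 0" "B \<le> B'" by (auto simp: B'_def)
  define M where "M = max (R + 2) (B' / h)"
  have "R + 2 \<le> M" "B' / h \<le> M" by (auto simp: M_def)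
  then have M: "M > 0" "R + 1 < M" "B' \<le> M * h" using R h by (auto simp: pos_divide_le_eq)
  \<comment> \<open>The cap is \<open>M\<close> up to \<open>z = B'/M\<close> and
    \<open>B'/z\<close> beyond, so it controls both \<open>Y\<close> and \<open>z Y\<close>. As
    \<open>M \<ge> B'/h\<close>, the range where the cap is \<open>M\<close> lies within length
    \<open>h\<close>; past it the a priori bound takes over.\<close>
  define m where "m = (\<lambda>z. B' / max z (B' / M))"
  have mpos: "m z > 0" and m_le: "m z \<le> M" for z
  proof -
    have *: "B' / M > 0" using M B' by simp
    then show "m z > 0" using B' unfolding m_def by (intro divide_pos_pos) auto
    have "m z \<le> B' / (B' / M)" unfolding m_def using * B' by (intro divide_left_mono mult_pos_pos) auto
    then show "m z \<le> M" using B' M by simp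
  qed
  have zm: "z * m z \<le> B'" if "z \<ge> 0" for z
  proof -
    have "B' / M > 0" using M B' by simp
    then have "max z (B' / M) > 0" by simp
    then have "z / max z (B' / M) \<le> 1" by (simp add: pos_divide_le_eq)
    then have "B' * (z / max z (B' / M)) \<le> B' * 1" using B' by (intro mult_left_mono) auto
    then show ?thesis by (simp add: m_def mult.commute)
  qed
  have m_cont: "continuous_on S m" for S
    unfolding m_def using M B' by (intro continuous_intros) (auto simp: max_def)
  define Gc where "Gc = (\<lambda>z y. G (max 0 z) (clamp3 (m (max 0 z)) y))"
  obtain L where L: "L \<ge> 0" "\<And>z u v. 0 \<le> z \<Longrightarrow> norm u \<le> 2 * M \<Longrightarrow> norm v \<le> 2 * M \<Longrightarrow>
      z * norm u \<le> 2 * B' \<Longrightarrow> z * norm v \<le> 2 * B' \<Longrightarrow> norm (G z u - G z v) \<le> L * norm (u - v)"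
    using lipE[of "2 * M" "2 * B'"] by metis
  have cl1: "norm (clamp3 (m z) u) \<le> 2 * M" for z u
    using norm_clamp3_le[of "m z" u] mpos[of z] m_le[of z] by linarith
  have cl2: "z * norm (clamp3 (m z) u) \<le> 2 * B'" if "z \<ge> 0" for z u
  proof -
    have "z * norm (clamp3 (m z) u) \<le> z * (2 * m z)"
      using norm_clamp3_le[of "m z" u] mpos[of z] that by (intro mult_left_mono) auto
    then show ?thesis using zm[OF that] by simp
  qed
  have Gc_lip: "norm (Gc z u - Gc z v) \<le> L * norm (u - v)" for z u v
  proof -
    have "norm (Gc z u - Gc z v) \<le> L * norm (clamp3 (m (max 0 z)) u - clamp3 (m (max 0 z)) v)"
      unfolding Gc_def by (intro L cl1 cl2) auto
    also have "\<dots> \<le> L * norm (u - v)" using L norm_clamp3_diff by (intro mult_left_mono)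
    finally show ?thesis .
  qed
  have Gc_bound: "norm (Gc z u) \<le> L * (2 * M)" for z u
  proof -
    have "norm (Gc z u - G (max 0 z) 0) \<le> L * norm (clamp3 (m (max 0 z)) u - 0)"
      unfolding Gc_def using M B' by (intro L cl1 cl2) auto
    also have "\<dots> \<le> L * (2 * M)" using L cl1 by (intro mult_left_mono) auto
    finally show ?thesis by (simp add: zero)
  qed
  have m_comp: "continuous_on S (\<lambda>x. m (f x))" if "continuous_on S f" for S :: "(real \<times> vec3) set" and f
    by (rule continuous_on_compose2[OF m_cont that subset_UNIV])
  have Gc_cont: "continuous_on UNIV (\<lambda>(z, y). Gc z y)"
    unfolding Gc_def split_def by (intro continuous_intros m_comp)
  obtain Y where Y: "continuous_on UNIV Y" and eq: "\<And>p z. z \<ge> 0 \<Longrightarrow>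
      Y (p, z) = p + z *\<^sub>R integral {0..1} (\<lambda>l. damp l (Gc (l * z) (Y (p, l * z))))"
    by (rule volterra_solution[OF Gc_cont Gc_lip Gc_bound]) (rule that, auto)
  have Yp: "continuous_on S (\<lambda>z. Y (p, z))" for p S
    by (rule continuous_on_compose2[OF Y]) (auto intro!: continuous_intros)
  have true_eq: "Y (p, z) = p + z *\<^sub>R integral {0..1} (\<lambda>l. damp l (G (l * z) (Y (p, l * z))))"
    if z: "0 \<le> z" and inactive: "\<And>w. 0 \<le> w \<Longrightarrow> w < z \<Longrightarrow> norm (Y (p, w)) \<le> m w" for p z
  proof (cases "z = 0")
    case False
    with z have zpos: "z > 0" by simp
    \<comment> \<open>The endpoint \<open>l = 1\<close> is a null set, so inactivity is needed only
      strictly before \<open>z\<close>. Hence \<open>z\<close> may itself be the first point where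
      the truncation is reached.\<close>
    have "integral {0..1} (\<lambda>l. damp l (Gc (l * z) (Y (p, l * z)))) = integral {0..1} (\<lambda>l. damp l (G (l * z) (Y (p, l * z))))"
    proof (rule integral_spike[of "{1}"])
      fix l :: real assume l: "l \<in> {0..1} - {1}"
      show "damp l (G (l * z) (Y (p, l * z))) = damp l (Gc (l * z) (Y (p, l * z)))"
      proof -
        have "l * z < z" using l z zpos by simp
        then show ?thesis using l z inactive[of "l * z"] by (simp add: Gc_def clamp3_id)
      qed
    qed simp
    with eq[OF z, of p] show ?thesis by simp
  qed (use eq[of 0 p] in simp)
  have inactive: "norm (Y (p, z)) < m z" if p: "p \<in> P" and z: "0 \<le> z" for p z
  proof (rule ccontr)
    assume "\<not> norm (Y (p, z)) < m z"
    then have neg: "m z - norm (Y (p, z)) \<le> 0" by simp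
    have Y0: "Y (p, 0) = p" using eq[of 0 p] by simp
    have "m 0 = M" using M B' by (auto simp: m_def)
    then have pos: "m 0 - norm (Y (p, 0)) > 0" using Y0 R(2)[OF p] M by simp
    have "continuous_on {0..z} (\<lambda>z. m z - norm (Y (p, z)))"
      by (intro continuous_intros m_cont Yp)
    from first_zero[OF this z pos neg]
    obtain c where c': "0 < c" "m c - norm (Y (p, c)) = 0" "\<And>x. 0 \<le> x \<Longrightarrow> x < c \<Longrightarrow> m x - norm (Y (p, x)) > 0"
      by blast
    then have c: "0 < c" "m c = norm (Y (p, c))" "\<And>x. 0 \<le> x \<Longrightarrow> x < c \<Longrightarrow> norm (Y (p, x)) < m x"
      by fastforce+
    have "scaled_solution G p c (\<lambda>z. Y (p, z))"
      using c P[OF p] by (intro volterra_imp_scaled_solution Yp true_eq) (auto intro: less_imp_le)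
    then have "c * norm (Y (p, c)) < B" using a_priori p c by blast
    then have cB: "c * m c < B'" using c B' by simp
    have "c < B' / M"
    proof (rule ccontr)
      assume "\<not> c < B' / M"
      then have "m c = B' / c" by (simp add: m_def max_def)
      then show False using cB c by simp
    qed
    then have mc: "m c = M" using M B' by (simp add: m_def)
    have "c * M < B'" using \<open>c < B' / M\<close> M by (simp add: pos_less_divide_eq)
    then have "c * M < h * M" using M(3) by (metis mult.commute less_le_trans)
    then have ch: "c < h" using M(1) by (metis mult_less_cancel_right_pos)
    have pos': "R + 1 - norm (Y (p, 0)) > 0" using Y0 R(2)[OF p] by simp
    have neg': "R + 1 - norm (Y (p, c)) \<le> 0" using c(2) mc M by simp
    have "continuous_on {0..c} (\<lambda>z. R + 1 - norm (Y (p, z)))" by (intro continuous_intros Yp)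
    from first_zero[OF this less_imp_le[OF c(1)] pos' neg']
    obtain d where d': "0 < d" "d \<le> c" "R + 1 - norm (Y (p, d)) = 0" "\<And>x. 0 \<le> x \<Longrightarrow> x < d \<Longrightarrow> R + 1 - norm (Y (p, x)) > 0"
      by blast
    then have d: "0 < d" "d \<le> c" "norm (Y (p, d)) = R + 1" "\<And>x. 0 \<le> x \<Longrightarrow> x < d \<Longrightarrow> norm (Y (p, x)) < R + 1"
      by fastforce+
    have nb: "norm (damp l (G (l * d) (Y (p, l * d)))) \<le> L1 * (R + 1)" if l: "l \<in> {0..1}" for l
    proof -
      have ld: "0 \<le> l * d" "l * d \<le> d" using l d by (auto simp: mult_left_le_one_le)
      have Yn: "norm (Y (p, l * d)) \<le> R + 1" using d(3) d(4)[OF ld(1)] ld(2) by (cases "l * d < d") (auto simp: less_le simp del: mult_cancel_right1 mult_cancel_right2)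
      have "l * d \<le> 1" using ld d ch h by linarith
      then have "l * d * norm (Y (p, l * d)) \<le> 1 * (R + 1)" using Yn ld by (intro mult_mono) auto
      then have "norm (G (l * d) (Y (p, l * d)) - G (l * d) 0) \<le> L1 * norm (Y (p, l * d) - 0)"
        using ld Yn R by (intro L1) auto
      also have "\<dots> \<le> L1 * (R + 1)" using Yn L1 by (intro mult_left_mono) auto
      finally have "norm (G (l * d) (Y (p, l * d))) \<le> L1 * (R + 1)" by (simp add: zero)
      then show ?thesis using norm_damp_le[OF l] order_trans by blast
    qed
    have "(\<lambda>l. damp l (G (l * d) (Y (p, l * d)))) integrable_on {0..1}"
      by (intro integrable_continuous_real continuous_intros continuous_on_compose2[OF Y]) auto
    then have "norm (integral {0..1} (\<lambda>l. damp l (G (l * d) (Y (p, l * d))))) \<le> L1 * (R + 1)"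
      using integral_norm_bound_integral[of "\<lambda>l. damp l (G (l * d) (Y (p, l * d)))" "{0..1}" "\<lambda>_. L1 * (R + 1)"] nb
      by (simp add: integrable_const_ivl)
    then have "d * norm (integral {0..1} (\<lambda>l. damp l (G (l * d) (Y (p, l * d))))) \<le> h * (L1 * (R + 1))"
      using d ch h \<open>L1 * (R + 1) \<ge> 0\<close> by (intro mult_mono) auto
    also have "\<dots> < 1" by (rule h)
    finally have J: "norm (d *\<^sub>R integral {0..1} (\<lambda>l. damp l (G (l * d) (Y (p, l * d))))) < 1" using d by simp
    have Yd: "Y (p, d) = p + d *\<^sub>R integral {0..1} (\<lambda>l. damp l (G (l * d) (Y (p, l * d))))"
      using d c by (intro true_eq) (auto intro: less_imp_le)
    have "norm (Y (p, d)) < R + 1"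
      unfolding Yd by (rule order.strict_trans1[OF norm_triangle_ineq add_le_less_mono[OF R(2)[OF p] J]])
    with d(3) show False by simp
  qed
  have "scaled_solution G p Z (\<lambda>z. Y (p, z))" if "p \<in> P" "Z > 0" for p Z
    using that P inactive[OF that(1)] by (intro volterra_imp_scaled_solution Yp true_eq) (auto intro: less_imp_le)
  with Y show thesis by (rule that)
qed

end

section \<open>Uniqueness of trajectories with equal first-order data\<close>

lemma gronwall_zero:
  fixes E S :: "real \<Rightarrow> real"
  assumes E: "\<And>t. 0 < t \<Longrightarrow> t < b \<Longrightarrow> (E has_real_derivative E' t) (at t)"
    and S: "\<And>t. 0 < t \<Longrightarrow> t < b \<Longrightarrow> (S has_real_derivative w t) (at t)"
    and le: "\<And>t. 0 < t \<Longrightarrow> t < b \<Longrightarrow> E' t \<le> k * w t * E t"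
    and lim: "((\<lambda>t. E t * exp (- k * S t)) \<longlongrightarrow> 0) (at_right 0)"
    and t: "0 < t" "t < b"
  shows "E t \<le> 0"
proof -
  have "E t * exp (- k * S t) \<le> E s * exp (- k * S s)" if s: "0 < s" "s \<le> t" for s
  proof (rule DERIV_nonpos_imp_nonincreasing[OF s(2)])
    fix x assume x: "s \<le> x" "x \<le> t"
    have "((\<lambda>t. E t * exp (- k * S t)) has_real_derivative (E' x - k * w x * E x) * exp (- k * S x)) (at x)"
      using x s t by (auto intro!: derivative_eq_intros E S simp: algebra_simps)
    moreover have "(E' x - k * w x * E x) * exp (- k * S x) \<le> 0"
      using le[of x] x s t by (intro mult_nonpos_nonneg) auto
    ultimately show "\<exists>y. ((\<lambda>t. E t * exp (- k * S t)) has_real_derivative y) (at x) \<and> y \<le> 0" by blast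
  qed
  then have "\<forall>\<^sub>F s in at_right 0. E t * exp (- k * S t) \<le> E s * exp (- k * S s)"
    using t by (auto simp: eventually_at_right_field intro!: exI[of _ t])
  then have "E t * exp (- k * S t) \<le> 0"
    by (intro tendsto_lowerbound[OF lim]) auto
  then show ?thesis by (simp add: mult_le_0_iff)
qed

context scaled_field
begin

definition field :: "vec3 \<Rightarrow> vec3" where
  "field D = (fst D, fst (snd D), - 2 * snd (snd D)) + G 1 D"

text \<open>The largest eigenvalue of the linear part is 1. A one-sided estimate suffices for
  forward growth, and there the eigenvalue -2 only helps.\<close>

lemma field_inner_le:
  assumes "norm (G 1 u - G 1 v) \<le> \<delta> * norm (u - v)"
  shows "(u - v) \<bullet> (field u - field v) \<le> (1 + \<delta>) * ((u - v) \<bullet> (u - v))"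
proof -
  have lin: "a \<bullet> (fst a, fst (snd a), - 2 * snd (snd a)) \<le> a \<bullet> a" for a :: vec3
    by (simp add: inner_prod_def mult_le_cancel_left)
  have "(u - v) \<bullet> (G 1 u - G 1 v) \<le> norm (u - v) * norm (G 1 u - G 1 v)"
    by (rule norm_cauchy_schwarz)
  also have "\<dots> \<le> norm (u - v) * (\<delta> * norm (u - v))"
    using assms by (intro mult_left_mono) auto
  also have "\<dots> = \<delta> * ((u - v) \<bullet> (u - v))"
    by (simp add: dot_square_norm power2_eq_square)
  finally have "(u - v) \<bullet> (G 1 u - G 1 v) \<le> \<delta> * ((u - v) \<bullet> (u - v))" .
  moreover have "field u - field v = (fst (u - v), fst (snd (u - v)), - 2 * snd (snd (u - v))) + (G 1 u - G 1 v)"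
    by (simp add: field_def prod_eq_iff)
  ultimately show ?thesis
    using lin[of "u - v"] by (simp add: inner_add_right distrib_right del: snd_diff fst_diff)
qed

lemma field_lipschitz_near_zero:
  assumes "\<delta> > 0"
  obtains \<rho> where "\<rho> > 0" "\<And>u v. norm u \<le> \<rho> \<Longrightarrow> norm v \<le> \<rho> \<Longrightarrow>
    (u - v) \<bullet> (field u - field v) \<le> (1 + \<delta>) * ((u - v) \<bullet> (u - v))"
    and "\<rho> \<le> 1"
proof -
  obtain L where L: "L \<ge> 0" "\<And>z u v. 0 \<le> z \<Longrightarrow> norm u \<le> 1 \<Longrightarrow> norm v \<le> 1 \<Longrightarrow>
      z * norm u \<le> 1 \<Longrightarrow> z * norm v \<le> 1 \<Longrightarrow> norm (G z u - G z v) \<le> L * norm (u - v)"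
    using lipE[of 1 1] by metis
  define \<rho> where "\<rho> = min 1 (\<delta> / (L + 1))"
  have r: "0 < \<rho>" "\<rho> \<le> 1" "\<rho> * L \<le> \<delta>"
  proof -
    show "0 < \<rho>" "\<rho> \<le> 1" using assms L by (auto simp: \<rho>_def)
    have "\<rho> * L \<le> \<delta> / (L + 1) * (L + 1)" using assms L by (intro mult_mono) (auto simp: \<rho>_def)
    then show "\<rho> * L \<le> \<delta>" using L by simp
  qed
  show thesis
  proof (rule that[OF r(1) _ r(2)])
    fix u v :: vec3 assume uv: "norm u \<le> \<rho>" "norm v \<le> \<rho>"
    \<comment> \<open>Quadratic vanishing enters through scaling: on the ball of radius
      \<open>\<rho>\<close> the field \<open>G 1\<close> has \<open>\<rho>\<close> times the
      Lipschitz constant of \<open>G \<rho>\<close> on the unit ball.\<close>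
    have G1: "G 1 w = \<rho>\<^sup>2 *\<^sub>R G \<rho> (w /\<^sub>R \<rho>)" for w
      using scale[of \<rho> "w /\<^sub>R \<rho>"] r by simp
    have "norm (G \<rho> (u /\<^sub>R \<rho>) - G \<rho> (v /\<^sub>R \<rho>)) \<le> L * norm (u /\<^sub>R \<rho> - v /\<^sub>R \<rho>)"
      using uv r by (intro L) (auto simp: field_simps)
    then have "\<rho>\<^sup>2 * norm (G \<rho> (u /\<^sub>R \<rho>) - G \<rho> (v /\<^sub>R \<rho>)) \<le> \<rho>\<^sup>2 * (L * norm (u /\<^sub>R \<rho> - v /\<^sub>R \<rho>))"
      by (intro mult_left_mono) auto
    also have "u /\<^sub>R \<rho> - v /\<^sub>R \<rho> = (u - v) /\<^sub>R \<rho>" by (simp add: scaleR_diff_right)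
    also have "\<rho>\<^sup>2 * (L * norm ((u - v) /\<^sub>R \<rho>)) = (\<rho> * L) * norm (u - v)"
    proof -
      have "norm ((u - v) /\<^sub>R \<rho>) = norm (u - v) / \<rho>" using r by (simp add: divide_inverse mult.commute)
      then show ?thesis using r by (simp add: power2_eq_square)
    qed
    also have "\<dots> \<le> \<delta> * norm (u - v)" using r by (intro mult_right_mono) auto
    finally have "norm (G 1 u - G 1 v) \<le> \<delta> * norm (u - v)"
      by (simp add: G1 flip: scaleR_diff_right)
    then show "(u - v) \<bullet> (field u - field v) \<le> (1 + \<delta>) * ((u - v) \<bullet> (u - v))"
      by (rule field_inner_le)
  qed
qed

lemma field_lipschitz_on_ball:
  obtains k where "k \<ge> 0" "\<And>u v. norm u \<le> \<rho> \<Longrightarrow> norm v \<le> \<rho> \<Longrightarrow>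
    (u - v) \<bullet> (field u - field v) \<le> (1 + k) * ((u - v) \<bullet> (u - v))"
proof -
  obtain L where L: "L \<ge> 0" "\<And>z u v. 0 \<le> z \<Longrightarrow> norm u \<le> \<rho> \<Longrightarrow> norm v \<le> \<rho> \<Longrightarrow>
      z * norm u \<le> \<rho> \<Longrightarrow> z * norm v \<le> \<rho> \<Longrightarrow> norm (G z u - G z v) \<le> L * norm (u - v)"
    using lipE[of \<rho> \<rho>] by metis
  show thesis
    by (rule that[OF L(1)], rule field_inner_le, rule L(2)) auto
qed

text \<open>Near the equilibrium the squared distance \<open>E\<close> grows at most at the rate
  \<open>2 + \<delta>\<close> in \<open>S\<close>, so \<open>E e^(-(2+\<delta>)S)\<close> is
  nonincreasing. By hypothesis \<open>E\<close> is \<open>O(e^((2+2\<delta>)S))\<close>, so this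
  quotient tends to 0 at the start and \<open>E\<close> vanishes there. A Lipschitz bound on the
  ball containing both trajectories carries this forward.\<close>

theorem trajectory_unique:
  fixes D1 D2 :: "real \<Rightarrow> vec3" and T :: ereal
  assumes D1: "\<And>t. t \<in> time_interval T \<Longrightarrow> (D1 has_vector_derivative w t *\<^sub>R field (D1 t)) (at t)"
    and D2: "\<And>t. t \<in> time_interval T \<Longrightarrow> (D2 has_vector_derivative w t *\<^sub>R field (D2 t)) (at t)"
    and S: "\<And>t. t \<in> time_interval T \<Longrightarrow> (S has_real_derivative w t) (at t)"
    and w: "\<And>t. t \<in> time_interval T \<Longrightarrow> w t > 0"
    and S_lim: "filterlim S at_bot (at_right 0)"
    and lim: "(D1 \<longlongrightarrow> 0) (at_right 0)" "(D2 \<longlongrightarrow> 0) (at_right 0)"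
    and close: "\<delta> > 0" "\<forall>\<^sub>F t in at_right 0. norm (D1 t - D2 t) \<le> C * exp ((1 + \<delta>) * S t)"
    and t: "t \<in> time_interval T"
  shows "D1 t = D2 t"
proof -
  obtain b where b: "t < b" "b \<in> time_interval T"
    using t ereal_dense2[of "ereal t" T] by (auto simp: time_interval_def intro: less_trans)
  have sub: "s \<in> time_interval T" if "0 < s" "s \<le> b" for s
    using b that by (auto simp: time_interval_def intro: order.strict_trans1[of "ereal s" "ereal b"])
  define E where "E t = (D1 t - D2 t) \<bullet> (D1 t - D2 t)" for t
  define E' where "E' t = 2 * (w t * ((D1 t - D2 t) \<bullet> (field (D1 t) - field (D2 t))))" for t
  have E: "(E has_real_derivative E' t) (at t)" if "0 < t" "t \<le> b" for t
  proof -
    have "((\<lambda>t. D1 t - D2 t) has_vector_derivative w t *\<^sub>R (field (D1 t) - field (D2 t))) (at t)"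
      using D1[OF sub[OF that]] D2[OF sub[OF that]]
      by (auto intro!: derivative_eq_intros simp: scaleR_diff_right)
    from bounded_bilinear.has_vector_derivative[OF bounded_bilinear_inner this this]
    show ?thesis unfolding E_def E'_def has_real_derivative_iff_has_vector_derivative
      by (simp add: inner_commute)
  qed
  have E'_le: "E' t \<le> (2 + 2 * k) * w t * E t"
    if "0 < t" "t \<le> b" "(D1 t - D2 t) \<bullet> (field (D1 t) - field (D2 t)) \<le> (1 + k) * E t" for t k
    using mult_left_mono[OF that(3), of "2 * w t"] w[OF sub[OF that(1,2)]]
    by (simp add: E'_def algebra_simps)
  have near: "\<exists>r>0. \<forall>s. 0 < s \<and> s < r \<longrightarrow> E s \<le> 0"
  proof -
    obtain \<rho> where \<rho>: "\<rho> > 0" "\<And>u v. norm u \<le> \<rho> \<Longrightarrow> norm v \<le> \<rho> \<Longrightarrow>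
      (u - v) \<bullet> (field u - field v) \<le> (1 + \<delta> / 2) * ((u - v) \<bullet> (u - v))"
      using field_lipschitz_near_zero[of "\<delta> / 2"] close(1) by (metis half_gt_zero)
    have "\<forall>\<^sub>F s in at_right 0. norm (D1 s) < \<rho> \<and> norm (D2 s) < \<rho>"
      using lim[THEN tendsto_norm] \<rho>(1) by (auto intro!: eventually_conj order_tendstoD)
    then obtain r0 where r0: "r0 > 0" "\<And>s. 0 < s \<Longrightarrow> s < r0 \<Longrightarrow> norm (D1 s) < \<rho> \<and> norm (D2 s) < \<rho>"
      by (auto simp: eventually_at_right_field)
    define r where "r = min r0 b"
    have bpos: "b > 0" using b by (simp add: time_interval_def)
    have "E s \<le> 0" if s: "0 < s" "s < r" for s
    proof (rule gronwall_zero[of r E E' S w "2 + \<delta>", OF _ _ _ _ s])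
      fix t assume t: "0 < t" "t < r"
      show "(E has_real_derivative E' t) (at t)" using t by (intro E) (auto simp: r_def)
      show "(S has_real_derivative w t) (at t)" using t by (intro S sub) (auto simp: r_def)
      have "(D1 t - D2 t) \<bullet> (field (D1 t) - field (D2 t)) \<le> (1 + \<delta> / 2) * E t"
        using r0(2)[of t] t unfolding E_def by (intro \<rho>(2)) (auto simp: r_def)
      then show "E' t \<le> (2 + \<delta>) * w t * E t"
        using E'_le[of t "\<delta> / 2"] t by (auto simp: r_def)
    next
      have "filterlim (\<lambda>t. \<delta> * S t) at_bot (at_right 0)"
        using filterlim_tendsto_pos_mult_at_bot[OF tendsto_const close(1) S_lim] .
      then have "((\<lambda>t. exp (\<delta> * S t)) \<longlongrightarrow> 0) (at_right 0)"
        by (rule filterlim_compose[OF exp_at_bot])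
      then have "((\<lambda>t. C\<^sup>2 * exp (\<delta> * S t)) \<longlongrightarrow> 0) (at_right 0)"
        by (rule tendsto_mult_right_zero)
      moreover have "\<forall>\<^sub>F t in at_right 0. norm (E t * exp (- (2 + \<delta>) * S t)) \<le> C\<^sup>2 * exp (\<delta> * S t)"
        using close(2)
      proof eventually_elim
        case (elim t)
        have "E t = (norm (D1 t - D2 t))\<^sup>2" by (simp add: E_def dot_square_norm)
        also have "\<dots> \<le> (C * exp ((1 + \<delta>) * S t))\<^sup>2" using elim by (intro power_mono) auto
        also have "\<dots> = C\<^sup>2 * exp (2 * ((1 + \<delta>) * S t))"
          by (simp add: power_mult_distrib flip: exp_of_nat_mult)
        finally have "E t * exp (- (2 + \<delta>) * S t) \<le> C\<^sup>2 * exp (2 * ((1 + \<delta>) * S t)) * exp (- (2 + \<delta>) * S t)"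
          by (intro mult_right_mono) auto
        also have "\<dots> = C\<^sup>2 * exp (\<delta> * S t)"
          by (simp add: mult.assoc flip: exp_add) (simp add: algebra_simps)
        finally show ?case by (simp add: E_def)
      qed
      ultimately show "((\<lambda>t. E t * exp (- (2 + \<delta>) * S t)) \<longlongrightarrow> 0) (at_right 0)"
        by (rule Lim_null_comparison[rotated])
    qed
    moreover have "r > 0" using r0 bpos by (simp add: r_def)
    ultimately show ?thesis by blast
  qed
  obtain r where r: "r > 0" "\<And>s. 0 < s \<Longrightarrow> s < r \<Longrightarrow> E s \<le> 0" using near by blast
  obtain B where B: "\<And>s. 0 < s \<Longrightarrow> s \<le> b \<Longrightarrow> norm (D1 s) \<le> B \<and> norm (D2 s) \<le> B"
  proof -
    have "\<forall>\<^sub>F s in at_right 0. norm (D1 s) < 1 \<and> norm (D2 s) < 1"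
      using lim[THEN tendsto_norm] by (auto intro!: eventually_conj order_tendstoD)
    then obtain r0 where r0: "r0 > 0" "\<And>s. 0 < s \<Longrightarrow> s < r0 \<Longrightarrow> norm (D1 s) < 1 \<and> norm (D2 s) < 1"
      by (auto simp: eventually_at_right_field)
    have "continuous_on {r0..b} D1" "continuous_on {r0..b} D2"
      using has_vector_derivative_continuous[OF D1[OF sub]] has_vector_derivative_continuous[OF D2[OF sub]] r0(1)
      by (auto intro!: continuous_at_imp_continuous_on)
    then have "bounded (D1 ` {r0..b})" "bounded (D2 ` {r0..b})"
      by (auto intro!: compact_imp_bounded compact_continuous_image)
    then obtain B1 B2 where "\<And>s. s \<in> {r0..b} \<Longrightarrow> norm (D1 s) \<le> B1" "\<And>s. s \<in> {r0..b} \<Longrightarrow> norm (D2 s) \<le> B2"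
      unfolding bounded_iff by (metis imageI)
    then have "norm (D1 s) \<le> max 1 (max B1 B2) \<and> norm (D2 s) \<le> max 1 (max B1 B2)" if "0 < s" "s \<le> b" for s
      using r0(2)[of s] that by (cases "s < r0") (force simp: le_max_iff_disj)+
    then show thesis by (rule that)
  qed
  obtain k where k: "k \<ge> 0" "\<And>u v. norm u \<le> B \<Longrightarrow> norm v \<le> B \<Longrightarrow>
    (u - v) \<bullet> (field u - field v) \<le> (1 + k) * ((u - v) \<bullet> (u - v))"
    using field_lipschitz_on_ball by metis
  \<comment> \<open>Gronwall a second time, now with a possibly large constant; the limit condition
    at 0 holds because \<open>E\<close> is already known to vanish near 0.\<close>
  have "E t \<le> 0"
  proof (rule gronwall_zero[of b E E' S w "2 + 2 * k"])
    fix t assume t: "0 < t" "t < b"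
    show "(E has_real_derivative E' t) (at t)" using t by (intro E) auto
    show "(S has_real_derivative w t) (at t)" using t by (intro S sub) auto
    show "E' t \<le> (2 + 2 * k) * w t * E t"
      using t B[of t] unfolding E_def by (intro E'_le[unfolded E_def] k) auto
  next
    have "E s = 0" if "0 < s" "s < r" for s
      using r(2)[OF that] by (intro antisym) (simp_all add: E_def)
    then have "\<forall>\<^sub>F s in at_right 0. E s * exp (- (2 + 2 * k) * S s) = 0"
      unfolding eventually_at_right_field using r(1) by (intro exI[of _ r]) simp
    then show "((\<lambda>t. E t * exp (- (2 + 2 * k) * S t)) \<longlongrightarrow> 0) (at_right 0)"
      by (rule tendsto_eventually)
  qed (use t b in \<open>auto simp: time_interval_def\<close>)
  then have "norm (D1 t - D2 t) ^ 2 \<le> 0" by (simp add: E_def dot_square_norm)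
  then show ?thesis by simp
qed

end

section \<open>Inverting the time function\<close>

text \<open>Stretching to the unit interval makes the domain of integration independent of the upper
  limit, so continuity of parameter integrals applies.\<close>

lemma continuous_on_primitive:
  fixes q :: "'a::topological_space \<times> real \<Rightarrow> real"
  assumes cont: "continuous_on (P \<times> {0..}) q"
  shows "continuous_on (P \<times> {0..}) (\<lambda>x. integral {0..snd x} (\<lambda>r. q (fst x, r)))"
proof -
  have "continuous_on ((P \<times> {0..}) \<times> cbox 0 (1::real)) (\<lambda>(x, l). q (fst x, l * snd x))"
    unfolding split_def by (intro continuous_on_compose2[OF cont]) (auto intro!: continuous_intros)
  from integral_continuous_on_param[OF this]
  have "continuous_on (P \<times> {0..}) (\<lambda>x. snd x * integral {0..1} (\<lambda>l. q (fst x, l * snd x)))"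
    by (intro continuous_intros) simp
  also have "?this \<longleftrightarrow> ?thesis"
  proof (rule continuous_on_cong[OF refl])
    fix x :: "'a \<times> real" assume x: "x \<in> P \<times> {0..}"
    have "continuous_on {0..snd x} (\<lambda>r. q (fst x, r))"
      using x by (intro continuous_on_compose2[OF cont]) (auto intro!: continuous_intros)
    then show "snd x * integral {0..1} (\<lambda>l. q (fst x, l * snd x)) = integral {0..snd x} (\<lambda>r. q (fst x, r))"
      using x integral_stretch[of "snd x" "\<lambda>r. q (fst x, r)"] by (cases "snd x = 0") auto
  qed
  finally show ?thesis .
qed

lemma primitive_derivative:
  fixes q :: "'a::topological_space \<times> real \<Rightarrow> real"
  assumes cont: "continuous_on (P \<times> {0..}) q" and "p \<in> P" "s > 0"
  shows "((\<lambda>s. integral {0..s} (\<lambda>r. q (p, r))) has_real_derivative q (p, s)) (at s)"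
proof -
  have "continuous_on {0..s+1} (\<lambda>r. q (p, r))"
    using assms by (intro continuous_on_compose2[OF cont]) (auto intro!: continuous_intros)
  then have "((\<lambda>s. integral {0..s} (\<lambda>r. q (p, r))) has_real_derivative q (p, s)) (at s within {0..s+1})"
    using integral_has_real_derivative[of 0 "s + 1" "\<lambda>r. q (p, r)" s] assms by simp
  moreover have "at s within {0..s+1} = at s" using assms by (intro at_within_interior) auto
  ultimately show ?thesis by simp
qed

text \<open>Joint continuity of the inverse rests on order alone: \<open>s < \<sigma> (p, t)\<close>
  holds exactly when the primitive at \<open>s\<close> is below \<open>t\<close>, and for fixed
  \<open>s\<close> this is an open condition on \<open>(p, t)\<close>.\<close>

lemma inverse_time:
  fixes \<psi> :: "'a::topological_space \<times> real \<Rightarrow> real"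
  assumes cont: "continuous_on (P \<times> {0..}) \<psi>"
    and pos: "\<And>p s. p \<in> P \<Longrightarrow> s \<ge> 0 \<Longrightarrow> \<psi> (p, s) > 0"
    and diverge: "\<And>p. p \<in> P \<Longrightarrow> filterlim (\<lambda>s. integral {0..s} (\<lambda>r. \<psi> (p, r))) at_top at_top"
  obtains \<sigma> where "continuous_on (P \<times> {0..}) \<sigma>"
    "\<And>p. p \<in> P \<Longrightarrow> \<sigma> (p, 0) = 0"
    "\<And>p t. p \<in> P \<Longrightarrow> t > 0 \<Longrightarrow> \<sigma> (p, t) > 0"
    "\<And>p t. p \<in> P \<Longrightarrow> t > 0 \<Longrightarrow> ((\<lambda>t. \<sigma> (p, t)) has_real_derivative 1 / \<psi> (p, \<sigma> (p, t))) (at t)"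
    "\<And>p s. p \<in> P \<Longrightarrow> s \<ge> 0 \<Longrightarrow> \<sigma> (p, integral {0..s} (\<lambda>r. \<psi> (p, r))) = s"
    "\<And>p. p \<in> P \<Longrightarrow> filterlim (\<lambda>t. \<sigma> (p, t)) at_top at_top"
proof -
  define \<theta> where "\<theta> p s = integral {0..s} (\<lambda>r. \<psi> (p, r))" for p s
  have contp: "continuous_on {0..s} (\<lambda>r. \<psi> (p, r))" if "p \<in> P" for p s
    using that by (intro continuous_on_compose2[OF cont]) (auto intro!: continuous_intros)
  have d: "(\<theta> p has_real_derivative \<psi> (p, s)) (at s)" if "p \<in> P" "s > 0" for p s
    unfolding \<theta>_def by (rule primitive_derivative[OF cont that])
  have c\<theta>: "continuous_on {0..s} (\<theta> p)" if "p \<in> P" for p s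
    unfolding \<theta>_def using that
    by (intro indefinite_integral_continuous_1 integrable_continuous_real contp)
  have mono: "\<theta> p r < \<theta> p s" if "p \<in> P" "0 \<le> r" "r < s" for p r s
  proof (rule DERIV_pos_imp_increasing_open[OF that(3)])
    fix x assume "r < x" "x < s"
    with that show "\<exists>y. (\<theta> p has_real_derivative y) (at x) \<and> 0 < y" using d[of p x] pos[of p x] by auto
  qed (use that in \<open>auto intro: continuous_on_subset[OF c\<theta>[of p s]]\<close>)
  have mono_iff: "\<theta> p r < \<theta> p s \<longleftrightarrow> r < s" if "p \<in> P" "0 \<le> r" "0 \<le> s" for p r s
    using mono[OF that(1)] that by (metis linorder_neqE_linordered_idom order.asym)
  have \<theta>0: "\<theta> p 0 = 0" for p by (simp add: \<theta>_def)
  have ex: "\<exists>s\<ge>0. \<theta> p s = t" if "p \<in> P" "t \<ge> 0" for p t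
  proof -
    have "\<forall>\<^sub>F s in at_top. \<theta> p s \<ge> t" using diverge[OF that(1)] unfolding \<theta>_def filterlim_at_top by blast
    then obtain N where N: "\<forall>s\<ge>N. \<theta> p s \<ge> t" by (auto simp: eventually_at_top_linorder)
    define s where "s = max 0 N"
    have "s \<ge> 0" "\<theta> p s \<ge> t" using N by (auto simp: s_def)
    then show ?thesis using IVT'[of "\<theta> p" 0 t s] c\<theta>[OF that(1)] \<theta>0[of p] that by auto
  qed
  define \<sigma> where "\<sigma> = (\<lambda>(p, t). SOME s. s \<ge> 0 \<and> \<theta> p s = t)"
  have \<sigma>: "\<sigma> (p, t) \<ge> 0" "\<theta> p (\<sigma> (p, t)) = t" if "p \<in> P" "t \<ge> 0" for p t
    using someI_ex[of "\<lambda>s. s \<ge> 0 \<and> \<theta> p s = t"] ex[OF that] by (auto simp: \<sigma>_def)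
  have inj: "\<sigma> (p, \<theta> p s) = s" if "p \<in> P" "s \<ge> 0" for p s
  proof -
    have "\<theta> p s \<ge> 0" using mono_iff[of p s 0] that \<theta>0[of p] by auto
    then show ?thesis using \<sigma>[OF that(1), of "\<theta> p s"] mono_iff[OF that(1)] that(2)
      by (metis linorder_neqE_linordered_idom order.irrefl)
  qed
  have \<theta>_cont: "continuous_on (P \<times> {0..}) (\<lambda>x. \<theta> (fst x) (snd x))"
    unfolding \<theta>_def by (rule continuous_on_primitive[OF cont])
  have lt_iff: "s < \<sigma> (p, t) \<longleftrightarrow> \<theta> p s < t" "\<sigma> (p, t) < s \<longleftrightarrow> t < \<theta> p s"
    if "p \<in> P" "t \<ge> 0" "s \<ge> 0" for p t s
    using mono_iff[OF that(1) that(3) \<sigma>(1)[OF that(1,2)]] mono_iff[OF that(1) \<sigma>(1)[OF that(1,2)] that(3)] \<sigma>(2)[OF that(1,2)]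
    by auto
  have \<sigma>_cont: "continuous_on (P \<times> {0..}) \<sigma>"
    unfolding continuous_on_def
  proof
    fix x :: "'a \<times> real" assume x: "x \<in> P \<times> {0..}"
    define F where "F = at x within P \<times> {0..}"
    have in_F: "\<forall>\<^sub>F y in F. y \<in> P \<times> {0..}" unfolding F_def by (simp add: eventually_at_filter)
    have lim: "((\<lambda>y. \<theta> (fst y) s - snd y) \<longlongrightarrow> \<theta> (fst x) s - snd x) F" if "s \<ge> 0" for s
    proof -
      have "continuous_on (P \<times> {0..}) (\<lambda>y. \<theta> (fst y) s - snd y)"
      proof (intro continuous_intros)
        have "continuous_on (P \<times> {0..}) (\<lambda>y. (\<lambda>x. \<theta> (fst x) (snd x)) (fst y, s))"
          by (rule continuous_on_compose2[OF \<theta>_cont]) (use that in \<open>auto intro!: continuous_intros\<close>)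
        then show "continuous_on (P \<times> {0..}) (\<lambda>y. \<theta> (fst y) s)" by simp
      qed
      then show ?thesis using x unfolding F_def continuous_on_def by blast
    qed
    show "(\<sigma> \<longlongrightarrow> \<sigma> x) F"
    proof (rule order_tendstoI)
      fix a assume a: "a < \<sigma> x"
      show "\<forall>\<^sub>F y in F. a < \<sigma> y"
      proof (cases "a < 0")
        case True
        show ?thesis using in_F by eventually_elim (use True \<sigma>(1) in \<open>force\<close>)
      next
        case False
        then have "\<theta> (fst x) a - snd x < 0" using lt_iff(1)[of "fst x" "snd x" a] x a by auto
        with lim[of a] False have "\<forall>\<^sub>F y in F. \<theta> (fst y) a - snd y < 0" by (intro order_tendstoD) auto
        with in_F show ?thesis
          by eventually_elim (use lt_iff(1) False in \<open>force\<close>)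
      qed
    next
      fix a assume a: "\<sigma> x < a"
      then have a0: "a \<ge> 0" using \<sigma>(1)[of "fst x" "snd x"] x by force
      then have "\<theta> (fst x) a - snd x > 0" using lt_iff(2)[of "fst x" "snd x" a] x a by auto
      with lim[OF a0] have "\<forall>\<^sub>F y in F. \<theta> (fst y) a - snd y > 0" by (intro order_tendstoD) auto
      with in_F show "\<forall>\<^sub>F y in F. \<sigma> y < a"
        by eventually_elim (use lt_iff(2) a0 in \<open>force\<close>)
    qed
  qed
  have \<sigma>_pos: "\<sigma> (p, t) > 0" if "p \<in> P" "t > 0" for p t
    using lt_iff(1)[of p t 0] that \<theta>0[of p] by auto
  show thesis
  proof (rule that[OF \<sigma>_cont])
    fix p assume p: "p \<in> P"
    show "\<sigma> (p, 0) = 0" using inj[OF p, of 0] \<theta>0[of p] by simp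
    show "\<sigma> (p, t) > 0" if "t > 0" for t by (rule \<sigma>_pos[OF p that])
    show "\<sigma> (p, integral {0..s} (\<lambda>r. \<psi> (p, r))) = s" if "s \<ge> 0" for s
      using inj[OF p that] by (simp add: \<theta>_def)
    show "((\<lambda>t. \<sigma> (p, t)) has_real_derivative 1 / \<psi> (p, \<sigma> (p, t))) (at t)" if t: "t > 0" for t
    proof -
      have "continuous_on {0<..} (\<lambda>t. \<sigma> (p, t))"
        by (rule continuous_on_compose2[OF \<sigma>_cont]) (use p in \<open>auto intro!: continuous_intros\<close>)
      then have "isCont (\<lambda>t. \<sigma> (p, t)) t" using t by (simp add: continuous_on_eq_continuous_at)
      from DERIV_inverse_function[OF d[OF p \<sigma>_pos[OF p t]] _ _ _ _ this, of 0 "t + 1"]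
      show ?thesis using t p \<sigma>(2)[OF p] pos[OF p, of "\<sigma> (p, t)"] \<sigma>_pos[OF p t]
        by (simp add: inverse_eq_divide)
    qed
    show "filterlim (\<lambda>t. \<sigma> (p, t)) at_top at_top"
      unfolding filterlim_at_top
    proof
      fix Z :: real
      have "\<forall>\<^sub>F t in at_top. t > max 0 (\<theta> p (max 0 Z))" by (rule eventually_gt_at_top)
      then show "\<forall>\<^sub>F t in at_top. Z \<le> \<sigma> (p, t)"
      proof eventually_elim
        case (elim t)
        then show ?case using lt_iff(1)[OF p, where t = t and s = "max 0 Z"] by simp
      qed
    qed
  qed
qed

section \<open>Limits of solutions\<close>

text \<open>Once \<open>e\<close> is below \<open>k a/2\<close>, the product
  \<open>(w - a/2) e^(kt)\<close> is nonincreasing, which pushes \<open>w\<close> eventually below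
  \<open>a\<close>.\<close>

lemma relaxation_tendsto_0:
  fixes w :: "real \<Rightarrow> real"
  assumes d: "\<And>t. t \<ge> t0 \<Longrightarrow> (w has_real_derivative w' t) (at t)"
    and le: "\<And>t. t \<ge> t0 \<Longrightarrow> w' t \<le> - k * w t + e t" and k: "k > 0"
    and e: "(e \<longlongrightarrow> 0) at_top" and nonneg: "\<And>t. t \<ge> t0 \<Longrightarrow> w t \<ge> 0"
  shows "(w \<longlongrightarrow> 0) at_top"
proof (rule order_tendstoI)
  fix a :: real assume a: "a < 0"
  show "\<forall>\<^sub>F t in at_top. a < w t"
    using eventually_ge_at_top[of t0] by eventually_elim (rule less_le_trans[OF a nonneg])
next
  fix a :: real assume a: "0 < a"
  have "\<forall>\<^sub>F t in at_top. e t < k * (a / 2)" using e a k by (intro order_tendstoD) auto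
  then obtain t1 where t1: "t1 \<ge> t0" "\<And>t. t \<ge> t1 \<Longrightarrow> e t < k * (a / 2)"
    unfolding eventually_at_top_linorder by (metis max.bounded_iff order_refl)
  have mono: "(w t - a / 2) * exp (k * t) \<le> (w t1 - a / 2) * exp (k * t1)" if "t \<ge> t1" for t
  proof (rule DERIV_nonpos_imp_nonincreasing[OF that])
    fix x assume x: "t1 \<le> x" "x \<le> t"
    have "((\<lambda>t. (w t - a / 2) * exp (k * t)) has_real_derivative (w' x + k * (w x - a / 2)) * exp (k * x)) (at x)"
      using x t1(1) by (auto intro!: derivative_eq_intros d simp: algebra_simps)
    moreover have "(w' x + k * (w x - a / 2)) * exp (k * x) \<le> 0"
    proof (intro mult_nonpos_nonneg)
      show "w' x + k * (w x - a / 2) \<le> 0"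
      using le[of x] t1(2)[of x] t1(1) x by (simp add: algebra_simps)
    qed simp
    ultimately show "\<exists>y. ((\<lambda>t. (w t - a / 2) * exp (k * t)) has_real_derivative y) (at x) \<and> y \<le> 0"
      by blast
  qed
  define C where "C = (w t1 - a / 2) * exp (k * t1)"
  have "((\<lambda>t. C * exp (- (k * t))) \<longlongrightarrow> C * 0) at_top"
    using k by (intro tendsto_mult tendsto_const filterlim_compose[OF exp_at_bot])
      (auto simp: filterlim_uminus_at_bot intro!: filterlim_tendsto_pos_mult_at_top[OF tendsto_const _ filterlim_ident])
  then have "\<forall>\<^sub>F t in at_top. C * exp (- (k * t)) < a / 2" using a by (intro order_tendstoD) auto
  then show "\<forall>\<^sub>F t in at_top. w t < a"
    using eventually_ge_at_top[of t1]
  proof eventually_elim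
    case (elim t)
    have "(w t - a / 2) * exp (k * t) * exp (- (k * t)) \<le> C * exp (- (k * t))"
      using mono[OF elim(2)] unfolding C_def by (intro mult_right_mono) auto
    then have "w t - a / 2 \<le> C * exp (- (k * t))" by (simp add: mult.assoc flip: exp_add)
    with elim(1) show ?case by simp
  qed
qed

lemma derivative_limit_imp_slope_limit:
  fixes a :: "real \<Rightarrow> real"
  assumes "\<And>t. t > 0 \<Longrightarrow> (a has_real_derivative a' t) (at t)" "(a' \<longlongrightarrow> L) at_top"
  shows "((\<lambda>t. a t / t) \<longlongrightarrow> L) at_top"
proof (rule lhospital_at_top_at_top[where f' = a' and g' = "\<lambda>_. 1"])
  show "\<forall>\<^sub>F t in at_top. (a has_real_derivative a' t) (at t)"
    using eventually_gt_at_top[of 0] by eventually_elim (rule assms)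
qed (use assms in \<open>auto intro: filterlim_ident\<close>)

section \<open>First-order expansions\<close>

text \<open>In the applications \<open>\<zeta>\<close> is \<open>e^(2\<eta>/3)\<close> and
  \<open>\<rho>\<close> the admissible error. By \<open>sq\<close> products of first-order terms are
  absorbed into the error, so the pairs \<open>(c, l)\<close> of an expansion calculate like dual
  numbers.\<close>

locale expansion_scale =
  fixes F :: "real filter" and \<zeta> \<rho> :: "real \<Rightarrow> real"
  assumes zeta: "(\<zeta> \<longlongrightarrow> 0) F" and rho: "(\<rho> \<longlongrightarrow> 0) F" and sq: "(\<lambda>t. (\<zeta> t)\<^sup>2) \<in> O[F](\<rho>)"
begin

definition expands :: "(real \<Rightarrow> real) \<Rightarrow> real \<Rightarrow> real \<Rightarrow> bool" where
  "expands f c l \<longleftrightarrow> (\<lambda>t. f t - (c + l * \<zeta> t)) \<in> O[F](\<rho>)"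

lemma expands_tendsto:
  assumes "expands f c l"
  shows "(f \<longlongrightarrow> c) F"
proof -
  have "((\<lambda>t. f t - (c + l * \<zeta> t)) \<longlongrightarrow> 0) F"
  proof -
    obtain C where C: "\<forall>\<^sub>F t in F. norm (f t - (c + l * \<zeta> t)) \<le> C * norm (\<rho> t)"
      using landau_o.bigE[OF assms[unfolded expands_def]] by blast
    have "((\<lambda>t. C * norm (\<rho> t)) \<longlongrightarrow> 0) F"
      by (rule tendsto_mult_right_zero[OF tendsto_norm_zero[OF rho]])
    with C show ?thesis by (rule Lim_null_comparison)
  qed
  from tendsto_add[OF this tendsto_add[OF tendsto_const tendsto_mult[OF tendsto_const zeta]], of c l]
  show ?thesis by simp
qed

lemma expands_const: "expands (\<lambda>_. c) c 0"
  by (simp add: expands_def)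

lemma expands_add:
  assumes "expands f c l" "expands g c' l'"
  shows "expands (\<lambda>t. f t + g t) (c + c') (l + l')"
  using sum_in_bigo(1)[OF assms[unfolded expands_def]] unfolding expands_def
  by (simp add: algebra_simps)

lemma expands_diff:
  assumes "expands f c l" "expands g c' l'"
  shows "expands (\<lambda>t. f t - g t) (c - c') (l - l')"
  using sum_in_bigo(2)[OF assms[unfolded expands_def]] unfolding expands_def
  by (simp add: algebra_simps)

lemma expands_bounded:
  assumes "expands f c l"
  shows "f \<in> O[F](\<lambda>_. 1)"
  using expands_tendsto[OF assms] by (intro bigoI_tendsto[of f "\<lambda>_. 1" c]) simp_all

lemma expands_mult:
  assumes f: "expands f c l" and g: "expands g c' l'"
  shows "expands (\<lambda>t. f t * g t) (c * c') (c * l' + l * c')"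
proof -
  have lin: "(\<lambda>t. c + l * \<zeta> t) \<in> O[F](\<lambda>_. 1)"
  proof (rule bigoI_tendsto[where c = "c + l * 0"])
    show "((\<lambda>t. (c + l * \<zeta> t) / 1) \<longlongrightarrow> c + l * 0) F"
      unfolding div_by_1 by (intro tendsto_intros zeta)
  qed simp
  have "(\<lambda>t. (f t - (c + l * \<zeta> t)) * g t) \<in> O[F](\<lambda>t. \<rho> t * 1)"
    using f expands_bounded[OF g] unfolding expands_def by (rule landau_o.big.mult)
  moreover have "(\<lambda>t. (c + l * \<zeta> t) * (g t - (c' + l' * \<zeta> t))) \<in> O[F](\<lambda>t. 1 * \<rho> t)"
    using lin g unfolding expands_def by (rule landau_o.big.mult)
  moreover have "(\<lambda>t. (l * l') * (\<zeta> t)\<^sup>2) \<in> O[F](\<rho>)"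
    using sq by (cases "l * l' = 0") auto
  ultimately have "(\<lambda>t. (f t - (c + l * \<zeta> t)) * g t + (c + l * \<zeta> t) * (g t - (c' + l' * \<zeta> t)) + (l * l') * (\<zeta> t)\<^sup>2) \<in> O[F](\<rho>)"
    by (intro sum_in_bigo) simp_all
  then show ?thesis unfolding expands_def by (simp add: algebra_simps power2_eq_square)
qed

text \<open>The slope of the quotient is the \<open>m\<close> for which
  \<open>g (c/c' + m \<zeta>)\<close> has the same expansion as \<open>f\<close>. Dividing the
  difference by \<open>g\<close>, which stays away from 0, preserves the error.\<close>

lemma expands_divide:
  assumes f: "expands f c l" and g: "expands g c' l'" and "c' \<noteq> 0"
  shows "expands (\<lambda>t. f t / g t) (c / c') ((l - c / c' * l') / c')"
proof -
  define m where "m = (l - c / c' * l') / c'"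
  have "expands (\<lambda>t. c / c' + m * \<zeta> t) (c / c') m"
    by (simp add: expands_def)
  from expands_diff[OF f expands_mult[OF g this]]
  have "(\<lambda>t. f t - g t * (c / c' + m * \<zeta> t)) \<in> O[F](\<rho>)"
    using assms(3) by (simp add: expands_def m_def)
  moreover have "(\<lambda>t. 1 / g t) \<in> O[F](\<lambda>_. 1)"
    by (rule bigoI_tendsto[where c = "1 / c'"]) (use assms(3) in \<open>auto intro!: tendsto_intros expands_tendsto[OF g]\<close>)
  ultimately have "(\<lambda>t. (f t - g t * (c / c' + m * \<zeta> t)) * (1 / g t)) \<in> O[F](\<lambda>t. \<rho> t * 1)"
    by (rule landau_o.big.mult)
  then have "(\<lambda>t. (f t - g t * (c / c' + m * \<zeta> t)) * (1 / g t)) \<in> O[F](\<rho>)"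
    by (simp only: mult_1_right)
  moreover have "\<forall>\<^sub>F t in F. g t \<noteq> 0"
    by (rule tendsto_imp_eventually_ne[OF expands_tendsto[OF g] assms(3)])
  then have ev: "\<forall>\<^sub>F t in F. (f t - g t * (c / c' + m * \<zeta> t)) * (1 / g t) = f t / g t - (c / c' + m * \<zeta> t)"
    by eventually_elim (simp add: field_simps)
  ultimately show ?thesis unfolding expands_def m_def[symmetric]
    using landau_o.big.in_cong[OF ev] by blast
qed

lemma expands_cong:
  assumes "\<forall>\<^sub>F t in F. f t = g t"
  shows "expands f c l \<longleftrightarrow> expands g c l"
  unfolding expands_def by (rule landau_o.big.in_cong) (use assms in \<open>auto elim: eventually_mono\<close>)

lemma expands_eq: "expands f c l \<Longrightarrow> c = c' \<Longrightarrow> l = l' \<Longrightarrow> expands f c' l'"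
  by simp

end

lemma bigo_norm_Pair:
  fixes f :: "'a \<Rightarrow> 'b::real_normed_vector" and g :: "'a \<Rightarrow> 'c::real_normed_vector"
  shows "(\<lambda>t. norm (f t, g t)) \<in> O[F](r) \<longleftrightarrow> (\<lambda>t. norm (f t)) \<in> O[F](r) \<and> (\<lambda>t. norm (g t)) \<in> O[F](r)"
proof (intro iffI conjI)
  assume *: "(\<lambda>t. norm (f t, g t)) \<in> O[F](r)"
  show "(\<lambda>t. norm (f t)) \<in> O[F](r)"
    by (rule landau_o.big_trans[OF _ *], rule bigoI[of _ 1]) (simp add: norm_fst_le)
  show "(\<lambda>t. norm (g t)) \<in> O[F](r)"
    by (rule landau_o.big_trans[OF _ *], rule bigoI[of _ 1]) (simp add: norm_snd_le)
next
  assume "(\<lambda>t. norm (f t)) \<in> O[F](r) \<and> (\<lambda>t. norm (g t)) \<in> O[F](r)"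
  then have *: "(\<lambda>t. norm (f t) + norm (g t)) \<in> O[F](r)" by (intro sum_in_bigo) auto
  show "(\<lambda>t. norm (f t, g t)) \<in> O[F](r)"
    by (rule landau_o.big_trans[OF _ *], rule bigoI[of _ 1]) (simp add: norm_Pair_le)
qed

section \<open>Differential inequalities\<close>

text \<open>Integrating factor. This is the workhorse for invariant regions: whatever the sign of
  \<open>h\<close>, a quantity that starts positive remains positive.\<close>

lemma linear_lower_bound:
  fixes y h :: "real \<Rightarrow> real"
  assumes y: "continuous_on {0..Z} y" and h: "continuous_on {0..Z} h"
    and d: "\<And>z. 0 < z \<Longrightarrow> z < Z \<Longrightarrow> (y has_real_derivative y' z) (at z)"
    and le: "\<And>z. 0 < z \<Longrightarrow> z < Z \<Longrightarrow> h z * y z \<le> y' z" and Z: "Z \<ge> 0"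
  shows "y 0 * exp (integral {0..Z} h) \<le> y Z"
proof -
  define H where "H z = integral {0..z} h" for z
  have H: "(H has_real_derivative h z) (at z)" if "0 < z" "z < Z" for z
  proof -
    have "(H has_real_derivative h z) (at z within {0..Z})"
      unfolding H_def using integral_has_real_derivative[OF h, of z] that by simp
    moreover have "at z within {0..Z} = at z" using that by (intro at_within_interior) auto
    ultimately show ?thesis by simp
  qed
  have "continuous_on {0..Z} H"
    unfolding H_def by (intro indefinite_integral_continuous_1 integrable_continuous_real h)
  then have "y 0 * exp (- H 0) \<le> y Z * exp (- H Z)"
  proof (intro DERIV_nonneg_imp_increasing_open[OF Z, of "\<lambda>z. y z * exp (- H z)"])
    fix z assume z: "0 < z" "z < Z"
    have "((\<lambda>z. y z * exp (- H z)) has_real_derivative (y' z - h z * y z) * exp (- H z)) (at z)"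
      using d[OF z] H[OF z] by (auto intro!: derivative_eq_intros simp: algebra_simps)
    moreover have "(y' z - h z * y z) * exp (- H z) \<ge> 0" using le[OF z] by simp
    ultimately show "\<exists>k. ((\<lambda>z. y z * exp (- H z)) has_real_derivative k) (at z) \<and> 0 \<le> k" by blast
  qed (intro continuous_intros y)
  then have "y 0 * exp (H Z) \<le> y Z * exp (- H Z) * exp (H Z)"
    by (simp add: H_def)
  then show ?thesis by (simp add: H_def mult.assoc flip: exp_add)
qed

lemma linear_solution:
  fixes y h :: "real \<Rightarrow> real"
  assumes y: "continuous_on {0..Z} y" and h: "continuous_on {0..Z} h"
    and d: "\<And>z. 0 < z \<Longrightarrow> z < Z \<Longrightarrow> (y has_real_derivative h z * y z) (at z)" and Z: "Z \<ge> 0"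
  shows "y Z = y 0 * exp (integral {0..Z} h)"
proof (rule antisym)
  show "y 0 * exp (integral {0..Z} h) \<le> y Z"
    by (rule linear_lower_bound[OF y h d _ Z]) auto
  have "(\<lambda>z. - y z) 0 * exp (integral {0..Z} h) \<le> (\<lambda>z. - y z) Z"
    by (rule linear_lower_bound[OF _ h _ _ Z]) (auto intro!: derivative_eq_intros d continuous_intros y)
  then show "y Z \<le> y 0 * exp (integral {0..Z} h)" by simp
qed

lemma positive_derivative_at_top:
  fixes f :: "real \<Rightarrow> real"
  assumes d: "\<And>s. s \<ge> 0 \<Longrightarrow> (f has_real_derivative f' s) (at s)"
    and le: "\<And>s. s \<ge> 0 \<Longrightarrow> c \<le> f' s" and c: "c > 0"
  shows "filterlim f at_top at_top"
proof (rule filterlim_at_top_mono)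
  show "filterlim (\<lambda>s. f 0 + c * s) at_top at_top"
    using c by (intro filterlim_tendsto_add_at_top[OF tendsto_const] filterlim_tendsto_pos_mult_at_top[OF tendsto_const _ filterlim_ident])
  show "\<forall>\<^sub>F s in at_top. f 0 + c * s \<le> f s"
    using eventually_ge_at_top[of 0]
  proof eventually_elim
    case (elim s)
    have "f 0 - c * 0 \<le> f s - c * s"
    proof (rule DERIV_nonneg_imp_nondecreasing[OF elim])
      fix x assume "0 \<le> x" "x \<le> s"
      then show "\<exists>y. ((\<lambda>s. f s - c * s) has_real_derivative y) (at x) \<and> 0 \<le> y"
        using d[of x] le[of x] by (intro exI[of _ "f' x - c"]) (auto intro!: derivative_eq_intros)
    qed
    then show ?case by simp
  qed
qed

lemma gronwall_zero_regular:
  fixes e :: "real \<Rightarrow> real"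
  assumes e: "continuous_on {0..Z} e" and d: "\<And>z. 0 < z \<Longrightarrow> z < Z \<Longrightarrow> (e has_real_derivative e' z) (at z)"
    and le: "\<And>z. 0 < z \<Longrightarrow> z < Z \<Longrightarrow> e' z \<le> K * e z" and "e 0 = 0" "Z \<ge> 0"
  shows "e Z \<le> 0"
proof -
  have "(\<lambda>z. - e z) 0 * exp (integral {0..Z} (\<lambda>_. K)) \<le> (\<lambda>z. - e z) Z"
    by (rule linear_lower_bound[where y' = "\<lambda>z. - e' z"])
      (use assms in \<open>auto intro!: derivative_eq_intros continuous_intros\<close>)
  with assms show ?thesis by simp
qed

section \<open>Quadratic fields\<close>

text \<open>\<open>order_at_0 d F\<close>: \<open>F\<close> vanishes to order \<open>d\<close> at the origin, together with the matching
  Lipschitz estimate, as for polynomials.\<close>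

definition order_at_0 :: "nat \<Rightarrow> (vec3 \<Rightarrow> real) \<Rightarrow> bool" where
  "order_at_0 d F \<longleftrightarrow> (\<forall>B. \<exists>C\<ge>0. \<forall>\<rho> u v. norm u \<le> \<rho> \<and> norm v \<le> \<rho> \<and> \<rho> \<le> B \<longrightarrow>
     \<bar>F u\<bar> \<le> C * \<rho> ^ d \<and> \<bar>F u - F v\<bar> \<le> C * \<rho> ^ (d - 1) * norm (u - v))"

lemma order_at_0E:
  assumes "order_at_0 d F"
  obtains C where "C \<ge> 0" "\<And>\<rho> u. norm u \<le> \<rho> \<Longrightarrow> \<rho> \<le> B \<Longrightarrow> \<bar>F u\<bar> \<le> C * \<rho> ^ d"
    "\<And>\<rho> u v. norm u \<le> \<rho> \<Longrightarrow> norm v \<le> \<rho> \<Longrightarrow> \<rho> \<le> B \<Longrightarrow> \<bar>F u - F v\<bar> \<le> C * \<rho> ^ (d - 1) * norm (u - v)"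
  using assms unfolding order_at_0_def by metis

lemma order_at_0_const: "order_at_0 0 (\<lambda>_. c)"
  unfolding order_at_0_def by (intro allI exI[of _ "\<bar>c\<bar>"]) auto

lemma order_at_0_components:
  "order_at_0 1 fst" "order_at_0 1 (\<lambda>v. fst (snd v))" "order_at_0 1 (\<lambda>v. snd (snd v))"
  unfolding order_at_0_def
  using norm_vec3_components[of "_ - _"] order_trans[OF norm_vec3_components(1)]
    order_trans[OF norm_vec3_components(2)] order_trans[OF norm_vec3_components(3)]
  by (intro allI exI[of _ 1]; simp)+

lemma order_at_0_uminus:
  assumes "order_at_0 d F"
  shows "order_at_0 d (\<lambda>v. - F v)"
  using assms unfolding order_at_0_def by (simp add: abs_minus_commute)

lemma order_at_0_add:
  assumes "order_at_0 d F" "order_at_0 d H"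
  shows "order_at_0 d (\<lambda>v. F v + H v)"
  unfolding order_at_0_def
proof
  fix B
  obtain C1 where C1: "C1 \<ge> 0" "\<And>\<rho> u. norm u \<le> \<rho> \<Longrightarrow> \<rho> \<le> B \<Longrightarrow> \<bar>F u\<bar> \<le> C1 * \<rho> ^ d"
    "\<And>\<rho> u v. norm u \<le> \<rho> \<Longrightarrow> norm v \<le> \<rho> \<Longrightarrow> \<rho> \<le> B \<Longrightarrow> \<bar>F u - F v\<bar> \<le> C1 * \<rho> ^ (d - 1) * norm (u - v)"
    by (rule order_at_0E[OF assms(1), of B]) (rule that)
  obtain C2 where C2: "C2 \<ge> 0" "\<And>\<rho> u. norm u \<le> \<rho> \<Longrightarrow> \<rho> \<le> B \<Longrightarrow> \<bar>H u\<bar> \<le> C2 * \<rho> ^ d"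
    "\<And>\<rho> u v. norm u \<le> \<rho> \<Longrightarrow> norm v \<le> \<rho> \<Longrightarrow> \<rho> \<le> B \<Longrightarrow> \<bar>H u - H v\<bar> \<le> C2 * \<rho> ^ (d - 1) * norm (u - v)"
    by (rule order_at_0E[OF assms(2), of B]) (rule that)
  show "\<exists>C\<ge>0. \<forall>\<rho> u v. norm u \<le> \<rho> \<and> norm v \<le> \<rho> \<and> \<rho> \<le> B \<longrightarrow> \<bar>F u + H u\<bar> \<le> C * \<rho> ^ d \<and>
      \<bar>F u + H u - (F v + H v)\<bar> \<le> C * \<rho> ^ (d - 1) * norm (u - v)"
  proof (intro exI[of _ "C1 + C2"] conjI allI impI)
    fix \<rho> and u v :: vec3 assume *: "norm u \<le> \<rho> \<and> norm v \<le> \<rho> \<and> \<rho> \<le> B"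
    show "\<bar>F u + H u\<bar> \<le> (C1 + C2) * \<rho> ^ d"
      using C1(2)[of u \<rho>] C2(2)[of u \<rho>] * by (simp add: distrib_right)
    show "\<bar>F u + H u - (F v + H v)\<bar> \<le> (C1 + C2) * \<rho> ^ (d - 1) * norm (u - v)"
      using C1(3)[of u \<rho> v] C2(3)[of u \<rho> v] * by (simp add: distrib_right)
  qed (use C1 C2 in auto)
qed

lemma order_at_0_diff:
  "order_at_0 d F \<Longrightarrow> order_at_0 d H \<Longrightarrow> order_at_0 d (\<lambda>v. F v - H v)"
  using order_at_0_add[of d F "\<lambda>v. - H v"] order_at_0_uminus by simp

lemma order_at_0_mult:
  assumes "order_at_0 d F" "order_at_0 d' H"
  shows "order_at_0 (d + d') (\<lambda>v. F v * H v)"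
  unfolding order_at_0_def
proof
  fix B :: real
  obtain C1 where C1: "C1 \<ge> 0" "\<And>\<rho> u. norm u \<le> \<rho> \<Longrightarrow> \<rho> \<le> B \<Longrightarrow> \<bar>F u\<bar> \<le> C1 * \<rho> ^ d"
    "\<And>\<rho> u v. norm u \<le> \<rho> \<Longrightarrow> norm v \<le> \<rho> \<Longrightarrow> \<rho> \<le> B \<Longrightarrow> \<bar>F u - F v\<bar> \<le> C1 * \<rho> ^ (d - 1) * norm (u - v)"
    by (rule order_at_0E[OF assms(1), of B]) (rule that)
  obtain C2 where C2: "C2 \<ge> 0" "\<And>\<rho> u. norm u \<le> \<rho> \<Longrightarrow> \<rho> \<le> B \<Longrightarrow> \<bar>H u\<bar> \<le> C2 * \<rho> ^ d'"
    "\<And>\<rho> u v. norm u \<le> \<rho> \<Longrightarrow> norm v \<le> \<rho> \<Longrightarrow> \<rho> \<le> B \<Longrightarrow> \<bar>H u - H v\<bar> \<le> C2 * \<rho> ^ (d' - 1) * norm (u - v)"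
    by (rule order_at_0E[OF assms(2), of B]) (rule that)
  define B' where "B' = max B 1"
  \<comment> \<open>Truncated subtraction makes \<open>m - 1\<close> equal to 0 for
    \<open>m = 0\<close>. The left side then has one power of \<open>\<rho>\<close> more than the
    right, and that surplus is bounded by \<open>B'\<close>.\<close>
  have pw: "\<rho> ^ n * \<rho> ^ (m - 1) \<le> B' * \<rho> ^ (n + m - 1)" if "0 \<le> \<rho>" "\<rho> \<le> B" for \<rho> :: real and n m :: nat
  proof (cases m)
    case 0
    show ?thesis
    proof (cases n)
      case (Suc k)
      then show ?thesis using 0 that by (auto simp: B'_def intro!: mult_right_mono)
    qed (use 0 in \<open>simp add: B'_def\<close>)
  next
    case (Suc k)
    have "1 * \<rho> ^ (n + k) \<le> B' * \<rho> ^ (n + k)" using that by (intro mult_right_mono) (auto simp: B'_def)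
    with Suc show ?thesis by (simp add: power_add)
  qed
  show "\<exists>C\<ge>0. \<forall>\<rho> u v. norm u \<le> \<rho> \<and> norm v \<le> \<rho> \<and> \<rho> \<le> B \<longrightarrow> \<bar>F u * H u\<bar> \<le> C * \<rho> ^ (d + d') \<and>
      \<bar>F u * H u - F v * H v\<bar> \<le> C * \<rho> ^ (d + d' - 1) * norm (u - v)"
  proof (intro exI[of _ "2 * B' * (C1 * C2)"] conjI allI impI)
    fix \<rho> :: real and u v :: vec3 assume *: "norm u \<le> \<rho> \<and> norm v \<le> \<rho> \<and> \<rho> \<le> B"
    then have r: "0 \<le> \<rho>" "\<rho> \<le> B" using norm_ge_zero order_trans by blast+
    have "\<bar>F u * H u\<bar> \<le> (C1 * \<rho> ^ d) * (C2 * \<rho> ^ d')"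
      unfolding abs_mult using C1(2)[of u \<rho>] C2(2)[of u \<rho>] * C1(1) r by (intro mult_mono) auto
    also have "\<dots> = 1 * (C1 * C2 * \<rho> ^ (d + d'))" by (simp add: power_add mult_ac)
    also have "\<dots> \<le> 2 * B' * (C1 * C2 * \<rho> ^ (d + d'))"
      using C1(1) C2(1) r by (intro mult_right_mono) (auto simp: B'_def)
    finally show "\<bar>F u * H u\<bar> \<le> 2 * B' * (C1 * C2) * \<rho> ^ (d + d')" by (simp add: mult_ac)
    have "\<bar>F u * H u - F v * H v\<bar> \<le> \<bar>F u - F v\<bar> * \<bar>H u\<bar> + \<bar>F v\<bar> * \<bar>H u - H v\<bar>"
      unfolding abs_mult[symmetric] by (rule order_trans[OF _ abs_triangle_ineq]) (simp add: algebra_simps)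
    also have "\<dots> \<le> (C1 * \<rho> ^ (d - 1) * norm (u - v)) * (C2 * \<rho> ^ d') + (C1 * \<rho> ^ d) * (C2 * \<rho> ^ (d' - 1) * norm (u - v))"
      using C1(3)[of u \<rho> v] C1(2)[of v \<rho>] C2(3)[of u \<rho> v] C2(2)[of u \<rho>] * C1(1) C2(1) r
      by (intro add_mono mult_mono) auto
    also have "\<dots> = (C1 * C2 * norm (u - v)) * (\<rho> ^ d' * \<rho> ^ (d - 1) + \<rho> ^ d * \<rho> ^ (d' - 1))"
      by (simp add: algebra_simps)
    also have "\<dots> \<le> (C1 * C2 * norm (u - v)) * (B' * \<rho> ^ (d' + d - 1) + B' * \<rho> ^ (d + d' - 1))"
      using pw[OF r] C1(1) C2(1) by (intro mult_left_mono add_mono) auto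
    finally show "\<bar>F u * H u - F v * H v\<bar> \<le> 2 * B' * (C1 * C2) * \<rho> ^ (d + d' - 1) * norm (u - v)"
      by (simp add: algebra_simps)
  qed (use C1 C2 in \<open>auto simp: B'_def\<close>)
qed

lemma order_at_0_weaken:
  assumes "order_at_0 1 F"
  shows "order_at_0 0 F"
  unfolding order_at_0_def
proof
  fix B :: real
  obtain C where C: "C \<ge> 0" "\<And>\<rho> u. norm u \<le> \<rho> \<Longrightarrow> \<rho> \<le> B \<Longrightarrow> \<bar>F u\<bar> \<le> C * \<rho> ^ 1"
    "\<And>\<rho> u v. norm u \<le> \<rho> \<Longrightarrow> norm v \<le> \<rho> \<Longrightarrow> \<rho> \<le> B \<Longrightarrow> \<bar>F u - F v\<bar> \<le> C * \<rho> ^ (1 - 1) * norm (u - v)"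
    by (rule order_at_0E[OF assms, of B]) (rule that)
  show "\<exists>C\<ge>0. \<forall>\<rho> u v. norm u \<le> \<rho> \<and> norm v \<le> \<rho> \<and> \<rho> \<le> B \<longrightarrow> \<bar>F u\<bar> \<le> C * \<rho> ^ 0 \<and>
      \<bar>F u - F v\<bar> \<le> C * \<rho> ^ (0 - 1) * norm (u - v)"
  proof (intro exI[of _ "C * max B 1"] conjI allI impI)
    fix \<rho> :: real and u v :: vec3 assume *: "norm u \<le> \<rho> \<and> norm v \<le> \<rho> \<and> \<rho> \<le> B"
    have "\<bar>F u\<bar> \<le> C * \<rho>" using C(2)[of u \<rho>] * by simp
    also have "\<dots> \<le> C * max B 1" using * C(1) by (intro mult_left_mono) auto
    finally show "\<bar>F u\<bar> \<le> C * max B 1 * \<rho> ^ 0" by simp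
    have "\<bar>F u - F v\<bar> \<le> C * 1 * norm (u - v)" using C(3)[of u \<rho> v] * by simp
    also have "\<dots> \<le> C * max B 1 * norm (u - v)" using C(1) by (intro mult_right_mono mult_left_mono) auto
    finally show "\<bar>F u - F v\<bar> \<le> C * max B 1 * \<rho> ^ (0 - 1) * norm (u - v)" by simp
  qed (use C in auto)
qed

lemma order_at_0_mult_cases:
  "order_at_0 0 F \<Longrightarrow> order_at_0 0 H \<Longrightarrow> order_at_0 0 (\<lambda>v. F v * H v)"
  "order_at_0 1 F \<Longrightarrow> order_at_0 0 H \<Longrightarrow> order_at_0 1 (\<lambda>v. F v * H v)"
  "order_at_0 1 F \<Longrightarrow> order_at_0 1 H \<Longrightarrow> order_at_0 2 (\<lambda>v. F v * H v)"
  "order_at_0 2 F \<Longrightarrow> order_at_0 0 H \<Longrightarrow> order_at_0 2 (\<lambda>v. F v * H v)"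
  using order_at_0_mult[of 0 F 0 H] order_at_0_mult[of 1 F 0 H] order_at_0_mult[of 1 F 1 H]
    order_at_0_mult[of 2 F 0 H]
  by (simp_all add: numeral_2_eq_2)

lemma order_at_0_zero: "order_at_0 d (\<lambda>_. 0)"
  unfolding order_at_0_def by (intro allI exI[of _ 0]) auto

lemmas order_at_0_intros = order_at_0_zero order_at_0_components order_at_0_const
  order_at_0_mult_cases order_at_0_add order_at_0_diff order_at_0_uminus
  order_at_0_components[THEN order_at_0_weaken]

text \<open>For \<open>z > 0\<close> the second-order estimate is applied on the ball of radius
  \<open>z max(|u|, |v|)\<close> and divided by \<open>z^2\<close>; the result does not depend on
  \<open>z\<close>. The case \<open>z = 0\<close> follows by letting \<open>z\<close> tend to 0 from
  the right.\<close>

lemma scaled_fieldI: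
  fixes G :: "real \<Rightarrow> vec3 \<Rightarrow> vec3"
  assumes cont: "continuous_on UNIV (\<lambda>(z, y). G z y)" and zero: "\<And>z. G z 0 = 0"
    and scale: "\<And>z y. G 1 (z *\<^sub>R y) = z\<^sup>2 *\<^sub>R G z y"
    and ord: "order_at_0 2 (\<lambda>v. fst (G 1 v))" "order_at_0 2 (\<lambda>v. fst (snd (G 1 v)))"
      "order_at_0 2 (\<lambda>v. snd (snd (G 1 v)))"
  shows "scaled_field G"
proof
  fix M B :: real
  define B' where "B' = max B 1"
  obtain C1 where C1: "C1 \<ge> 0" "\<And>\<rho> u v. norm u \<le> \<rho> \<Longrightarrow> norm v \<le> \<rho> \<Longrightarrow> \<rho> \<le> B' \<Longrightarrow> \<bar>fst (G 1 u) - fst (G 1 v)\<bar> \<le> C1 * \<rho> ^ (2 - 1) * norm (u - v)"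
    by (rule order_at_0E[OF ord(1), of B']) (rule that)
  obtain C2 where C2: "C2 \<ge> 0" "\<And>\<rho> u v. norm u \<le> \<rho> \<Longrightarrow> norm v \<le> \<rho> \<Longrightarrow> \<rho> \<le> B' \<Longrightarrow> \<bar>fst (snd (G 1 u)) - fst (snd (G 1 v))\<bar> \<le> C2 * \<rho> ^ (2 - 1) * norm (u - v)"
    by (rule order_at_0E[OF ord(2), of B']) (rule that)
  obtain C3 where C3: "C3 \<ge> 0" "\<And>\<rho> u v. norm u \<le> \<rho> \<Longrightarrow> norm v \<le> \<rho> \<Longrightarrow> \<rho> \<le> B' \<Longrightarrow> \<bar>snd (snd (G 1 u)) - snd (snd (G 1 v))\<bar> \<le> C3 * \<rho> ^ (2 - 1) * norm (u - v)"
    by (rule order_at_0E[OF ord(3), of B']) (rule that)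
  define C where "C = C1 + C2 + C3"
  have G1: "norm (G 1 u - G 1 v) \<le> C * \<rho> * norm (u - v)" if "norm u \<le> \<rho>" "norm v \<le> \<rho>" "\<rho> \<le> B'" for \<rho> u v
  proof -
    have "norm (G 1 u - G 1 v) \<le> \<bar>fst (G 1 u) - fst (G 1 v)\<bar> + (\<bar>fst (snd (G 1 u)) - fst (snd (G 1 v))\<bar>
        + \<bar>snd (snd (G 1 u)) - snd (snd (G 1 v))\<bar>)"
      using norm_Pair_le[of "fst (G 1 u - G 1 v)" "snd (G 1 u - G 1 v)"]
        norm_Pair_le[of "fst (snd (G 1 u - G 1 v))" "snd (snd (G 1 u - G 1 v))"]
      unfolding prod.collapse by simp
    also have "\<dots> \<le> C * \<rho> * norm (u - v)"
      using C1(2)[OF that] C2(2)[OF that] C3(2)[OF that] by (simp add: C_def algebra_simps)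
    finally show ?thesis .
  qed
  have pos: "norm (G z u - G z v) \<le> C * M * norm (u - v)"
    if z: "z > 0" and uv: "norm u \<le> M" "norm v \<le> M" "z * norm u \<le> B'" "z * norm v \<le> B'" for z u v
  proof -
    define \<rho> where "\<rho> = z * max (norm u) (norm v)"
    have r: "z * norm u \<le> \<rho>" "z * norm v \<le> \<rho>" using z by (auto simp: \<rho>_def)
    have rB: "\<rho> \<le> B'" using uv z unfolding \<rho>_def by (auto simp: max_def)
    have rM: "\<rho> \<le> z * M" using uv z unfolding \<rho>_def by (intro mult_left_mono) auto
    have "z\<^sup>2 * norm (G z u - G z v) = norm (G 1 (z *\<^sub>R u) - G 1 (z *\<^sub>R v))"
      by (simp add: scale flip: scaleR_diff_right)
    also have "\<dots> \<le> C * \<rho> * norm (z *\<^sub>R u - z *\<^sub>R v)"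
      using r rB z by (intro G1) auto
    also have "\<dots> = C * \<rho> * (z * norm (u - v))" using z by (simp flip: scaleR_diff_right)
    also have "\<dots> \<le> C * (z * M) * (z * norm (u - v))"
      using rM z C1(1) C2(1) C3(1) by (intro mult_right_mono mult_left_mono) (auto simp: C_def)
    also have "\<dots> = z\<^sup>2 * (C * M * norm (u - v))" by (simp add: power2_eq_square algebra_simps)
    finally show ?thesis using z by simp
  qed
  show "\<exists>L. \<forall>z u v. 0 \<le> z \<and> norm u \<le> M \<and> norm v \<le> M \<and> z * norm u \<le> B \<and> z * norm v \<le> B
      \<longrightarrow> norm (G z u - G z v) \<le> L * norm (u - v)"
  proof (intro exI[of _ "C * M"] allI impI, elim conjE)
    fix z :: real and u v :: vec3 assume *: "0 \<le> z" "norm u \<le> M" "norm v \<le> M" "z * norm u \<le> B" "z * norm v \<le> B"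
    show "norm (G z u - G z v) \<le> C * M * norm (u - v)"
    proof (cases "z = 0")
      case False
      with * show ?thesis by (intro pos) (auto simp: B'_def)
    next
      case True
      have c: "isCont (\<lambda>z. G z w) 0" for w
      proof -
        have "continuous_on UNIV (\<lambda>z. (\<lambda>(z, y). G z y) (z, w))"
          by (rule continuous_on_compose2[OF cont]) (auto intro!: continuous_intros)
        then show ?thesis by (simp add: continuous_on_eq_continuous_at)
      qed
      have "((\<lambda>z. norm (G z u - G z v)) \<longlongrightarrow> norm (G 0 u - G 0 v)) (at_right 0)"
        using c[of u] c[of v] unfolding continuous_at
        by (intro tendsto_intros) (auto intro: filterlim_mono[OF _ order_refl at_le])
      moreover have "\<forall>\<^sub>F z in at_right 0. norm (G z u - G z v) \<le> C * M * norm (u - v)"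
      proof -
        have "\<forall>\<^sub>F z in at_right 0. z * norm w < B'" for w :: vec3
        proof (rule order_tendstoD(2))
          show "((\<lambda>z. z * norm w) \<longlongrightarrow> 0 * norm w) (at_right 0)" by (intro tendsto_intros)
        qed (simp add: B'_def)
        then have "\<forall>\<^sub>F z in at_right 0. z * norm u < B' \<and> z * norm v < B'"
          by (intro eventually_conj)
        then show ?thesis using eventually_at_right_less[of 0]
          by eventually_elim (use * in \<open>auto intro!: pos\<close>)
      qed
      ultimately show ?thesis using True by (auto intro!: tendsto_upperbound)
    qed
  qed
qed fact+

lemma scaled_solutionD:
  assumes "scaled_solution G p Z Y"
  shows "continuous_on {0..Z} (\<lambda>z. fst (Y z))" "continuous_on {0..Z} (\<lambda>z. fst (snd (Y z)))"
    "continuous_on {0..Z} (\<lambda>z. snd (snd (Y z)))" "Y 0 = p"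
    "\<And>z. 0 < z \<Longrightarrow> z < Z \<Longrightarrow> ((\<lambda>z. fst (Y z)) has_real_derivative fst (G z (Y z))) (at z)"
    "\<And>z. 0 < z \<Longrightarrow> z < Z \<Longrightarrow> ((\<lambda>z. fst (snd (Y z))) has_real_derivative fst (snd (G z (Y z)))) (at z)"
    "\<And>z. 0 < z \<Longrightarrow> z < Z \<Longrightarrow> ((\<lambda>z. snd (snd (Y z))) has_real_derivative
        snd (snd (G z (Y z))) - 3 * snd (snd (Y z)) / z) (at z)"
proof -
  have c: "continuous_on {0..Z} Y" using assms by (simp add: scaled_solution_def)
  show "continuous_on {0..Z} (\<lambda>z. fst (Y z))" "continuous_on {0..Z} (\<lambda>z. fst (snd (Y z)))"
    "continuous_on {0..Z} (\<lambda>z. snd (snd (Y z)))" by (intro continuous_intros c)+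
  show "Y 0 = p" using assms by (simp add: scaled_solution_def)
  fix z assume "0 < z" "z < Z"
  then have d: "(Y has_vector_derivative (G z (Y z) - (0, 0, 3 * snd (snd (Y z)) / z))) (at z)"
    using assms by (simp add: scaled_solution_def)
  have d1: "((\<lambda>z. fst (Y z)) has_vector_derivative fst (G z (Y z) - (0, 0, 3 * snd (snd (Y z)) / z))) (at z)"
    by (rule bounded_linear.has_vector_derivative[OF bounded_linear_fst d])
  have d2: "((\<lambda>z. snd (Y z)) has_vector_derivative snd (G z (Y z) - (0, 0, 3 * snd (snd (Y z)) / z))) (at z)"
    by (rule bounded_linear.has_vector_derivative[OF bounded_linear_snd d])
  show "((\<lambda>z. fst (Y z)) has_real_derivative fst (G z (Y z))) (at z)"
    using d1 by (simp add: has_real_derivative_iff_has_vector_derivative)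
  show "((\<lambda>z. fst (snd (Y z))) has_real_derivative fst (snd (G z (Y z)))) (at z)"
    using bounded_linear.has_vector_derivative[OF bounded_linear_fst d2]
    by (simp add: has_real_derivative_iff_has_vector_derivative)
  show "((\<lambda>z. snd (snd (Y z))) has_real_derivative snd (snd (G z (Y z))) - 3 * snd (snd (Y z)) / z) (at z)"
    using bounded_linear.has_vector_derivative[OF bounded_linear_snd d2]
    by (simp add: has_real_derivative_iff_has_vector_derivative)
qed

lemma scaled_solution_third:
  assumes sol: "scaled_solution G p Z Y" and "snd (snd p) = 0"
  shows "continuous_on {0..Z} (\<lambda>z. z ^ 3 * snd (snd (Y z)))"
    "\<And>z. 0 < z \<Longrightarrow> z < Z \<Longrightarrow> ((\<lambda>z. z ^ 3 * snd (snd (Y z))) has_real_derivative z ^ 3 * snd (snd (G z (Y z)))) (at z)"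
proof -
  show "continuous_on {0..Z} (\<lambda>z. z ^ 3 * snd (snd (Y z)))"
    by (intro continuous_intros scaled_solutionD[OF sol])
  fix z assume z: "0 < z" "z < Z"
  show "((\<lambda>z. z ^ 3 * snd (snd (Y z))) has_real_derivative z ^ 3 * snd (snd (G z (Y z)))) (at z)"
    using z by (auto intro!: derivative_eq_intros scaled_solutionD(7)[OF sol] simp: field_simps power2_eq_square power3_eq_cube)
qed

lemma mean_value_bound:
  fixes f :: "real \<Rightarrow> real"
  assumes f: "continuous_on {0..z} f" and d: "\<And>x. 0 < x \<Longrightarrow> x < z \<Longrightarrow> (f has_real_derivative f' x) (at x)"
    and le: "\<And>x. 0 < x \<Longrightarrow> x < z \<Longrightarrow> \<bar>f' x\<bar> \<le> C" and z: "z > 0"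
  shows "\<bar>f z - f 0\<bar> \<le> C * z"
proof -
  have "f differentiable (at x)" if "0 < x" "x < z" for x
    using d[OF that] real_differentiable_def by blast
  from MVT[OF z f this] obtain l x where x: "0 < x" "x < z" "(f has_real_derivative l) (at x)" "f z - f 0 = (z - 0) * l"
    by blast
  then have "l = f' x" using DERIV_unique[OF x(3) d[OF x(1,2)]] by simp
  then show ?thesis using x le[OF x(1,2)] z by (simp add: abs_mult mult.commute mult_left_mono)
qed

section \<open>Families of trajectories and the metrics they carry\<close>

locale solution_family = scaled_field +
  fixes P :: "vec3 set" and Y :: "vec3 \<times> real \<Rightarrow> vec3"
  assumes Y_cont: "continuous_on UNIV Y" and P3: "\<And>p. p \<in> P \<Longrightarrow> snd (snd p) = 0"
    and sol: "\<And>p Z. p \<in> P \<Longrightarrow> Z > 0 \<Longrightarrow> scaled_solution G p Z (\<lambda>z. Y (p, z))"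
begin

abbreviation traj :: "vec3 \<Rightarrow> real \<Rightarrow> vec3" where
  "traj p z \<equiv> z *\<^sub>R Y (p, z)"

lemma Y_cont' [continuous_intros]: "continuous_on S f \<Longrightarrow> continuous_on S (\<lambda>x. Y (f x))"
  by (rule continuous_on_compose2[OF Y_cont]) auto

lemma Y_0: "p \<in> P \<Longrightarrow> Y (p, 0) = p"
  using sol[of p 1] by (simp add: scaled_solution_def)

lemma traj_derivative:
  assumes "p \<in> P" "z > 0"
  shows "(traj p has_vector_derivative (1 / z) *\<^sub>R field (traj p z)) (at z)"
proof -
  have "((\<lambda>z. Y (p, z)) has_vector_derivative (G z (Y (p, z)) - (0, 0, 3 * snd (snd (Y (p, z))) / z))) (at z)"
    using sol[of p "z + 1"] assms by (simp add: scaled_solution_def)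
  from has_vector_derivative_scaleR[OF DERIV_ident this]
  have "(traj p has_vector_derivative z *\<^sub>R (G z (Y (p, z)) - (0, 0, 3 * snd (snd (Y (p, z))) / z)) + 1 *\<^sub>R Y (p, z)) (at z)" .
  also have "z *\<^sub>R (G z (Y (p, z)) - (0, 0, 3 * snd (snd (Y (p, z))) / z)) + 1 *\<^sub>R Y (p, z) = (1 / z) *\<^sub>R field (traj p z)"
    using assms by (simp add: field_def scale prod_eq_iff power2_eq_square field_simps)
  finally show ?thesis .
qed

lemma traj_derivative_compose:
  assumes "p \<in> P" "\<zeta> t > 0" "(\<zeta> has_real_derivative \<zeta> t * w) (at t)"
  shows "((\<lambda>t. traj p (\<zeta> t)) has_vector_derivative w *\<^sub>R field (traj p (\<zeta> t))) (at t)"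
  using vector_diff_chain_at[OF assms(3)[unfolded has_real_derivative_iff_has_vector_derivative] traj_derivative[OF assms(1,2)]] assms(2)
  by (simp add: o_def)

text \<open>Makes \<open>z p\<close> the exact first-order part of the trajectory, with error
  \<open>O(z^2)\<close>. In the third component the derivative of \<open>z^3 Y3\<close> is
  \<open>O(z^3)\<close>, so \<open>Y3\<close> is \<open>O(z)\<close> in spite of the singular
  term.\<close>

lemma Y_linear_bound:
  assumes p: "p \<in> P"
  obtains C where "\<And>z. 0 \<le> z \<Longrightarrow> z \<le> 1 \<Longrightarrow> \<bar>fst (Y (p, z)) - fst p\<bar> \<le> C * z"
    "\<And>z. 0 \<le> z \<Longrightarrow> z \<le> 1 \<Longrightarrow> \<bar>fst (snd (Y (p, z))) - fst (snd p)\<bar> \<le> C * z"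
    "\<And>z. 0 \<le> z \<Longrightarrow> z \<le> 1 \<Longrightarrow> \<bar>snd (snd (Y (p, z))) - snd (snd p)\<bar> \<le> C * z"
proof -
  have "continuous_on {0..1} (\<lambda>z. G z (Y (p, z)))" by (intro continuous_intros)
  then have "bounded ((\<lambda>z. G z (Y (p, z))) ` {0..1})"
    by (intro compact_imp_bounded compact_continuous_image) auto
  then obtain C where C0: "\<forall>x\<in>(\<lambda>z. G z (Y (p, z))) ` {0..1}. norm x \<le> C"
    unfolding bounded_iff by blast
  have C: "norm (G z (Y (p, z))) \<le> C" if "0 \<le> z" "z \<le> 1" for z
    by (rule bspec[OF C0]) (use that in auto)
  have *: "0 \<le> z \<and> z \<le> 1 \<longrightarrow> \<bar>fst (Y (p, z)) - fst p\<bar> \<le> C * z \<and> \<bar>fst (snd (Y (p, z))) - fst (snd p)\<bar> \<le> C * z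
      \<and> \<bar>snd (snd (Y (p, z))) - snd (snd p)\<bar> \<le> C * z" for z
  proof (cases "z = 0")
    case False
    show ?thesis
    proof (intro impI conjI)
      assume "0 \<le> z \<and> z \<le> 1"
      with False have z: "0 < z" "z \<le> 1" by auto
      note s = sol[OF p z(1)]
      note Gn = order_trans[OF norm_vec3_components(1)] order_trans[OF norm_vec3_components(2)] order_trans[OF norm_vec3_components(3)]
      show "\<bar>fst (Y (p, z)) - fst p\<bar> \<le> C * z"
        using mean_value_bound[OF scaled_solutionD(1,5)[OF s] Gn(1)[OF C] z(1)] z Y_0[OF p] by simp
      show "\<bar>fst (snd (Y (p, z))) - fst (snd p)\<bar> \<le> C * z"
        using mean_value_bound[OF scaled_solutionD(2,6)[OF s] Gn(2)[OF C] z(1)] z Y_0[OF p] by simp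
      have "\<bar>x ^ 3 * snd (snd (G x (Y (p, x))))\<bar> \<le> C * z ^ 3" if x: "0 < x" "x < z" for x
      proof -
        have "\<bar>x ^ 3 * snd (snd (G x (Y (p, x))))\<bar> \<le> z ^ 3 * C"
          unfolding abs_mult using x z Gn(3)[OF C, of x] by (intro mult_mono) (auto intro: power_mono)
        then show ?thesis by (simp add: mult.commute)
      qed
      from mean_value_bound[OF scaled_solution_third[OF s P3[OF p]] this z(1)]
      have "z ^ 3 * \<bar>snd (snd (Y (p, z)))\<bar> \<le> z ^ 3 * (C * z)" using z by (simp add: abs_mult mult_ac)
      then show "\<bar>snd (snd (Y (p, z))) - snd (snd p)\<bar> \<le> C * z" using z P3[OF p] by simp
    qed
  qed (use Y_0[OF p] in simp)
  show thesis by (rule that[of C]) (use * in blast)+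
qed

end

context expansion_scale
begin

lemma expands_scaled_traj:
  assumes z: "expands z 0 1" "\<forall>\<^sub>F t in F. z t > 0"
    and f: "\<And>r. 0 \<le> r \<Longrightarrow> r \<le> 1 \<Longrightarrow> \<bar>f r - c\<bar> \<le> C * r"
  shows "expands (\<lambda>t. z t * f (z t)) 0 c"
proof -
  have z0: "(z \<longlongrightarrow> 0) F" by (rule expands_tendsto[OF z(1)])
  have "(\<lambda>t. f (z t) - c) \<in> O[F](z)"
  proof (rule bigoI[of _ C])
    have "\<forall>\<^sub>F t in F. z t < 1" using z0 by (rule order_tendstoD) simp
    with z(2) show "\<forall>\<^sub>F t in F. norm (f (z t) - c) \<le> C * norm (z t)"
      by eventually_elim (use f in auto)
  qed
  then have "(\<lambda>t. z t * (f (z t) - c)) \<in> O[F](\<lambda>t. z t * z t)" by (intro landau_o.big.mult) auto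
  also have "(\<lambda>t. z t * z t) \<in> O[F](\<rho>)"
    using expands_mult[OF z(1) z(1)] by (simp add: expands_def)
  finally have "expands (\<lambda>t. z t * (f (z t) - c)) 0 0" by (simp add: expands_def)
  from expands_add[OF this expands_mult[OF expands_const[of c] z(1)]]
  show ?thesis by (simp add: algebra_simps)
qed

end

lemma continuous_on_primitive_single:
  fixes q :: "vec3 \<times> real \<Rightarrow> real"
  assumes "continuous_on (P \<times> {0..}) q" "p \<in> P"
  shows "((\<lambda>z. integral {0..z} (\<lambda>r. q (p, r))) \<longlongrightarrow> 0) (at_right 0)"
    "\<exists>C. \<forall>z. 0 \<le> z \<and> z \<le> 1 \<longrightarrow> \<bar>integral {0..z} (\<lambda>r. q (p, r))\<bar> \<le> C * z"
proof -
  have qc: "continuous_on {0..z} (\<lambda>r. q (p, r))" for z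
    using assms(2) by (intro continuous_on_compose2[OF assms(1)]) (auto intro!: continuous_intros)
  have "bounded ((\<lambda>r. q (p, r)) ` {0..1})"
    by (intro compact_imp_bounded compact_continuous_image qc) auto
  then obtain C where C0: "\<forall>x\<in>(\<lambda>r. q (p, r)) ` {0..1}. norm x \<le> C"
    unfolding bounded_iff by blast
  have C: "\<bar>q (p, r)\<bar> \<le> C" if "0 \<le> r" "r \<le> 1" for r
    using C0 that by simp
  have b: "\<bar>integral {0..z} (\<lambda>r. q (p, r))\<bar> \<le> C * z" if "0 \<le> z" "z \<le> 1" for z
    using integral_norm_bound_integral[OF integrable_continuous_real[OF qc[of z]], of "\<lambda>_. C"] C that
    by (simp add: integrable_const_ivl mult.commute)
  then show "\<exists>C. \<forall>z. 0 \<le> z \<and> z \<le> 1 \<longrightarrow> \<bar>integral {0..z} (\<lambda>r. q (p, r))\<bar> \<le> C * z" by blast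
  have lim: "((\<lambda>z. C * z) \<longlongrightarrow> 0) (at_right 0)"
    by (rule tendsto_mult_right_zero) (rule tendsto_ident_at)
  have "\<forall>\<^sub>F z in at_right 0. norm (integral {0..z} (\<lambda>r. q (p, r))) \<le> C * z"
    unfolding eventually_at_right_field by (intro exI[of _ 1]) (simp add: b)
  from Lim_null_comparison[OF this lim]
  show "((\<lambda>z. integral {0..z} (\<lambda>r. q (p, r))) \<longlongrightarrow> 0) (at_right 0)" .
qed

text \<open>\<open>size\<close> is the metric function \<open>a\<close>, \<open>g\<close> its logarithmic derivative in \<open>ln z\<close>, \<open>m\<close> relates \<open>z\<close> to the
  arc length \<open>t\<close> by \<open>dt/d(ln z) = size m / 2\<close>, \<open>lam\<close> relates \<open>z\<close> to \<open>\<eta>\<close> by \<open>d\<eta>/d(ln z) = 3/2 lam\<close>, and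
  \<open>\<psi>\<close> is the derivative of \<open>t\<close> with respect to \<open>sqrt z\<close>, which is regular at the singular orbit.\<close>

locale coh1_family = solution_family +
  fixes g m lam :: "vec3 \<Rightarrow> real" and size kap \<psi> :: "vec3 \<times> real \<Rightarrow> real"
  assumes size_derivative: "\<And>p z. p \<in> P \<Longrightarrow> z > 0 \<Longrightarrow>
      ((\<lambda>z. size (p, z)) has_real_derivative size (p, z) * g (traj p z) / z) (at z)"
    and size_pos: "\<And>p z. p \<in> P \<Longrightarrow> z > 0 \<Longrightarrow> size (p, z) > 0"
    and m_pos: "\<And>p z. p \<in> P \<Longrightarrow> z > 0 \<Longrightarrow> m (traj p z) > 0"
    and \<psi>_cont: "continuous_on (P \<times> {0..}) \<psi>"
    and \<psi>_pos: "\<And>p r. p \<in> P \<Longrightarrow> r \<ge> 0 \<Longrightarrow> \<psi> (p, r) > 0"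
    and \<psi>_eq: "\<And>p r. p \<in> P \<Longrightarrow> r > 0 \<Longrightarrow> \<psi> (p, r) = size (p, r\<^sup>2) * m (traj p (r\<^sup>2)) / r"
    and growth: "\<And>p. p \<in> P \<Longrightarrow> \<exists>c>0. \<forall>z\<ge>1. c \<le> size (p, z) * m (traj p z)"
    and kap_cont: "continuous_on (P \<times> {0..}) kap"
    and lam_eq: "\<And>p z. p \<in> P \<Longrightarrow> z > 0 \<Longrightarrow> lam (traj p z) = 1 + z * kap (p, z)"
begin

text \<open>Source of forward completeness: in the variable \<open>ln z\<close> the arc length has
  derivative \<open>size m / 2\<close>, which \<open>growth\<close> bounds below for
  \<open>z \<ge> 1\<close>. So \<open>t\<close> exhausts the half line.\<close>

lemma inverse_time_exists:
  "\<exists>\<sigma>. continuous_on (P \<times> {0..}) \<sigma> \<and> (\<forall>p\<in>P. \<sigma> (p, 0) = 0 \<and>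
    (\<forall>t>0. \<sigma> (p, t) > 0 \<and> ((\<lambda>t. \<sigma> (p, t)) has_real_derivative 1 / \<psi> (p, \<sigma> (p, t))) (at t)) \<and>
    (\<forall>r\<ge>0. \<sigma> (p, integral {0..r} (\<lambda>r. \<psi> (p, r))) = r) \<and> filterlim (\<lambda>t. \<sigma> (p, t)) at_top at_top)"
proof -
  have diverge: "filterlim (\<lambda>r. integral {0..r} (\<lambda>r. \<psi> (p, r))) at_top at_top" if p: "p \<in> P" for p
  proof -
    define f where "f s = integral {0..exp (s / 2)} (\<lambda>r. \<psi> (p, r))" for s
    obtain c where c: "c > 0" "\<And>z. z \<ge> 1 \<Longrightarrow> c \<le> size (p, z) * m (traj p z)" using growth[OF p] by blast
    have "filterlim f at_top at_top"
    proof (rule positive_derivative_at_top)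
      fix s :: real assume s: "s \<ge> 0"
      show "(f has_real_derivative \<psi> (p, exp (s / 2)) * (exp (s / 2) / 2)) (at s)"
        unfolding f_def by (rule DERIV_chain2[OF primitive_derivative[OF \<psi>_cont p]]) (auto intro!: derivative_eq_intros)
      have "\<psi> (p, exp (s / 2)) * (exp (s / 2) / 2) = size (p, exp s) * m (traj p (exp s)) / 2"
        using \<psi>_eq[OF p, of "exp (s / 2)"] by (simp flip: exp_double)
      then show "c / 2 \<le> \<psi> (p, exp (s / 2)) * (exp (s / 2) / 2)" using c(2)[of "exp s"] s by simp
    qed (use c in simp)
    moreover have "filterlim (\<lambda>r::real. 2 * ln r) at_top at_top"
      by (intro filterlim_tendsto_pos_mult_at_top[OF tendsto_const _ ln_at_top]) simp
    ultimately have "filterlim (\<lambda>r. f (2 * ln r)) at_top at_top" by (rule filterlim_compose)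
    moreover have "\<forall>\<^sub>F r in at_top. f (2 * ln r) = integral {0..r} (\<lambda>r. \<psi> (p, r))"
      using eventually_gt_at_top[of 0] by eventually_elim (simp add: f_def)
    ultimately show ?thesis by (rule filterlim_cong[OF refl refl, THEN iffD1, rotated])
  qed
  obtain \<sigma> where s: "continuous_on (P \<times> {0..}) \<sigma>"
    "\<And>p. p \<in> P \<Longrightarrow> \<sigma> (p, 0) = 0"
    "\<And>p t. p \<in> P \<Longrightarrow> t > 0 \<Longrightarrow> \<sigma> (p, t) > 0"
    "\<And>p t. p \<in> P \<Longrightarrow> t > 0 \<Longrightarrow> ((\<lambda>t. \<sigma> (p, t)) has_real_derivative 1 / \<psi> (p, \<sigma> (p, t))) (at t)"
    "\<And>p s. p \<in> P \<Longrightarrow> s \<ge> 0 \<Longrightarrow> \<sigma> (p, integral {0..s} (\<lambda>r. \<psi> (p, r))) = s"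
    "\<And>p. p \<in> P \<Longrightarrow> filterlim (\<lambda>t. \<sigma> (p, t)) at_top at_top"
    by (rule inverse_time[OF \<psi>_cont \<psi>_pos diverge]) blast+
  show ?thesis by (rule exI[of _ \<sigma>]) (intro conjI ballI allI impI s)
qed

definition \<sigma> :: "vec3 \<times> real \<Rightarrow> real" where
  "\<sigma> = (SOME \<sigma>. continuous_on (P \<times> {0..}) \<sigma> \<and> (\<forall>p\<in>P. \<sigma> (p, 0) = 0 \<and>
    (\<forall>t>0. \<sigma> (p, t) > 0 \<and> ((\<lambda>t. \<sigma> (p, t)) has_real_derivative 1 / \<psi> (p, \<sigma> (p, t))) (at t)) \<and>
    (\<forall>r\<ge>0. \<sigma> (p, integral {0..r} (\<lambda>r. \<psi> (p, r))) = r) \<and> filterlim (\<lambda>t. \<sigma> (p, t)) at_top at_top))"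

lemma \<sigma>_cont: "continuous_on (P \<times> {0..}) \<sigma>"
  and \<sigma>_0: "p \<in> P \<Longrightarrow> \<sigma> (p, 0) = 0"
  and \<sigma>_pos: "p \<in> P \<Longrightarrow> t > 0 \<Longrightarrow> \<sigma> (p, t) > 0"
  and \<sigma>_derivative: "p \<in> P \<Longrightarrow> t > 0 \<Longrightarrow> ((\<lambda>t. \<sigma> (p, t)) has_real_derivative 1 / \<psi> (p, \<sigma> (p, t))) (at t)"
  and \<sigma>_inverse: "p \<in> P \<Longrightarrow> r \<ge> 0 \<Longrightarrow> \<sigma> (p, integral {0..r} (\<lambda>r. \<psi> (p, r))) = r"
  and \<sigma>_at_top: "p \<in> P \<Longrightarrow> filterlim (\<lambda>t. \<sigma> (p, t)) at_top at_top"
  using someI_ex[OF inverse_time_exists] unfolding \<sigma>_def[symmetric] by blast+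

definition zeta :: "vec3 \<Rightarrow> real \<Rightarrow> real" where "zeta p t = (\<sigma> (p, t))\<^sup>2"

text \<open>The value of \<open>d(ln z)/dt\<close> along the family, since
  \<open>dt = (size m / 2) d(ln z)\<close>.\<close>

definition rate :: "vec3 \<Rightarrow> real \<Rightarrow> real" where
  "rate p t = 2 / (size (p, zeta p t) * m (traj p (zeta p t)))"

lemma zeta_pos: "p \<in> P \<Longrightarrow> t > 0 \<Longrightarrow> zeta p t > 0"
  using \<sigma>_pos[of p t] by (simp add: zeta_def)

lemma zeta_derivative:
  assumes "p \<in> P" "t > 0"
  shows "(zeta p has_real_derivative zeta p t * rate p t) (at t)"
proof -
  have "((\<lambda>t. (\<sigma> (p, t))\<^sup>2) has_real_derivative 2 * \<sigma> (p, t) * (1 / \<psi> (p, \<sigma> (p, t)))) (at t)"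
    using assms by (auto intro!: derivative_eq_intros \<sigma>_derivative)
  also have "2 * \<sigma> (p, t) * (1 / \<psi> (p, \<sigma> (p, t))) = zeta p t * rate p t"
    using assms \<sigma>_pos[OF assms] size_pos[OF assms(1) zeta_pos[OF assms]] m_pos[OF assms(1) zeta_pos[OF assms]]
    by (simp add: \<psi>_eq rate_def zeta_def power2_eq_square)
  finally show ?thesis by (simp add: zeta_def[abs_def])
qed

lemma size_t_derivative:
  assumes "p \<in> P" "t > 0"
  shows "((\<lambda>t. size (p, zeta p t)) has_real_derivative size (p, zeta p t) * (rate p t * g (traj p (zeta p t)))) (at t)"
  using DERIV_chain2[OF size_derivative[OF assms(1) zeta_pos[OF assms]] zeta_derivative[OF assms]] zeta_pos[OF assms]
  by (simp add: mult_ac)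

lemma zeta_tendsto_0:
  assumes "p \<in> P"
  shows "filterlim (zeta p) (at_right 0) (at_right 0)"
proof -
  have "continuous_on {0..} (\<lambda>t. \<sigma> (p, t))"
    using assms by (intro continuous_on_compose2[OF \<sigma>_cont]) (auto intro!: continuous_intros)
  then have "((\<lambda>t. \<sigma> (p, t)) \<longlongrightarrow> \<sigma> (p, 0)) (at 0 within {0..})" by (simp add: continuous_on_def)
  then have "((\<lambda>t. \<sigma> (p, t)) \<longlongrightarrow> 0) (at_right 0)"
    using \<sigma>_0[OF assms] by (auto intro: tendsto_within_subset)
  then have "(zeta p \<longlongrightarrow> 0) (at_right 0)"
    unfolding zeta_def[abs_def] by (auto intro!: tendsto_eq_intros)
  moreover have "\<forall>\<^sub>F t in at_right 0. zeta p t \<in> {0<..} \<and> zeta p t \<noteq> 0"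
    using eventually_at_right_less[of "0::real"]
    by eventually_elim (simp add: zeta_pos[OF assms] less_imp_neq[symmetric])
  ultimately show ?thesis by (simp add: filterlim_at)
qed

lemma zeta_at_top:
  assumes "p \<in> P"
  shows "filterlim (\<lambda>t. ln (zeta p t)) at_top at_top"
proof (rule filterlim_compose[OF ln_at_top])
  have "filterlim (\<lambda>t. \<sigma> (p, t) * \<sigma> (p, t)) at_top at_top"
    using \<sigma>_at_top[OF assms] by (rule filterlim_at_top_mult_at_top[rotated]) (rule \<sigma>_at_top[OF assms])
  then show "filterlim (zeta p) at_top at_top" by (simp add: zeta_def[abs_def] power2_eq_square)
qed

text \<open>The normalisation \<open>e\<^bsup>2\<eta>/3\<^esup> = z (1 + O(z))\<close> fixes the additive constant of \<open>\<eta>\<close>.\<close>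

definition eta :: "vec3 \<Rightarrow> real \<Rightarrow> real" where
  "eta p t = 3 / 2 * (ln (zeta p t) + integral {0..zeta p t} (\<lambda>r. kap (p, r)))"

lemma eta_derivative:
  assumes "p \<in> P" "t > 0"
  shows "(eta p has_real_derivative 3 / 2 * rate p t * lam (traj p (zeta p t))) (at t)"
proof -
  note z = zeta_pos[OF assms]
  have "((\<lambda>t. ln (zeta p t)) has_real_derivative 1 / zeta p t * (zeta p t * rate p t)) (at t)"
    by (rule DERIV_chain2[where f = ln, OF DERIV_ln_divide[OF z] zeta_derivative[OF assms]])
  moreover have "((\<lambda>t. integral {0..zeta p t} (\<lambda>r. kap (p, r))) has_real_derivative kap (p, zeta p t) * (zeta p t * rate p t)) (at t)"
    by (rule DERIV_chain2[where f = "\<lambda>z. integral {0..z} (\<lambda>r. kap (p, r))", OF primitive_derivative[OF kap_cont assms(1) z] zeta_derivative[OF assms]])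
  ultimately have "((\<lambda>t. 3 / 2 * (ln (zeta p t) + integral {0..zeta p t} (\<lambda>r. kap (p, r)))) has_real_derivative
      3 / 2 * (1 / zeta p t * (zeta p t * rate p t) + kap (p, zeta p t) * (zeta p t * rate p t))) (at t)"
    by (intro DERIV_cmult DERIV_add)
  moreover have "3 / 2 * (1 / zeta p t * (zeta p t * rate p t) + kap (p, zeta p t) * (zeta p t * rate p t))
      = 3 / 2 * rate p t * lam (traj p (zeta p t))"
    using z lam_eq[OF assms(1) z] by (simp add: algebra_simps add_divide_distrib)
  ultimately show ?thesis by (simp only: eta_def[abs_def])
qed

lemma exp_eta: "p \<in> P \<Longrightarrow> t > 0 \<Longrightarrow>
    exp (2 / 3 * eta p t) = zeta p t * exp (integral {0..zeta p t} (\<lambda>r. kap (p, r)))"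
proof -
  assume "p \<in> P" "t > 0"
  have "2 / 3 * eta p t = ln (zeta p t) + integral {0..zeta p t} (\<lambda>r. kap (p, r))"
    by (simp add: eta_def)
  then show ?thesis using zeta_pos[OF \<open>p \<in> P\<close> \<open>t > 0\<close>] by (simp only: exp_add exp_ln)
qed

lemma eta_at_bot:
  assumes "p \<in> P"
  shows "filterlim (eta p) at_bot (at_right 0)"
proof -
  have "((\<lambda>t. integral {0..zeta p t} (\<lambda>r. kap (p, r))) \<longlongrightarrow> 0) (at_right 0)"
    by (rule filterlim_compose[OF continuous_on_primitive_single(1)[OF kap_cont assms] zeta_tendsto_0[OF assms]])
  moreover have "filterlim (\<lambda>t. ln (zeta p t)) at_bot (at_right 0)"
    by (rule filterlim_compose[OF ln_at_0 zeta_tendsto_0[OF assms]])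
  ultimately have "filterlim (\<lambda>t. - integral {0..zeta p t} (\<lambda>r. kap (p, r)) + - ln (zeta p t)) at_top (at_right 0)"
    by (intro filterlim_tendsto_add_at_top[OF tendsto_minus]) (auto simp: filterlim_uminus_at_bot)
  then have "filterlim (\<lambda>t. integral {0..zeta p t} (\<lambda>r. kap (p, r)) + ln (zeta p t)) at_bot (at_right 0)"
    by (subst filterlim_uminus_at_bot) simp
  from filterlim_tendsto_pos_mult_at_bot[OF tendsto_const[of "3 / 2 :: real"] _ this]
  show ?thesis by (simp add: eta_def[abs_def] add.commute)
qed

end

section \<open>Matching an arbitrary time function at the singular orbit\<close>

lemma expansion_scale_exp:
  assumes "filterlim \<eta> at_bot F" "0 < \<delta>" "\<delta> \<le> 2 / 3"
  shows "expansion_scale F (\<lambda>t. exp (2 / 3 * \<eta> t)) (\<lambda>t. exp ((2 / 3 + \<delta>) * \<eta> t))"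
proof
  have l: "((\<lambda>t. exp (c * \<eta> t)) \<longlongrightarrow> 0) F" if "c > 0" for c :: real
    by (rule filterlim_compose[OF exp_at_bot filterlim_tendsto_pos_mult_at_bot[OF tendsto_const that assms(1)]])
  show "((\<lambda>t. exp (2 / 3 * \<eta> t)) \<longlongrightarrow> 0) F" "((\<lambda>t. exp ((2 / 3 + \<delta>) * \<eta> t)) \<longlongrightarrow> 0) F"
    by (rule l, use assms in simp)+
  have "\<forall>\<^sub>F t in F. \<eta> t \<le> 0" using assms(1) unfolding filterlim_at_bot by blast
  then have "\<forall>\<^sub>F t in F. norm ((exp (2 / 3 * \<eta> t))\<^sup>2) \<le> 1 * norm (exp ((2 / 3 + \<delta>) * \<eta> t))"
  proof eventually_elim
    case (elim t)
    \<comment> \<open>The bound \<open>\<delta> \<le> 2/3\<close> enters here: it makes the square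
      of the scale no larger than the error once \<open>\<eta> \<le> 0\<close>.\<close>
    have "2 * (2 / 3 * \<eta> t) \<le> (2 / 3 + \<delta>) * \<eta> t"
      using mult_nonpos_nonneg[OF elim, of "2 / 3 - \<delta>"] assms by (simp add: algebra_simps)
    then show ?case by (simp flip: exp_double)
  qed
  then show "(\<lambda>t. (exp (2 / 3 * \<eta> t))\<^sup>2) \<in> O[F](\<lambda>t. exp ((2 / 3 + \<delta>) * \<eta> t))"
    by (rule bigoI)
qed

lemma abs_exp_minus_1_le:
  assumes "\<bar>d :: real\<bar> \<le> 1 / 2"
  shows "\<bar>exp d - 1\<bar> \<le> 2 * \<bar>d\<bar>"
proof -
  have "exp d \<le> 1 + 2 * \<bar>d\<bar>" using exp_bound_lemma[of d] assms by simp
  moreover have "1 + d \<le> exp d" by (rule exp_ge_add_one_self)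
  ultimately show ?thesis by linarith
qed

lemma (in expansion_scale) expands_log_close:
  assumes "\<forall>\<^sub>F t in F. \<zeta> t > 0" "\<forall>\<^sub>F t in F. z t > 0" and close: "\<forall>\<^sub>F t in F. \<bar>ln (z t) - ln (\<zeta> t)\<bar> \<le> K * \<zeta> t"
  shows "expands z 0 1"
proof -
  have "((\<lambda>t. K * \<zeta> t) \<longlongrightarrow> K * 0) F" by (intro tendsto_intros zeta)
  then have "\<forall>\<^sub>F t in F. K * \<zeta> t < 1 / 2" by (rule order_tendstoD) simp
  with assms have "\<forall>\<^sub>F t in F. norm (z t - \<zeta> t) \<le> (2 * K) * norm ((\<zeta> t)\<^sup>2)"
  proof eventually_elim
    case (elim t)
    define d where "d = ln (z t) - ln (\<zeta> t)"
    have "z t = \<zeta> t * exp d" using elim by (simp add: d_def exp_diff)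
    then have "z t - \<zeta> t = \<zeta> t * (exp d - 1)" by (simp add: algebra_simps)
    then have "norm (z t - \<zeta> t) = \<zeta> t * \<bar>exp d - 1\<bar>"
      using elim by (simp add: abs_mult)
    also have "\<dots> \<le> \<zeta> t * (2 * \<bar>d\<bar>)"
      using elim by (intro mult_left_mono abs_exp_minus_1_le) (auto simp: d_def)
    also have "\<dots> \<le> \<zeta> t * (2 * (K * \<zeta> t))" using elim by (intro mult_left_mono) (auto simp: d_def)
    finally show ?case by (simp add: power2_eq_square mult_ac)
  qed
  then have "(\<lambda>t. z t - \<zeta> t) \<in> O[F](\<lambda>t. (\<zeta> t)\<^sup>2)" by (rule bigoI)
  from landau_o.big_trans[OF this sq] show ?thesis by (simp add: expands_def)
qed

text \<open>The error in \<open>w\<close> has the primitive \<open>3/2 C e^(2\<eta>/3)\<close> with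
  respect to \<open>t\<close>. Adding it to \<open>S - 2/3 \<eta>\<close> gives a nondecreasing
  function, subtracting it a nonincreasing one; the two bracket a single constant, the limit at the
  singular orbit.\<close>

lemma primitive_normalisation:
  fixes \<eta> S w L :: "real \<Rightarrow> real"
  assumes \<eta>: "\<And>t. 0 < t \<Longrightarrow> t < b \<Longrightarrow> (\<eta> has_real_derivative L t) (at t)"
    and S: "\<And>t. 0 < t \<Longrightarrow> t < b \<Longrightarrow> (S has_real_derivative w t * L t) (at t)"
    and L: "\<And>t. 0 < t \<Longrightarrow> t < b \<Longrightarrow> L t > 0"
    and w: "\<And>t. 0 < t \<Longrightarrow> t < b \<Longrightarrow> \<bar>w t - 2 / 3\<bar> \<le> C * exp (2 / 3 * \<eta> t)"
    and lim: "filterlim \<eta> at_bot (at_right 0)" and b: "b > 0"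
  obtains c where "\<And>t. 0 < t \<Longrightarrow> t < b \<Longrightarrow> \<bar>S t - 2 / 3 * \<eta> t - c\<bar> \<le> 3 / 2 * C * exp (2 / 3 * \<eta> t)"
proof -
  define U where "U t = S t - 2 / 3 * \<eta> t + 3 / 2 * C * exp (2 / 3 * \<eta> t)" for t
  define V where "V t = S t - 2 / 3 * \<eta> t - 3 / 2 * C * exp (2 / 3 * \<eta> t)" for t
  have U: "U s \<le> U t" if "0 < s" "s \<le> t" "t < b" for s t
  proof (rule DERIV_nonneg_imp_nondecreasing[OF that(2)])
    fix x assume x: "s \<le> x" "x \<le> t"
    have "(U has_real_derivative L x * (w x - 2 / 3 + C * exp (2 / 3 * \<eta> x))) (at x)"
      unfolding U_def using x that by (auto intro!: derivative_eq_intros S \<eta> simp: algebra_simps)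
    moreover have "w x - 2 / 3 + C * exp (2 / 3 * \<eta> x) \<ge> 0" using w[of x] x that by auto
    then have "L x * (w x - 2 / 3 + C * exp (2 / 3 * \<eta> x)) \<ge> 0"
      using L[of x] x that by (intro mult_nonneg_nonneg) auto
    ultimately show "\<exists>y. (U has_real_derivative y) (at x) \<and> 0 \<le> y" by blast
  qed
  have V: "V t \<le> V s" if "0 < s" "s \<le> t" "t < b" for s t
  proof (rule DERIV_nonpos_imp_nonincreasing[OF that(2)])
    fix x assume x: "s \<le> x" "x \<le> t"
    have "(V has_real_derivative L x * (w x - 2 / 3 - C * exp (2 / 3 * \<eta> x))) (at x)"
      unfolding V_def using x that by (auto intro!: derivative_eq_intros S \<eta> simp: algebra_simps)
    moreover have "w x - 2 / 3 - C * exp (2 / 3 * \<eta> x) \<le> 0" using w[of x] x that by auto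
    then have "L x * (w x - 2 / 3 - C * exp (2 / 3 * \<eta> x)) \<le> 0"
      using L[of x] x that by (intro mult_nonneg_nonpos) auto
    ultimately show "\<exists>y. (V has_real_derivative y) (at x) \<and> y \<le> 0" by blast
  qed
  have C0: "C * exp (2 / 3 * \<eta> t) \<ge> 0" if "0 < t" "t < b" for t using w[OF that] by linarith
  have VU: "V s \<le> U t" if s: "0 < s" "s < b" and t: "0 < t" "t < b" for s t
  proof -
    have "V s \<le> V (min s t)" using V[of "min s t" s] s t by auto
    also have "\<dots> \<le> U (min s t)" using C0[of "min s t"] s t by (simp add: U_def V_def min_def)
    also have "\<dots> \<le> U t" using U[of "min s t" t] s t by auto
    finally show ?thesis .
  qed
  define c where "c = Inf (U ` {0<..<b})"
  have ne: "U ` {0<..<b} \<noteq> {}" using b by (auto intro!: exI[of _ "b / 2"])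
  have Vc: "V s \<le> c" if "0 < s" "s < b" for s
    unfolding c_def using ne VU that by (intro cInf_greatest) auto
  have cU: "c \<le> U t" if "0 < t" "t < b" for t
    unfolding c_def using that b VU[of "b / 2"] by (intro cInf_lower bdd_belowI[of _ "V (b / 2)"]) auto
  show thesis
  proof (rule that[of c])
    fix t assume t: "0 < t" "t < b"
    define u e where "u = S t - 2 / 3 * \<eta> t" and "e = 3 / 2 * C * exp (2 / 3 * \<eta> t)"
    have "u - e \<le> c" using Vc[OF t] unfolding V_def u_def e_def .
    moreover have "c \<le> u + e" using cU[OF t] unfolding U_def u_def e_def .
    ultimately have "\<bar>u - c\<bar> \<le> e" by linarith
    then show "\<bar>S t - 2 / 3 * \<eta> t - c\<bar> \<le> 3 / 2 * C * exp (2 / 3 * \<eta> t)"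
      unfolding u_def e_def .
  qed
qed

lemma time_interval_const:
  assumes "\<And>t. t \<in> time_interval T \<Longrightarrow> (f has_real_derivative 0) (at t)" "s \<in> time_interval T" "t \<in> time_interval T"
  shows "f s = f t"
proof -
  have *: "f s = f t" if "s < t" "s \<in> time_interval T" "t \<in> time_interval T" for s t
  proof -
    have mem: "x \<in> time_interval T" if "s \<le> x" "x \<le> t" for x
      using that \<open>s \<in> _\<close> \<open>t \<in> _\<close> by (auto simp: time_interval_def intro: order.strict_trans1[of "ereal x" "ereal t"])
    have "continuous_on {s..t} f"
      by (intro continuous_at_imp_continuous_on ballI DERIV_isCont[OF assms(1)] mem) auto
    with that(1) have "f t = f s"
      by (rule DERIV_isconst_end) (use mem assms(1) in auto)
    then show ?thesis by simp
  qed
  show ?thesis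
  proof (cases s t rule: linorder_cases)
    case less
    then show ?thesis by (rule *[OF _ assms(2,3)])
  next
    case greater
    then show ?thesis by (rule *[OF _ assms(3,2), symmetric])
  qed simp
qed

lemma time_interval_initial:
  assumes "T > 0"
  shows "\<exists>b>0. \<forall>t. 0 < t \<and> t < b \<longrightarrow> t \<in> time_interval T"
proof -
  obtain b where "0 < ereal b" "ereal b < T" using ereal_dense2[OF assms] by (auto simp: zero_ereal_def)
  then show ?thesis by (intro exI[of _ b]) (auto simp: time_interval_def intro: less_trans[of "ereal _" "ereal b"])
qed

context coh1_family
begin

lemma expansion_scale_eta:
  "p \<in> P \<Longrightarrow> expansion_scale (at_right 0) (\<lambda>t. exp (2 / 3 * eta p t)) (\<lambda>t. exp ((2 / 3 + 2 / 3) * eta p t))"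
  by (intro expansion_scale_exp eta_at_bot) auto

lemma expands_traj:
  assumes p: "p \<in> P" and "expansion_scale F \<zeta> \<rho>" and z: "expansion_scale.expands F \<zeta> \<rho> z 0 1" "\<forall>\<^sub>F t in F. z t > 0"
  shows "expansion_scale.expands F \<zeta> \<rho> (\<lambda>t. fst (traj p (z t))) 0 (fst p)"
    "expansion_scale.expands F \<zeta> \<rho> (\<lambda>t. fst (snd (traj p (z t)))) 0 (fst (snd p))"
    "expansion_scale.expands F \<zeta> \<rho> (\<lambda>t. snd (snd (traj p (z t)))) 0 (snd (snd p))"
proof -
  interpret expansion_scale F \<zeta> \<rho> by fact
  obtain C where C: "\<And>z. 0 \<le> z \<Longrightarrow> z \<le> 1 \<Longrightarrow> \<bar>fst (Y (p, z)) - fst p\<bar> \<le> C * z"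
    "\<And>z. 0 \<le> z \<Longrightarrow> z \<le> 1 \<Longrightarrow> \<bar>fst (snd (Y (p, z))) - fst (snd p)\<bar> \<le> C * z"
    "\<And>z. 0 \<le> z \<Longrightarrow> z \<le> 1 \<Longrightarrow> \<bar>snd (snd (Y (p, z))) - snd (snd p)\<bar> \<le> C * z"
    by (rule Y_linear_bound[OF p]) blast
  show "expands (\<lambda>t. fst (traj p (z t))) 0 (fst p)" "expands (\<lambda>t. fst (snd (traj p (z t)))) 0 (fst (snd p))"
    "expands (\<lambda>t. snd (snd (traj p (z t)))) 0 (snd (snd p))"
    using expands_scaled_traj[OF z C(1)] expands_scaled_traj[OF z C(2)] expands_scaled_traj[OF z C(3)] by simp_all
qed

lemma expands_zeta:
  assumes p: "p \<in> P"
  shows "expansion_scale.expands (at_right 0) (\<lambda>t. exp (2 / 3 * eta p t)) (\<lambda>t. exp ((2 / 3 + 2 / 3) * eta p t)) (zeta p) 0 1"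
proof -
  interpret expansion_scale "at_right 0" "\<lambda>t. exp (2 / 3 * eta p t)" "\<lambda>t. exp ((2 / 3 + 2 / 3) * eta p t)"
    by (rule expansion_scale_eta[OF p])
  obtain C where C: "\<And>z. 0 \<le> z \<Longrightarrow> z \<le> 1 \<Longrightarrow> \<bar>integral {0..z} (\<lambda>r. kap (p, r))\<bar> \<le> C * z"
    using continuous_on_primitive_single(2)[OF kap_cont p] by blast
  have z0: "(zeta p \<longlongrightarrow> 0) (at_right 0)" using zeta_tendsto_0[OF p] by (simp add: filterlim_at)
  have pos: "\<forall>\<^sub>F t in at_right 0. zeta p t > 0"
    using eventually_at_right_less[of "0::real"] by eventually_elim (rule zeta_pos[OF p])
  have "((\<lambda>t. C * zeta p t) \<longlongrightarrow> C * 0) (at_right 0)" by (intro tendsto_intros z0)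
  then have "\<forall>\<^sub>F t in at_right 0. C * zeta p t < ln 2" by (rule order_tendstoD) simp
  moreover have "\<forall>\<^sub>F t in at_right 0. zeta p t < 1" using z0 by (rule order_tendstoD) simp
  ultimately have "\<forall>\<^sub>F t in at_right 0. \<bar>ln (zeta p t) - ln (exp (2 / 3 * eta p t))\<bar> \<le> (2 * \<bar>C\<bar>) * exp (2 / 3 * eta p t)"
    using pos eventually_at_right_less[of "0::real"]
  proof eventually_elim
    case (elim t)
    define k where "k = integral {0..zeta p t} (\<lambda>r. kap (p, r))"
    have k: "\<bar>k\<bar> \<le> C * zeta p t" unfolding k_def using elim by (intro C) auto
    have e: "exp (2 / 3 * eta p t) = zeta p t * exp k" using exp_eta[OF p elim(4)] by (simp add: k_def)
    have "exp (- ln 2) \<le> exp k" using k elim by simp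
    then have "1 / 2 \<le> exp k" by (simp add: exp_minus)
    then have z: "zeta p t \<le> 2 * exp (2 / 3 * eta p t)" using elim unfolding e by simp
    have "\<bar>ln (zeta p t) - ln (exp (2 / 3 * eta p t))\<bar> = \<bar>k\<bar>" using elim unfolding e by (simp add: ln_mult)
    also have "\<dots> \<le> \<bar>C\<bar> * zeta p t" using k elim abs_ge_self[of C] mult_right_mono[of C "\<bar>C\<bar>" "zeta p t"] by linarith
    also have "\<dots> \<le> \<bar>C\<bar> * (2 * exp (2 / 3 * eta p t))" using z by (intro mult_left_mono) auto
    finally show ?case by simp
  qed
  from expands_log_close[OF _ pos this] show ?thesis by simp
qed

text \<open>The given metric has its own logarithmic time \<open>S\<close>, a primitive of
  \<open>2/(a m)\<close>. Its additive constant is fixed by requiring \<open>S - 2/3 \<eta>\<close>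
  to tend to 0. Then \<open>D\<close> and the trajectory of \<open>p\<close> at \<open>e^S\<close>
  share their first-order expansion, hence coincide. It follows that \<open>a/size\<close> is a
  constant \<open>\<mu>\<close>, and the arc lengths agree up to the factor \<open>\<mu>\<close>
  because both start at 0.\<close>

theorem homothetic_to_family:
  fixes T :: ereal and D :: "real \<Rightarrow> vec3" and a \<eta> L :: "real \<Rightarrow> real"
  assumes p: "p \<in> P" and T: "T > 0" and \<delta>: "0 < \<delta>" "\<delta> \<le> 2 / 3"
    and \<eta>: "\<And>t. t \<in> time_interval T \<Longrightarrow> (\<eta> has_real_derivative L t) (at t)" "filterlim \<eta> at_bot (at_right 0)"
    and D: "\<And>t. t \<in> time_interval T \<Longrightarrow> (D has_vector_derivative (2 / (a t * m (D t))) *\<^sub>R field (D t)) (at t)"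
    and a: "\<And>t. t \<in> time_interval T \<Longrightarrow> (a has_real_derivative 2 / m (D t) * g (D t)) (at t)"
    and pos: "\<And>t. t \<in> time_interval T \<Longrightarrow> a t > 0" "\<And>t. t \<in> time_interval T \<Longrightarrow> m (D t) > 0"
    and m_cont: "\<And>t. t \<in> time_interval T \<Longrightarrow> isCont (\<lambda>t. m (D t)) t"
    and w: "expansion_scale.expands (at_right 0) (\<lambda>t. exp (2 / 3 * \<eta> t)) (\<lambda>t. exp ((2 / 3 + \<delta>) * \<eta> t)) (\<lambda>t. 2 / (a t * m (D t)) / L t) (2 / 3) l"
    and D_exp: "expansion_scale.expands (at_right 0) (\<lambda>t. exp (2 / 3 * \<eta> t)) (\<lambda>t. exp ((2 / 3 + \<delta>) * \<eta> t)) (\<lambda>t. fst (D t)) 0 (fst p)"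
      "expansion_scale.expands (at_right 0) (\<lambda>t. exp (2 / 3 * \<eta> t)) (\<lambda>t. exp ((2 / 3 + \<delta>) * \<eta> t)) (\<lambda>t. fst (snd (D t))) 0 (fst (snd p))"
      "expansion_scale.expands (at_right 0) (\<lambda>t. exp (2 / 3 * \<eta> t)) (\<lambda>t. exp ((2 / 3 + \<delta>) * \<eta> t)) (\<lambda>t. snd (snd (D t))) 0 (snd (snd p))"
  shows "\<exists>\<mu>>0. \<forall>t\<in>time_interval T. a t = \<mu> * size (p, zeta p (t / \<mu>)) \<and> D t = traj p (zeta p (t / \<mu>))"
proof -
  let ?z = "\<lambda>t. exp (2 / 3 * \<eta> t)" and ?r = "\<lambda>t. exp ((2 / 3 + \<delta>) * \<eta> t)"
  interpret es: expansion_scale "at_right 0" ?z ?r by (rule expansion_scale_exp[OF \<eta>(2) \<delta>])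
  define q where "q t = 2 / (a t * m (D t))" for t
  have q_pos: "q t > 0" if "t \<in> time_interval T" for t using pos[OF that] by (simp add: q_def)
  obtain b0 where b0: "b0 > 0" "\<And>t. 0 < t \<Longrightarrow> t < b0 \<Longrightarrow> t \<in> time_interval T"
    using time_interval_initial[OF T] by blast
  have "\<exists>S. \<forall>t::real. 0 < ereal t \<longrightarrow> ereal t < T \<longrightarrow> (S has_vector_derivative q t) (at t)"
  proof (rule einterval_antiderivative[OF T])
    fix t assume "0 < ereal t" "ereal t < T"
    then have t: "t \<in> time_interval T" by (simp add: time_interval_def)
    have "a t * m (D t) \<noteq> 0" using pos[OF t] by simp
    then show "isCont q t" unfolding q_def[abs_def]
      by (intro continuous_intros DERIV_isCont[OF a[OF t]] m_cont[OF t])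
  qed
  then obtain S0 where S0: "\<And>t. t \<in> time_interval T \<Longrightarrow> (S0 has_real_derivative q t) (at t)"
    by (auto simp: time_interval_def has_real_derivative_iff_has_vector_derivative)
  have w_lim: "((\<lambda>t. q t / L t) \<longlongrightarrow> 2 / 3) (at_right 0)"
    using es.expands_tendsto[OF w] by (simp add: q_def)
  have "\<forall>\<^sub>F t in at_right 0. q t / L t > 1 / 3" using w_lim by (rule order_tendstoD) simp
  moreover have "(\<lambda>t. q t / L t - 2 / 3) \<in> O[at_right 0](?z)"
  proof -
    have "(\<lambda>t. q t / L t - (2 / 3 + l * ?z t)) \<in> O[at_right 0](?r)" using w unfolding es.expands_def q_def .
    also have "?r \<in> O[at_right 0](?z)"
    proof (rule bigoI[of _ 1])
      have "\<forall>\<^sub>F t in at_right 0. \<eta> t \<le> 0" using \<eta>(2) unfolding filterlim_at_bot by blast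
      then show "\<forall>\<^sub>F t in at_right 0. norm (?r t) \<le> 1 * norm (?z t)"
        by eventually_elim (use \<delta> in \<open>simp add: distrib_right mult_nonneg_nonpos\<close>)
    qed
    finally have "(\<lambda>t. q t / L t - (2 / 3 + l * ?z t)) \<in> O[at_right 0](?z)" .
    moreover have "(\<lambda>t. l * ?z t) \<in> O[at_right 0](?z)" by (cases "l = 0") auto
    ultimately have "(\<lambda>t. (q t / L t - (2 / 3 + l * ?z t)) + l * ?z t) \<in> O[at_right 0](?z)" by (rule sum_in_bigo(1))
    then show ?thesis by (simp add: algebra_simps)
  qed
  then obtain C where "\<forall>\<^sub>F t in at_right 0. norm (q t / L t - 2 / 3) \<le> C * norm (?z t)" by (elim landau_o.bigE)
  ultimately have "\<forall>\<^sub>F t in at_right 0. q t / L t > 1 / 3 \<and> \<bar>q t / L t - 2 / 3\<bar> \<le> C * ?z t"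
    by eventually_elim simp
  then obtain b1 where b1: "b1 > 0" "\<And>t. 0 < t \<Longrightarrow> t < b1 \<Longrightarrow> q t / L t > 1 / 3 \<and> \<bar>q t / L t - 2 / 3\<bar> \<le> C * ?z t"
    by (auto simp: eventually_at_right_field)
  define b where "b = min b0 b1"
  have b: "b > 0" "\<And>t. 0 < t \<Longrightarrow> t < b \<Longrightarrow> t \<in> time_interval T" using b0 b1 by (auto simp: b_def)
  have L_pos: "L t > 0" if "0 < t" "t < b" for t
  proof -
    have "t < b1" using that by (simp add: b_def)
    from b1(2)[OF that(1) this] have "q t / L t > 0" by linarith
    then show ?thesis using q_pos[OF b(2)[OF that]] by (simp add: zero_less_divide_iff)
  qed
  obtain c where c: "\<And>t. 0 < t \<Longrightarrow> t < b \<Longrightarrow> \<bar>S0 t - 2 / 3 * \<eta> t - c\<bar> \<le> 3 / 2 * C * ?z t"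
  proof (rule primitive_normalisation[of b \<eta> L S0 "\<lambda>t. q t / L t" C])
    fix t assume t: "0 < t" "t < b"
    show "(S0 has_real_derivative q t / L t * L t) (at t)" using S0[OF b(2)[OF t]] L_pos[OF t] by simp
    show "\<bar>q t / L t - 2 / 3\<bar> \<le> C * ?z t" using b1(2)[of t] t by (auto simp: b_def)
  qed (use \<eta> b L_pos in auto)
  define S where "S t = S0 t - c" for t
  have S: "(S has_real_derivative q t) (at t)" if "t \<in> time_interval T" for t
    unfolding S_def using S0[OF that] by (auto intro!: derivative_eq_intros)
  define K where "K = 3 / 2 * C"
  have S_close: "\<forall>\<^sub>F t in at_right 0. \<bar>S t - 2 / 3 * \<eta> t\<bar> \<le> K * ?z t"
    unfolding eventually_at_right_field using b(1) c by (intro exI[of _ b]) (auto simp: S_def K_def algebra_simps)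
  have "((\<lambda>t. K * ?z t) \<longlongrightarrow> K * 0) (at_right 0)" by (intro tendsto_intros es.zeta)
  then have "\<forall>\<^sub>F t in at_right 0. K * ?z t < 1" by (rule order_tendstoD) simp
  with S_close have S_close1: "\<forall>\<^sub>F t in at_right 0. \<bar>S t - 2 / 3 * \<eta> t\<bar> \<le> 1" by eventually_elim simp
  define z where "z t = exp (S t)" for t
  have z_exp: "es.expands z 0 1"
    by (rule es.expands_log_close[of z K]) (use S_close in \<open>auto simp: z_def\<close>)
  have z_deriv: "(z has_real_derivative z t * q t) (at t)" if "t \<in> time_interval T" for t
    unfolding z_def using S[OF that] by (auto intro!: derivative_eq_intros)
  have z0: "(z \<longlongrightarrow> 0) (at_right 0)" by (rule es.expands_tendsto[OF z_exp])
  have D2_exp: "es.expands (\<lambda>t. fst (traj p (z t))) 0 (fst p)" "es.expands (\<lambda>t. fst (snd (traj p (z t)))) 0 (fst (snd p))"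
    "es.expands (\<lambda>t. snd (snd (traj p (z t)))) 0 (snd (snd p))"
    using expands_traj[OF p es.expansion_scale_axioms z_exp] by (auto simp: z_def)
  have S_bot: "filterlim S at_bot (at_right 0)"
  proof (rule filterlim_at_bot_mono)
    have "filterlim (\<lambda>t. - 1 + - (2 / 3 * \<eta> t)) at_top (at_right 0)"
      using filterlim_tendsto_pos_mult_at_bot[OF tendsto_const[of "2 / 3 :: real"] _ \<eta>(2)]
      by (intro filterlim_tendsto_add_at_top[OF tendsto_const]) (simp add: filterlim_uminus_at_bot)
    then show "filterlim (\<lambda>t. 1 + 2 / 3 * \<eta> t) at_bot (at_right 0)"
      by (subst filterlim_uminus_at_bot) simp
    show "\<forall>\<^sub>F t in at_right 0. S t \<le> 1 + 2 / 3 * \<eta> t" using S_close1 by eventually_elim simp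
  qed
  have vec_lim: "(E \<longlongrightarrow> 0) (at_right 0)" if "es.expands (\<lambda>t. fst (E t)) 0 l1" "es.expands (\<lambda>t. fst (snd (E t))) 0 l2"
    "es.expands (\<lambda>t. snd (snd (E t))) 0 l3" for E :: "real \<Rightarrow> vec3" and l1 l2 l3
    using tendsto_Pair[OF es.expands_tendsto[OF that(1)] tendsto_Pair[OF es.expands_tendsto[OF that(2)] es.expands_tendsto[OF that(3)]]]
    by (simp add: zero_prod_def)
  have dif: "(\<lambda>t. norm (D t - traj p (z t))) \<in> O[at_right 0](?r)"
  proof -
    have e0: "f \<in> O[at_right 0](?r)" if "es.expands f (0 - 0) (k - k)" for f k
      using that unfolding es.expands_def by simp
    have "(\<lambda>t. norm (fst (D t) - fst (traj p (z t)), fst (snd (D t)) - fst (snd (traj p (z t))), snd (snd (D t)) - snd (snd (traj p (z t))))) \<in> O[at_right 0](?r)"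
      unfolding bigo_norm_Pair
      using e0[OF es.expands_diff[OF D_exp(1) D2_exp(1)]] e0[OF es.expands_diff[OF D_exp(2) D2_exp(2)]]
        e0[OF es.expands_diff[OF D_exp(3) D2_exp(3)]]
      by simp
    also have "(\<lambda>t. norm (fst (D t) - fst (traj p (z t)), fst (snd (D t)) - fst (snd (traj p (z t))), snd (snd (D t)) - snd (snd (traj p (z t)))))
       = (\<lambda>t. norm (D t - traj p (z t)))" by (simp add: minus_prod_def)
    finally show ?thesis .
  qed
  then obtain C1 where C1: "C1 > 0" "\<forall>\<^sub>F t in at_right 0. norm (norm (D t - traj p (z t))) \<le> C1 * norm (?r t)"
    by (elim landau_o.bigE)
  \<comment> \<open>In the time \<open>S\<close>, which differs from \<open>2/3 \<eta>\<close> by a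
    bounded amount, the exponent \<open>2/3 + \<delta>\<close> becomes
    \<open>1 + 3/2 \<delta>\<close>, above the critical rate 1.\<close>
  have D_eq: "D t = traj p (z t)" if t: "t \<in> time_interval T" for t
  proof (rule trajectory_unique[where ?D1.0 = D and ?D2.0 = "\<lambda>t. traj p (z t)" and w = q and S = S and T = T and \<delta> = "3 / 2 * \<delta>" and C = "C1 * exp (1 + 3 / 2 * \<delta>)"])
    show "\<forall>\<^sub>F t in at_right 0. norm (D t - traj p (z t)) \<le> C1 * exp (1 + 3 / 2 * \<delta>) * exp ((1 + 3 / 2 * \<delta>) * S t)"
      using C1(2) S_close1
    proof eventually_elim
      case (elim t)
      have "(1 + 3 / 2 * \<delta>) * (2 / 3 * \<eta> t) \<le> (1 + 3 / 2 * \<delta>) * (1 + S t)"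
        using elim(2) \<delta> by (intro mult_left_mono) auto
      then have "(2 / 3 + \<delta>) * \<eta> t \<le> (1 + 3 / 2 * \<delta>) + (1 + 3 / 2 * \<delta>) * S t"
        by (simp add: algebra_simps add_divide_distrib)
      then have "C1 * ?r t \<le> C1 * exp ((1 + 3 / 2 * \<delta>) + (1 + 3 / 2 * \<delta>) * S t)"
        using C1(1) by (intro mult_left_mono) auto
      with elim(1) show ?case by (simp add: exp_add mult.assoc)
    qed
    show "3 / 2 * \<delta> > 0" using \<delta> by simp
    show "(D \<longlongrightarrow> 0) (at_right 0)" by (rule vec_lim[OF D_exp])
    show "((\<lambda>t. traj p (z t)) \<longlongrightarrow> 0) (at_right 0)" by (rule vec_lim[OF D2_exp])
    show "(D has_vector_derivative q s *\<^sub>R field (D s)) (at s)" if "s \<in> time_interval T" for s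
      using D[OF that] by (simp add: q_def)
    show "((\<lambda>t. traj p (z t)) has_vector_derivative q s *\<^sub>R field (traj p (z s))) (at s)" if "s \<in> time_interval T" for s
      using traj_derivative_compose[OF p, of z s "q s"] z_deriv[OF that] by (simp add: z_def)
  qed (use S q_pos S_bot t in auto)
  have zpos: "z t > 0" for t by (simp add: z_def)
  define R where "R t = a t / size (p, z t)" for t
  have R_deriv: "(R has_real_derivative 0) (at t)" if t: "t \<in> time_interval T" for t
  proof -
    have s: "((\<lambda>t. size (p, z t)) has_real_derivative size (p, z t) * g (traj p (z t)) / z t * (z t * q t)) (at t)"
      by (rule DERIV_chain2[where f = "\<lambda>z. size (p, z)", OF size_derivative[OF p zpos] z_deriv[OF t]])
    have "(R has_real_derivative (2 / m (D t) * g (D t) * size (p, z t) - a t * (size (p, z t) * g (traj p (z t)) / z t * (z t * q t)))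
        / (size (p, z t) * size (p, z t))) (at t)"
      unfolding R_def using size_pos[OF p zpos[of t]] by (intro DERIV_divide a[OF t] s) simp
    moreover have "2 / m (D t) * g (D t) * size (p, z t) - a t * (size (p, z t) * g (traj p (z t)) / z t * (z t * q t)) = 0"
      using zpos[of t] pos[OF t] by (simp add: D_eq[OF t, symmetric] q_def)
    ultimately show ?thesis by simp
  qed
  define t0 where "t0 = b / 2"
  have t0: "t0 \<in> time_interval T" using b by (auto simp: t0_def)
  define \<mu> where "\<mu> = R t0"
  have \<mu>: "\<mu> > 0" using pos[OF t0] size_pos[OF p zpos[of t0]] by (simp add: \<mu>_def R_def)
  have a_eq: "a t = \<mu> * size (p, z t)" if t: "t \<in> time_interval T" for t
    using time_interval_const[OF R_deriv t t0] size_pos[OF p zpos[of t]] by (simp add: \<mu>_def R_def field_simps)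
  \<comment> \<open>The arc length which the family assigns to the point \<open>z t\<close>. It is
    compared with \<open>t / \<mu>\<close>.\<close>
  define \<Theta> where "\<Theta> t = integral {0..sqrt (z t)} (\<lambda>r. \<psi> (p, r))" for t
  have \<Theta>_deriv: "((\<lambda>t. \<Theta> t - t / \<mu>) has_real_derivative 0) (at t)" if t: "t \<in> time_interval T" for t
  proof -
    have sq: "((\<lambda>t. sqrt (z t)) has_real_derivative sqrt (z t) * q t / 2) (at t)"
      using z_deriv[OF t] zpos[of t] by (auto intro!: derivative_eq_intros simp: field_simps)
    have "(\<Theta> has_real_derivative \<psi> (p, sqrt (z t)) * (sqrt (z t) * q t / 2)) (at t)"
      unfolding \<Theta>_def
      by (rule DERIV_chain2[where f = "\<lambda>x. integral {0..x} (\<lambda>r. \<psi> (p, r))", OF primitive_derivative[OF \<psi>_cont p] sq]) (simp add: zpos)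
    moreover have "\<psi> (p, sqrt (z t)) * (sqrt (z t) * q t / 2) = 1 / \<mu>"
      using \<psi>_eq[OF p, of "sqrt (z t)"] zpos[of t] pos[OF t] size_pos[OF p zpos[of t]] \<mu> a_eq[OF t]
      by (simp add: q_def D_eq[OF t, symmetric] field_simps)
    ultimately have d: "(\<Theta> has_real_derivative 1 / \<mu>) (at t)" by simp
    have "((\<lambda>t. \<Theta> t - t / \<mu>) has_real_derivative 1 / \<mu> - 1 / \<mu>) (at t)"
      by (intro DERIV_diff d DERIV_cdivide DERIV_ident)
    then show ?thesis by simp
  qed
  have "((\<lambda>t. \<Theta> t - t / \<mu>) \<longlongrightarrow> 0 - 0 / \<mu>) (at_right 0)"
  proof (intro tendsto_diff tendsto_divide tendsto_const tendsto_ident_at)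
    have "((\<lambda>t. sqrt (z t)) \<longlongrightarrow> sqrt 0) (at_right 0)" by (intro tendsto_intros z0)
    then have "filterlim (\<lambda>t. sqrt (z t)) (at_right 0) (at_right 0)"
      using zpos by (simp add: filterlim_at less_imp_neq[symmetric])
    then show "(\<Theta> \<longlongrightarrow> 0) (at_right 0)"
      unfolding \<Theta>_def by (rule filterlim_compose[OF continuous_on_primitive_single(1)[OF \<psi>_cont p]])
  qed (use \<mu> in simp)
  moreover have "\<forall>\<^sub>F t in at_right 0. \<Theta> t - t / \<mu> = \<Theta> t0 - t0 / \<mu>"
    unfolding eventually_at_right_field
    using b time_interval_const[OF \<Theta>_deriv _ t0] by (intro exI[of _ b]) blast
  ultimately have "\<Theta> t0 - t0 / \<mu> = 0"
    using tendsto_eventually[of "\<lambda>t. \<Theta> t - t / \<mu>"] tendsto_unique[of "at_right (0::real)"] by fastforce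
  then have \<Theta>_eq: "\<Theta> t = t / \<mu>" if "t \<in> time_interval T" for t
    using time_interval_const[OF \<Theta>_deriv that t0] by simp
  have zeta_eq: "zeta p (t / \<mu>) = z t" if t: "t \<in> time_interval T" for t
  proof -
    have "\<sigma> (p, \<Theta> t) = sqrt (z t)" unfolding \<Theta>_def using zpos[of t] by (intro \<sigma>_inverse[OF p]) simp
    then show ?thesis using zpos[of t] by (simp add: zeta_def \<Theta>_eq[OF t])
  qed
  show ?thesis
    by (intro exI[of _ \<mu>] conjI ballI \<mu>) (auto simp: zeta_eq a_eq D_eq)
qed

end

section \<open>The reduced system on \<open>M\<^sup>(\<^sup>2\<^sup>)\<close>\<close>

text \<open>Here \<open>b = c\<close>. With \<open>x = f/(3a)\<close>, \<open>y = a\<^sup>2/b\<^sup>2\<close> and \<open>ds = (2/a) dt\<close> the system becomes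
  \<open>2 x' = x (x - 1) (2 - y)\<close>, \<open>2 y' = y (4 - 2x - 4y - xy)\<close>, and the field below is its nonlinear part
  in the coordinates \<open>(x - 1, y, 0)\<close>. The line \<open>x = 1\<close> is the Bryant-Salamon metric.\<close>

definition spinor_field :: "real \<Rightarrow> vec3 \<Rightarrow> vec3" where
  "spinor_field z v =
     (fst v * (fst v - fst (snd v) * (1/2 * (1 + z * fst v))),
      fst (snd v) * (- fst v - fst (snd v) * (5/2) - fst (snd v) * (z * fst v * (1/2))), 0)"

lemma scaled_field_spinor: "scaled_field spinor_field"
proof (rule scaled_fieldI)
  show "continuous_on UNIV (\<lambda>(z, y). spinor_field z y)"
    unfolding spinor_field_def split_def by (intro continuous_intros)
  show "spinor_field z 0 = 0" for z by (simp add: spinor_field_def zero_prod_def)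
  show "spinor_field 1 (z *\<^sub>R y) = z\<^sup>2 *\<^sub>R spinor_field z y" for z y
    by (simp add: spinor_field_def algebra_simps power2_eq_square)
  show "order_at_0 2 (\<lambda>v. fst (spinor_field 1 v))" "order_at_0 2 (\<lambda>v. fst (snd (spinor_field 1 v)))"
    "order_at_0 2 (\<lambda>v. snd (snd (spinor_field 1 v)))"
    unfolding spinor_field_def fst_conv snd_conv
    by ((rule order_at_0_intros)+)[3]
qed

text \<open>Obtained by comparing linear terms: with \<open>x = 1 + n \<zeta>\<close> and
  \<open>y = q \<zeta>\<close> the component \<open>X_2\<close> requires \<open>q/2 = 9 s2\<close>,
  and \<open>X_4\<close> requires \<open>4/9 n - 2/3 q = - 4 s1 - 24 s2\<close>.\<close>

definition spinor_params :: "real \<times> real \<Rightarrow> vec3" where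
  "spinor_params s = (- 9 * fst s - 27 * snd s, 18 * snd s, 0)"

abbreviation "P2 \<equiv> spinor_params ` parameters 2"

lemma parameters_bounds:
  assumes "s \<in> parameters i"
  shows "\<bar>fst s\<bar> \<le> 1" "\<bar>snd s\<bar> \<le> 1" "(fst s)\<^sup>2 + (snd s)\<^sup>2 = 1" "snd s > 0" "fst s \<ge> s_star i"
proof -
  show n: "(fst s)\<^sup>2 + (snd s)\<^sup>2 = 1"
    using assms by (auto simp: parameters_def norm_Pair real_sqrt_eq_iff)
  then have "(fst s)\<^sup>2 \<le> 1" "(snd s)\<^sup>2 \<le> 1"
    using zero_le_power2[of "fst s"] zero_le_power2[of "snd s"] by linarith+
  then show "\<bar>fst s\<bar> \<le> 1" "\<bar>snd s\<bar> \<le> 1" by (simp_all add: abs_square_le_1)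
  show "snd s > 0" "fst s \<ge> s_star i" using assms by (auto simp: parameters_def)
qed

lemma circle_threshold:
  fixes a b c k :: real
  assumes circle: "a\<^sup>2 + b\<^sup>2 = 1" and "b > 0" "k > 0" "c < 0" "c \<le> a" and c: "c\<^sup>2 * (1 + k\<^sup>2) = k\<^sup>2"
  shows "a + k * b \<ge> 0" "a + k * b = 0 \<longleftrightarrow> a = c"
proof -
  have kb: "(k * b)\<^sup>2 = k\<^sup>2 * (1 - a\<^sup>2)" using circle by (simp add: power_mult_distrib)
  show "a + k * b \<ge> 0"
  proof (rule ccontr)
    assume "\<not> ?thesis"
    then have l: "k * b < - a" by simp
    then have "(k * b)\<^sup>2 < (- a)\<^sup>2" using assms(2,3) by (intro power_strict_mono) auto
    then have "c\<^sup>2 * (1 + k\<^sup>2) < a\<^sup>2 * (1 + k\<^sup>2)" using kb c by (simp add: algebra_simps)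
    then have "c\<^sup>2 < a\<^sup>2" by (rule mult_right_less_imp_less) simp
    moreover have "k * b > 0" using assms by simp
    then have "a\<^sup>2 \<le> c\<^sup>2" using assms(4,5) l by (intro abs_le_square_iff[THEN iffD1]) auto
    ultimately show False by simp
  qed
  show "a + k * b = 0 \<longleftrightarrow> a = c"
  proof
    assume "a + k * b = 0"
    then have e: "k * b = - a" by simp
    then have "c\<^sup>2 * (1 + k\<^sup>2) = a\<^sup>2 * (1 + k\<^sup>2)" using kb c by (simp add: algebra_simps)
    moreover have "1 + k\<^sup>2 \<noteq> 0" using zero_le_power2[of k] by linarith
    ultimately have "a\<^sup>2 = c\<^sup>2" by simp
    moreover have "k * b > 0" using assms by simp
    ultimately show "a = c" using e assms(4) by (auto simp: power2_eq_iff)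
  next
    assume ac: "a = c"
    then have "(k * b)\<^sup>2 = (- c)\<^sup>2" using kb c by (simp add: algebra_simps)
    then have "k * b = - c \<or> k * b = c" unfolding power2_eq_iff by simp
    moreover have "k * b > 0" using assms by simp
    ultimately show "a + k * b = 0" using ac assms(4) by auto
  qed
qed

lemma spinor_threshold:
  assumes "s \<in> parameters 2"
  shows "fst s + 3 * snd s \<ge> 0" "fst s + 3 * snd s = 0 \<longleftrightarrow> fst s = s_star 2"
  by (rule circle_threshold[OF parameters_bounds(3,4)[OF assms] _ _ parameters_bounds(5)[OF assms]];
      simp add: s_star_def power_divide)+

lemma P2E:
  assumes "p \<in> P2"
  obtains N Q where "p = (N, Q, 0)" "N \<le> 0" "Q > 0"
  using assms spinor_threshold(1) parameters_bounds(4) by (force simp: spinor_params_def)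

text \<open>This is the invariant region \<open>0 < x \<le> 1\<close>, \<open>0 < y < 1\<close> in
  scaled variables. \<open>N\<close>, \<open>Q\<close> and \<open>x = 1 + z N\<close> each solve a
  homogeneous linear equation along the solution, so each keeps its sign; \<open>1 - y\<close>
  satisfies a linear inequality.\<close>

lemma spinor_bounds:
  assumes p: "p \<in> P2" and Z: "Z > 0" and sol: "scaled_solution spinor_field p Z Y"
  shows "snd (snd (Y Z)) = 0" "fst (snd (Y Z)) > 0" "Z * fst (snd (Y Z)) < 1" "fst (Y Z) \<le> 0"
    "1 + Z * fst (Y Z) > 0" "fst p < 0 \<Longrightarrow> fst (Y Z) < 0" "fst p = 0 \<Longrightarrow> fst (Y Z) = 0"
proof -
  obtain N0 Q0 where p_eq: "p = (N0, Q0, 0)" "N0 \<le> 0" "Q0 > 0" using P2E[OF p] by blast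
  define N where "N z = fst (Y z)" for z
  define Q where "Q z = fst (snd (Y z))" for z
  note D = scaled_solutionD[OF sol]
  have c [continuous_intros]: "continuous_on {0..Z} N" "continuous_on {0..Z} Q" unfolding N_def Q_def by (fact D)+
  have zero: "N 0 = N0" "Q 0 = Q0" using D(4) p_eq by (auto simp: N_def Q_def)
  have dN: "(N has_real_derivative (N z - Q z * (1/2 * (1 + z * N z))) * N z) (at z)" if "0 < z" "z < Z" for z
    using D(5)[OF that] by (simp add: spinor_field_def N_def[abs_def] Q_def mult.commute)
  have dQ: "(Q has_real_derivative (- N z - Q z * (5/2) - Q z * (z * N z * (1/2))) * Q z) (at z)" if "0 < z" "z < Z" for z
    using D(6)[OF that] by (simp add: spinor_field_def N_def Q_def[abs_def] mult.commute)
  have N_eq: "N Z = N 0 * exp (integral {0..Z} (\<lambda>z. N z - Q z * (1/2 * (1 + z * N z))))"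
    using Z by (intro linear_solution dN c) (auto intro!: continuous_intros)
  then show "fst (Y Z) \<le> 0" "fst p < 0 \<Longrightarrow> fst (Y Z) < 0" "fst p = 0 \<Longrightarrow> fst (Y Z) = 0"
    using zero p_eq by (auto simp: N_def mult_le_0_iff mult_less_0_iff)
  have Q_pos: "Q z > 0" if "0 < z" "z \<le> Z" for z
  proof -
    have "Q z = Q 0 * exp (integral {0..z} (\<lambda>z. - N z - Q z * (5/2) - Q z * (z * N z * (1/2))))"
      using that by (intro linear_solution dQ) (auto intro!: continuous_intros intro: continuous_on_subset[OF c(1)] continuous_on_subset[OF c(2)])
    then show ?thesis using zero p_eq by simp
  qed
  then show "fst (snd (Y Z)) > 0" using Z by (auto simp: Q_def)
  define x where "x z = 1 + z * N z" for z
  have x_pos: "x z > 0" if "0 < z" "z \<le> Z" for z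
  proof -
    have "x z = x 0 * exp (integral {0..z} (\<lambda>z. N z - 1/2 * (z * N z * Q z)))"
    proof (rule linear_solution)
      fix w assume w: "0 < w" "w < z"
      show "(x has_real_derivative (N w - 1/2 * (w * N w * Q w)) * x w) (at w)"
        unfolding x_def using w that by (auto intro!: derivative_eq_intros dN simp: algebra_simps)
    qed (use that in \<open>auto simp: x_def intro!: continuous_intros intro: continuous_on_subset[OF c(1)] continuous_on_subset[OF c(2)]\<close>)
    then show ?thesis by (simp add: x_def)
  qed
  then show "1 + Z * fst (Y Z) > 0" using Z by (auto simp: x_def N_def)
  have "(\<lambda>z. 1 - z * Q z) 0 * exp (integral {0..Z} (\<lambda>z. - 2 * Q z)) \<le> (\<lambda>z. 1 - z * Q z) Z"
  proof (rule linear_lower_bound[where y' = "\<lambda>z. - (Q z + z * ((- N z - Q z * (5/2) - Q z * (z * N z * (1/2))) * Q z))"])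
    fix z assume z: "0 < z" "z < Z"
    show "((\<lambda>z. 1 - z * Q z) has_real_derivative - (Q z + z * ((- N z - Q z * (5/2) - Q z * (z * N z * (1/2))) * Q z))) (at z)"
      using z by (auto intro!: derivative_eq_intros dQ)
    \<comment> \<open>With the comparison rate \<open>- 2 Q\<close> the remainder in the equation of
      \<open>1 - y\<close> is this manifestly nonnegative product.\<close>
    have "0 \<le> 1/2 * (Q z * (x z * (2 + z * Q z)))" using Q_pos[of z] x_pos[of z] z by simp
    also have "\<dots> = - (Q z + z * ((- N z - Q z * (5/2) - Q z * (z * N z * (1/2))) * Q z)) - (- 2 * Q z) * (1 - z * Q z)"
      by (simp add: x_def algebra_simps)
    finally show "- 2 * Q z * (1 - z * Q z) \<le> - (Q z + z * ((- N z - Q z * (5/2) - Q z * (z * N z * (1/2))) * Q z))"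
      by (simp only: diff_ge_0_iff_ge)
  qed (use Z in \<open>auto intro!: continuous_intros c\<close>)
  moreover have "0 < (\<lambda>z. 1 - z * Q z) 0 * exp (integral {0..Z} (\<lambda>z. - 2 * Q z))" by simp
  ultimately have "0 < 1 - Z * Q Z" by linarith
  then show "Z * fst (snd (Y Z)) < 1" by (simp add: Q_def)
  have "snd (snd p) = 0" using p_eq by simp
  note R = scaled_solution_third[OF sol this]
  have "Z ^ 3 * snd (snd (Y Z)) = 0 ^ 3 * snd (snd (Y 0))"
    using Z R(1) by (rule DERIV_isconst_end) (use R(2) in \<open>auto simp: spinor_field_def\<close>)
  then show "snd (snd (Y Z)) = 0" using Z by simp
qed

lemma bounded_P2: "bounded P2"
proof -
  have "norm (spinor_params s) \<le> 54" if "s \<in> parameters 2" for s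
  proof -
    have "norm (spinor_params s) \<le> norm (- 9 * fst s - 27 * snd s) + (norm (18 * snd s) + norm (0::real))"
      unfolding spinor_params_def by (rule order_trans[OF norm_Pair_le add_left_mono[OF norm_Pair_le]])
    then show ?thesis using parameters_bounds(1,2)[OF that] by (auto simp: abs_le_iff)
  qed
  then show ?thesis by (auto intro!: boundedI)
qed

lemma spinor_family_exists: "\<exists>Y. solution_family spinor_field P2 Y"
proof -
  interpret scaled_field spinor_field by (rule scaled_field_spinor)
  have a: "Z * norm (Y Z) < 3" if "p \<in> P2" "Z > 0" "scaled_solution spinor_field p Z Y" for p Z Y
  proof -
    note b = spinor_bounds[OF that]
    have "norm (Z *\<^sub>R Y Z) \<le> norm (Z * fst (Y Z)) + (norm (Z * fst (snd (Y Z))) + norm (Z * snd (snd (Y Z))))"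
      using norm_Pair_le[of "Z * fst (Y Z)" "(Z * fst (snd (Y Z)), Z * snd (snd (Y Z)))"]
        norm_Pair_le[of "Z * fst (snd (Y Z))" "Z * snd (snd (Y Z))"]
      by (simp add: scaleR_prod_def)
    moreover have "Z * fst (Y Z) \<le> 0" "Z * fst (snd (Y Z)) > 0" using b that by (auto simp: mult_le_0_iff)
    ultimately show ?thesis using b that by auto
  qed
  have P3: "snd (snd p) = 0" if "p \<in> P2" for p using that by (auto simp: spinor_params_def)
  obtain Y where "continuous_on UNIV Y" "\<And>p Z. p \<in> P2 \<Longrightarrow> Z > 0 \<Longrightarrow> scaled_solution spinor_field p Z (\<lambda>z. Y (p, z))"
    by (rule global_scaled_solutions[where P = P2 and B = 3]) (rule bounded_P2 | erule P3 | erule (2) a | blast)+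
  then have "solution_family spinor_field P2 Y"
    by unfold_locales (auto simp: spinor_params_def)
  then show ?thesis by blast
qed

definition spinor_solution :: "vec3 \<times> real \<Rightarrow> vec3" where
  "spinor_solution = (SOME Y. solution_family spinor_field P2 Y)"

interpretation spinor: solution_family spinor_field P2 spinor_solution
  unfolding spinor_solution_def by (rule someI_ex[OF spinor_family_exists])

lemma monotone_bounded_limit:
  fixes f :: "real \<Rightarrow> real"
  assumes mono: "\<And>s t. 0 \<le> s \<Longrightarrow> s \<le> t \<Longrightarrow> f s \<le> f t" and bound: "\<And>s. 0 \<le> s \<Longrightarrow> f s \<le> C"
  shows "\<exists>L\<ge>f 0. (f \<longlongrightarrow> L) at_top"
proof -
  define L where "L = Sup (f ` {0..})"
  have bdd: "bdd_above (f ` {0..})" using bound by (auto intro!: bdd_aboveI[of _ C])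
  have le: "f s \<le> L" if "s \<ge> 0" for s unfolding L_def using that bdd by (intro cSup_upper) auto
  have "(f \<longlongrightarrow> L) at_top"
  proof (rule order_tendstoI)
    fix a assume "a < L"
    then obtain s where s: "s \<ge> 0" "a < f s" unfolding L_def using bdd less_cSup_iff[of "f ` {0..}" a] by auto
    show "\<forall>\<^sub>F t in at_top. a < f t"
      using eventually_ge_at_top[of s] by eventually_elim (use mono s in force)
  next
    fix a assume a: "L < a"
    show "\<forall>\<^sub>F t in at_top. f t < a"
      using eventually_ge_at_top[of 0] by eventually_elim (rule le_less_trans[OF le a])
  qed
  with le[of 0] show ?thesis by auto
qed

text \<open>The value 1/4 is the equilibrium of \<open>f (1 - 4 f)\<close>. The smaller of it and
  \<open>f 0\<close> is a barrier, since the distance to it satisfies a linear inequality with rate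
  \<open>- 4 f\<close>.\<close>

lemma logistic_lower_bound:
  fixes f :: "real \<Rightarrow> real"
  assumes d: "\<And>s. s \<ge> 0 \<Longrightarrow> (f has_real_derivative f' s) (at s)"
    and le: "\<And>s. s \<ge> 0 \<Longrightarrow> f s * (1 - 4 * f s) \<le> f' s" and nonneg: "\<And>s. s \<ge> 0 \<Longrightarrow> f s \<ge> 0" and s: "s \<ge> 0"
  shows "min (f 0) (1/4) \<le> f s"
proof -
  define k where "k = min (f 0) (1/4)"
  have c: "continuous_on {0..s} f" by (rule DERIV_continuous_on) (auto intro: DERIV_subset[OF d])
  have "(\<lambda>s. f s - k) 0 * exp (integral {0..s} (\<lambda>s. - 4 * f s)) \<le> (\<lambda>s. f s - k) s"
  proof (rule linear_lower_bound[OF _ _ _ _ s])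
    fix w assume w: "0 < w" "w < s"
    show "((\<lambda>s. f s - k) has_real_derivative f' w) (at w)"
      using DERIV_diff[OF d DERIV_const, of w] w by simp
    have "f w * (1 - 4 * k) \<ge> 0" using nonneg[of w] w by (simp add: k_def)
    then have "- 4 * f w * (f w - k) \<le> f w * (1 - 4 * f w)" by (simp add: algebra_simps)
    also have "\<dots> \<le> f' w" using le w by simp
    finally show "- 4 * f w * (f w - k) \<le> f' w" .
  qed (use c in \<open>auto intro!: continuous_intros\<close>)
  moreover have "0 \<le> (f 0 - k) * exp (integral {0..s} (\<lambda>s. - 4 * f s))" by (simp add: k_def)
  ultimately have "0 \<le> f s - k" using order_trans by blast
  then show ?thesis unfolding k_def[symmetric] by simp
qed

lemma norm_expansion_iff:
  fixes e r :: "'a \<Rightarrow> real"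
  shows "(\<lambda>t. norm ((X1 t, X2 t, X3 t, X4 t, X5 t, X6 t, X7 t, X8 t) -
      ((c1, c2, c3, c4, c5, c6, c7, c8) + e t *\<^sub>R (l1, l2, l3, l4, l5, l6, l7, l8 :: real)))) \<in> O[F](r) \<longleftrightarrow>
    (\<lambda>t. X1 t - (c1 + l1 * e t)) \<in> O[F](r) \<and> (\<lambda>t. X2 t - (c2 + l2 * e t)) \<in> O[F](r) \<and>
    (\<lambda>t. X3 t - (c3 + l3 * e t)) \<in> O[F](r) \<and> (\<lambda>t. X4 t - (c4 + l4 * e t)) \<in> O[F](r) \<and>
    (\<lambda>t. X5 t - (c5 + l5 * e t)) \<in> O[F](r) \<and> (\<lambda>t. X6 t - (c6 + l6 * e t)) \<in> O[F](r) \<and>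
    (\<lambda>t. X7 t - (c7 + l7 * e t)) \<in> O[F](r) \<and> (\<lambda>t. X8 t - (c8 + l8 * e t)) \<in> O[F](r)"
  by (simp add: bigo_norm_Pair mult.commute)

section \<open>Metrics on \<open>M\<^sup>(\<^sup>2\<^sup>)\<close> from the reduced system\<close>

definition spinor_reduced :: "ereal \<Rightarrow> (real \<Rightarrow> real) \<Rightarrow> (real \<Rightarrow> real) \<Rightarrow> (real \<Rightarrow> real) \<Rightarrow> bool" where
  "spinor_reduced T x y a \<longleftrightarrow> (\<forall>t\<in>time_interval T. a t > 0 \<and> x t > 0 \<and> y t > 0 \<and>
     (x has_real_derivative x t * (x t - 1) * (2 - y t) / a t) (at t) \<and>
     (y has_real_derivative y t * (4 - 2 * x t - 4 * y t - x t * y t) / a t) (at t) \<and>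
     (a has_real_derivative 2 - x t - y t) (at t))"

definition spinor_metric :: "(real \<Rightarrow> real) \<Rightarrow> (real \<Rightarrow> real) \<Rightarrow> (real \<Rightarrow> real) \<Rightarrow> coh1_metric" where
  "spinor_metric x y a = (a, \<lambda>t. a t / sqrt (y t), \<lambda>t. a t / sqrt (y t), \<lambda>t. 3 * x t * a t)"

lemma spinor_metric_derivatives:
  assumes "spinor_reduced T x y a" "t \<in> time_interval T"
  shows "(a has_real_derivative 2 - x t - y t) (at t)"
    "((\<lambda>t. a t / sqrt (y t)) has_real_derivative sqrt (y t) * (1 + x t / 2)) (at t)"
    "((\<lambda>t. 3 * x t * a t) has_real_derivative 3 * (x t)\<^sup>2 * (1 - y t)) (at t)"
proof -
  have pos: "a t > 0" "x t > 0" "y t > 0"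
    and d: "(x has_real_derivative x t * (x t - 1) * (2 - y t) / a t) (at t)"
     "(y has_real_derivative y t * (4 - 2 * x t - 4 * y t - x t * y t) / a t) (at t)"
     "(a has_real_derivative 2 - x t - y t) (at t)"
    using assms by (auto simp: spinor_reduced_def)
  show "(a has_real_derivative 2 - x t - y t) (at t)" by (rule d)
  have "((\<lambda>t. 3 * x t * a t) has_real_derivative 3 * (x t * (x t - 1) * (2 - y t) / a t) * a t + (2 - x t - y t) * (3 * x t)) (at t)"
    by (auto intro!: derivative_eq_intros d)
  moreover have "3 * (x t * (x t - 1) * (2 - y t) / a t) * a t + (2 - x t - y t) * (3 * x t) = 3 * (x t)\<^sup>2 * (1 - y t)"
    using pos by (simp add: field_simps power2_eq_square)
  ultimately show "((\<lambda>t. 3 * x t * a t) has_real_derivative 3 * (x t)\<^sup>2 * (1 - y t)) (at t)" by simp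
  define w where "w = sqrt (y t)"
  have w: "w > 0" "y t = w\<^sup>2" using pos by (simp_all add: w_def)
  have s: "((\<lambda>t. sqrt (y t)) has_real_derivative y t * (4 - 2 * x t - 4 * y t - x t * y t) / a t / (2 * w)) (at t)"
    using pos by (auto intro!: derivative_eq_intros d simp: w_def divide_simps)
  have "((\<lambda>t. a t / sqrt (y t)) has_real_derivative
      ((2 - x t - y t) * sqrt (y t) - a t * (y t * (4 - 2 * x t - 4 * y t - x t * y t) / a t / (2 * w))) / (sqrt (y t) * sqrt (y t))) (at t)"
    using pos by (intro DERIV_divide d s) simp
  moreover have "((2 - x t - y t) * sqrt (y t) - a t * (y t * (4 - 2 * x t - 4 * y t - x t * y t) / a t / (2 * w))) / (sqrt (y t) * sqrt (y t))
     = sqrt (y t) * (1 + x t / 2)"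
    using pos w(1) unfolding w_def[symmetric] w(2) by (simp add: field_simps power2_eq_square)
  ultimately show "((\<lambda>t. a t / sqrt (y t)) has_real_derivative sqrt (y t) * (1 + x t / 2)) (at t)" by simp
qed

lemma spinor_metric_spin7:
  assumes red: "spinor_reduced T x y a"
  shows "spin7_metric 1 T (spinor_metric x y a)"
  unfolding spinor_metric_def spin7_metric.simps
proof (intro conjI ballI)
  fix t assume t: "t \<in> time_interval T"
  note d = spinor_metric_derivatives[OF red t]
  have pos: "a t > 0" "x t > 0" "y t > 0" using red t by (auto simp: spinor_reduced_def)
  define w where "w = sqrt (y t)"
  have w: "w > 0" "y t = w\<^sup>2" "sqrt (w\<^sup>2) = w" using pos by (simp_all add: w_def)
  show "0 < a t" "0 < a t / sqrt (y t)" "0 < a t / sqrt (y t)" "0 < 3 * x t * a t" using pos by auto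
  show "a differentiable at t" "(\<lambda>t. a t / sqrt (y t)) differentiable at t" "(\<lambda>t. a t / sqrt (y t)) differentiable at t"
    "(\<lambda>t. 3 * x t * a t) differentiable at t"
    using d real_differentiable_def by blast+
  show "deriv a t / a t = a t / sqrt (y t) / (a t * (a t / sqrt (y t))) + a t / sqrt (y t) / (a t * (a t / sqrt (y t))) -
       a t / (a t / sqrt (y t) * (a t / sqrt (y t))) - 1 / 3 * (3 * x t * a t / (a t)\<^sup>2)"
    using pos w(1) unfolding DERIV_imp_deriv[OF d(1)] w(2,3) by (simp add: field_simps power2_eq_square)
  show "deriv (\<lambda>t. a t / sqrt (y t)) t / (a t / sqrt (y t)) = a t / sqrt (y t) / (a t * (a t / sqrt (y t))) + a t / (a t / sqrt (y t) * (a t / sqrt (y t))) -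
       a t / sqrt (y t) / (a t * (a t / sqrt (y t))) + 1 / 6 * (3 * x t * a t / (a t / sqrt (y t))\<^sup>2)"
    using pos w(1) unfolding DERIV_imp_deriv[OF d(2)] w(2,3) by (simp add: field_simps power2_eq_square)
  then show "deriv (\<lambda>t. a t / sqrt (y t)) t / (a t / sqrt (y t)) = a t / (a t / sqrt (y t) * (a t / sqrt (y t))) + a t / sqrt (y t) / (a t * (a t / sqrt (y t))) -
       a t / sqrt (y t) / (a t * (a t / sqrt (y t))) + 1 / 6 * (3 * x t * a t / (a t / sqrt (y t))\<^sup>2)"
    by simp
  show "deriv (\<lambda>t. 3 * x t * a t) t / (3 * x t * a t) = 1 * (1 / 3 * (3 * x t * a t / (a t)\<^sup>2) -
       1 / 6 * (3 * x t * a t / (a t / sqrt (y t))\<^sup>2) - 1 / 6 * (3 * x t * a t / (a t / sqrt (y t))\<^sup>2))"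
    using pos w(1) unfolding DERIV_imp_deriv[OF d(3)] w(2,3) by (simp add: field_simps power2_eq_square)
qed simp

text \<open>The product of \<open>a\<close> with \<open>trL\<close>. Its value at the equilibrium
  \<open>(1, 0)\<close> is 3, so \<open>spinor_lam\<close> below is normalised to 1 there and
  \<open>\<eta>\<close> grows initially by 3/2 per unit of \<open>ln z\<close>.\<close>

definition spinor_Lam :: "real \<Rightarrow> real \<Rightarrow> real" where
  "spinor_Lam x y = 4 + 2 * y - x + x * y"

lemma spinor_metric_trL:
  assumes red: "spinor_reduced T x y a" and t: "t \<in> time_interval T"
  shows "trL (spinor_metric x y a) t = spinor_Lam (x t) (y t) / a t"
proof -
  note d = spinor_metric_derivatives[OF red t]
  have pos: "a t > 0" "x t > 0" "y t > 0" using red t by (auto simp: spinor_reduced_def)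
  define w where "w = sqrt (y t)"
  have w: "w > 0" "y t = w\<^sup>2" "sqrt (w\<^sup>2) = w" using pos by (simp_all add: w_def)
  show ?thesis using pos w(1)
    unfolding spinor_metric_def trL.simps d[THEN DERIV_imp_deriv] spinor_Lam_def w(2,3)
    by (simp add: field_simps power2_eq_square)
qed

lemma spinor_metric_XZ:
  assumes red: "spinor_reduced T x y a" and t: "t \<in> time_interval T" and L: "spinor_Lam (x t) (y t) \<noteq> 0"
  defines "\<Lambda> \<equiv> spinor_Lam (x t) (y t)"
  shows "XZ (spinor_metric x y a) t =
    ((2 - x t - y t) / \<Lambda>, (y t * (1 + x t / 2)) / \<Lambda>, (y t * (1 + x t / 2)) / \<Lambda>, (x t * (1 - y t)) / \<Lambda>,
     y t / \<Lambda>, 1 / \<Lambda>, 1 / \<Lambda>, 3 * x t * \<Lambda>)"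
proof -
  note d = spinor_metric_derivatives[OF red t]
  have pos: "a t > 0" "x t > 0" "y t > 0" using red t by (auto simp: spinor_reduced_def)
  define w where "w = sqrt (y t)"
  have w: "w > 0" "y t = w\<^sup>2" "sqrt (w\<^sup>2) = w" using pos by (simp_all add: w_def)
  have L': "\<Lambda> \<noteq> 0" using L by (simp add: \<Lambda>_def)
  have tr: "trL (a, \<lambda>t. a t / sqrt (y t), \<lambda>t. a t / sqrt (y t), \<lambda>t. 3 * x t * a t) t = \<Lambda> / a t"
    using spinor_metric_trL[OF red t] by (simp add: spinor_metric_def \<Lambda>_def)
  show ?thesis using pos w(1) L'
    unfolding spinor_metric_def XZ.simps tr Let_def d[THEN DERIV_imp_deriv] w(2,3)
    by (simp add: field_simps power2_eq_square)
qed

section \<open>The family on \<open>M\<^sup>(\<^sup>2\<^sup>)\<close>\<close>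

definition spinor_N :: "vec3 \<times> real \<Rightarrow> real" where "spinor_N q = fst (spinor_solution q)"
definition spinor_Q :: "vec3 \<times> real \<Rightarrow> real" where "spinor_Q q = fst (snd (spinor_solution q))"

text \<open>In the variable \<open>ln z\<close> the logarithmic derivative of \<open>a\<close> is
  \<open>1/2 - z (N + Q)/2\<close>. The summand 1/2 gives \<open>sqrt z\<close>; the rest gives this
  regular factor, equal to 1 at \<open>z = 0\<close>, which is also the derivative of
  \<open>t\<close> with respect to \<open>sqrt z\<close>.\<close>

definition spinor_alpha :: "vec3 \<times> real \<Rightarrow> real" where
  "spinor_alpha q = exp (integral {0..snd q} (\<lambda>r. - (spinor_N (fst q, r) + spinor_Q (fst q, r)) / 2))"

definition spinor_size :: "vec3 \<times> real \<Rightarrow> real" where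
  "spinor_size q = sqrt (snd q) * spinor_alpha q"

definition spinor_x :: "vec3 \<Rightarrow> real \<Rightarrow> real" where "spinor_x p z = 1 + z * spinor_N (p, z)"
definition spinor_y :: "vec3 \<Rightarrow> real \<Rightarrow> real" where "spinor_y p z = z * spinor_Q (p, z)"

lemma spinor_N_cont [continuous_intros]: "continuous_on S f \<Longrightarrow> continuous_on S (\<lambda>q. spinor_N (f q))"
  unfolding spinor_N_def by (intro continuous_intros spinor.Y_cont')

lemma spinor_Q_cont [continuous_intros]: "continuous_on S f \<Longrightarrow> continuous_on S (\<lambda>q. spinor_Q (f q))"
  unfolding spinor_Q_def by (intro continuous_intros spinor.Y_cont')

lemma spinor_alpha_cont: "continuous_on (P2 \<times> {0..}) spinor_alpha"
proof -
  have "continuous_on (P2 \<times> {0..}) (\<lambda>q. - (spinor_N q + spinor_Q q) / 2)" by (intro continuous_intros) auto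
  from continuous_on_exp[OF continuous_on_primitive[OF this]]
  show ?thesis by (simp only: spinor_alpha_def[abs_def])
qed

lemma spinor_alpha_derivative:
  assumes "p \<in> P2" "z > 0"
  shows "((\<lambda>z. spinor_alpha (p, z)) has_real_derivative spinor_alpha (p, z) * (- (spinor_N (p, z) + spinor_Q (p, z)) / 2)) (at z)"
proof -
  have "continuous_on (P2 \<times> {0..}) (\<lambda>q. - (spinor_N q + spinor_Q q) / 2)" by (intro continuous_intros) auto
  from DERIV_fun_exp[OF primitive_derivative[OF this assms]]
  show ?thesis by (simp only: spinor_alpha_def fst_conv snd_conv)
qed

lemma spinor_alpha_pos: "spinor_alpha q > 0" by (simp add: spinor_alpha_def)

lemma spinor_xy_bounds:
  assumes "p \<in> P2" "z > 0"
  shows "0 < spinor_x p z" "spinor_x p z \<le> 1" "0 < spinor_y p z" "spinor_y p z < 1" "spinor_Q (p, z) > 0"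
    "fst p < 0 \<Longrightarrow> spinor_x p z < 1" "fst p = 0 \<Longrightarrow> spinor_x p z = 1" "snd (snd (spinor_solution (p, z))) = 0"
  using spinor_bounds[OF assms spinor.sol[OF assms]] assms(2)
  by (auto simp: spinor_x_def spinor_y_def spinor_N_def spinor_Q_def mult_le_0_iff mult_less_0_iff)

lemma spinor_traj:
  assumes "p \<in> P2" "z > 0"
  shows "spinor.traj p z = (spinor_x p z - 1, spinor_y p z, 0)"
  using spinor_xy_bounds(8)[OF assms] by (simp add: spinor_x_def spinor_y_def spinor_N_def spinor_Q_def prod_eq_iff)

lemma spinor_xy_derivatives:
  assumes "p \<in> P2" "\<zeta> t > 0" "(\<zeta> has_real_derivative \<zeta> t * w) (at t)"
  shows "((\<lambda>t. spinor_x p (\<zeta> t)) has_real_derivative w * (spinor_x p (\<zeta> t) * (spinor_x p (\<zeta> t) - 1) * (2 - spinor_y p (\<zeta> t)) / 2)) (at t)"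
    "((\<lambda>t. spinor_y p (\<zeta> t)) has_real_derivative w * (spinor_y p (\<zeta> t) * (4 - 2 * spinor_x p (\<zeta> t) - 4 * spinor_y p (\<zeta> t) - spinor_x p (\<zeta> t) * spinor_y p (\<zeta> t)) / 2)) (at t)"
proof -
  have d: "((\<lambda>t. spinor.traj p (\<zeta> t)) has_vector_derivative w *\<^sub>R spinor.field (spinor.traj p (\<zeta> t))) (at t)"
    by (rule spinor.traj_derivative_compose[OF assms])
  from bounded_linear.has_vector_derivative[OF bounded_linear_fst this]
  have "((\<lambda>t. spinor_x p (\<zeta> t) - 1) has_real_derivative w * fst (spinor.field (spinor.traj p (\<zeta> t)))) (at t)"
    by (simp add: has_real_derivative_iff_has_vector_derivative spinor_x_def spinor_N_def)
  from DERIV_add[OF this DERIV_const[of 1]]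
  show "((\<lambda>t. spinor_x p (\<zeta> t)) has_real_derivative w * (spinor_x p (\<zeta> t) * (spinor_x p (\<zeta> t) - 1) * (2 - spinor_y p (\<zeta> t)) / 2)) (at t)"
    unfolding spinor_traj[OF assms(1,2)] by (simp add: spinor.field_def spinor_field_def field_simps)
  from bounded_linear.has_vector_derivative[OF bounded_linear_fst bounded_linear.has_vector_derivative[OF bounded_linear_snd d]]
  have "((\<lambda>t. spinor_y p (\<zeta> t)) has_real_derivative w * fst (snd (spinor.field (spinor.traj p (\<zeta> t))))) (at t)"
    by (simp add: has_real_derivative_iff_has_vector_derivative spinor_y_def spinor_Q_def)
  from DERIV_cong[OF this]
  show "((\<lambda>t. spinor_y p (\<zeta> t)) has_real_derivative w * (spinor_y p (\<zeta> t) * (4 - 2 * spinor_x p (\<zeta> t) - 4 * spinor_y p (\<zeta> t) - spinor_x p (\<zeta> t) * spinor_y p (\<zeta> t)) / 2)) (at t)"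
    unfolding spinor_traj[OF assms(1,2)] by (simp add: spinor.field_def spinor_field_def field_simps)
qed

definition spinor_g :: "vec3 \<Rightarrow> real" where "spinor_g D = (1 - fst D - fst (snd D)) / 2"
definition spinor_lam :: "vec3 \<Rightarrow> real" where "spinor_lam D = spinor_Lam (1 + fst D) (fst (snd D)) / 3"

lemma spinor_size_derivative:
  assumes "p \<in> P2" "z > 0"
  shows "((\<lambda>z. spinor_size (p, z)) has_real_derivative spinor_size (p, z) * spinor_g (spinor.traj p z) / z) (at z)"
proof -
  define r where "r = sqrt z"
  have r: "r > 0" "z = r\<^sup>2" using assms by (simp_all add: r_def)
  have s: "(sqrt has_real_derivative 1 / (2 * r)) (at z)"
    using assms by (auto intro!: derivative_eq_intros simp: r_def divide_simps)
  have "((\<lambda>z. sqrt z * spinor_alpha (p, z)) has_real_derivative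
      1 / (2 * r) * spinor_alpha (p, z) + spinor_alpha (p, z) * (- (spinor_N (p, z) + spinor_Q (p, z)) / 2) * sqrt z) (at z)"
    by (intro DERIV_mult s spinor_alpha_derivative assms)
  also have "1 / (2 * r) * spinor_alpha (p, z) + spinor_alpha (p, z) * (- (spinor_N (p, z) + spinor_Q (p, z)) / 2) * sqrt z
      = spinor_size (p, z) * spinor_g (spinor.traj p z) / z"
    unfolding spinor_size_def spinor_g_def r_def[symmetric] snd_conv
    using r by (simp add: spinor_N_def spinor_Q_def field_simps power2_eq_square)
  finally show ?thesis by (simp add: spinor_size_def)
qed

lemma spinor_size_pos: "z > 0 \<Longrightarrow> spinor_size (p, z) > 0"
  by (simp add: spinor_size_def spinor_alpha_pos)

interpretation spinor_fam: coh1_family spinor_field P2 spinor_solution spinor_g "\<lambda>_. 1" spinor_lam spinor_size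
  "\<lambda>q. (3 * spinor_Q q - spinor_N q + snd q * spinor_N q * spinor_Q q) / 3" "\<lambda>q. spinor_alpha (fst q, (snd q)\<^sup>2)"
proof
  show "\<And>p z. p \<in> P2 \<Longrightarrow> 0 < z \<Longrightarrow> ((\<lambda>z. spinor_size (p, z)) has_real_derivative spinor_size (p, z) * spinor_g (spinor.traj p z) / z) (at z)"
    by (rule spinor_size_derivative)
  show "\<And>p z. p \<in> P2 \<Longrightarrow> 0 < z \<Longrightarrow> 0 < spinor_size (p, z)" by (rule spinor_size_pos)
  show "continuous_on (P2 \<times> {0..}) (\<lambda>q. spinor_alpha (fst q, (snd q)\<^sup>2))"
    by (rule continuous_on_compose2[OF spinor_alpha_cont]) (auto intro!: continuous_intros)
  show "\<And>p r. p \<in> P2 \<Longrightarrow> 0 \<le> r \<Longrightarrow> 0 < spinor_alpha (fst (p, r), (snd (p, r))\<^sup>2)" by (rule spinor_alpha_pos)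
  show "\<And>p r. p \<in> P2 \<Longrightarrow> 0 < r \<Longrightarrow> spinor_alpha (fst (p, r), (snd (p, r))\<^sup>2) = spinor_size (p, r\<^sup>2) * 1 / r"
    by (simp add: spinor_size_def)
  show "continuous_on (P2 \<times> {0..}) (\<lambda>q. (3 * spinor_Q q - spinor_N q + snd q * spinor_N q * spinor_Q q) / 3)"
    by (intro continuous_intros) auto
  show "\<And>p z. p \<in> P2 \<Longrightarrow> 0 < z \<Longrightarrow> spinor_lam (spinor.traj p z) =
      1 + z * ((3 * spinor_Q (p, z) - spinor_N (p, z) + snd (p, z) * spinor_N (p, z) * spinor_Q (p, z)) / 3)"
    by (simp add: spinor_lam_def spinor_Lam_def spinor_N_def spinor_Q_def field_simps)
  show "\<exists>c>0. \<forall>z\<ge>1. c \<le> spinor_size (p, z) * 1" if p: "p \<in> P2" for p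
  proof (intro exI[of _ "spinor_size (p, 1)"] conjI allI impI)
    fix z :: real assume z: "1 \<le> z"
    show "spinor_size (p, 1) \<le> spinor_size (p, z) * 1"
      unfolding mult_1_right
    proof (rule DERIV_nonneg_imp_nondecreasing[OF z])
      fix w assume w: "1 \<le> w" "w \<le> z"
      have "spinor_g (spinor.traj p w) \<ge> 0"
        using spinor_xy_bounds[OF p, of w] spinor_traj[OF p, of w] w by (simp add: spinor_g_def)
      then have "spinor_size (p, w) * spinor_g (spinor.traj p w) / w \<ge> 0"
        using spinor_size_pos[of w p] w by simp
      with spinor_size_derivative[OF p, of w] w
      show "\<exists>y. ((\<lambda>z. spinor_size (p, z)) has_real_derivative y) (at w) \<and> 0 \<le> y" by auto
    qed
  qed (simp add: spinor_size_pos)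
qed auto

abbreviation "sx p t \<equiv> spinor_x p (spinor_fam.zeta p t)"
abbreviation "sy p t \<equiv> spinor_y p (spinor_fam.zeta p t)"
abbreviation "sa p t \<equiv> spinor_size (p, spinor_fam.zeta p t)"

definition spinor_gamma :: "vec3 \<Rightarrow> coh1_metric" where
  "spinor_gamma p = spinor_metric (sx p) (sy p) (sa p)"

lemma spinor_reduced_family:
  assumes p: "p \<in> P2"
  shows "spinor_reduced T (sx p) (sy p) (sa p)"
  unfolding spinor_reduced_def
proof (intro ballI conjI)
  fix t assume "t \<in> time_interval T"
  then have t: "t > 0" by (simp add: time_interval_def)
  note z = spinor_fam.zeta_pos[OF p t]
  note b = spinor_xy_bounds[OF p z]
  show "sa p t > 0" "sx p t > 0" "sy p t > 0" using b spinor_size_pos[OF z] by auto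
  have r: "spinor_fam.rate p t = 2 / sa p t" by (simp add: spinor_fam.rate_def)
  note d = spinor_xy_derivatives[OF p z spinor_fam.zeta_derivative[OF p t]]
  show "(sx p has_real_derivative sx p t * (sx p t - 1) * (2 - sy p t) / sa p t) (at t)"
    by (rule DERIV_cong[OF d(1)]) (simp add: r)
  show "(sy p has_real_derivative sy p t * (4 - 2 * sx p t - 4 * sy p t - sx p t * sy p t) / sa p t) (at t)"
    by (rule DERIV_cong[OF d(2)]) (simp add: r)
  show "(sa p has_real_derivative 2 - sx p t - sy p t) (at t)"
    by (rule DERIV_cong[OF spinor_fam.size_t_derivative[OF p t]])
      (use spinor_size_pos[OF z, of p] in \<open>simp add: r spinor_g_def spinor_traj[OF p z]\<close>)
qed

lemma spinor_gamma_spin7: "p \<in> P2 \<Longrightarrow> spin7_metric 1 T (spinor_gamma p)"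
  unfolding spinor_gamma_def by (rule spinor_metric_spin7[OF spinor_reduced_family])

text \<open>At the singular orbit \<open>a / sqrt y\<close> is a quotient of two vanishing
  quantities. Cancelling \<open>sqrt z\<close> turns it into \<open>alpha / sqrt Q\<close>, so this
  form of the jet is continuous up to \<open>t = 0\<close>.\<close>

definition spinor_jet :: "vec3 \<Rightarrow> real \<Rightarrow> real \<times> real \<times> real \<times> real \<times> real \<times> real \<times> real \<times> real" where
  "spinor_jet p t =
    (let z = spinor_fam.zeta p t; x = spinor_x p z; y = spinor_y p z; b = spinor_alpha (p, z) / sqrt (spinor_Q (p, z)) in
      (spinor_size (p, z), b, b, 3 * x * spinor_size (p, z),
       2 - x - y, sqrt y * (1 + x / 2), sqrt y * (1 + x / 2), 3 * x\<^sup>2 * (1 - y)))"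

lemma spinor_gamma_jet:
  assumes p: "p \<in> P2" and t: "t > 0"
  shows "jet1 (spinor_gamma p) t = spinor_jet p t"
proof -
  have "t \<in> time_interval \<infinity>" using t by (simp add: time_interval_def)
  note d = spinor_metric_derivatives[OF spinor_reduced_family[OF p] this, THEN DERIV_imp_deriv]
  have "sa p t / sqrt (sy p t) = spinor_alpha (p, spinor_fam.zeta p t) / sqrt (spinor_Q (p, spinor_fam.zeta p t))"
    using spinor_fam.zeta_pos[OF p t] by (simp add: spinor_size_def spinor_y_def real_sqrt_mult)
  then show ?thesis
    unfolding spinor_gamma_def spinor_metric_def jet1.simps d by (simp add: spinor_jet_def Let_def)
qed

lemma spinor_Q_pos: "p \<in> P2 \<Longrightarrow> z \<ge> 0 \<Longrightarrow> spinor_Q (p, z) > 0"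
  using spinor_xy_bounds(5)[of p z] spinor.Y_0[of p] by (cases "z = 0") (auto simp: spinor_Q_def elim!: P2E)

lemma spinor_zeta_cont: "continuous_on (P2 \<times> {0..}) (\<lambda>q. spinor_fam.zeta (fst q) (snd q))"
  using continuous_on_power[OF spinor_fam.\<sigma>_cont, of 2]
  unfolding spinor_fam.zeta_def prod.collapse .

lemma spinor_jet_cont: "continuous_on (P2 \<times> {0..}) (\<lambda>q. spinor_jet (fst q) (snd q))"
proof -
  note [continuous_intros] = spinor_zeta_cont
  have nonneg: "0 \<le> spinor_fam.zeta p t" for p t by (simp add: spinor_fam.zeta_def)
  have alpha: "continuous_on (P2 \<times> {0..}) (\<lambda>q. spinor_alpha (fst q, spinor_fam.zeta (fst q) (snd q)))"
    by (rule continuous_on_compose2[OF spinor_alpha_cont])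
      (auto intro!: continuous_intros nonneg)
  have Q: "spinor_Q (fst q, spinor_fam.zeta (fst q) (snd q)) \<noteq> 0" if "q \<in> P2 \<times> {0..}" for q
    using spinor_Q_pos[of "fst q" "spinor_fam.zeta (fst q) (snd q)"] that by (auto simp: spinor_fam.zeta_def)
  show ?thesis
    unfolding spinor_jet_def Let_def spinor_size_def spinor_x_def spinor_y_def snd_conv
    using Q by (intro continuous_intros alpha) auto
qed

lemma spinor_jet_0:
  assumes p: "p \<in> P2"
  shows "spinor_jet p 0 = (0, 1 / sqrt (fst (snd p)), 1 / sqrt (fst (snd p)), 0, 1, 0, 0, 3)"
proof -
  have z0: "spinor_fam.zeta p 0 = 0" by (simp add: spinor_fam.zeta_def spinor_fam.\<sigma>_0[OF p])
  have a0: "spinor_alpha (p, 0) = 1" by (simp add: spinor_alpha_def)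
  have Q0: "spinor_Q (p, 0) = fst (snd p)" by (simp add: spinor_Q_def spinor.Y_0[OF p])
  show ?thesis
    by (simp add: spinor_jet_def Let_def z0 a0 Q0 spinor_size_def spinor_x_def spinor_y_def)
qed

lemma jet_at_singular_orbit:
  assumes J: "continuous_on (P \<times> {0..}) (\<lambda>q. J (fst q) (snd q))" and p: "p \<in> P"
    and jet: "\<And>t. t > 0 \<Longrightarrow> jet1 g t = J p t"
  shows "(jet1 g \<longlongrightarrow> J p 0) (at_right 0)" "t \<ge> 0 \<Longrightarrow> extended_jet1 g t = J p t"
proof -
  have "continuous_on {0..} (\<lambda>t. J p t)"
    by (rule continuous_on_compose2[OF J, of "{0..}" "\<lambda>t. (p, t)", unfolded fst_conv snd_conv])
      (use p in \<open>auto intro!: continuous_intros\<close>)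
  then have "(J p \<longlongrightarrow> J p 0) (at 0 within {0..})" by (simp add: continuous_on_def)
  then have "(J p \<longlongrightarrow> J p 0) (at_right 0)" by (rule tendsto_within_subset) auto
  moreover have "\<forall>\<^sub>F t in at_right 0. J p t = jet1 g t"
    using eventually_at_right_less[of "0::real"] by eventually_elim (simp add: jet)
  ultimately show *: "(jet1 g \<longlongrightarrow> J p 0) (at_right 0)" by (rule Lim_transform_eventually)
  show "t \<ge> 0 \<Longrightarrow> extended_jet1 g t = J p t"
    using tendsto_Lim[OF _ *] jet by (auto simp: extended_jet1_def)
qed

lemmas spinor_singular_orbit = jet_at_singular_orbit[where J = spinor_jet, OF spinor_jet_cont _ spinor_gamma_jet]

lemma spinor_closes_up:
  assumes p: "p \<in> P2"
  shows "closes_up_on_M 2 (spinor_gamma p)"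
proof -
  have "fst (snd p) > 0" by (rule P2E[OF p]) simp
  then show ?thesis unfolding closes_up_on_M_def
    using spinor_singular_orbit(1)[OF p p] spinor_jet_0[OF p]
    by (intro exI[of _ "1 / sqrt (fst (snd p))"]) simp
qed

context expansion_scale
begin

lemma spinor_XZ_expands:
  assumes x: "expands x 1 n" and y: "expands y 0 q"
  defines "\<Lambda> \<equiv> \<lambda>t. spinor_Lam (x t) (y t)"
  shows "expands (\<lambda>t. (2 - x t - y t) / \<Lambda> t) (1/3) (- 2/9 * n - 2/3 * q)"
    "expands (\<lambda>t. (y t * (1 + x t / 2)) / \<Lambda> t) 0 (q / 2)"
    "expands (\<lambda>t. (x t * (1 - y t)) / \<Lambda> t) (1/3) (4/9 * n - 2/3 * q)"
    "expands (\<lambda>t. y t / \<Lambda> t) 0 (q / 3)"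
    "expands (\<lambda>t. 1 / \<Lambda> t) (1/3) (n / 9 - q / 3)"
    "expands (\<lambda>t. 3 * x t * \<Lambda> t) 9 (6 * n + 9 * q)"
    "expands \<Lambda> 3 (3 * q - n)"
proof -
  have L: "expands \<Lambda> 3 (3 * q - n)"
    unfolding \<Lambda>_def spinor_Lam_def
    by (rule expands_eq) (rule expands_add expands_diff expands_mult expands_const x y | simp)+
  then show "expands \<Lambda> 3 (3 * q - n)" .
  show "expands (\<lambda>t. (2 - x t - y t) / \<Lambda> t) (1/3) (- 2/9 * n - 2/3 * q)"
    "expands (\<lambda>t. (y t * (1 + x t / 2)) / \<Lambda> t) 0 (q / 2)"
    "expands (\<lambda>t. (x t * (1 - y t)) / \<Lambda> t) (1/3) (4/9 * n - 2/3 * q)"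
    "expands (\<lambda>t. y t / \<Lambda> t) 0 (q / 3)"
    "expands (\<lambda>t. 1 / \<Lambda> t) (1/3) (n / 9 - q / 3)"
    "expands (\<lambda>t. 3 * x t * \<Lambda> t) 9 (6 * n + 9 * q)"
    by (rule expands_eq, (rule expands_divide expands_add expands_diff expands_mult expands_const x y L | simp; fail)+, (simp_all add: field_simps; fail)?)+
qed

end

text \<open>The expansion holds with \<open>\<delta> = 2/3\<close>, because the terms after the
  linear one are of order \<open>z^2\<close>.\<close>

lemma (in coh1_family) gamma_expansionI:
  assumes p: "p \<in> P"
    and XZ: "\<And>t. t > 0 \<Longrightarrow> XZ h t = (X1 t, X2 t, X3 t, X4 t, X5 t, X6 t, X7 t, X8 t)"
    and tr: "\<And>t. t > 0 \<Longrightarrow> trL h t = 3 / 2 * rate p t * lam (traj p (zeta p t))"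
    and P0: "P0 i = (c1, c2, c3, c4, c5, c6, c7, c8)"
    and lin: "fst s *\<^sub>R v1 i + snd s *\<^sub>R v2 i = (l1, l2, l3, l4, l5, l6, l7, l8)"
  defines "z \<equiv> \<lambda>t. exp (2 / 3 * eta p t)" and "r \<equiv> \<lambda>t. exp ((2 / 3 + 2 / 3) * eta p t)"
  assumes E: "expansion_scale.expands (at_right 0) z r X1 c1 l1" "expansion_scale.expands (at_right 0) z r X2 c2 l2"
    "expansion_scale.expands (at_right 0) z r X3 c3 l3" "expansion_scale.expands (at_right 0) z r X4 c4 l4"
    "expansion_scale.expands (at_right 0) z r X5 c5 l5" "expansion_scale.expands (at_right 0) z r X6 c6 l6"
    "expansion_scale.expands (at_right 0) z r X7 c7 l7" "expansion_scale.expands (at_right 0) z r X8 c8 l8"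
  shows "gamma_expansion i s \<infinity> h"
proof -
  interpret es: expansion_scale "at_right 0" z r
    unfolding z_def r_def by (rule expansion_scale_eta[OF p])
  have "(\<lambda>t. norm (XZ h t - (P0 i + z t *\<^sub>R (fst s *\<^sub>R v1 i + snd s *\<^sub>R v2 i)))) \<in> O[at_right 0](r)"
  proof (subst landau_o.big.in_cong)
    show "\<forall>\<^sub>F t in at_right 0. norm (XZ h t - (P0 i + z t *\<^sub>R (fst s *\<^sub>R v1 i + snd s *\<^sub>R v2 i))) =
      norm ((X1 t, X2 t, X3 t, X4 t, X5 t, X6 t, X7 t, X8 t) - (P0 i + z t *\<^sub>R (fst s *\<^sub>R v1 i + snd s *\<^sub>R v2 i)))"
      using eventually_at_right_less[of "0::real"] by eventually_elim (simp only: XZ)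
    show "(\<lambda>t. norm ((X1 t, X2 t, X3 t, X4 t, X5 t, X6 t, X7 t, X8 t) - (P0 i + z t *\<^sub>R (fst s *\<^sub>R v1 i + snd s *\<^sub>R v2 i))))
      \<in> O[at_right 0](r)"
      unfolding lin P0 norm_expansion_iff by (intro conjI E[unfolded es.expands_def])
  qed
  moreover have "(eta p has_real_derivative trL h t) (at t)" if "t \<in> time_interval \<infinity>" for t
  proof -
    have t: "t > 0" using that by (simp add: time_interval_def)
    show ?thesis by (rule DERIV_cong[OF eta_derivative[OF p t] tr[OF t, symmetric]])
  qed
  ultimately show ?thesis
    unfolding gamma_expansion_def z_def r_def
    by (intro exI[of _ "eta p"] exI[of _ "2/3"] conjI ballI eta_at_bot[OF p]) auto
qed

lemma spinor_gamma_expansion: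
  assumes s: "s \<in> parameters 2"
  shows "gamma_expansion 2 s \<infinity> (spinor_gamma (spinor_params s))"
proof -
  define p where "p = spinor_params s"
  have p: "p \<in> P2" using s by (simp add: p_def)
  interpret es: expansion_scale "at_right 0" "\<lambda>t. exp (2 / 3 * spinor_fam.eta p t)" "\<lambda>t. exp ((2 / 3 + 2 / 3) * spinor_fam.eta p t)"
    by (rule spinor_fam.expansion_scale_eta[OF p])
  have zpos: "\<forall>\<^sub>F t in at_right 0. spinor_fam.zeta p t > 0"
    using eventually_at_right_less[of "0::real"] by eventually_elim (rule spinor_fam.zeta_pos[OF p])
  note tr = spinor_fam.expands_traj[OF p es.expansion_scale_axioms spinor_fam.expands_zeta[OF p] zpos]
  define n where "n = fst p"
  define q where "q = fst (snd p)"
  have "es.expands (\<lambda>t. 1 + fst (spinor.traj p (spinor_fam.zeta p t))) (1 + 0) (0 + n)"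
    unfolding n_def by (rule es.expands_add[OF es.expands_const tr(1)])
  then have x: "es.expands (sx p) 1 n" by (simp add: spinor_x_def spinor_N_def)
  have y: "es.expands (sy p) 0 q" using tr(2) by (simp add: spinor_y_def spinor_Q_def q_def)
  note E = es.spinor_XZ_expands[OF x y]
  have t_in: "t \<in> time_interval \<infinity>" if "t > 0" for t using that by (simp add: time_interval_def)
  have Lam_pos: "spinor_Lam (sx p t) (sy p t) > 0" if t: "t > 0" for t
  proof -
    note b = spinor_xy_bounds[OF p spinor_fam.zeta_pos[OF p t]]
    have "sx p t * sy p t > 0" using b by simp
    then show ?thesis using b unfolding spinor_Lam_def by linarith
  qed
  have nq: "n = - 9 * fst s - 27 * snd s" "q = 18 * snd s" by (simp_all add: n_def q_def p_def spinor_params_def)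
  show ?thesis
    unfolding p_def[symmetric]
  proof (rule spinor_fam.gamma_expansionI[OF p _ _ _ _ E(1,2,2,3,4,5,5,6)])
    fix t :: real assume t: "t > 0"
    let ?L = "spinor_Lam (sx p t) (sy p t)"
    show "XZ (spinor_gamma p) t = ((2 - sx p t - sy p t) / ?L, (sy p t * (1 + sx p t / 2)) / ?L,
       (sy p t * (1 + sx p t / 2)) / ?L, (sx p t * (1 - sy p t)) / ?L, sy p t / ?L, 1 / ?L, 1 / ?L, 3 * sx p t * ?L)"
      unfolding spinor_gamma_def
      by (rule spinor_metric_XZ[OF spinor_reduced_family[OF p] t_in[OF t]]) (use Lam_pos[OF t] in simp)
    show "trL (spinor_gamma p) t = 3 / 2 * spinor_fam.rate p t * spinor_lam (spinor.traj p (spinor_fam.zeta p t))"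
      using spinor_metric_trL[OF spinor_reduced_family[OF p] t_in[OF t]]
      unfolding spinor_traj[OF p spinor_fam.zeta_pos[OF p t]] spinor_lam_def spinor_fam.rate_def spinor_gamma_def by simp
  next
    show "P0 2 = (1/3, 0, 0, 1/3, 0, 1/3, 1/3, 9)" by (simp add: P0_def)
    show "fst s *\<^sub>R v1 2 + snd s *\<^sub>R v2 2 =
      (- 2/9 * n - 2/3 * q, q / 2, q / 2, 4/9 * n - 2/3 * q, q / 3, n / 9 - q / 3, n / 9 - q / 3, 6 * n + 9 * q)"
      by (simp add: v1_def v2_def nq algebra_simps)
  qed
qed

section \<open>Asymptotics on \<open>M\<^sup>(\<^sup>2\<^sup>)\<close>\<close>

lemma (in coh1_family) tendsto_zeta:
  assumes "p \<in> P" "((\<lambda>s. F (exp s)) \<longlongrightarrow> L) at_top"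
  shows "((\<lambda>t. F (zeta p t)) \<longlongrightarrow> L) at_top"
proof -
  have "((\<lambda>t. F (exp (ln (zeta p t)))) \<longlongrightarrow> L) at_top"
    by (rule filterlim_compose[OF assms(2) zeta_at_top[OF assms(1)]])
  moreover have "\<forall>\<^sub>F t in at_top. F (exp (ln (zeta p t))) = F (zeta p t)"
    using eventually_gt_at_top[of 0] by eventually_elim (simp add: zeta_pos[OF assms(1)])
  ultimately show ?thesis by (rule Lim_transform_eventually)
qed

lemma spinor_exp_derivatives:
  assumes p: "p \<in> P2"
  shows "((\<lambda>s. spinor_x p (exp s)) has_real_derivative spinor_x p (exp s) * (spinor_x p (exp s) - 1) * (2 - spinor_y p (exp s)) / 2) (at s)"
    "((\<lambda>s. spinor_y p (exp s)) has_real_derivative spinor_y p (exp s) * (4 - 2 * spinor_x p (exp s) - 4 * spinor_y p (exp s) - spinor_x p (exp s) * spinor_y p (exp s)) / 2) (at s)"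
    "((\<lambda>s. spinor_size (p, exp s)) has_real_derivative spinor_size (p, exp s) * (2 - spinor_x p (exp s) - spinor_y p (exp s)) / 2) (at s)"
proof -
  have e: "(exp has_real_derivative exp s * 1) (at s)" by (auto intro!: derivative_eq_intros)
  show "((\<lambda>s. spinor_x p (exp s)) has_real_derivative spinor_x p (exp s) * (spinor_x p (exp s) - 1) * (2 - spinor_y p (exp s)) / 2) (at s)"
    "((\<lambda>s. spinor_y p (exp s)) has_real_derivative spinor_y p (exp s) * (4 - 2 * spinor_x p (exp s) - 4 * spinor_y p (exp s) - spinor_x p (exp s) * spinor_y p (exp s)) / 2) (at s)"
    using spinor_xy_derivatives[OF p _ e] by simp_all
  have "((\<lambda>s. spinor_size (p, exp s)) has_real_derivative spinor_size (p, exp s) * spinor_g (spinor.traj p (exp s)) / exp s * (exp s * 1)) (at s)"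
    by (rule DERIV_chain2[where f = "\<lambda>z. spinor_size (p, z)", OF spinor_size_derivative[OF p exp_gt_zero] e])
  then show "((\<lambda>s. spinor_size (p, exp s)) has_real_derivative spinor_size (p, exp s) * (2 - spinor_x p (exp s) - spinor_y p (exp s)) / 2) (at s)"
    unfolding spinor_traj[OF p exp_gt_zero] by (simp add: spinor_g_def)
qed

text \<open>As \<open>x \<le> 1\<close>, the factor \<open>4 - 2x - 4y - xy\<close> is at least
  \<open>2 - 5y\<close>, hence at least \<open>2 - 8y\<close>, which is the form of the logistic
  barrier.\<close>

lemma spinor_y_lower:
  assumes p: "p \<in> P2"
  obtains k where "k > 0" "\<And>s. s \<ge> 0 \<Longrightarrow> k \<le> spinor_y p (exp s)"
proof -
  note b = spinor_xy_bounds[OF p exp_gt_zero]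
  have "min (spinor_y p (exp 0)) (1/4) \<le> spinor_y p (exp s)" if "s \<ge> 0" for s
  proof (rule logistic_lower_bound[where f = "\<lambda>s. spinor_y p (exp s)", OF spinor_exp_derivatives(2)[OF p] _ _ that])
    fix s
    define x y where "x = spinor_x p (exp s)" and "y = spinor_y p (exp s)"
    have xy: "0 < y" "x \<le> 1" using b[of s] by (auto simp: x_def y_def)
    have "x * y \<le> 1 * y" using xy by (intro mult_right_mono) auto
    then have "2 - 8 * y \<le> 4 - 2 * x - 4 * y - x * y" using xy by linarith
    from mult_left_mono[OF this less_imp_le[OF xy(1)]]
    have "y * (2 - 8 * y) / 2 \<le> y * (4 - 2 * x - 4 * y - x * y) / 2" by (rule divide_right_mono) simp
    moreover have "y * (1 - 4 * y) = y * (2 - 8 * y) / 2" by (simp add: field_simps)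
    ultimately
    show "spinor_y p (exp s) * (1 - 4 * spinor_y p (exp s)) \<le>
      spinor_y p (exp s) * (4 - 2 * spinor_x p (exp s) - 4 * spinor_y p (exp s) - spinor_x p (exp s) * spinor_y p (exp s)) / 2"
      unfolding x_def[symmetric] y_def[symmetric] by (simp only:)
  qed (use b in \<open>auto intro: less_imp_le\<close>)
  moreover have "min (spinor_y p (exp 0)) (1/4) > 0" using b(3)[of 0] by simp
  ultimately show thesis by (rule that[rotated])
qed

text \<open>\<open>x\<close> is nonincreasing, so it stays below its value \<open>x0 < 1\<close> at
  \<open>z = 1\<close>. Then \<open>(1 - x)(2 - y) \<ge> 1 - x0\<close>, and \<open>x\<close> decays
  exponentially in \<open>ln z\<close>.\<close>

lemma spinor_x_limit:
  assumes p: "p \<in> P2" and neg: "fst p < 0"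
  obtains k where "k > 0" "\<And>s. s \<ge> 0 \<Longrightarrow> spinor_x p (exp s) * (spinor_x p (exp s) - 1) * (2 - spinor_y p (exp s)) / 2 \<le> - k * spinor_x p (exp s)"
    "((\<lambda>s. spinor_x p (exp s)) \<longlongrightarrow> 0) at_top"
proof -
  note b = spinor_xy_bounds[OF p exp_gt_zero]
  note d = spinor_exp_derivatives[OF p]
  define x0 where "x0 = spinor_x p 1"
  have x0: "x0 < 1" using b(6)[of 0] neg by (simp add: x0_def)
  have mono: "spinor_x p (exp s) \<le> x0" if "s \<ge> 0" for s
  proof -
    have "(\<lambda>s. spinor_x p (exp s)) s \<le> (\<lambda>s. spinor_x p (exp s)) 0"
    proof (rule DERIV_nonpos_imp_nonincreasing[OF that])
      fix r
      have "spinor_x p (exp r) * (spinor_x p (exp r) - 1) \<le> 0" using b[of r] by (intro mult_nonneg_nonpos) auto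
      then have "spinor_x p (exp r) * (spinor_x p (exp r) - 1) * (2 - spinor_y p (exp r)) \<le> 0"
        by (rule mult_nonpos_nonneg) (use b(4)[of r] in linarith)
      then show "\<exists>y. ((\<lambda>s. spinor_x p (exp s)) has_real_derivative y) (at r) \<and> y \<le> 0"
        using d(1)[of r] by (intro exI[of _ "spinor_x p (exp r) * (spinor_x p (exp r) - 1) * (2 - spinor_y p (exp r)) / 2"]) simp
    qed
    then show ?thesis by (simp add: x0_def)
  qed
  define k where "k = (1 - x0) / 2"
  have k: "k > 0" using x0 by (simp add: k_def)
  have le: "spinor_x p (exp s) * (spinor_x p (exp s) - 1) * (2 - spinor_y p (exp s)) / 2 \<le> - k * spinor_x p (exp s)" if s: "s \<ge> 0" for s
  proof -
    define x y where "x = spinor_x p (exp s)" and "y = spinor_y p (exp s)"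
    have xy: "0 < x" "x \<le> x0" "y < 1" using b[of s] mono[OF s] by (auto simp: x_def y_def)
    have "(1 - x0) * 1 \<le> (1 - x) * (2 - y)" using xy x0 by (intro mult_mono) auto
    then have "x * (2 * k) \<le> x * ((1 - x) * (2 - y))" using xy by (intro mult_left_mono) (auto simp: k_def)
    then show ?thesis unfolding x_def[symmetric] y_def[symmetric] by (simp add: algebra_simps)
  qed
  moreover have "((\<lambda>s. spinor_x p (exp s)) \<longlongrightarrow> 0) at_top"
    by (rule relaxation_tendsto_0[where e = "\<lambda>_. 0" and ?t0.0 = 0, OF d(1) _ k]) (use le b in \<open>auto intro: less_imp_le\<close>)
  ultimately show thesis using k by (intro that)
qed

text \<open>For \<open>x = 0\<close> the equation is \<open>y' = 2 y (1 - y)\<close>. The lower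
  bound \<open>k\<close> on \<open>y\<close> gives \<open>1 - y\<close> the relaxation rate
  \<open>2 k\<close>, and the terms with \<open>x\<close> form an error tending to 0.\<close>

lemma spinor_y_limit_ALC:
  assumes p: "p \<in> P2" and neg: "fst p < 0"
  shows "((\<lambda>s. spinor_y p (exp s)) \<longlongrightarrow> 1) at_top"
proof -
  note b = spinor_xy_bounds[OF p exp_gt_zero]
  note d = spinor_exp_derivatives[OF p]
  obtain k where k: "k > 0" "\<And>s. s \<ge> 0 \<Longrightarrow> k \<le> spinor_y p (exp s)" by (rule spinor_y_lower[OF p]) blast
  have x0: "((\<lambda>s. spinor_x p (exp s)) \<longlongrightarrow> 0) at_top" by (rule spinor_x_limit[OF p neg]) blast
  have "((\<lambda>s. 1 - spinor_y p (exp s)) \<longlongrightarrow> 0) at_top"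
  proof (rule relaxation_tendsto_0[where e = "\<lambda>s. 3 / 2 * spinor_x p (exp s)" and ?t0.0 = 0 and k = "2 * k"])
    fix s :: real assume s: "s \<ge> 0"
    define x y where "x = spinor_x p (exp s)" and "y = spinor_y p (exp s)"
    show "((\<lambda>s. 1 - spinor_y p (exp s)) has_real_derivative 0 - y * (4 - 2 * x - 4 * y - x * y) / 2) (at s)"
      unfolding x_def y_def by (intro DERIV_diff d DERIV_const)
    have xy: "0 < x" "0 < y" "y < 1" "k \<le> y" using b[of s] k(2)[OF s] by (auto simp: x_def y_def)
    have "k * (2 * (1 - y)) \<le> y * (2 * (1 - y))" using xy by (intro mult_right_mono) auto
    moreover have "y * (2 * x + x * y) \<le> 1 * (2 * x + x * 1)" using xy by (intro mult_mono add_mono) auto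
    moreover have "0 - y * (4 - 2 * x - 4 * y - x * y) / 2 = - (y * (2 * (1 - y))) + y * (2 * x + x * y) / 2" by (simp add: field_simps)
    ultimately show "0 - y * (4 - 2 * x - 4 * y - x * y) / 2 \<le> - (2 * k) * (1 - spinor_y p (exp s)) + 3 / 2 * spinor_x p (exp s)"
    proof -
      assume *: "k * (2 * (1 - y)) \<le> y * (2 * (1 - y))" "y * (2 * x + x * y) \<le> 1 * (2 * x + x * 1)"
        "0 - y * (4 - 2 * x - 4 * y - x * y) / 2 = - (y * (2 * (1 - y))) + y * (2 * x + x * y) / 2"
      have "- (2 * k) * (1 - y) = - (k * (2 * (1 - y)))" by simp
      moreover have "y * (2 * x + x * y) / 2 \<le> 3 / 2 * x" using *(2) by simp
      then have "- (y * (2 * (1 - y))) + y * (2 * x + x * y) / 2 \<le> - (k * (2 * (1 - y))) + 3 / 2 * x"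
        by (rule add_mono[OF le_imp_neg_le[OF *(1)]])
      ultimately show ?thesis unfolding x_def[symmetric] y_def[symmetric] *(3) by (simp only:)
    qed
    show "0 \<le> 1 - spinor_y p (exp s)" using xy by (simp add: y_def)
  next
    show "((\<lambda>s. 3 / 2 * spinor_x p (exp s)) \<longlongrightarrow> 0) at_top" by (rule tendsto_mult_right_zero[OF x0])
  qed (use k in auto)
  from tendsto_diff[OF tendsto_const[of 1] this] show ?thesis by simp
qed

text \<open>\<open>F\<close>, the logarithm of \<open>f/3\<close>, has derivative
  \<open>x (1 - y)/2\<close>, which lies between 0 and \<open>x/2\<close>. Since
  \<open>x' \<le> - k x\<close>, the sum \<open>F + x/(2k)\<close> is nonincreasing; thus
  \<open>F\<close> is increasing and bounded.\<close>

lemma spinor_f_limit: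
  assumes p: "p \<in> P2" and neg: "fst p < 0"
  shows "\<exists>l>0. ((\<lambda>s. 3 * spinor_x p (exp s) * spinor_size (p, exp s)) \<longlongrightarrow> l) at_top"
proof -
  note b = spinor_xy_bounds[OF p exp_gt_zero]
  note d = spinor_exp_derivatives[OF p]
  obtain k where k: "k > 0" "\<And>s. s \<ge> 0 \<Longrightarrow> spinor_x p (exp s) * (spinor_x p (exp s) - 1) * (2 - spinor_y p (exp s)) / 2 \<le> - k * spinor_x p (exp s)"
    by (rule spinor_x_limit[OF p neg]) blast
  define F where "F s = ln (spinor_x p (exp s)) + ln (spinor_size (p, exp s))" for s
  have pos: "spinor_x p (exp s) > 0" "spinor_size (p, exp s) > 0" for s using b[of s] spinor_size_pos by auto
  have F: "(F has_real_derivative spinor_x p (exp s) * (1 - spinor_y p (exp s)) / 2) (at s)" for s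
    unfolding F_def using pos[of s]
    by (intro DERIV_cong[OF DERIV_add[OF DERIV_chain2[OF DERIV_ln_divide d(1)] DERIV_chain2[OF DERIV_ln_divide d(3)]]])
      (auto simp: field_simps)
  have mono: "F s \<le> F t" if "s \<le> t" for s t
    by (rule DERIV_nonneg_imp_nondecreasing[OF that]) (use F b in \<open>metis less_imp_le diff_ge_0_iff_ge mult_nonneg_nonneg divide_nonneg_pos zero_less_numeral\<close>)
  have bound: "F s \<le> F 0 + spinor_x p 1 / (2 * k)" if s: "s \<ge> 0" for s
  proof -
    have "(\<lambda>s. F s + spinor_x p (exp s) / (2 * k)) s \<le> (\<lambda>s. F s + spinor_x p (exp s) / (2 * k)) 0"
    proof (rule DERIV_nonpos_imp_nonincreasing[OF s])
      fix r assume r: "0 \<le> r" "r \<le> s"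
      define x y x' where "x = spinor_x p (exp r)" and "y = spinor_y p (exp r)" and "x' = x * (x - 1) * (2 - y) / 2"
      have "((\<lambda>s. F s + spinor_x p (exp s) / (2 * k)) has_real_derivative x * (1 - y) / 2 + x' / (2 * k)) (at r)"
        unfolding x_def y_def x'_def by (intro DERIV_add F DERIV_cdivide d)
      moreover have "x' / (2 * k) \<le> - k * x / (2 * k)"
        using k(1) k(2)[OF r(1)] unfolding x'_def x_def y_def by (intro divide_right_mono) auto
      then have "x' / (2 * k) \<le> - x / 2" using k(1) by simp
      moreover have "x * (1 - y) \<le> x * 1" using b[of r] unfolding x_def y_def by (intro mult_left_mono) auto
      ultimately show "\<exists>y. ((\<lambda>s. F s + spinor_x p (exp s) / (2 * k)) has_real_derivative y) (at r) \<and> y \<le> 0"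
        by (intro exI conjI) auto
    qed
    moreover have "spinor_x p (exp s) / (2 * k) \<ge> 0" using pos[of s] k(1) by simp
    ultimately show ?thesis by simp
  qed
  obtain L where "(F \<longlongrightarrow> L) at_top"
    using monotone_bounded_limit[of F, OF mono bound] by blast
  then have "((\<lambda>s. 3 * exp (F s)) \<longlongrightarrow> 3 * exp L) at_top" by (intro tendsto_intros)
  moreover have "3 * exp (F s) = 3 * spinor_x p (exp s) * spinor_size (p, exp s)" for s
    using pos[of s] by (simp add: F_def exp_add)
  ultimately show ?thesis by (intro exI[of _ "3 * exp L"]) simp
qed

lemma spinor_gamma_sq_length:
  assumes p: "p \<in> P2" and t: "t > 0"
  shows "k \<in> {1, 2} \<Longrightarrow> sq_length (spinor_gamma p) t k = (sa p t)\<^sup>2"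
    "k \<in> {3, 4, 5, 6} \<Longrightarrow> sq_length (spinor_gamma p) t k = (sa p t)\<^sup>2 / sy p t"
    "sq_length (spinor_gamma p) t 7 = (3 * sx p t * sa p t)\<^sup>2"
  using spinor_xy_bounds(3)[OF p spinor_fam.zeta_pos[OF p t]]
  by (auto simp: spinor_gamma_def spinor_metric_def power_divide)

lemma spinor_size_slope:
  assumes p: "p \<in> P2" and x: "((\<lambda>s. spinor_x p (exp s)) \<longlongrightarrow> X) at_top" and y: "((\<lambda>s. spinor_y p (exp s)) \<longlongrightarrow> Y) at_top"
  shows "((\<lambda>t. sa p t / t) \<longlongrightarrow> 2 - X - Y) at_top"
proof (rule derivative_limit_imp_slope_limit)
  fix t :: real assume "t > 0"
  then show "(sa p has_real_derivative 2 - sx p t - sy p t) (at t)"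
    using spinor_reduced_family[OF p, of \<infinity>] by (auto simp: spinor_reduced_def time_interval_def)
next
  show "((\<lambda>t. 2 - sx p t - sy p t) \<longlongrightarrow> 2 - X - Y) at_top"
    by (intro tendsto_intros spinor_fam.tendsto_zeta[OF p] x y)
qed

lemma spinor_asymptotics:
  assumes p: "p \<in> P2" and x: "((\<lambda>s. spinor_x p (exp s)) \<longlongrightarrow> X) at_top" and y: "((\<lambda>s. spinor_y p (exp s)) \<longlongrightarrow> Y) at_top"
    and Y: "Y > 0"
  shows "k \<in> {1, 2} \<Longrightarrow> ((\<lambda>t. sq_length (spinor_gamma p) t k / t\<^sup>2) \<longlongrightarrow> (2 - X - Y)\<^sup>2) at_top"
    "k \<in> {3, 4, 5, 6} \<Longrightarrow> ((\<lambda>t. sq_length (spinor_gamma p) t k / t\<^sup>2) \<longlongrightarrow> (2 - X - Y)\<^sup>2 / Y) at_top"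
    "((\<lambda>t. sq_length (spinor_gamma p) t 7 / t\<^sup>2) \<longlongrightarrow> (3 * X * (2 - X - Y))\<^sup>2) at_top"
proof -
  note a = spinor_size_slope[OF p x y]
  note zx = spinor_fam.tendsto_zeta[OF p x]
  note zy = spinor_fam.tendsto_zeta[OF p y]
  have ev: "\<forall>\<^sub>F t::real in at_top. t > 0" by (rule eventually_gt_at_top)
  note sq = spinor_gamma_sq_length[OF p]
  have "((\<lambda>t. (sa p t / t)\<^sup>2) \<longlongrightarrow> (2 - X - Y)\<^sup>2) at_top" by (intro tendsto_intros a)
  then show "((\<lambda>t. sq_length (spinor_gamma p) t k / t\<^sup>2) \<longlongrightarrow> (2 - X - Y)\<^sup>2) at_top" if "k \<in> {1, 2}"
    by (rule Lim_transform_eventually) (use ev in eventually_elim, use sq(1)[OF _ that] in \<open>simp add: power_divide\<close>)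
  have "((\<lambda>t. (sa p t / t)\<^sup>2 / sy p t) \<longlongrightarrow> (2 - X - Y)\<^sup>2 / Y) at_top" using Y by (intro tendsto_intros a zy) auto
  then show "((\<lambda>t. sq_length (spinor_gamma p) t k / t\<^sup>2) \<longlongrightarrow> (2 - X - Y)\<^sup>2 / Y) at_top" if "k \<in> {3, 4, 5, 6}"
    by (rule Lim_transform_eventually) (use ev in eventually_elim, use sq(2)[OF _ that] in \<open>simp add: power_divide\<close>)
  have "((\<lambda>t. (3 * sx p t * (sa p t / t))\<^sup>2) \<longlongrightarrow> (3 * X * (2 - X - Y))\<^sup>2) at_top" by (intro tendsto_intros a zx)
  then show "((\<lambda>t. sq_length (spinor_gamma p) t 7 / t\<^sup>2) \<longlongrightarrow> (3 * X * (2 - X - Y))\<^sup>2) at_top"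
    by (rule Lim_transform_eventually) (use ev in eventually_elim, simp add: sq(3) power_divide)
qed

lemma asymptotic_to_coneI:
  assumes "\<And>k. k \<in> {1..n} \<Longrightarrow> q k > 0" "\<And>k. k \<in> {1..n} \<Longrightarrow> ((\<lambda>t. sq_length g t k / t\<^sup>2) \<longlongrightarrow> q k) at_top"
  shows "asymptotic_to_cone n g q"
  unfolding asymptotic_to_cone_def
proof
  fix k assume k: "k \<in> {1..n}"
  have "((\<lambda>t. sq_length g t k / t\<^sup>2 / q k) \<longlongrightarrow> q k / q k) at_top"
    using assms(1)[OF k] by (intro tendsto_divide assms(2)[OF k] tendsto_const) simp
  then show "((\<lambda>t. sq_length g t k / (t\<^sup>2 * q k)) \<longlongrightarrow> 1) at_top" using assms(1)[OF k] by simp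
qed

lemma spinor_ALC:
  assumes p: "p \<in> P2" and neg: "fst p < 0"
  shows "asymptotic_to_cone 6 (spinor_gamma p) (\<lambda>_. 1)"
    "\<exists>l>0. ((\<lambda>t. sqrt (sq_length (spinor_gamma p) t 7)) \<longlongrightarrow> l) at_top"
proof -
  have x: "((\<lambda>s. spinor_x p (exp s)) \<longlongrightarrow> 0) at_top" by (rule spinor_x_limit[OF p neg]) blast
  note A = spinor_asymptotics[OF p x spinor_y_limit_ALC[OF p neg] zero_less_one]
  show "asymptotic_to_cone 6 (spinor_gamma p) (\<lambda>_. 1)"
  proof (rule asymptotic_to_coneI)
    fix k :: nat assume "k \<in> {1..6}"
    then have "k \<in> {1, 2} \<or> k \<in> {3, 4, 5, 6}" by auto
    then show "((\<lambda>t. sq_length (spinor_gamma p) t k / t\<^sup>2) \<longlongrightarrow> 1) at_top"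
      using A(1)[of k] A(2)[of k] by auto
  qed simp
  obtain l where l: "l > 0" "((\<lambda>s. 3 * spinor_x p (exp s) * spinor_size (p, exp s)) \<longlongrightarrow> l) at_top"
    using spinor_f_limit[OF p neg] by blast
  from spinor_fam.tendsto_zeta[OF p this(2)]
  have "((\<lambda>t. sqrt (sq_length (spinor_gamma p) t 7)) \<longlongrightarrow> l) at_top"
  proof (rule Lim_transform_eventually)
    show "\<forall>\<^sub>F t in at_top. 3 * sx p t * sa p t = sqrt (sq_length (spinor_gamma p) t 7)"
      using eventually_gt_at_top[of 0]
    proof eventually_elim
      case (elim t)
      have "3 * sx p t * sa p t > 0"
        using spinor_xy_bounds(1)[OF p spinor_fam.zeta_pos[OF p elim]] spinor_size_pos[OF spinor_fam.zeta_pos[OF p elim], of p] by simp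
      then show ?case unfolding spinor_gamma_sq_length(3)[OF p elim] by simp
    qed
  qed
  with l(1) show "\<exists>l>0. ((\<lambda>t. sqrt (sq_length (spinor_gamma p) t 7)) \<longlongrightarrow> l) at_top" by blast
qed

text \<open>On the invariant line \<open>x = 1\<close> the equation of \<open>y\<close> is
  \<open>y' = y (2 - 5 y)/2\<close>, so \<open>y\<close> tends to 2/5. The squared distance to 2/5
  decays because \<open>y\<close> is bounded away from 0.\<close>

lemma spinor_AC:
  assumes p: "p \<in> P2" and zero: "fst p = 0" and q: "q 1 = 9/25" "q 2 = 9/25" "\<And>k. k \<in> {3, 4, 5, 6} \<Longrightarrow> q k = 9/10" "q 7 = 81/25"
  shows "asymptotic_to_cone 7 (spinor_gamma p) q"
proof -
  note b = spinor_xy_bounds[OF p exp_gt_zero]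
  note d = spinor_exp_derivatives[OF p]
  have x1: "spinor_x p (exp s) = 1" for s using b(7)[of s] zero by simp
  have x: "((\<lambda>s. spinor_x p (exp s)) \<longlongrightarrow> 1) at_top" by (simp add: x1)
  obtain k where k: "k > 0" "\<And>s. s \<ge> 0 \<Longrightarrow> k \<le> spinor_y p (exp s)" by (rule spinor_y_lower[OF p]) blast
  have "((\<lambda>s. (spinor_y p (exp s) - 2/5)\<^sup>2) \<longlongrightarrow> 0) at_top"
  proof (rule relaxation_tendsto_0[where e = "\<lambda>_. 0" and ?t0.0 = 0 and k = "5 * k"])
    fix s :: real assume s: "s \<ge> 0"
    define y where "y = spinor_y p (exp s)"
    have "((\<lambda>s. spinor_y p (exp s)) has_real_derivative y * (4 - 2 * 1 - 4 * y - 1 * y) / 2) (at s)"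
      using d(2)[of s] unfolding x1 y_def by simp
    from DERIV_power[OF DERIV_diff[OF this DERIV_const[of "2/5"]], of 2]
    show "((\<lambda>s. (spinor_y p (exp s) - 2/5)\<^sup>2) has_real_derivative - 5 * y * (y - 2/5)\<^sup>2) (at s)"
      by (rule DERIV_cong) (simp add: y_def[symmetric] field_simps power2_eq_square)
    have "5 * k * (y - 2/5)\<^sup>2 \<le> 5 * y * (y - 2/5)\<^sup>2" using k(2)[OF s] by (intro mult_right_mono) (auto simp: y_def)
    then show "- 5 * y * (y - 2/5)\<^sup>2 \<le> - (5 * k) * (spinor_y p (exp s) - 2/5)\<^sup>2 + 0" by (simp add: y_def)
  qed (use k in auto)
  from tendsto_real_sqrt[OF this] have "((\<lambda>s. \<bar>spinor_y p (exp s) - 2/5\<bar>) \<longlongrightarrow> 0) at_top" by simp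
  then have "((\<lambda>s. spinor_y p (exp s) - 2/5) \<longlongrightarrow> 0) at_top" by (rule tendsto_rabs_zero_cancel)
  from tendsto_add[OF this tendsto_const[of "2/5"]] have y: "((\<lambda>s. spinor_y p (exp s)) \<longlongrightarrow> 2/5) at_top" by simp
  have "(0::real) < 2 / 5" by simp
  note A = spinor_asymptotics[OF p x y this]
  show ?thesis
  proof (rule asymptotic_to_coneI)
    fix k :: nat assume "k \<in> {1..7}"
    then have k: "k \<in> {1, 2} \<or> k \<in> {3, 4, 5, 6} \<or> k = 7" by auto
    then show "q k > 0" using q(1,2,4) q(3)[of k] by auto
    have v: "(2 - 1 - 2/5 :: real)\<^sup>2 = 9/25" "(9/25 :: real) / (2/5) = 9/10" "(3 * 1 * (2 - 1 - 2/5) :: real)\<^sup>2 = 81/25"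
      by (simp_all add: power2_eq_square)
    from k show "((\<lambda>t. sq_length (spinor_gamma p) t k / t\<^sup>2) \<longlongrightarrow> q k) at_top"
    proof (elim disjE)
      assume k: "k \<in> {1, 2}"
      then have "q k = 9/25" using q(1,2) by blast
      with A(1)[OF k] show ?thesis by (simp only: v)
    next
      assume k: "k \<in> {3, 4, 5, 6}"
      with A(2)[OF k] q(3)[OF k] show ?thesis by (simp only: v)
    next
      assume "k = 7"
      with A(3) q(4) show ?thesis by (simp only: v)
    qed
  qed
qed

section \<open>Uniqueness on \<open>M\<^sup>(\<^sup>2\<^sup>)\<close>\<close>

lemma spin7_metricD:
  assumes "spin7_metric \<epsilon> T (a, b, c, f)" "t \<in> time_interval T"
  shows "a t > 0" "b t > 0" "c t > 0" "f t > 0"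
    "(a has_real_derivative a t * (b t / (a t * c t) + c t / (a t * b t) - a t / (b t * c t) - \<epsilon> / 3 * (f t / (a t)\<^sup>2))) (at t)"
    "(b has_real_derivative b t * (c t / (a t * b t) + a t / (b t * c t) - b t / (a t * c t) + \<epsilon> / 6 * (f t / (b t)\<^sup>2))) (at t)"
    "(c has_real_derivative c t * (a t / (b t * c t) + b t / (a t * c t) - c t / (a t * b t) + \<epsilon> / 6 * (f t / (c t)\<^sup>2))) (at t)"
    "(f has_real_derivative f t * (\<epsilon> * (1/3 * (f t / (a t)\<^sup>2) - 1/6 * (f t / (b t)\<^sup>2) - 1/6 * (f t / (c t)\<^sup>2)))) (at t)"
proof -
  have *: "(g has_real_derivative g t * r) (at t)" if "g t > 0" "g differentiable at t" "deriv g t / g t = r" for g r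
    using that by (auto simp: DERIV_deriv_iff_real_differentiable[symmetric])
  show "a t > 0" "b t > 0" "c t > 0" "f t > 0" using assms by auto
  show "(a has_real_derivative a t * (b t / (a t * c t) + c t / (a t * b t) - a t / (b t * c t) - \<epsilon> / 3 * (f t / (a t)\<^sup>2))) (at t)"
    "(b has_real_derivative b t * (c t / (a t * b t) + a t / (b t * c t) - b t / (a t * c t) + \<epsilon> / 6 * (f t / (b t)\<^sup>2))) (at t)"
    "(c has_real_derivative c t * (a t / (b t * c t) + b t / (a t * c t) - c t / (a t * b t) + \<epsilon> / 6 * (f t / (c t)\<^sup>2))) (at t)"
    "(f has_real_derivative f t * (\<epsilon> * (1/3 * (f t / (a t)\<^sup>2) - 1/6 * (f t / (b t)\<^sup>2) - 1/6 * (f t / (c t)\<^sup>2)))) (at t)"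
    using assms by (auto intro!: *)
qed

lemma closes_up_2_limits:
  assumes "closes_up_on_M 2 (a, b, c, f)"
  obtains r where "r > 0" "(a \<longlongrightarrow> 0) (at_right 0)" "(b \<longlongrightarrow> r) (at_right 0)" "(c \<longlongrightarrow> r) (at_right 0)"
    "(f \<longlongrightarrow> 0) (at_right 0)" "(deriv f \<longlongrightarrow> 3) (at_right 0)"
proof -
  obtain r where r: "r > 0" "(jet1 (a, b, c, f) \<longlongrightarrow> (0, r, r, 0, 1, 0, 0, 3)) (at_right 0)"
    using assms by (auto simp: closes_up_on_M_def)
  note l0 = tendsto_fst[OF r(2)] tendsto_snd[OF r(2)]
  note l1 = tendsto_fst[OF l0(2)] tendsto_snd[OF l0(2)]
  note l2 = tendsto_fst[OF l1(2)] tendsto_snd[OF l1(2)]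
  note l3 = tendsto_fst[OF l2(2)] tendsto_snd[OF l2(2)]
  note l7 = tendsto_snd[OF tendsto_snd[OF tendsto_snd[OF l3(2)]]]
  show thesis by (rule that[OF r(1)]) (use l0 l1 l2 l3 l7 in simp_all)
qed

text \<open>Near the singular orbit \<open>a\<close> is smaller than \<open>b\<close> and
  \<open>c\<close>, so the bracket multiplying \<open>\<epsilon>\<close> in the equation of
  \<open>f\<close> is positive. Since \<open>f'\<close> tends to 3, the sign must be
  positive.\<close>

lemma spinor_chirality:
  assumes sp: "spin7_metric \<epsilon> T (a, b, c, f)" and T: "T > 0" and cl: "closes_up_on_M 2 (a, b, c, f)"
  shows "\<epsilon> = 1"
proof -
  obtain r where r: "r > 0" "(a \<longlongrightarrow> 0) (at_right 0)" "(b \<longlongrightarrow> r) (at_right 0)" "(c \<longlongrightarrow> r) (at_right 0)"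
    "(f \<longlongrightarrow> 0) (at_right 0)" "(deriv f \<longlongrightarrow> 3) (at_right 0)" by (rule closes_up_2_limits[OF cl])
  have "\<forall>\<^sub>F t in at_right 0. deriv f t > 0" using r(6) by (rule order_tendstoD) simp
  moreover have "\<forall>\<^sub>F t in at_right 0. b t - a t > 0" "\<forall>\<^sub>F t in at_right 0. c t - a t > 0"
    using order_tendstoD(1)[OF tendsto_diff[OF r(3,2)], of 0] order_tendstoD(1)[OF tendsto_diff[OF r(4,2)], of 0] r(1)
    by simp_all
  moreover have "\<forall>\<^sub>F t in at_right 0. t \<in> time_interval T"
    using time_interval_initial[OF T] by (auto simp: eventually_at_right_field)
  ultimately have "\<forall>\<^sub>F t in at_right (0::real). deriv f t > 0 \<and> b t - a t > 0 \<and> c t - a t > 0 \<and> t \<in> time_interval T"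
    by eventually_elim simp
  then obtain t where t: "deriv f t > 0" "a t < b t" "a t < c t" "t \<in> time_interval T"
    using eventually_happens'[OF trivial_limit_at_right_real] by force
  note D = spin7_metricD[OF sp t(4)]
  have "0 < f t * (\<epsilon> * (1/3 * (f t / (a t)\<^sup>2) - 1/6 * (f t / (b t)\<^sup>2) - 1/6 * (f t / (c t)\<^sup>2)))"
    using t(1) DERIV_imp_deriv[OF D(8)] by simp
  moreover have "f t / (b t)\<^sup>2 < f t / (a t)\<^sup>2" "f t / (c t)\<^sup>2 < f t / (a t)\<^sup>2"
    using D(1-4) t by (auto intro!: divide_strict_left_mono power_strict_mono)
  then have "1/3 * (f t / (a t)\<^sup>2) - 1/6 * (f t / (b t)\<^sup>2) - 1/6 * (f t / (c t)\<^sup>2) > 0" by simp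
  ultimately have "\<epsilon> > 0" using D(4) by (simp add: zero_less_mult_iff)
  then show ?thesis using sp by auto
qed

text \<open>The equation \<open>b = c\<close> is part of the reduced system but not of the
  definition of a Spin(7) metric. The derivative of \<open>ln b - ln c\<close> has the sign of
  \<open>c^2 - b^2\<close>, so its square is nonincreasing; it starts at 0 because \<open>b\<close>
  and \<open>c\<close> have the same positive limit.\<close>

lemma spinor_symmetric:
  assumes sp: "spin7_metric 1 T (a, b, c, f)" and T: "T > 0" and cl: "closes_up_on_M 2 (a, b, c, f)"
    and t: "t \<in> time_interval T"
  shows "b t = c t"
proof -
  obtain r where r: "r > 0" "(b \<longlongrightarrow> r) (at_right 0)" "(c \<longlongrightarrow> r) (at_right 0)" by (rule closes_up_2_limits[OF cl]) blast
  obtain B where B: "t < B" "B \<in> time_interval T"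
    using t ereal_dense2[of "ereal t" T] by (auto simp: time_interval_def intro: less_trans)
  have mem: "s \<in> time_interval T" if "0 < s" "s < B" for s
    using B(2) that by (auto simp: time_interval_def intro: less_trans[of "ereal s" "ereal B"])
  define E where "E t = (ln (b t) - ln (c t))\<^sup>2" for t
  define E' where "E' t = 2 * (ln (b t) - ln (c t)) * (((c t)\<^sup>2 - (b t)\<^sup>2) * (2 / (a t * b t * c t) + f t / (6 * (b t)\<^sup>2 * (c t)\<^sup>2)))" for t
  have "E t \<le> 0"
  proof (rule gronwall_zero[where k = 0 and S = "\<lambda>t. t" and w = "\<lambda>_. 1" and b = B and E = E and E' = E'])
    fix s assume s: "0 < s" "s < B"
    note D = spin7_metricD[OF sp mem[OF s]]
    have "(E has_real_derivative 2 * (ln (b s) - ln (c s)) * (1 / b s * (b s * (c s / (a s * b s) + a s / (b s * c s) - b s / (a s * c s) + 1 / 6 * (f s / (b s)\<^sup>2)))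
       - 1 / c s * (c s * (a s / (b s * c s) + b s / (a s * c s) - c s / (a s * b s) + 1 / 6 * (f s / (c s)\<^sup>2))))) (at s)"
      unfolding E_def
      by (rule DERIV_cong[OF DERIV_power[OF DERIV_diff[OF DERIV_chain2[OF DERIV_ln_divide[OF D(2)] D(6)] DERIV_chain2[OF DERIV_ln_divide[OF D(3)] D(7)]], of 2]])
        (simp add: mult_ac)
    then show "(E has_real_derivative E' s) (at s)"
      by (rule DERIV_cong) (use D(1-3) in \<open>simp add: E'_def field_simps power2_eq_square\<close>)
    have "(ln (b s) - ln (c s)) * ((c s)\<^sup>2 - (b s)\<^sup>2) \<le> 0"
    proof (cases "b s \<le> c s")
      case True
      then show ?thesis using D(2,3) by (intro mult_nonpos_nonneg) (auto intro: power_mono)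
    next
      case False
      then show ?thesis using D(2,3) by (intro mult_nonneg_nonpos) (auto intro: power_mono)
    qed
    moreover have "2 / (a s * b s * c s) + f s / (6 * (b s)\<^sup>2 * (c s)\<^sup>2) \<ge> 0" using D(1-4) by simp
    ultimately have "((ln (b s) - ln (c s)) * ((c s)\<^sup>2 - (b s)\<^sup>2)) * (2 / (a s * b s * c s) + f s / (6 * (b s)\<^sup>2 * (c s)\<^sup>2)) \<le> 0"
      by (rule mult_nonpos_nonneg)
    moreover have "E' s = 2 * (((ln (b s) - ln (c s)) * ((c s)\<^sup>2 - (b s)\<^sup>2)) * (2 / (a s * b s * c s) + f s / (6 * (b s)\<^sup>2 * (c s)\<^sup>2)))"
      unfolding E'_def by (simp only: mult.assoc)
    ultimately show "E' s \<le> 0 * 1 * E s" by linarith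
    show "((\<lambda>t. t) has_real_derivative 1) (at s)" by (rule DERIV_ident)
  next
    have "((\<lambda>t. (ln (b t) - ln (c t))\<^sup>2) \<longlongrightarrow> (ln r - ln r)\<^sup>2) (at_right 0)"
      using r by (intro tendsto_intros) auto
    then show "((\<lambda>t. E t * exp (- 0 * t)) \<longlongrightarrow> 0) (at_right 0)" by (simp add: E_def)
  qed (use t B in \<open>auto simp: time_interval_def\<close>)
  then have "ln (b t) = ln (c t)" by (simp add: E_def)
  then show ?thesis using spin7_metricD(2,3)[OF sp t] by simp
qed

lemma spinor_reducedI:
  assumes sp: "spin7_metric 1 T (a, b, c, f)" and sym: "\<And>t. t \<in> time_interval T \<Longrightarrow> b t = c t"
  shows "spinor_reduced T (\<lambda>t. f t / (3 * a t)) (\<lambda>t. (a t)\<^sup>2 / (b t)\<^sup>2) a"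
  unfolding spinor_reduced_def
proof (intro ballI conjI)
  fix t assume t: "t \<in> time_interval T"
  note D = spin7_metricD[OF sp t]
  show "a t > 0" "f t / (3 * a t) > 0" "(a t)\<^sup>2 / (b t)\<^sup>2 > 0" using D by auto
  have bc: "c t = b t" using sym[OF t] by simp
  note pos = D(1,2,4)
  have a: "(a has_real_derivative 2 - f t / (3 * a t) - (a t)\<^sup>2 / (b t)\<^sup>2) (at t)"
    by (rule DERIV_cong[OF D(5)]) (use pos in \<open>simp add: bc field_simps power2_eq_square\<close>)
  then show "(a has_real_derivative 2 - f t / (3 * a t) - (a t)\<^sup>2 / (b t)\<^sup>2) (at t)" .
  have b: "(b has_real_derivative a t / b t + f t / (6 * b t)) (at t)"
    by (rule DERIV_cong[OF D(6)]) (use pos in \<open>simp add: bc field_simps power2_eq_square\<close>)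
  have f: "(f has_real_derivative f t * (f t / (3 * (a t)\<^sup>2) - f t / (3 * (b t)\<^sup>2))) (at t)"
    by (rule DERIV_cong[OF D(8)]) (use pos in \<open>simp add: bc field_simps power2_eq_square\<close>)
  show "((\<lambda>t. f t / (3 * a t)) has_real_derivative
      f t / (3 * a t) * (f t / (3 * a t) - 1) * (2 - (a t)\<^sup>2 / (b t)\<^sup>2) / a t) (at t)"
    by (rule DERIV_cong[OF DERIV_divide[OF f DERIV_cmult[OF a]]]) (use pos in \<open>simp_all add: field_simps power2_eq_square\<close>)
  show "((\<lambda>t. (a t)\<^sup>2 / (b t)\<^sup>2) has_real_derivative
      (a t)\<^sup>2 / (b t)\<^sup>2 * (4 - 2 * (f t / (3 * a t)) - 4 * ((a t)\<^sup>2 / (b t)\<^sup>2) - f t / (3 * a t) * ((a t)\<^sup>2 / (b t)\<^sup>2)) / a t) (at t)"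
    by (rule DERIV_cong[OF DERIV_divide[OF DERIV_power[OF a, of 2] DERIV_power[OF b, of 2]]])
      (use pos in \<open>simp_all add: field_simps power2_eq_square\<close>)
qed

text \<open>A smaller \<open>\<delta>\<close> enlarges the error, as \<open>\<eta>\<close> is
  negative near the singular orbit. The bound 2/3 is what the calculus of expansions asks
  for.\<close>

lemma gamma_expansion_weaken:
  assumes "gamma_expansion i s T g"
  obtains \<eta> \<delta> where "0 < \<delta>" "\<delta> \<le> 2 / 3" "\<And>t. t \<in> time_interval T \<Longrightarrow> (\<eta> has_real_derivative trL g t) (at t)"
    "filterlim \<eta> at_bot (at_right 0)"
    "(\<lambda>t. norm (XZ g t - (P0 i + exp (2 / 3 * \<eta> t) *\<^sub>R (fst s *\<^sub>R v1 i + snd s *\<^sub>R v2 i)))) \<in> O[at_right 0](\<lambda>t. exp ((2 / 3 + \<delta>) * \<eta> t))"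
proof -
  obtain \<eta> \<delta> where g: "\<delta> > 0" "\<And>t. t \<in> time_interval T \<Longrightarrow> (\<eta> has_real_derivative trL g t) (at t)"
    "filterlim \<eta> at_bot (at_right 0)"
    "(\<lambda>t. norm (XZ g t - (P0 i + exp (2 / 3 * \<eta> t) *\<^sub>R (fst s *\<^sub>R v1 i + snd s *\<^sub>R v2 i)))) \<in> O[at_right 0](\<lambda>t. exp ((2 / 3 + \<delta>) * \<eta> t))"
    using assms unfolding gamma_expansion_def by blast
  define \<delta>' where "\<delta>' = min \<delta> (2 / 3)"
  have "(\<lambda>t. exp ((2 / 3 + \<delta>) * \<eta> t)) \<in> O[at_right 0](\<lambda>t. exp ((2 / 3 + \<delta>') * \<eta> t))"
  proof (rule bigoI[of _ 1])
    have "\<forall>\<^sub>F t in at_right 0. \<eta> t \<le> 0" using g(3) unfolding filterlim_at_bot by blast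
    then show "\<forall>\<^sub>F t in at_right 0. norm (exp ((2 / 3 + \<delta>) * \<eta> t)) \<le> 1 * norm (exp ((2 / 3 + \<delta>') * \<eta> t))"
      by eventually_elim (auto simp: \<delta>'_def intro!: mult_right_mono_neg)
  qed
  from landau_o.big_trans[OF g(4) this] show thesis
    using g by (intro that[of \<delta>' \<eta>]) (auto simp: \<delta>'_def)
qed

text \<open>The reduced data are recovered from the given expansions:
  \<open>x = Z_2 Z_4 / 3\<close>, \<open>y = Z_1 / Z_2\<close>, and the ratio of the time rates
  \<open>2/a\<close> and \<open>trL\<close> is \<open>2 Z_2\<close>, all by
  \<open>b = c\<close>.\<close>

theorem spinor_unique:
  assumes s: "s \<in> parameters 2" and T: "T > 0" and h: "is_gamma 2 s T h"
  shows "homothetic_on T (spinor_gamma (spinor_params s)) h"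
proof -
  define p where "p = spinor_params s"
  have p: "p \<in> P2" using s by (simp add: p_def)
  obtain a b c f where h_eq: "h = (a, b, c, f)" by (cases h) auto
  obtain \<epsilon> where sp\<epsilon>: "spin7_metric \<epsilon> T (a, b, c, f)" and cl: "closes_up_on_M 2 (a, b, c, f)"
    and ge: "gamma_expansion 2 s T (a, b, c, f)" using h by (auto simp: is_gamma_def h_eq)
  have sp: "spin7_metric 1 T (a, b, c, f)" using spinor_chirality[OF sp\<epsilon> T cl] sp\<epsilon> by simp
  note D = spin7_metricD[OF sp]
  have sym: "b t = c t" if "t \<in> time_interval T" for t by (rule spinor_symmetric[OF sp T cl that])
  define x where "x t = f t / (3 * a t)" for t
  define y where "y t = (a t)\<^sup>2 / (b t)\<^sup>2" for t
  have red: "spinor_reduced T x y a"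
    using spinor_reducedI[OF sp sym] by (simp add: x_def[abs_def] y_def[abs_def])
  define L where "L = trL (a, b, c, f)"
  obtain \<eta> \<delta> where e: "0 < \<delta>" "\<delta> \<le> 2 / 3" "\<And>t. t \<in> time_interval T \<Longrightarrow> (\<eta> has_real_derivative L t) (at t)"
    "filterlim \<eta> at_bot (at_right 0)"
    "(\<lambda>t. norm (XZ (a, b, c, f) t - (P0 2 + exp (2 / 3 * \<eta> t) *\<^sub>R (fst s *\<^sub>R v1 2 + snd s *\<^sub>R v2 2)))) \<in> O[at_right 0](\<lambda>t. exp ((2 / 3 + \<delta>) * \<eta> t))"
    unfolding L_def by (rule gamma_expansion_weaken[OF ge]) blast
  interpret es: expansion_scale "at_right 0" "\<lambda>t. exp (2 / 3 * \<eta> t)" "\<lambda>t. exp ((2 / 3 + \<delta>) * \<eta> t)"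
    by (rule expansion_scale_exp[OF e(4,1,2)])
  have lin: "fst s *\<^sub>R v1 2 + snd s *\<^sub>R v2 2 = (2 * fst s - 6 * snd s, 9 * snd s, 9 * snd s, - 4 * fst s - 24 * snd s,
      6 * snd s, - fst s - 9 * snd s, - fst s - 9 * snd s, - 54 * fst s)"
    by (simp add: v1_def v2_def)
  have P0: "P0 2 = (1/3, 0, 0, 1/3, 0, 1/3, 1/3, 9)" by (simp add: P0_def)
  have "es.expands (\<lambda>t. a t / (b t * c t) / L t) 0 (6 * snd s) \<and> es.expands (\<lambda>t. b t / (a t * c t) / L t) (1/3) (- fst s - 9 * snd s)
      \<and> es.expands (\<lambda>t. f t * L t) 9 (- 54 * fst s)"
    using e(5) unfolding lin P0 XZ.simps Let_def norm_expansion_iff es.expands_def L_def[symmetric] by blast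
  then have Z1: "es.expands (\<lambda>t. a t / (b t * c t) / L t) 0 (6 * snd s)"
    and Z2: "es.expands (\<lambda>t. b t / (a t * c t) / L t) (1/3) (- fst s - 9 * snd s)"
    and Z4: "es.expands (\<lambda>t. f t * L t) 9 (- 54 * fst s)" by blast+
  have in_T: "\<forall>\<^sub>F t in at_right 0. t \<in> time_interval T"
    using time_interval_initial[OF T] by (auto simp: eventually_at_right_field)
  have "\<forall>\<^sub>F t in at_right 0. b t / (a t * c t) / L t \<noteq> 0"
    by (rule tendsto_imp_eventually_ne[OF es.expands_tendsto[OF Z2]]) simp
  then have L0: "\<forall>\<^sub>F t in at_right 0. L t \<noteq> 0" by eventually_elim auto
  have "\<forall>\<^sub>F t in at_right 0. (1/3) * ((f t * L t) * (b t / (a t * c t) / L t)) = x t"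
    using in_T L0
  proof eventually_elim
    case (elim t)
    then show ?case using D(1-3)[OF elim(1)] sym[OF elim(1)] by (simp add: x_def field_simps)
  qed
  then have x_exp: "es.expands x 1 (fst p)"
    using es.expands_eq[OF es.expands_mult[OF es.expands_const[of "1/3"] es.expands_mult[OF Z4 Z2]], of 1 "fst p"] es.expands_cong
    by (auto simp: p_def spinor_params_def)
  have "\<forall>\<^sub>F t in at_right 0. (a t / (b t * c t) / L t) / (b t / (a t * c t) / L t) = y t"
    using in_T L0
  proof eventually_elim
    case (elim t)
    then show ?case using D(1-3)[OF elim(1)] sym[OF elim(1)] by (simp add: y_def field_simps power2_eq_square)
  qed
  then have y_exp: "es.expands y 0 (fst (snd p))"
    using es.expands_eq[OF es.expands_divide[OF Z1 Z2], of 0 "fst (snd p)"] es.expands_cong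
    by (auto simp: p_def spinor_params_def)
  have "\<forall>\<^sub>F t in at_right 0. 2 * (b t / (a t * c t) / L t) = 2 / (a t * 1) / L t"
    using in_T
  proof eventually_elim
    case (elim t)
    then show ?case using D(1-3)[OF elim] sym[OF elim] by (simp add: field_simps)
  qed
  then have w_exp: "es.expands (\<lambda>t. 2 / (a t * 1) / L t) (2/3) (2 * (- fst s - 9 * snd s))"
    using es.expands_eq[OF es.expands_mult[OF es.expands_const[of 2] Z2], of "2/3" "2 * (- fst s - 9 * snd s)"] es.expands_cong
    by auto
  define V where "V t = (x t - 1, y t, 0::real)" for t
  have "\<exists>\<mu>>0. \<forall>t\<in>time_interval T. a t = \<mu> * spinor_size (p, spinor_fam.zeta p (t / \<mu>)) \<and> V t = spinor.traj p (spinor_fam.zeta p (t / \<mu>))"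
  proof (rule spinor_fam.homothetic_to_family[OF p T e(1,2,3,4)])
    fix t assume t: "t \<in> time_interval T"
    have pos: "a t > 0" "x t > 0" "y t > 0" using red t by (auto simp: spinor_reduced_def)
    have d: "(x has_real_derivative x t * (x t - 1) * (2 - y t) / a t) (at t)"
      "(y has_real_derivative y t * (4 - 2 * x t - 4 * y t - x t * y t) / a t) (at t)"
      "(a has_real_derivative 2 - x t - y t) (at t)" using red t by (auto simp: spinor_reduced_def)
    have "(V has_vector_derivative (x t * (x t - 1) * (2 - y t) / a t - 0, y t * (4 - 2 * x t - 4 * y t - x t * y t) / a t, 0)) (at t)"
      unfolding V_def by (intro has_vector_derivative_Pair has_vector_derivative_diff has_vector_derivative_const
        d[unfolded has_real_derivative_iff_has_vector_derivative])
    moreover have "(x t * (x t - 1) * (2 - y t) / a t - 0, y t * (4 - 2 * x t - 4 * y t - x t * y t) / a t, 0) = (2 / (a t * 1)) *\<^sub>R spinor.field (V t)"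
      using pos by (simp add: V_def spinor.field_def spinor_field_def field_simps)
    ultimately show "(V has_vector_derivative (2 / (a t * 1)) *\<^sub>R spinor.field (V t)) (at t)" by simp
    show "(a has_real_derivative 2 / 1 * spinor_g (V t)) (at t)"
      by (rule DERIV_cong[OF d(3)]) (simp add: spinor_g_def V_def)
    show "a t > 0" by (rule pos)
  next
    show "es.expands (\<lambda>t. 2 / (a t * 1) / L t) (2/3) (2 * (- fst s - 9 * snd s))" by (rule w_exp)
    show "es.expands (\<lambda>t. fst (V t)) 0 (fst p)"
      using es.expands_diff[OF x_exp es.expands_const[of 1]] by (simp add: V_def)
    show "es.expands (\<lambda>t. fst (snd (V t))) 0 (fst (snd p))" using y_exp by (simp add: V_def)
    show "es.expands (\<lambda>t. snd (snd (V t))) 0 (snd (snd p))"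
      using es.expands_const[of 0] by (simp add: V_def p_def spinor_params_def)
  qed auto
  then obtain \<mu> where mu: "\<mu> > 0" "\<And>t. t \<in> time_interval T \<Longrightarrow> a t = \<mu> * sa p (t / \<mu>)"
    "\<And>t. t \<in> time_interval T \<Longrightarrow> V t = spinor.traj p (spinor_fam.zeta p (t / \<mu>))" by blast
  show ?thesis
    unfolding homothetic_on_def p_def[symmetric]
  proof (intro exI[of _ \<mu>] conjI ballI mu)
    fix t assume t: "t \<in> time_interval T"
    then have tm: "t / \<mu> > 0" using mu(1) by (simp add: time_interval_def)
    note z = spinor_fam.zeta_pos[OF p tm]
    have xy: "x t = sx p (t / \<mu>)" "y t = sy p (t / \<mu>)"
      using mu(3)[OF t] unfolding spinor_traj[OF p z] V_def by auto
    note Dt = D[OF t]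
    have sq: "sqrt (y t) = a t / b t" using Dt(1,2) by (simp add: y_def real_sqrt_divide)
    have "b t = a t / sqrt (y t)" "f t = 3 * x t * a t" using Dt(1,2) unfolding sq by (simp_all add: x_def)
    then show "metric_at h t = \<mu> *\<^sub>R metric_at (spinor_gamma p) (t / \<mu>)"
      using sym[OF t] mu(2)[OF t] by (simp add: h_eq spinor_gamma_def spinor_metric_def xy)
  qed
qed

section \<open>The reduced system on \<open>M\<^sup>(\<^sup>1\<^sup>)\<close>\<close>

text \<open>With \<open>u = b\<^sup>2/a\<^sup>2\<close>, \<open>v = c\<^sup>2/a\<^sup>2\<close>, \<open>x = fa/(6bc)\<close> and \<open>ds = (2a/(bc)) dt\<close> the system becomes
  \<open>u' = u (2 - 2u - xv - 2xuv)\<close>, \<open>v' = v (2 - 2v - xu - 2xuv)\<close>, \<open>x' = x ((x + 1/2)(u + v) - 3/2)\<close>.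
  The linearisation at the singular orbit \<open>(u, v, x) = (1, 0, 1)\<close> is diagonal in the coordinates
  \<open>(x - 1 + r/2, v, r)\<close> with \<open>r = u + v - 1\<close>. The set \<open>x = 1\<close>, \<open>r = 0\<close> is the Calabi metric.\<close>

definition cot_X :: "vec3 \<Rightarrow> real" where "cot_X w = fst w - snd (snd w) * (1/2)"
definition cot_U :: "vec3 \<Rightarrow> real" where "cot_U w = snd (snd w) - fst (snd w)"

text \<open>The scaled nonlinear part of \<open>r'\<close>, in which \<open>1 + z cot_X\<close>
  stands for \<open>x\<close> and \<open>1 + z cot_U\<close> for \<open>u\<close>. Half of it
  reappears in the first component of the field, because that coordinate contains
  \<open>r/2\<close>.\<close>

definition cot_G3 :: "real \<Rightarrow> vec3 \<Rightarrow> real" where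
  "cot_G3 z w = - (snd (snd w) * (snd (snd w) * 2)) - cot_X w * (fst (snd w) * (4 * (1 + z * cot_U w)))
     - fst (snd w) * (snd (snd w) * (2 * (1 + z * cot_U w) * (1 + z * cot_X w)))"

definition cotangent_field :: "real \<Rightarrow> vec3 \<Rightarrow> vec3" where
  "cotangent_field z w =
     (cot_X w * snd (snd w) + cot_X w * cot_X w + cot_X w * (snd (snd w) * (z * cot_X w + 3/2)) + cot_G3 z w * (1/2),
      fst (snd w) * (- (fst (snd w) * 2) - cot_X w - cot_U w - cot_X w * (z * cot_U w)
        - fst (snd w) * (2 * (1 + z * cot_X w) * (1 + z * cot_U w))),
      cot_G3 z w)"

lemma scaled_field_cotangent: "scaled_field cotangent_field"
proof (rule scaled_fieldI)
  show "continuous_on UNIV (\<lambda>(z, y). cotangent_field z y)"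
    unfolding cotangent_field_def cot_G3_def cot_X_def cot_U_def split_def by (intro continuous_intros)
  show "cotangent_field z 0 = 0" for z
    by (simp add: cotangent_field_def cot_G3_def cot_X_def cot_U_def zero_prod_def)
  show "cotangent_field 1 (z *\<^sub>R y) = z\<^sup>2 *\<^sub>R cotangent_field z y" for z y
    unfolding cotangent_field_def cot_G3_def cot_X_def cot_U_def
    by (simp add: algebra_simps power2_eq_square) (simp add: field_simps)
  show "order_at_0 2 (\<lambda>v. fst (cotangent_field 1 v))" "order_at_0 2 (\<lambda>v. fst (snd (cotangent_field 1 v)))"
    "order_at_0 2 (\<lambda>v. snd (snd (cotangent_field 1 v)))"
    unfolding cotangent_field_def cot_G3_def cot_X_def cot_U_def fst_conv snd_conv
    by ((rule order_at_0_intros)+)[3]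
qed

text \<open>Obtained by comparing linear terms: with \<open>x = 1 + n \<zeta>\<close> and
  \<open>v = q \<zeta>\<close> the component \<open>Z_3\<close> requires \<open>q/3 = 3 s2\<close>,
  and \<open>Z_4\<close> requires \<open>12 (n + q) = - 108 s1\<close>.\<close>

definition cot_params :: "real \<times> real \<Rightarrow> vec3" where
  "cot_params s = (- 9 * fst s - 9 * snd s, 9 * snd s, 0)"

abbreviation "P1 \<equiv> cot_params ` parameters 1"

lemma cot_threshold:
  assumes "s \<in> parameters 1"
  shows "fst s + snd s \<ge> 0" "fst s + snd s = 0 \<longleftrightarrow> fst s = s_star 1"
  by (rule circle_threshold[OF parameters_bounds(3,4)[OF assms] zero_less_one _ parameters_bounds(5)[OF assms], unfolded mult_1_left];
      simp add: s_star_def power_divide)+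

lemma P1E:
  assumes "p \<in> P1"
  obtains N V where "p = (N, V, 0)" "N \<le> 0" "V > 0"
  using assms cot_threshold(1) parameters_bounds(4) by (force simp: cot_params_def)

section \<open>Inequality and identities behind the invariant region\<close>

lemma cot_quotient_bound:
  fixes u v :: real
  assumes "0 < u" "u < 1" "0 < v" "v < 1"
  defines "p \<equiv> u + v"
  shows "p * (5 - p) / 4 \<le> 2 * p - u * v * (p + 3) / p"
proof -
  have p: "0 < p" using assms by simp
  \<comment> \<open>The arithmetic-geometric mean bound on \<open>u v\<close> leaves a function of
    the sum alone, visibly positive for sums below 5; the sums in question are below 2.\<close>
  have "0 \<le> (u - v)\<^sup>2" by simp
  then have "u * v \<le> p\<^sup>2 / 4" unfolding p_def by (simp add: power2_eq_square algebra_simps)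
  then have "u * v * (p + 3) / p \<le> p\<^sup>2 / 4 * (p + 3) / p" using p by (intro divide_right_mono mult_right_mono) auto
  also have "\<dots> = p * (p + 3) / 4" using p by (simp add: power2_eq_square)
  finally show ?thesis by (simp add: field_simps)
qed

lemma cot_x_identity:
  fixes z X R :: real
  shows "z * (X * R + X\<^sup>2 + X * R * (z * X + 3/2)) + 3 * R * (1/2) + X = (X + (1 + z * X + 1/2) * R) * (1 + z * X)"
  by algebra

lemma cot_u_identity:
  fixes z X R V :: real
  defines "u \<equiv> 1 + z * (R - V)" and "x \<equiv> 1 + z * X"
  shows "z * (- 2 * R\<^sup>2 - 4 * X * V * u - 2 * V * R * u * x) - 3 * R
     - z * ((- 2 * V - X - (R - V) - z * X * (R - V) - 2 * V * x * u) * V) + (R - V)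
     = (- 2 * (R - V) - x * V - 2 * x * u * V) * u"
  unfolding u_def x_def by algebra

text \<open>The right side is a square plus a product of positive factors. This definite sign is
  what keeps \<open>u\<close> below 1.\<close>

lemma cot_U_identity:
  fixes z X R V :: real
  defines "u \<equiv> 1 + z * (R - V)" and "x \<equiv> 1 + z * X"
  shows "3 * V + z * ((- 2 * V - X - (R - V) - z * X * (R - V) - 2 * V * x * u) * V) - z * (- 2 * R\<^sup>2 - 4 * X * V * u - 2 * V * R * u * x)
     = 2 * z * (R - V)\<^sup>2 + (1 + 2 * u) * u * x * V"
  unfolding u_def x_def by algebra

text \<open>Here \<open>h\<close> is \<open>H\<close>, and \<open>w\<close> and \<open>Q\<close>
  stand for \<open>1/z\<close> and \<open>1/q\<close>. The identity is polynomial modulo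
  \<open>z w = 1\<close> and \<open>q Q = 1\<close>, and the proof applies these two relations
  explicitly between purely polynomial steps. The right side separates a multiple of
  \<open>h\<close> from a multiple of \<open>R\<close>.\<close>

lemma cot_H_identity:
  fixes z X R V w Q :: real
  defines "u \<equiv> 1 + z * (R - V)" and "x \<equiv> 1 + z * X"
  defines "E \<equiv> X * R + X\<^sup>2 + X * R * (z * X + 3/2)" and "G \<equiv> - 2 * R\<^sup>2 - 4 * X * V * u - 2 * V * R * u * x"
    and "h \<equiv> - (X + (x + 1/2) * R)" and "q \<equiv> 1 + z * R"
  assumes w: "z * w = 1" and Q: "q * Q = 1"
  shows "- (E + 3 * R * w * (1/2) + ((X + (E + 3 * R * w * (1/2)) * z) * R + (G - 3 * R * w) * (x + 1/2)))
    = (R + X + z * R * X - 2 * V * u * (x + 1/2) * (1 + q) * Q) * h + (x + 1/2) * (2 * q - u * (z * V) * (q + 3) * Q) * R * w"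
proof -
  have "- (E + 3 * R * w * (1/2) + ((X + (E + 3 * R * w * (1/2)) * z) * R + (G - 3 * R * w) * (x + 1/2)))
    = - (E + 3 * R * w * (1/2) + ((X + E * z + 3 * R * (1/2) * (z * w)) * R + (G - 3 * R * w) * (x + 1/2)))"
    by (simp add: algebra_simps)
  also have "\<dots> = - (E + 3 * R * w * (1/2) + ((X + E * z + 3 * R * (1/2)) * R + (G - 3 * R * w) * (x + 1/2)))"
    by (simp only: w mult_1_right)
  also have "\<dots> = - E - (X + E * z + 3 * R * (1/2)) * R - G * (x + 1/2) + 3 * R * w * (x + 1/2) - 3 * R * w * (1/2)"
    by algebra
  also have "\<dots> = - E - (X + E * z + 3 * R * (1/2)) * R - G * (x + 1/2) + 3 * R * w + 3 * R * X * (z * w)"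
    unfolding x_def by algebra
  also have "\<dots> = - E - (X + E * z + 3 * R * (1/2)) * R - G * (x + 1/2) + 3 * R * w + 3 * R * X"
    by (simp only: w mult_1_right)
  finally have lhs: "- (E + 3 * R * w * (1/2) + ((X + (E + 3 * R * w * (1/2)) * z) * R + (G - 3 * R * w) * (x + 1/2)))
    = - E - (X + E * z + 3 * R * (1/2)) * R - G * (x + 1/2) + 3 * R * w + 3 * R * X" .
  have r1: "(x + 1/2) * (2 * q - u * (z * V) * (q + 3) * Q) * R * w
     = 3 * R * w + R * (3 * R + 2 * X + 2 * z * R * X) * (z * w) - (x + 1/2) * u * V * (q + 3) * Q * R * (z * w)"
    unfolding x_def q_def by algebra
  have r2: "(R + X + z * R * X - 2 * V * u * (x + 1/2) * (1 + q) * Q) * h - (x + 1/2) * u * V * (q + 3) * Q * R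
     = (R + X + z * R * X) * h + V * u * (x + 1/2) * (2 * X + 2 * (x + 1/2) * R + 2 * q * X + 2 * q * (x + 1/2) * R - q * R - 3 * R) * Q"
    unfolding h_def by algebra
  have r3: "2 * X + 2 * (x + 1/2) * R + 2 * q * X + 2 * q * (x + 1/2) * R - q * R - 3 * R = q * (4 * X + 2 * x * R)"
    unfolding x_def q_def by algebra
  have "(R + X + z * R * X - 2 * V * u * (x + 1/2) * (1 + q) * Q) * h + (x + 1/2) * (2 * q - u * (z * V) * (q + 3) * Q) * R * w
     = (R + X + z * R * X) * h + V * u * (x + 1/2) * (4 * X + 2 * x * R) * (q * Q) + 3 * R * w + R * (3 * R + 2 * X + 2 * z * R * X)"
    using r2 unfolding r1 w mult_1_right r3 by algebra
  then have rhs: "(R + X + z * R * X - 2 * V * u * (x + 1/2) * (1 + q) * Q) * h + (x + 1/2) * (2 * q - u * (z * V) * (q + 3) * Q) * R * w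
     = (R + X + z * R * X) * h + V * u * (x + 1/2) * (4 * X + 2 * x * R) + 3 * R * w + R * (3 * R + 2 * X + 2 * z * R * X)"
    by (simp only: Q mult_1_right)
  show ?thesis unfolding lhs rhs unfolding E_def G_def h_def x_def by algebra
qed

text \<open>The functions of \<open>z\<close> occurring in a solution: \<open>H = (3/2 - (x + 1/2)(u + v))/z\<close> and \<open>R\<close> satisfy
  a linear system with nonnegative off-diagonal coefficients, which keeps \<open>x\<close> below 1.\<close>

locale cot_solution =
  fixes p :: vec3 and Z :: real and Y :: "real \<Rightarrow> vec3"
  assumes p: "p \<in> P1" and Z: "Z > 0" and sol: "scaled_solution cotangent_field p Z Y"
begin

definition "N z = fst (Y z)"
definition "V z = fst (snd (Y z))"
definition "R z = snd (snd (Y z))"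
definition "X z = N z - R z / 2"
definition "U z = R z - V z"
definition "x z = 1 + z * X z"
definition "u z = 1 + z * U z"
definition "v z = z * V z"
definition "G3 z = - 2 * (R z)\<^sup>2 - 4 * X z * V z * u z - 2 * V z * R z * u z * x z"
definition "E1 z = X z * R z + (X z)\<^sup>2 + X z * R z * (z * X z + 3/2)"
definition "H z = - (X z + (x z + 1/2) * R z)"

lemma cont: "continuous_on {0..Z} N" "continuous_on {0..Z} V" "continuous_on {0..Z} R"
  unfolding N_def V_def R_def by (fact scaled_solutionD[OF sol])+

lemma cont_sub [continuous_intros]: "continuous_on {0..c} N" "continuous_on {0..c} V" "continuous_on {0..c} R"
  if "c \<le> Z"
  using that by (auto intro: continuous_on_subset[OF cont(1)] continuous_on_subset[OF cont(2)] continuous_on_subset[OF cont(3)])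

lemma cont_X [continuous_intros]: "c \<le> Z \<Longrightarrow> continuous_on {0..c} X"
  and cont_x [continuous_intros]: "c \<le> Z \<Longrightarrow> continuous_on {0..c} x"
  and cont_u [continuous_intros]: "c \<le> Z \<Longrightarrow> continuous_on {0..c} u"
  and cont_v [continuous_intros]: "c \<le> Z \<Longrightarrow> continuous_on {0..c} v"
  and cont_U [continuous_intros]: "c \<le> Z \<Longrightarrow> continuous_on {0..c} U"
  and cont_H [continuous_intros]: "c \<le> Z \<Longrightarrow> continuous_on {0..c} H"
  unfolding X_def[abs_def] x_def[abs_def] u_def[abs_def] v_def[abs_def] U_def[abs_def] H_def[abs_def]
  by (intro continuous_intros; simp)+

lemma field_components:
  "cot_G3 z (Y z) = G3 z"
  "fst (cotangent_field z (Y z)) = E1 z + G3 z / 2"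
  "fst (snd (cotangent_field z (Y z))) = (- 2 * V z - X z - U z - z * X z * U z - 2 * V z * x z * u z) * V z"
  "snd (snd (cotangent_field z (Y z))) = G3 z"
proof -
  show G: "cot_G3 z (Y z) = G3 z"
    unfolding cot_G3_def cot_X_def cot_U_def G3_def N_def V_def R_def X_def U_def x_def u_def by algebra
  show "snd (snd (cotangent_field z (Y z))) = G3 z" by (simp add: cotangent_field_def G)
  show "fst (cotangent_field z (Y z)) = E1 z + G3 z / 2"
    unfolding cotangent_field_def fst_conv G unfolding cot_X_def N_def R_def X_def E1_def power2_eq_square times_divide_eq_right mult_1_right
    by (simp only: mult.assoc)
  show "fst (snd (cotangent_field z (Y z))) = (- 2 * V z - X z - U z - z * X z * U z - 2 * V z * x z * u z) * V z"
    unfolding cotangent_field_def fst_conv snd_conv cot_X_def cot_U_def N_def V_def R_def X_def U_def x_def u_def by algebra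
qed

lemma derivatives:
  assumes "0 < z" "z < Z"
  shows "(N has_real_derivative E1 z + G3 z / 2) (at z)"
    "(V has_real_derivative (- 2 * V z - X z - U z - z * X z * U z - 2 * V z * x z * u z) * V z) (at z)"
    "(R has_real_derivative G3 z - 3 * R z / z) (at z)"
proof -
  show "(N has_real_derivative E1 z + G3 z / 2) (at z)"
    unfolding N_def[abs_def] by (rule DERIV_cong[OF scaled_solutionD(5)[OF sol assms] field_components(2)])
  show "(V has_real_derivative (- 2 * V z - X z - U z - z * X z * U z - 2 * V z * x z * u z) * V z) (at z)"
    unfolding V_def[abs_def] by (rule DERIV_cong[OF scaled_solutionD(6)[OF sol assms] field_components(3)[unfolded V_def]])
  show "(R has_real_derivative G3 z - 3 * R z / z) (at z)"
    unfolding R_def[abs_def] by (rule DERIV_cong[OF scaled_solutionD(7)[OF sol assms]]) (simp only: field_components(4) R_def)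
qed

lemma initial: "N 0 = fst p" "V 0 = fst (snd p)" "R 0 = 0" "fst p \<le> 0" "fst (snd p) > 0"
proof -
  obtain n w where "p = (n, w, 0)" "n \<le> 0" "w > 0" by (rule P1E[OF p]) blast
  then show "N 0 = fst p" "V 0 = fst (snd p)" "R 0 = 0" "fst p \<le> 0" "fst (snd p) > 0"
    using scaled_solutionD(4)[OF sol] by (simp_all add: N_def V_def R_def)
qed

lemma X_derivative:
  assumes "0 < z" "z < Z"
  shows "(X has_real_derivative E1 z + 3 * R z / (2 * z)) (at z)"
  unfolding X_def[abs_def]
  by (rule DERIV_cong[OF DERIV_diff[OF derivatives(1)[OF assms] DERIV_cdivide[OF derivatives(3)[OF assms], of 2]]])
    (use assms in \<open>simp add: field_simps\<close>)

lemma V_pos: "0 \<le> z \<Longrightarrow> z \<le> Z \<Longrightarrow> V z > 0"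
proof -
  assume z: "0 \<le> z" "z \<le> Z"
  have "V z = V 0 * exp (integral {0..z} (\<lambda>z. - 2 * V z - X z - U z - z * X z * U z - 2 * V z * x z * u z))"
    using z by (intro linear_solution derivatives) (auto intro!: continuous_intros)
  then show ?thesis using initial by simp
qed

lemma x_derivative:
  assumes "0 < z" "z < Z"
  shows "(x has_real_derivative (X z + (x z + 1/2) * R z) * x z) (at z)"
proof -
  have "z * (E1 z + 3 * R z / (2 * z)) = z * E1 z + 3 * R z * (1/2)"
    using assms by (simp add: distrib_left)
  then have "0 + (1 * X z + (E1 z + 3 * R z / (2 * z)) * z) = (X z + (x z + 1/2) * R z) * x z"
    using cot_x_identity[of z "X z" "R z"] unfolding E1_def x_def by (simp only: mult.commute[of "_ + _ / _" z])
  then show ?thesis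
    unfolding x_def[abs_def]
    by (rule DERIV_cong[OF DERIV_add[OF DERIV_const DERIV_mult[OF DERIV_ident X_derivative[OF assms]]]])
qed

lemma x_pos: "0 \<le> z \<Longrightarrow> z \<le> Z \<Longrightarrow> x z > 0"
proof -
  assume z: "0 \<le> z" "z \<le> Z"
  have "x z = x 0 * exp (integral {0..z} (\<lambda>z. X z + (x z + 1/2) * R z))"
    using z by (intro linear_solution x_derivative) (auto intro!: continuous_intros)
  then show ?thesis by (simp add: x_def)
qed

lemma u_derivative:
  assumes "0 < z" "z < Z"
  shows "(u has_real_derivative (- 2 * U z - x z * V z - 2 * x z * u z * V z) * u z) (at z)"
proof -
  let ?V = "(- 2 * V z - X z - U z - z * X z * U z - 2 * V z * x z * u z) * V z"
  have "(g - 3 * R z / z - w) * z = z * g - 3 * R z - z * w" for g w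
    using assms by (simp add: field_simps)
  note cancel = this[of "G3 z" ?V]
  have "0 + (1 * (R z - V z) + (G3 z - 3 * R z / z - ?V) * z) = z * G3 z - 3 * R z - z * ?V + (R z - V z)"
    unfolding cancel mult_1_left add_0_left by (rule add.commute)
  also have "\<dots> = (- 2 * U z - x z * V z - 2 * x z * u z * V z) * u z"
    unfolding G3_def u_def U_def x_def by (rule cot_u_identity)
  finally have eq: "0 + (1 * (R z - V z) + (G3 z - 3 * R z / z - ?V) * z) = (- 2 * U z - x z * V z - 2 * x z * u z * V z) * u z" .
  have "((\<lambda>z. 1 + z * (R z - V z)) has_real_derivative (- 2 * U z - x z * V z - 2 * x z * u z * V z) * u z) (at z)"
    by (rule DERIV_cong[OF DERIV_add[OF DERIV_const DERIV_mult[OF DERIV_ident DERIV_diff[OF derivatives(3,2)[OF assms]]]] eq])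
  then show ?thesis by (simp only: u_def[abs_def] U_def[abs_def])
qed

lemma u_pos: "0 \<le> z \<Longrightarrow> z \<le> Z \<Longrightarrow> u z > 0"
proof -
  assume z: "0 \<le> z" "z \<le> Z"
  have "u z = u 0 * exp (integral {0..z} (\<lambda>z. - 2 * U z - x z * V z - 2 * x z * u z * V z))"
    using z by (intro linear_solution u_derivative) (auto intro!: continuous_intros)
  then show ?thesis by (simp add: u_def)
qed

text \<open>\<open>u < 1\<close> means \<open>U < 0\<close>. The factor \<open>z^3\<close> removes
  the singular term \<open>- 3 R / z\<close> and makes the initial value 0, so strict monotonicity
  of \<open>- z^3 U\<close> is enough.\<close>

lemma u_less_1: "0 < z \<Longrightarrow> z \<le> Z \<Longrightarrow> u z < 1"
proof -
  assume z: "0 < z" "z \<le> Z"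
  have U_step: "of_nat 3 * (1 * w ^ (3 - Suc 0)) * - (R w - V w) + - (G3 w - 3 * R w / w - (- 2 * V w - X w - U w - w * X w * U w - 2 * V w * x w * u w) * V w) * w ^ 3
      = w\<^sup>2 * (2 * w * (U w)\<^sup>2 + (1 + 2 * u w) * u w * x w * V w)" if "w > 0" for w
  proof -
    let ?V = "(- 2 * V w - X w - U w - w * X w * U w - 2 * V w * x w * u w) * V w"
    have "(G3 w - 3 * R w / w - ?V) * w ^ 3 = w\<^sup>2 * (w * G3 w - 3 * R w - w * ?V)"
      using that by (simp only: power2_eq_square power3_eq_cube left_diff_distrib right_diff_distrib) simp
    then have "of_nat 3 * (1 * w ^ (3 - Suc 0)) * - (R w - V w) + - (G3 w - 3 * R w / w - ?V) * w ^ 3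
      = w\<^sup>2 * (3 * V w + w * ?V - w * G3 w)"
      by (simp only: minus_mult_left[symmetric]) (simp add: algebra_simps)
    then show ?thesis
      using cot_U_identity[of "V w" w "X w" "R w"] by (simp add: G3_def u_def U_def x_def)
  qed
  have "(\<lambda>z. z ^ 3 * (- U z)) 0 < (\<lambda>z. z ^ 3 * (- U z)) z"
  proof (rule DERIV_pos_imp_increasing_open[OF z(1)])
    fix w assume w: "0 < w" "w < z"
    then have wZ: "w < Z" using z by simp
    have "((\<lambda>z. z ^ 3 * (- U z)) has_real_derivative w\<^sup>2 * (2 * w * (U w)\<^sup>2 + (1 + 2 * u w) * u w * x w * V w)) (at w)"
      unfolding U_def[abs_def]
      by (rule DERIV_cong[OF DERIV_mult[OF DERIV_power[OF DERIV_ident, of 3] DERIV_minus[OF DERIV_diff[OF derivatives(3,2)[OF w(1) wZ]]]]])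
        (use U_step[OF w(1)] in \<open>simp only: U_def\<close>)
    moreover have "w\<^sup>2 * (2 * w * (U w)\<^sup>2 + (1 + 2 * u w) * u w * x w * V w) > 0"
      using w wZ u_pos[of w] x_pos[of w] V_pos[of w]
      by (intro mult_pos_pos add_nonneg_pos) auto
    ultimately show "\<exists>y. ((\<lambda>z. z ^ 3 * (- U z)) has_real_derivative y) (at w) \<and> 0 < y" by blast
  qed (use z in \<open>auto intro!: continuous_intros\<close>)
  then have "U z < 0" using z by (simp add: mult_less_0_iff zero_less_mult_iff)
  then show ?thesis using z by (simp add: u_def mult_less_0_iff zero_less_mult_iff)
qed

lemma v_less_1: "0 \<le> z \<Longrightarrow> z \<le> Z \<Longrightarrow> v z < 1"
proof -
  assume z: "0 \<le> z" "z \<le> Z"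
  have "(\<lambda>z. 1 - v z) 0 * exp (integral {0..z} (\<lambda>z. - 2 * V z)) \<le> (\<lambda>z. 1 - v z) z"
  proof (rule linear_lower_bound[OF _ _ _ _ z(1)])
    fix w assume w: "0 < w" "w < z"
    then have wZ: "w < Z" using z by simp
    show "((\<lambda>z. 1 - v z) has_real_derivative - 2 * V w * (1 - v w) + V w * x w * u w * (1 + 2 * v w)) (at w)"
      unfolding v_def[abs_def]
      by (rule DERIV_cong[OF DERIV_diff[OF DERIV_const DERIV_mult[OF DERIV_ident derivatives(2)[OF w(1) wZ]]]])
        (unfold v_def x_def u_def U_def, algebra)
    have "V w * x w * u w * (1 + 2 * v w) \<ge> 0"
      using w wZ u_pos[of w] x_pos[of w] V_pos[of w] by (auto simp: v_def)
    then show "- 2 * V w * (1 - v w) \<le> - 2 * V w * (1 - v w) + V w * x w * u w * (1 + 2 * v w)" by simp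
  qed (use z in \<open>auto intro!: continuous_intros\<close>)
  moreover have "(\<lambda>z. 1 - v z) 0 * exp (integral {0..z} (\<lambda>z. - 2 * V z)) > 0" by (simp add: v_def)
  ultimately show ?thesis by linarith
qed

lemma sum_eq: "u z + v z = 1 + z * R z" by (simp add: u_def v_def U_def algebra_simps)

lemma sum_pos: "0 \<le> z \<Longrightarrow> z \<le> Z \<Longrightarrow> 1 + z * R z > 0"
  using add_pos_nonneg[OF u_pos[of z], of "v z"] V_pos[of z] sum_eq[of z] by (simp add: v_def)

text \<open>The singular factor \<open>1/z\<close> appears only with \<open>R\<close>, whose
  coefficient is nonnegative in the region already established. Nonnegativity of \<open>R\<close>
  therefore turns this into a linear lower bound for \<open>H\<close>.\<close>

lemma H_derivative:
  assumes z: "0 < z" "z < Z"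
  defines "q \<equiv> 1 + z * R z"
  shows "(H has_real_derivative
      (R z + X z + z * R z * X z - 2 * V z * u z * (x z + 1/2) * (1 + q) / q) * H z
      + (x z + 1/2) * (2 * q - u z * v z * (q + 3) / q) * R z / z) (at z)"
proof -
  have q0: "q \<noteq> 0" using sum_pos[of z] z by (simp add: q_def)
  have "(H has_real_derivative - (E1 z + 3 * R z / (2 * z) + ((0 + (1 * X z + (E1 z + 3 * R z / (2 * z)) * z)) * R z + (G3 z - 3 * R z / z) * (x z + 1/2)))) (at z)"
    unfolding H_def[abs_def] x_def[abs_def]
    by (rule DERIV_cong[OF DERIV_minus[OF DERIV_add[OF X_derivative[OF z] DERIV_mult[OF DERIV_add[OF DERIV_add[OF DERIV_const DERIV_mult[OF DERIV_ident X_derivative[OF z]]] DERIV_const] derivatives(3)[OF z]]]]])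
      (simp add: x_def)
  moreover have "- (E1 z + 3 * R z / (2 * z) + ((0 + (1 * X z + (E1 z + 3 * R z / (2 * z)) * z)) * R z + (G3 z - 3 * R z / z) * (x z + 1/2)))
     = (R z + X z + z * R z * X z - 2 * V z * u z * (x z + 1/2) * (1 + q) / q) * H z
      + (x z + 1/2) * (2 * q - u z * v z * (q + 3) / q) * R z / z"
    using cot_H_identity[of z "1 / z" "R z" "1 / q" "X z" "V z"] z q0
    by (simp add: H_def E1_def G3_def v_def u_def U_def x_def q_def mult.commute[of z 2])
  ultimately show ?thesis by simp
qed

lemma third_zero: "snd (snd p) = 0"
  using scaled_solutionD(4)[OF sol] initial(3) by (simp add: R_def)

text \<open>Substituting \<open>- X = H + (x + 1/2) R\<close> into \<open>G3\<close> gives a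
  multiple of \<open>R\<close> plus \<open>4 V u H\<close>. While \<open>H\<close> is nonnegative,
  \<open>z^3 R\<close> thus satisfies a linear inequality with initial value 0.\<close>

lemma R_nonneg_if:
  assumes c: "0 < c" "c \<le> Z" and H: "\<And>z. 0 < z \<Longrightarrow> z < c \<Longrightarrow> H z \<ge> 0"
  shows "R c \<ge> 0"
proof -
  let ?h = "\<lambda>z. - 2 * R z - 2 * V z * u z * x z + 4 * V z * u z * (x z + 1/2)"
  have "(\<lambda>z. z ^ 3 * R z) 0 * exp (integral {0..c} ?h) \<le> (\<lambda>z. z ^ 3 * R z) c"
  proof (rule linear_lower_bound[OF _ _ _ _ less_imp_le[OF c(1)]])
    fix z assume z: "0 < z" "z < c"
    then have zZ: "z < Z" using c by simp
    show "((\<lambda>z. z ^ 3 * R z) has_real_derivative z ^ 3 * G3 z) (at z)"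
      using scaled_solution_third(2)[OF sol third_zero z(1) zZ] field_components(4) by (simp add: R_def[abs_def])
    have "0 \<le> z ^ 3 * (4 * V z * u z * H z)"
      using z zZ V_pos[of z] u_pos[of z] H[OF z] by simp
    also have "\<dots> = z ^ 3 * G3 z - ?h z * (z ^ 3 * R z)"
      unfolding H_def G3_def by algebra
    finally show "?h z * (z ^ 3 * R z) \<le> z ^ 3 * G3 z" by linarith
  qed (use c in \<open>auto intro!: continuous_intros\<close>)
  then show ?thesis using c by (simp add: zero_le_mult_iff)
qed

text \<open>The two signs protect each other: up to the first zero of \<open>H\<close> the function
  \<open>R\<close> is nonnegative, so \<open>H\<close> stays above a positive multiple of its
  initial value \<open>- fst p\<close> and cannot reach 0.\<close>

lemma H_pos:
  assumes neg: "fst p < 0" and z: "0 \<le> z" "z \<le> Z"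
  shows "H z > 0"
proof (rule ccontr)
  assume "\<not> ?thesis"
  then have le: "H z \<le> 0" by simp
  have H0: "H 0 > 0" using neg initial by (simp add: H_def X_def)
  obtain c where c: "0 < c" "c \<le> z" "H c = 0" "\<And>w. 0 \<le> w \<Longrightarrow> w < c \<Longrightarrow> H w > 0"
    by (rule first_zero[OF cont_H[OF z(2)] z(1) H0 le]) blast
  have cZ: "c \<le> Z" using c z by simp
  let ?q = "\<lambda>z. 1 + z * R z"
  let ?h = "\<lambda>z. R z + X z + z * R z * X z - 2 * V z * u z * (x z + 1/2) * (1 + ?q z) / ?q z"
  have q: "?q w > 0" if "0 \<le> w" "w \<le> c" for w using sum_pos[of w] that cZ by simp
  have "H 0 * exp (integral {0..c} ?h) \<le> H c"
  proof (rule linear_lower_bound[OF cont_H[OF cZ] _ H_derivative _ less_imp_le[OF c(1)]])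
    show "continuous_on {0..c} ?h" using cZ q by (auto intro!: continuous_intros simp: less_imp_neq[symmetric])
    fix w assume w: "0 < w" "w < c"
    then have wZ: "w < Z" "w \<le> Z" using cZ by auto
    show "w < Z" by (rule wZ) show "0 < w" by (rule w)
    have R: "R w \<ge> 0" using w wZ c(4) by (intro R_nonneg_if) (auto intro: less_imp_le)
    have b: "0 < u w" "u w < 1" "0 < v w" "v w < 1" "0 < x w"
      using w wZ u_pos[of w] u_less_1[of w] V_pos[of w] v_less_1[of w] x_pos[of w] by (auto simp: v_def)
    have "0 \<le> (u w + v w) * (5 - (u w + v w)) / 4" using b by simp
    also have "\<dots> \<le> 2 * (u w + v w) - u w * v w * ((u w + v w) + 3) / (u w + v w)"
      by (rule cot_quotient_bound[OF b(1-4)])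
    finally have "0 \<le> (x w + 1/2) * (2 * ?q w - u w * v w * (?q w + 3) / ?q w) * R w / w"
      unfolding sum_eq using R b w by simp
    then show "?h w * H w \<le> ?h w * H w + (x w + 1/2) * (2 * ?q w - u w * v w * (?q w + 3) / ?q w) * R w / w"
      by simp
  qed
  moreover have "H 0 * exp (integral {0..c} ?h) > 0" using H0 by simp
  ultimately show False using c(3) by linarith
qed

text \<open>\<open>E1\<close> and \<open>G3\<close> are linear in \<open>(N, R)\<close> with bounded
  coefficients along the solution, and the singular term contributes
  \<open>- 6 R^2 / z \<le> 0\<close> to the derivative of \<open>N^2 + R^2\<close>. Gronwall's
  inequality keeps this at its initial value 0.\<close>

lemma calabi:
  assumes zero: "fst p = 0" and z: "0 \<le> z" "z \<le> Z"
  shows "N z = 0" "R z = 0"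
proof -
  define M where "M w = R w + X w + R w * (w * X w + 3/2)" for w
  define A where "A w = - 2 * R w - 2 * V w * u w * x w + 2 * V w * u w" for w
  define B where "B w = - 4 * V w * u w" for w
  have G: "G3 w = A w * R w + B w * N w" for w
    unfolding G3_def A_def B_def X_def by algebra
  have E: "E1 w = N w * M w - R w * M w / 2" for w
  proof -
    have "E1 w = X w * M w" unfolding E1_def M_def by algebra
    then show ?thesis by (simp add: X_def left_diff_distrib)
  qed
  let ?f = "\<lambda>w. \<bar>M w + B w / 2\<bar> + \<bar>A w / 2 - M w / 2 + B w\<bar> + \<bar>A w\<bar>"
  have "continuous_on {0..z} ?f"
    unfolding M_def A_def B_def using z by (auto intro!: continuous_intros)
  from continuous_attains_sup[OF compact_Icc _ this] z(1) obtain w0 where "\<forall>w\<in>{0..z}. ?f w \<le> ?f w0"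
    by fastforce
  then obtain K where K: "\<And>w. w \<in> {0..z} \<Longrightarrow> ?f w \<le> K" by blast
  have "(\<lambda>w. (N w)\<^sup>2 + (R w)\<^sup>2) z \<le> 0"
  proof (rule gronwall_zero_regular[where e = "\<lambda>w. (N w)\<^sup>2 + (R w)\<^sup>2" and K = "2 * K"])
    fix w assume w: "0 < w" "w < z"
    then have wZ: "w < Z" using z by simp
    show "((\<lambda>w. (N w)\<^sup>2 + (R w)\<^sup>2) has_real_derivative
        2 * ((E1 w + G3 w / 2) * N w) + 2 * ((G3 w - 3 * R w / w) * R w)) (at w)"
      by (rule DERIV_cong[OF DERIV_add[OF DERIV_power[OF derivatives(1)[OF w(1) wZ]] DERIV_power[OF derivatives(3)[OF w(1) wZ]]]])
        (simp add: numeral_2_eq_2)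
    let ?e = "(N w)\<^sup>2 + (R w)\<^sup>2"
    have mixed: "\<bar>N w * R w\<bar> \<le> ?e"
    proof -
      have "0 \<le> (\<bar>N w\<bar> - \<bar>R w\<bar>)\<^sup>2" by simp
      then have "2 * \<bar>N w * R w\<bar> \<le> ?e" by (simp add: power2_diff abs_mult)
      then show ?thesis by simp
    qed
    have b: "c * y \<le> \<bar>c\<bar> * ?e" if "\<bar>y\<bar> \<le> ?e" for c y
      using mult_left_mono[OF that, of "\<bar>c\<bar>"] abs_ge_self[of "c * y"] by (simp add: abs_mult)
    have "2 * ((E1 w + G3 w / 2) * N w) + 2 * ((G3 w - 3 * R w / w) * R w)
        = 2 * ((M w + B w / 2) * (N w)\<^sup>2 + (A w / 2 - M w / 2 + B w) * (N w * R w) + A w * (R w)\<^sup>2) - 6 * (R w)\<^sup>2 / w"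
      unfolding G E power2_eq_square by (simp add: algebra_simps)
    also have "\<dots> \<le> 2 * (\<bar>M w + B w / 2\<bar> * ?e + \<bar>A w / 2 - M w / 2 + B w\<bar> * ?e + \<bar>A w\<bar> * ?e)"
    proof -
      have lin: "2 * (i + j + k) - d \<le> 2 * (i' + j' + k')" if "i \<le> i'" "j \<le> j'" "k \<le> k'" "0 \<le> d" for i j k d i' j' k' :: real
      proof -
        have "i + j + k \<le> i' + j' + k'" using that by (intro add_mono)
        then show ?thesis using that(4) by simp
      qed
      show ?thesis
        by (rule lin; (rule b)?) (use mixed w in simp_all)
    qed
    also have "\<dots> = 2 * (?f w * ?e)" by algebra
    also have "\<dots> \<le> 2 * (K * ?e)" using K[of w] w by (intro mult_left_mono mult_right_mono) auto
    finally show "2 * ((E1 w + G3 w / 2) * N w) + 2 * ((G3 w - 3 * R w / w) * R w) \<le> 2 * K * ?e" by (simp add: mult.assoc)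
  next
    show "(N 0)\<^sup>2 + (R 0)\<^sup>2 = 0" using initial zero by simp
  qed (use z in \<open>auto intro!: continuous_intros\<close>)
  then show "N z = 0" "R z = 0" by (simp_all add: sum_power2_le_zero_iff)
qed

lemma bounds:
  assumes z: "0 < z" "z \<le> Z"
  shows "0 < u z" "u z < 1" "0 < v z" "v z < 1" "0 < x z" "x z \<le> 1" "0 \<le> R z" "z * R z < 1"
    "fst p < 0 \<Longrightarrow> x z < 1" "fst p < 0 \<Longrightarrow> H z > 0" "fst p = 0 \<Longrightarrow> x z = 1" "fst p = 0 \<Longrightarrow> R z = 0"
proof -
  show b: "0 < u z" "u z < 1" "0 < v z" "v z < 1" "0 < x z"
    using z u_pos[of z] u_less_1[of z] V_pos[of z] v_less_1[of z] x_pos[of z] by (auto simp: v_def)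
  then show "z * R z < 1" using sum_eq[of z] by linarith
  show H: "H z > 0" if "fst p < 0" using H_pos[OF that] z by simp
  show zero: "x z = 1" "R z = 0" if "fst p = 0"
    using calabi[OF that, of z] z by (simp_all add: x_def X_def)
  have neg: "R z \<ge> 0 \<and> x z < 1" if "fst p < 0"
  proof -
    have R: "R z \<ge> 0" using z H_pos[OF that] by (intro R_nonneg_if) (auto intro: less_imp_le)
    have "(x z + 1/2) * R z \<ge> 0" using R b by simp
    then have "X z < 0" using H[OF that] unfolding H_def by linarith
    then have "z * X z < 0" using z by (simp add: mult_less_0_iff)
    then show ?thesis using R by (simp add: x_def)
  qed
  then show "x z < 1" if "fst p < 0" using that by blast
  show "x z \<le> 1" "R z \<ge> 0" using neg zero initial(4) by (auto simp: order.order_iff_strict)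
qed

lemma norm_bound: "Z * norm (Y Z) < 4"
proof -
  note b = bounds[OF Z order_refl]
  have "norm (Z *\<^sub>R Y Z) \<le> norm (Z * fst (Y Z)) + (norm (Z * fst (snd (Y Z))) + norm (Z * snd (snd (Y Z))))"
    using norm_Pair_le[of "Z * fst (Y Z)" "(Z * fst (snd (Y Z)), Z * snd (snd (Y Z)))"]
      norm_Pair_le[of "Z * fst (snd (Y Z))" "Z * snd (snd (Y Z))"]
    by (simp add: scaleR_prod_def)
  moreover have "Z * fst (Y Z) = x Z - 1 + Z * R Z / 2"
    by (simp add: x_def X_def N_def algebra_simps)
  moreover have "Z * fst (snd (Y Z)) = v Z" "Z * snd (snd (Y Z)) = Z * R Z"
    by (simp_all add: v_def V_def R_def)
  moreover have "Z * R Z \<ge> 0" using b Z by simp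
  ultimately have "norm (Z *\<^sub>R Y Z) \<le> \<bar>x Z - 1 + Z * R Z / 2\<bar> + (\<bar>v Z\<bar> + \<bar>Z * R Z\<bar>)" by simp
  also have "\<dots> < 4" using b \<open>Z * R Z \<ge> 0\<close> by linarith
  finally show ?thesis using Z by simp
qed

end

lemma bounded_P1: "bounded P1"
proof -
  have "norm (cot_params s) \<le> 27" if "s \<in> parameters 1" for s
  proof -
    have "norm (cot_params s) \<le> norm (- 9 * fst s - 9 * snd s) + (norm (9 * snd s) + norm (0::real))"
      unfolding cot_params_def by (rule order_trans[OF norm_Pair_le add_left_mono[OF norm_Pair_le]])
    then show ?thesis using parameters_bounds(1,2)[OF that] by (auto simp: abs_le_iff)
  qed
  then show ?thesis by (auto intro!: boundedI)
qed

lemma cot_family_exists: "\<exists>Y. solution_family cotangent_field P1 Y"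
proof -
  interpret scaled_field cotangent_field by (rule scaled_field_cotangent)
  have a: "Z * norm (Y Z) < 4" if "p \<in> P1" "Z > 0" "scaled_solution cotangent_field p Z Y" for p Z Y
  proof -
    interpret cot_solution p Z Y by (rule cot_solution.intro) (fact that)+
    show ?thesis by (rule norm_bound)
  qed
  have P3: "snd (snd p) = 0" if "p \<in> P1" for p using that by (auto simp: cot_params_def)
  obtain Y where "continuous_on UNIV Y" "\<And>p Z. p \<in> P1 \<Longrightarrow> Z > 0 \<Longrightarrow> scaled_solution cotangent_field p Z (\<lambda>z. Y (p, z))"
    by (rule global_scaled_solutions[where P = P1 and B = 4]) (rule bounded_P1 | erule P3 | erule (2) a | blast)+
  then have "solution_family cotangent_field P1 Y"
    by unfold_locales (auto simp: cot_params_def)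
  then show ?thesis by blast
qed

definition cot_family :: "vec3 \<times> real \<Rightarrow> vec3" where
  "cot_family = (SOME Y. solution_family cotangent_field P1 Y)"

interpretation cot: solution_family cotangent_field P1 cot_family
  unfolding cot_family_def by (rule someI_ex[OF cot_family_exists])

section \<open>Metrics on \<open>M\<^sup>(\<^sup>1\<^sup>)\<close> from the reduced system\<close>

text \<open>The factor \<open>2 / (a sqrt (u v))\<close> is \<open>ds/dt = 2a/(bc)\<close>, since
  \<open>bc = a^2 sqrt (u v)\<close>.\<close>

definition cot_reduced :: "ereal \<Rightarrow> (real \<Rightarrow> real) \<Rightarrow> (real \<Rightarrow> real) \<Rightarrow> (real \<Rightarrow> real) \<Rightarrow> (real \<Rightarrow> real) \<Rightarrow> bool" where
  "cot_reduced T x u v a \<longleftrightarrow> (\<forall>t\<in>time_interval T. a t > 0 \<and> x t > 0 \<and> u t > 0 \<and> v t > 0 \<and>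
     (x has_real_derivative x t * ((x t + 1/2) * (u t + v t) - 3/2) * (2 / (a t * sqrt (u t * v t)))) (at t) \<and>
     (u has_real_derivative u t * (2 - 2 * u t - x t * v t - 2 * x t * u t * v t) * (2 / (a t * sqrt (u t * v t)))) (at t) \<and>
     (v has_real_derivative v t * (2 - 2 * v t - x t * u t - 2 * x t * u t * v t) * (2 / (a t * sqrt (u t * v t)))) (at t) \<and>
     (a has_real_derivative (u t + v t - 1 + 2 * x t * u t * v t) / sqrt (u t * v t)) (at t))"

definition cot_metric :: "(real \<Rightarrow> real) \<Rightarrow> (real \<Rightarrow> real) \<Rightarrow> (real \<Rightarrow> real) \<Rightarrow> (real \<Rightarrow> real) \<Rightarrow> coh1_metric" where
  "cot_metric x u v a =
    (a, \<lambda>t. a t * sqrt (u t), \<lambda>t. a t * sqrt (v t), \<lambda>t. 6 * x t * (a t * (sqrt (u t) * sqrt (v t))))"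

lemma sqrt_derivative:
  assumes "(f has_real_derivative d) (at t)" "f t > 0"
  shows "((\<lambda>t. sqrt (f t)) has_real_derivative d / (2 * sqrt (f t))) (at t)"
  using assms by (auto intro!: derivative_eq_intros simp: divide_simps)

lemma cot_metric_derivatives:
  assumes "cot_reduced T x u v a" "t \<in> time_interval T"
  shows "(a has_real_derivative (u t + v t - 1 + 2 * x t * u t * v t) / sqrt (u t * v t)) (at t)"
    "((\<lambda>t. a t * sqrt (u t)) has_real_derivative (1 + v t - u t - x t * v t) / sqrt (v t)) (at t)"
    "((\<lambda>t. a t * sqrt (v t)) has_real_derivative (1 + u t - v t - x t * u t) / sqrt (u t)) (at t)"
    "((\<lambda>t. 6 * x t * (a t * (sqrt (u t) * sqrt (v t)))) has_real_derivative 12 * (x t)\<^sup>2 * ((u t + v t) / 2 - u t * v t)) (at t)"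
proof -
  define p q where "p = sqrt (u t)" and "q = sqrt (v t)"
  let ?w = "2 / (a t * (p * q))"
  have pos: "a t > 0" "x t > 0" "u t > 0" "v t > 0" and pq: "sqrt (u t * v t) = p * q"
    using assms by (auto simp: cot_reduced_def p_def q_def real_sqrt_mult)
  have d: "(x has_real_derivative x t * ((x t + 1/2) * (u t + v t) - 3/2) * ?w) (at t)"
     "(u has_real_derivative u t * (2 - 2 * u t - x t * v t - 2 * x t * u t * v t) * ?w) (at t)"
     "(v has_real_derivative v t * (2 - 2 * v t - x t * u t - 2 * x t * u t * v t) * ?w) (at t)"
     "(a has_real_derivative (u t + v t - 1 + 2 * x t * u t * v t) / (p * q)) (at t)"
    using assms unfolding cot_reduced_def pq[symmetric] by blast+
  have p: "p > 0" "q > 0" "u t = p\<^sup>2" "v t = q\<^sup>2" using pos by (simp_all add: p_def q_def)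
  have s: "((\<lambda>t. sqrt (u t)) has_real_derivative (2 - 2 * u t - x t * v t - 2 * x t * u t * v t) / (a t * q)) (at t)"
    by (rule DERIV_cong[OF sqrt_derivative[OF d(2) pos(3)]])
      (use pos(1) p in \<open>simp add: p_def[symmetric] power2_eq_square field_simps\<close>)
  have s': "((\<lambda>t. sqrt (v t)) has_real_derivative (2 - 2 * v t - x t * u t - 2 * x t * u t * v t) / (a t * p)) (at t)"
    by (rule DERIV_cong[OF sqrt_derivative[OF d(3) pos(4)]])
      (use pos(1) p in \<open>simp add: q_def[symmetric] power2_eq_square field_simps\<close>)
  show "(a has_real_derivative (u t + v t - 1 + 2 * x t * u t * v t) / sqrt (u t * v t)) (at t)"
    unfolding pq by (rule d)
  show "((\<lambda>t. a t * sqrt (u t)) has_real_derivative (1 + v t - u t - x t * v t) / sqrt (v t)) (at t)"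
  proof (rule DERIV_cong[OF DERIV_mult[OF d(4) s]])
    have "(u t + v t - 1 + 2 * x t * u t * v t) / (p * q) * p = (u t + v t - 1 + 2 * x t * u t * v t) / q"
      "(2 - 2 * u t - x t * v t - 2 * x t * u t * v t) / (a t * q) * a t = (2 - 2 * u t - x t * v t - 2 * x t * u t * v t) / q"
      using pos p by simp_all
    then show "(u t + v t - 1 + 2 * x t * u t * v t) / (p * q) * sqrt (u t) +
      (2 - 2 * u t - x t * v t - 2 * x t * u t * v t) / (a t * q) * a t = (1 + v t - u t - x t * v t) / sqrt (v t)"
      unfolding p_def[symmetric] q_def[symmetric] by (simp flip: add_divide_distrib)
  qed
  show "((\<lambda>t. a t * sqrt (v t)) has_real_derivative (1 + u t - v t - x t * u t) / sqrt (u t)) (at t)"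
  proof (rule DERIV_cong[OF DERIV_mult[OF d(4) s']])
    have "(u t + v t - 1 + 2 * x t * u t * v t) / (p * q) * q = (u t + v t - 1 + 2 * x t * u t * v t) / p"
      "(2 - 2 * v t - x t * u t - 2 * x t * u t * v t) / (a t * p) * a t = (2 - 2 * v t - x t * u t - 2 * x t * u t * v t) / p"
      using pos p by simp_all
    then show "(u t + v t - 1 + 2 * x t * u t * v t) / (p * q) * sqrt (v t) +
      (2 - 2 * v t - x t * u t - 2 * x t * u t * v t) / (a t * p) * a t = (1 + u t - v t - x t * u t) / sqrt (u t)"
      unfolding p_def[symmetric] q_def[symmetric] by (simp flip: add_divide_distrib)
  qed
  show "((\<lambda>t. 6 * x t * (a t * (sqrt (u t) * sqrt (v t)))) has_real_derivative 12 * (x t)\<^sup>2 * ((u t + v t) / 2 - u t * v t)) (at t)"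
  proof (rule DERIV_cong[OF DERIV_mult[OF DERIV_cmult[OF d(1)] DERIV_mult[OF d(4) DERIV_mult[OF s s']]]])
    have e1: "6 * (X * ?w) * (a t * (p * q)) = 12 * X" for X
      using pos p by simp
    have e2: "A / (p * q) * (p * q) = A" for A using pos p by simp
    have e3: "B / (a t * q) * q = B / a t" "C / (a t * p) * p = C / a t" for B C using pos p by simp_all
    have e4: "(B / a t + C / a t) * a t = B + C" for B C using pos by (simp flip: add_divide_distrib)
    show "6 * (x t * ((x t + 1/2) * (u t + v t) - 3/2) * ?w) * (a t * (sqrt (u t) * sqrt (v t))) +
       ((u t + v t - 1 + 2 * x t * u t * v t) / (p * q) * (sqrt (u t) * sqrt (v t)) +
        ((2 - 2 * u t - x t * v t - 2 * x t * u t * v t) / (a t * q) * sqrt (v t) +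
         (2 - 2 * v t - x t * u t - 2 * x t * u t * v t) / (a t * p) * sqrt (u t)) * a t) * (6 * x t) =
       12 * (x t)\<^sup>2 * ((u t + v t) / 2 - u t * v t)"
      unfolding p_def[symmetric] q_def[symmetric] e1 e2 e3 e4 by (simp add: field_simps power2_eq_square)
  qed
qed

lemma cot_metric_spin7:
  assumes red: "cot_reduced T x u v a"
  shows "spin7_metric (- 1) T (cot_metric x u v a)"
  unfolding cot_metric_def spin7_metric.simps
proof (intro conjI ballI)
  fix t assume t: "t \<in> time_interval T"
  note d = cot_metric_derivatives[OF red t]
  have pos: "a t > 0" "x t > 0" "u t > 0" "v t > 0" using red t by (auto simp: cot_reduced_def)
  define p q where "p = sqrt (u t)" and "q = sqrt (v t)"
  have w: "p > 0" "q > 0" "sqrt (u t * v t) = p * q" "sqrt (u t) = p" "sqrt (v t) = q" "u t = p\<^sup>2" "v t = q\<^sup>2"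
    using pos by (simp_all add: p_def q_def real_sqrt_mult)
  show "0 < a t" "0 < a t * sqrt (u t)" "0 < a t * sqrt (v t)" "0 < 6 * x t * (a t * (sqrt (u t) * sqrt (v t)))" using pos by auto
  show "a differentiable at t" "(\<lambda>t. a t * sqrt (u t)) differentiable at t" "(\<lambda>t. a t * sqrt (v t)) differentiable at t"
    "(\<lambda>t. 6 * x t * (a t * (sqrt (u t) * sqrt (v t)))) differentiable at t"
    using d real_differentiable_def by blast+
  show "deriv a t / a t = a t * sqrt (u t) / (a t * (a t * sqrt (v t))) + a t * sqrt (v t) / (a t * (a t * sqrt (u t))) -
       a t / (a t * sqrt (u t) * (a t * sqrt (v t))) - - 1 / 3 * (6 * x t * (a t * (sqrt (u t) * sqrt (v t))) / (a t)\<^sup>2)"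
    using pos(1) w(1,2) unfolding DERIV_imp_deriv[OF d(1)] w(3-5) unfolding w(6,7) by (simp add: field_simps power2_eq_square)
  show "deriv (\<lambda>t. a t * sqrt (u t)) t / (a t * sqrt (u t)) = a t * sqrt (v t) / (a t * (a t * sqrt (u t))) + a t / (a t * sqrt (u t) * (a t * sqrt (v t))) -
       a t * sqrt (u t) / (a t * (a t * sqrt (v t))) + - 1 / 6 * (6 * x t * (a t * (sqrt (u t) * sqrt (v t))) / (a t * sqrt (u t))\<^sup>2)"
    using pos(1) w(1,2) unfolding DERIV_imp_deriv[OF d(2)] w(3-5) unfolding w(6,7) by (simp add: field_simps power2_eq_square)
  show "deriv (\<lambda>t. a t * sqrt (v t)) t / (a t * sqrt (v t)) = a t / (a t * sqrt (u t) * (a t * sqrt (v t))) + a t * sqrt (u t) / (a t * (a t * sqrt (v t))) -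
       a t * sqrt (v t) / (a t * (a t * sqrt (u t))) + - 1 / 6 * (6 * x t * (a t * (sqrt (u t) * sqrt (v t))) / (a t * sqrt (v t))\<^sup>2)"
    using pos(1) w(1,2) unfolding DERIV_imp_deriv[OF d(3)] w(3-5) unfolding w(6,7) by (simp add: field_simps power2_eq_square)
  show "deriv (\<lambda>t. 6 * x t * (a t * (sqrt (u t) * sqrt (v t)))) t / (6 * x t * (a t * (sqrt (u t) * sqrt (v t)))) =
     - 1 * (1 / 3 * (6 * x t * (a t * (sqrt (u t) * sqrt (v t))) / (a t)\<^sup>2) -
       1 / 6 * (6 * x t * (a t * (sqrt (u t) * sqrt (v t))) / (a t * sqrt (u t))\<^sup>2) - 1 / 6 * (6 * x t * (a t * (sqrt (u t) * sqrt (v t))) / (a t * sqrt (v t))\<^sup>2))"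
    using pos(1,2) w(1,2) unfolding DERIV_imp_deriv[OF d(4)] w(3-5) unfolding w(6,7) by (simp add: field_simps power2_eq_square)
qed simp

text \<open>The product of \<open>trL\<close> with \<open>bc/(2a)\<close>. At the equilibrium
  \<open>(x, u, v) = (1, 1, 0)\<close> it equals 3/2, whence the factor 2/3 in
  \<open>cot_lam\<close> below.\<close>

definition cot_Lam :: "real \<Rightarrow> real \<Rightarrow> real \<Rightarrow> real" where
  "cot_Lam x u v = 1 + u + v + x * u * v - x * (u + v) / 2"

lemma cot_metric_trL:
  assumes red: "cot_reduced T x u v a" and t: "t \<in> time_interval T"
  shows "trL (cot_metric x u v a) t = 2 * cot_Lam (x t) (u t) (v t) / (a t * sqrt (u t * v t))"
proof -
  note d = cot_metric_derivatives[OF red t]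
  have pos: "a t > 0" "x t > 0" "u t > 0" "v t > 0" using red t by (auto simp: cot_reduced_def)
  define p q where "p = sqrt (u t)" and "q = sqrt (v t)"
  have w: "p > 0" "q > 0" "sqrt (u t * v t) = p * q" "sqrt (u t) = p" "sqrt (v t) = q" "u t = p\<^sup>2" "v t = q\<^sup>2"
    using pos by (simp_all add: p_def q_def real_sqrt_mult)
  show ?thesis using pos(1,2) w(1,2)
    unfolding cot_metric_def trL.simps d[THEN DERIV_imp_deriv] cot_Lam_def w(3-5) unfolding w(6,7)
    by (simp add: field_simps power2_eq_square)
qed

lemma cot_metric_XZ:
  assumes red: "cot_reduced T x u v a" and t: "t \<in> time_interval T" and L: "cot_Lam (x t) (u t) (v t) \<noteq> 0"
  defines "\<Lambda> \<equiv> cot_Lam (x t) (u t) (v t)"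
  shows "XZ (cot_metric x u v a) t =
    (1/2 * (u t + v t - 1 + 2 * x t * u t * v t) / \<Lambda>, 1/2 * (1 + v t - u t - x t * v t) / \<Lambda>,
     1/2 * (1 + u t - v t - x t * u t) / \<Lambda>, x t * ((u t + v t) / 2 - u t * v t) / \<Lambda>,
     1/2 / \<Lambda>, 1/2 * u t / \<Lambda>, 1/2 * v t / \<Lambda>, 12 * x t * \<Lambda>)"
proof -
  note d = cot_metric_derivatives[OF red t]
  have pos: "a t > 0" "x t > 0" "u t > 0" "v t > 0" using red t by (auto simp: cot_reduced_def)
  define p q where "p = sqrt (u t)" and "q = sqrt (v t)"
  have w: "p > 0" "q > 0" "sqrt (u t * v t) = p * q" "sqrt (u t) = p" "sqrt (v t) = q" "u t = p\<^sup>2" "v t = q\<^sup>2"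
    using pos by (simp_all add: p_def q_def real_sqrt_mult)
  have L': "\<Lambda> \<noteq> 0" using L by (simp add: \<Lambda>_def)
  have tr: "trL (cot_metric x u v a) t = 2 * \<Lambda> / (a t * (p * q))"
    unfolding cot_metric_trL[OF red t] w(3) \<Lambda>_def ..
  have div: "A / a t / (2 * \<Lambda> / (a t * (p * q))) = 1/2 * (A * (p * q)) / \<Lambda>" for A
    using pos(1) w(1,2) L' by (simp add: field_simps)
  show ?thesis using pos(1,2) w(1,2) L'
    unfolding cot_metric_def XZ.simps tr[unfolded cot_metric_def] Let_def d[THEN DERIV_imp_deriv] w(3-5)
    unfolding w(6,7)
    by (simp add: field_simps power2_eq_square)
qed

section \<open>The family on \<open>M\<^sup>(\<^sup>1\<^sup>)\<close>\<close>

definition cot_N :: "vec3 \<times> real \<Rightarrow> real" where "cot_N q = fst (cot_family q)"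
definition cot_V :: "vec3 \<times> real \<Rightarrow> real" where "cot_V q = fst (snd (cot_family q))"
definition cot_R :: "vec3 \<times> real \<Rightarrow> real" where "cot_R q = snd (snd (cot_family q))"

definition cot_x :: "vec3 \<times> real \<Rightarrow> real" where "cot_x q = 1 + snd q * (cot_N q - cot_R q / 2)"
definition cot_u :: "vec3 \<times> real \<Rightarrow> real" where "cot_u q = 1 + snd q * (cot_R q - cot_V q)"
definition cot_v :: "vec3 \<times> real \<Rightarrow> real" where "cot_v q = snd q * cot_V q"

text \<open>On this singular orbit \<open>a\<close> has a positive limit, so no factor
  \<open>sqrt z\<close> is split off; the scale is fixed by \<open>a = 1\<close> at
  \<open>z = 0\<close>. The integrand is \<open>(r + 2 x u v)/2\<close>, the logarithmic derivative
  in \<open>ln z\<close>, divided by \<open>z\<close>.\<close>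

definition cot_size :: "vec3 \<times> real \<Rightarrow> real" where
  "cot_size q = exp (integral {0..snd q} (\<lambda>r. (cot_R (fst q, r) + 2 * cot_x (fst q, r) * cot_u (fst q, r) * cot_V (fst q, r)) / 2))"

lemma cot_NVR_cont [continuous_intros]:
  "continuous_on S f \<Longrightarrow> continuous_on S (\<lambda>q. cot_N (f q))"
  "continuous_on S f \<Longrightarrow> continuous_on S (\<lambda>q. cot_V (f q))"
  "continuous_on S f \<Longrightarrow> continuous_on S (\<lambda>q. cot_R (f q))"
  unfolding cot_N_def cot_V_def cot_R_def by (intro continuous_intros cot.Y_cont'; assumption)+

lemma cot_xuv_cont [continuous_intros]:
  "continuous_on S f \<Longrightarrow> continuous_on S (\<lambda>q. cot_x (f q))"
  "continuous_on S f \<Longrightarrow> continuous_on S (\<lambda>q. cot_u (f q))"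
  "continuous_on S f \<Longrightarrow> continuous_on S (\<lambda>q. cot_v (f q))"
  unfolding cot_x_def cot_u_def cot_v_def by (intro continuous_intros; (assumption | simp))+

lemma cot_rate_cont: "continuous_on (P1 \<times> {0..}) (\<lambda>q. (cot_R q + 2 * cot_x q * cot_u q * cot_V q) / 2)"
  by (intro continuous_intros) auto

lemma cot_size_cont: "continuous_on (P1 \<times> {0..}) cot_size"
  using continuous_on_exp[OF continuous_on_primitive[OF cot_rate_cont]] by (simp only: cot_size_def[abs_def])

lemma cot_solution_family:
  assumes "p \<in> P1" "z > 0"
  shows "cot_solution p z (\<lambda>z. cot_family (p, z))"
  by (rule cot_solution.intro) (fact assms, fact assms, rule cot.sol[OF assms])

lemma cot_bounds:
  assumes p: "p \<in> P1" and z: "z > 0"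
  shows "0 < cot_x (p, z)" "cot_x (p, z) \<le> 1" "0 < cot_u (p, z)" "cot_u (p, z) < 1" "0 < cot_v (p, z)" "cot_v (p, z) < 1"
    "1 \<le> cot_u (p, z) + cot_v (p, z)" "cot_V (p, z) > 0"
    "fst p < 0 \<Longrightarrow> cot_x (p, z) < 1" "fst p < 0 \<Longrightarrow> (cot_x (p, z) + 1/2) * (cot_u (p, z) + cot_v (p, z)) < 3/2"
    "fst p = 0 \<Longrightarrow> cot_x (p, z) = 1" "fst p = 0 \<Longrightarrow> cot_u (p, z) + cot_v (p, z) = 1"
proof -
  interpret S: cot_solution p z "\<lambda>z. cot_family (p, z)" by (rule cot_solution_family[OF assms])
  note b = S.bounds[OF z order_refl]
  have e: "S.x z = cot_x (p, z)" "S.u z = cot_u (p, z)" "S.v z = cot_v (p, z)" "S.V z = cot_V (p, z)"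
    by (simp_all add: S.x_def S.X_def S.N_def S.R_def S.u_def S.U_def S.V_def S.v_def cot_x_def cot_u_def cot_v_def cot_N_def cot_V_def cot_R_def)
  show "0 < cot_x (p, z)" "cot_x (p, z) \<le> 1" "0 < cot_u (p, z)" "cot_u (p, z) < 1" "0 < cot_v (p, z)" "cot_v (p, z) < 1"
    "fst p < 0 \<Longrightarrow> cot_x (p, z) < 1" "fst p = 0 \<Longrightarrow> cot_x (p, z) = 1"
    using b(1-6,9,11) unfolding e by auto
  show "cot_V (p, z) > 0" using S.V_pos[of z] z unfolding e by simp
  have s: "cot_u (p, z) + cot_v (p, z) = 1 + z * S.R z" using S.sum_eq[of z] unfolding e .
  then show "1 \<le> cot_u (p, z) + cot_v (p, z)" "fst p = 0 \<Longrightarrow> cot_u (p, z) + cot_v (p, z) = 1"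
    using b(7,12) z by simp_all
  have "z * S.H z = 3/2 - (S.x z + 1/2) * (S.u z + S.v z)"
    unfolding S.sum_eq unfolding S.H_def S.x_def by algebra
  then show "fst p < 0 \<Longrightarrow> (cot_x (p, z) + 1/2) * (cot_u (p, z) + cot_v (p, z)) < 3/2"
    using b(10) z mult_pos_pos[OF z, of "S.H z"] unfolding e by simp
qed

lemma cot_xuv_derivatives:
  assumes p: "p \<in> P1" and z: "z > 0"
  defines "x \<equiv> cot_x (p, z)" and "u \<equiv> cot_u (p, z)" and "v \<equiv> cot_v (p, z)"
  shows "((\<lambda>z. cot_x (p, z)) has_real_derivative x * ((x + 1/2) * (u + v) - 3/2) / z) (at z)"
    "((\<lambda>z. cot_u (p, z)) has_real_derivative u * (2 - 2 * u - x * v - 2 * x * u * v) / z) (at z)"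
    "((\<lambda>z. cot_v (p, z)) has_real_derivative v * (2 - 2 * v - x * u - 2 * x * u * v) / z) (at z)"
proof -
  have z1: "z + 1 > 0" "z < z + 1" using z by auto
  interpret S: cot_solution p "z + 1" "\<lambda>z. cot_family (p, z)" by (rule cot_solution_family[OF p z1(1)])
  have e: "S.x = (\<lambda>z. cot_x (p, z))" "S.u = (\<lambda>z. cot_u (p, z))" "S.v = (\<lambda>z. cot_v (p, z))"
    by (simp_all add: fun_eq_iff S.x_def S.X_def S.N_def S.R_def S.u_def S.U_def S.V_def S.v_def cot_x_def cot_u_def cot_v_def cot_N_def cot_V_def cot_R_def)
  have E: "x = S.x z" "u = S.u z" "v = S.v z" by (simp_all add: e x_def u_def v_def)
  have h: "A = B / z" if "z * A = B" for A B using that z by (simp add: field_simps)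
  show "((\<lambda>z. cot_x (p, z)) has_real_derivative x * ((x + 1/2) * (u + v) - 3/2) / z) (at z)"
    unfolding e(1)[symmetric]
  proof (rule DERIV_cong[OF S.x_derivative[OF z z1(2)] h])
    show "z * ((S.X z + (S.x z + 1/2) * S.R z) * S.x z) = x * ((x + 1/2) * (u + v) - 3/2)"
      unfolding E S.sum_eq unfolding S.x_def by algebra
  qed
  show "((\<lambda>z. cot_u (p, z)) has_real_derivative u * (2 - 2 * u - x * v - 2 * x * u * v) / z) (at z)"
    unfolding e(2)[symmetric]
  proof (rule DERIV_cong[OF S.u_derivative[OF z z1(2)] h])
    show "z * ((- 2 * S.U z - S.x z * S.V z - 2 * S.x z * S.u z * S.V z) * S.u z) = u * (2 - 2 * u - x * v - 2 * x * u * v)"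
      unfolding E S.u_def S.v_def by algebra
  qed
  have "((\<lambda>z. z * S.V z) has_real_derivative v * (2 - 2 * v - x * u - 2 * x * u * v) / z) (at z)"
  proof (rule DERIV_cong[OF DERIV_mult[OF DERIV_ident S.derivatives(2)[OF z z1(2)]] h])
    show "z * (1 * S.V z + (- 2 * S.V z - S.X z - S.U z - z * S.X z * S.U z - 2 * S.V z * S.x z * S.u z) * S.V z * z)
       = v * (2 - 2 * v - x * u - 2 * x * u * v)"
      unfolding E S.u_def S.v_def S.x_def by algebra
  qed
  then show "((\<lambda>z. cot_v (p, z)) has_real_derivative v * (2 - 2 * v - x * u - 2 * x * u * v) / z) (at z)"
    unfolding e(3)[symmetric] by (simp only: S.v_def[abs_def])
qed

lemma cot_traj:
  "cot.traj p z = (cot_x (p, z) - 1 + (cot_u (p, z) + cot_v (p, z) - 1) / 2, cot_v (p, z), cot_u (p, z) + cot_v (p, z) - 1)"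
  by (simp add: cot_x_def cot_u_def cot_v_def cot_N_def cot_V_def cot_R_def prod_eq_iff algebra_simps)

text \<open>The coordinates \<open>x\<close> and \<open>u\<close> of a point \<open>(x - 1 + r/2, v, r)\<close>.\<close>

definition pt_x :: "vec3 \<Rightarrow> real" where "pt_x D = 1 + fst D - snd (snd D) / 2"
definition pt_u :: "vec3 \<Rightarrow> real" where "pt_u D = 1 + snd (snd D) - fst (snd D)"

definition cot_g :: "vec3 \<Rightarrow> real" where
  "cot_g D = (snd (snd D) + 2 * pt_x D * pt_u D * fst (snd D)) / 2"
definition cot_m :: "vec3 \<Rightarrow> real" where "cot_m D = sqrt (pt_u D * fst (snd D))"
definition cot_lam :: "vec3 \<Rightarrow> real" where "cot_lam D = 2 / 3 * cot_Lam (pt_x D) (pt_u D) (fst (snd D))"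

lemma cot_traj_values:
  "pt_x (cot.traj p z) = cot_x (p, z)" "pt_u (cot.traj p z) = cot_u (p, z)"
  "cot_g (cot.traj p z) = (cot_u (p, z) + cot_v (p, z) - 1 + 2 * cot_x (p, z) * cot_u (p, z) * cot_v (p, z)) / 2"
  "cot_m (cot.traj p z) = sqrt (cot_u (p, z) * cot_v (p, z))"
  "cot_lam (cot.traj p z) = 2 / 3 * cot_Lam (cot_x (p, z)) (cot_u (p, z)) (cot_v (p, z))"
proof -
  show x: "pt_x (cot.traj p z) = cot_x (p, z)" and u: "pt_u (cot.traj p z) = cot_u (p, z)"
    unfolding cot_traj pt_x_def pt_u_def by simp_all
  have v: "fst (snd (cot.traj p z)) = cot_v (p, z)" "snd (snd (cot.traj p z)) = cot_u (p, z) + cot_v (p, z) - 1"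
    unfolding cot_traj by simp_all
  show "cot_g (cot.traj p z) = (cot_u (p, z) + cot_v (p, z) - 1 + 2 * cot_x (p, z) * cot_u (p, z) * cot_v (p, z)) / 2"
    "cot_m (cot.traj p z) = sqrt (cot_u (p, z) * cot_v (p, z))"
    "cot_lam (cot.traj p z) = 2 / 3 * cot_Lam (cot_x (p, z)) (cot_u (p, z)) (cot_v (p, z))"
    unfolding cot_g_def cot_m_def cot_lam_def x u v by (rule refl)+
qed

lemma cot_size_derivative:
  assumes "p \<in> P1" "z > 0"
  shows "((\<lambda>z. cot_size (p, z)) has_real_derivative cot_size (p, z) * cot_g (cot.traj p z) / z) (at z)"
proof -
  have "((\<lambda>z. cot_size (p, z)) has_real_derivative
     cot_size (p, z) * ((cot_R (p, z) + 2 * cot_x (p, z) * cot_u (p, z) * cot_V (p, z)) / 2)) (at z)"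
    using DERIV_fun_exp[OF primitive_derivative[OF cot_rate_cont assms]] by (simp only: cot_size_def fst_conv snd_conv)
  moreover have "cot_size (p, z) * ((cot_R (p, z) + 2 * cot_x (p, z) * cot_u (p, z) * cot_V (p, z)) / 2)
    = cot_size (p, z) * cot_g (cot.traj p z) / z"
  proof -
    have "cot_u (p, z) + cot_v (p, z) - 1 = z * cot_R (p, z)" by (simp add: cot_u_def cot_v_def algebra_simps)
    then show ?thesis
      unfolding cot_traj_values using assms(2) by (simp add: cot_v_def field_simps)
  qed
  ultimately show ?thesis by simp
qed

lemma cot_size_pos: "cot_size q > 0" by (simp add: cot_size_def)

lemma cot_exp_derivatives:
  assumes p: "p \<in> P1"
  defines "x \<equiv> \<lambda>s. cot_x (p, exp s)" and "u \<equiv> \<lambda>s. cot_u (p, exp s)" and "v \<equiv> \<lambda>s. cot_v (p, exp s)"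
  shows "(x has_real_derivative x s * ((x s + 1/2) * (u s + v s) - 3/2)) (at s)"
    "(u has_real_derivative u s * (2 - 2 * u s - x s * v s - 2 * x s * u s * v s)) (at s)"
    "(v has_real_derivative v s * (2 - 2 * v s - x s * u s - 2 * x s * u s * v s)) (at s)"
  unfolding x_def u_def v_def
  by (rule DERIV_cong[OF DERIV_chain2[OF cot_xuv_derivatives(1)[OF p] DERIV_exp]], simp, simp,
      rule DERIV_cong[OF DERIV_chain2[OF cot_xuv_derivatives(2)[OF p] DERIV_exp]], simp, simp,
      rule DERIV_cong[OF DERIV_chain2[OF cot_xuv_derivatives(3)[OF p] DERIV_exp]], simp, simp)

text \<open>Both equations have the form \<open>y' = y (2 - 2 y - x w - 2 x y w)\<close> with
  \<open>x\<close> and \<open>w\<close> at most 1, so \<open>y' \<ge> y (1 - 4 y)\<close>. The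
  bounds serve both completeness and the limits at infinity.\<close>

lemma cot_uv_lower:
  assumes p: "p \<in> P1"
  obtains k where "k > 0" "\<And>z. z \<ge> 1 \<Longrightarrow> k \<le> cot_u (p, z)" "\<And>z. z \<ge> 1 \<Longrightarrow> k \<le> cot_v (p, z)"
proof -
  define x u v where "x s = cot_x (p, exp s)" and "u s = cot_u (p, exp s)" and "v s = cot_v (p, exp s)" for s
  note d = cot_exp_derivatives[OF p, folded x_def u_def v_def]
  have b: "0 < x s" "x s \<le> 1" "0 < u s" "u s < 1" "0 < v s" "v s < 1" for s
    using cot_bounds[OF p, of "exp s"] by (auto simp: x_def u_def v_def)
  have step: "y * (1 - 4 * y) \<le> y * (2 - 2 * y - a * c - 2 * a * y * c)"
    if "0 \<le> y" "0 \<le> a" "a \<le> 1" "0 \<le> c" "c \<le> 1" for a c y :: real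
  proof (rule mult_left_mono[OF _ that(1)])
    have ac: "a * c \<le> 1" using that mult_mono[of a 1 c 1] by simp
    have "a * c * (2 * y) \<le> 1 * (2 * y)" using ac that by (intro mult_right_mono) auto
    then show "1 - 4 * y \<le> 2 - 2 * y - a * c - 2 * a * y * c" using ac by (simp add: mult_ac)
  qed
  have u: "min (u 0) (1/4) \<le> u s" if "s \<ge> 0" for s
    by (rule logistic_lower_bound[OF d(2) step _ that]) (use b in \<open>auto intro: less_imp_le\<close>)
  have v: "min (v 0) (1/4) \<le> v s" if "s \<ge> 0" for s
  proof (rule logistic_lower_bound[OF d(3) _ _ that])
    show "v s * (1 - 4 * v s) \<le> v s * (2 - 2 * v s - x s * u s - 2 * x s * u s * v s)" for s
      using step[of "v s" "x s" "u s"] b[of s] by (simp add: mult_ac)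
  qed (use b in \<open>auto intro: less_imp_le\<close>)
  have r: "z = exp (ln z)" "ln z \<ge> 0" if "z \<ge> 1" for z :: real using that by auto
  show ?thesis
  proof (rule that[of "min (min (u 0) (v 0)) (1/4)"])
    show "min (min (u 0) (v 0)) (1/4) > 0" using b by simp
    fix z :: real assume z: "z \<ge> 1"
    have "u (ln z) = cot_u (p, z)" "v (ln z) = cot_v (p, z)" using z by (simp_all add: u_def v_def)
    then show "min (min (u 0) (v 0)) (1/4) \<le> cot_u (p, z)" "min (min (u 0) (v 0)) (1/4) \<le> cot_v (p, z)"
      using u[OF r(2)[OF z]] v[OF r(2)[OF z]] by auto
  qed
qed

lemma cot_g_nonneg:
  assumes p: "p \<in> P1" and z: "z > 0"
  shows "cot_g (cot.traj p z) \<ge> 0"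
  using cot_bounds[OF assms] unfolding cot_traj_values by simp

lemma cot_V_pos: "p \<in> P1 \<Longrightarrow> z \<ge> 0 \<Longrightarrow> cot_V (p, z) > 0"
proof -
  assume p: "p \<in> P1" and z: "z \<ge> 0"
  obtain n w where "p = (n, w, 0)" "n \<le> 0" "w > 0" by (rule P1E[OF p]) blast
  then show ?thesis
    using cot_bounds(8)[OF p, of z] cot.Y_0[OF p] z by (cases "z = 0") (simp_all add: cot_V_def)
qed

lemma cot_u_pos: "p \<in> P1 \<Longrightarrow> z \<ge> 0 \<Longrightarrow> cot_u (p, z) > 0"
  using cot_bounds(3)[of p z] by (cases "z = 0") (auto simp: cot_u_def)

text \<open>Since \<open>v = z V\<close>, dividing \<open>sqrt (u v)\<close> by
  \<open>sqrt z\<close> leaves \<open>sqrt (u V)\<close>, which is regular and positive at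
  \<open>z = 0\<close>.\<close>

definition cot_psi :: "vec3 \<times> real \<Rightarrow> real" where
  "cot_psi q = cot_size (fst q, (snd q)\<^sup>2) * sqrt (cot_u (fst q, (snd q)\<^sup>2) * cot_V (fst q, (snd q)\<^sup>2))"

interpretation cot_fam: coh1_family cotangent_field P1 cot_family cot_g cot_m cot_lam cot_size
  "\<lambda>q. (cot_R q + 2 * cot_x q * cot_u q * cot_V q - (cot_N q - cot_R q / 2) - snd q * (cot_N q - cot_R q / 2) * cot_R q) / 3"
  cot_psi
proof
  show "\<And>p z. p \<in> P1 \<Longrightarrow> 0 < z \<Longrightarrow> ((\<lambda>z. cot_size (p, z)) has_real_derivative cot_size (p, z) * cot_g (cot.traj p z) / z) (at z)"
    by (rule cot_size_derivative)
  show "\<And>p z. p \<in> P1 \<Longrightarrow> 0 < z \<Longrightarrow> 0 < cot_size (p, z)" by (rule cot_size_pos)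
  show "\<And>p z. p \<in> P1 \<Longrightarrow> 0 < z \<Longrightarrow> 0 < cot_m (cot.traj p z)"
    unfolding cot_traj_values using cot_bounds(3,5) by simp
  show "continuous_on (P1 \<times> {0..}) cot_psi"
    unfolding cot_psi_def[abs_def] by (intro continuous_intros continuous_on_compose2[OF cot_size_cont]) (auto intro!: continuous_intros)
  show "\<And>p r. p \<in> P1 \<Longrightarrow> 0 \<le> r \<Longrightarrow> 0 < cot_psi (p, r)"
    using cot_V_pos cot_u_pos by (simp add: cot_psi_def cot_size_pos)
  show "cot_psi (p, r) = cot_size (p, r\<^sup>2) * cot_m (cot.traj p (r\<^sup>2)) / r" if "0 < r" for p r
    unfolding cot_traj_values cot_v_def using that by (simp add: cot_psi_def real_sqrt_mult)
  show "\<exists>c>0. \<forall>z\<ge>1. c \<le> cot_size (p, z) * cot_m (cot.traj p z)" if p: "p \<in> P1" for p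
  proof -
    obtain k where k: "k > 0" "\<And>z. z \<ge> 1 \<Longrightarrow> k \<le> cot_u (p, z)" "\<And>z. z \<ge> 1 \<Longrightarrow> k \<le> cot_v (p, z)"
      by (rule cot_uv_lower[OF p]) blast
    show ?thesis
    proof (intro exI[of _ "cot_size (p, 1) * k"] conjI allI impI)
      show "cot_size (p, 1) * k > 0" using k cot_size_pos by simp
      fix z :: real assume z: "1 \<le> z"
      have "cot_size (p, 1) \<le> cot_size (p, z)"
      proof (rule DERIV_nonneg_imp_nondecreasing[OF z])
        fix w assume w: "1 \<le> w" "w \<le> z"
        then have "cot_size (p, w) * cot_g (cot.traj p w) / w \<ge> 0"
          using cot_size_pos[of "(p, w)"] cot_g_nonneg[OF p, of w] by simp
        with cot_size_derivative[OF p, of w] w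
        show "\<exists>y. ((\<lambda>z. cot_size (p, z)) has_real_derivative y) (at w) \<and> 0 \<le> y" by auto
      qed
      moreover have "k \<le> sqrt (cot_u (p, z) * cot_v (p, z))"
        using mult_mono[OF k(2)[OF z] k(3)[OF z]] k cot_bounds[OF p, of z] z
        by (intro real_le_rsqrt) (simp add: power2_eq_square)
      ultimately show "cot_size (p, 1) * k \<le> cot_size (p, z) * cot_m (cot.traj p z)"
        unfolding cot_traj_values using k cot_size_pos[of "(p, z)"] by (intro mult_mono) auto
    qed
  qed
  show "continuous_on (P1 \<times> {0..}) (\<lambda>q. (cot_R q + 2 * cot_x q * cot_u q * cot_V q - (cot_N q - cot_R q / 2) - snd q * (cot_N q - cot_R q / 2) * cot_R q) / 3)"
    by (intro continuous_intros) auto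
  show "cot_lam (cot.traj p z) =
      1 + z * ((cot_R (p, z) + 2 * cot_x (p, z) * cot_u (p, z) * cot_V (p, z) - (cot_N (p, z) - cot_R (p, z) / 2) - snd (p, z) * (cot_N (p, z) - cot_R (p, z) / 2) * cot_R (p, z)) / 3)"
    for p z
  proof -
    have s: "cot_u (p, z) + cot_v (p, z) = 1 + z * cot_R (p, z)" by (simp add: cot_u_def cot_v_def algebra_simps)
    have "cot_Lam (cot_x (p, z)) (cot_u (p, z)) (cot_v (p, z)) = 1 + (cot_u (p, z) + cot_v (p, z))
        + cot_x (p, z) * cot_u (p, z) * cot_v (p, z) - cot_x (p, z) * (cot_u (p, z) + cot_v (p, z)) / 2"
      by (simp add: cot_Lam_def)
    also have "\<dots> = 3/2 + z * (cot_R (p, z) + 2 * cot_x (p, z) * cot_u (p, z) * cot_V (p, z) - (cot_N (p, z) - cot_R (p, z) / 2) - z * (cot_N (p, z) - cot_R (p, z) / 2) * cot_R (p, z)) / 2"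
    proof -
      have "1 + (1 + z * r) + x * u * (z * w) - x * (1 + z * r) / 2 = 3/2 + z * (r + 2 * x * u * w - y - z * y * r) / 2"
        if "x = 1 + z * y" for r x y u w using that by (simp add: field_simps)
      then show ?thesis unfolding s unfolding cot_v_def snd_conv by (simp add: cot_x_def)
    qed
    finally show ?thesis unfolding cot_traj_values by simp
  qed
qed

declare One_nat_def [simp del]

abbreviation "cx p t \<equiv> cot_x (p, cot_fam.zeta p t)"
abbreviation "cu p t \<equiv> cot_u (p, cot_fam.zeta p t)"
abbreviation "cv p t \<equiv> cot_v (p, cot_fam.zeta p t)"
abbreviation "ca p t \<equiv> cot_size (p, cot_fam.zeta p t)"

definition cot_gamma :: "vec3 \<Rightarrow> coh1_metric" where
  "cot_gamma p = cot_metric (cx p) (cu p) (cv p) (ca p)"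

lemma cot_rate: "cot_fam.rate p t = 2 / (ca p t * sqrt (cu p t * cv p t))"
  unfolding cot_fam.rate_def cot_traj_values ..

lemma cot_reduced_family:
  assumes p: "p \<in> P1"
  shows "cot_reduced T (cx p) (cu p) (cv p) (ca p)"
  unfolding cot_reduced_def
proof (intro ballI conjI)
  fix t assume "t \<in> time_interval T"
  then have t: "t > 0" by (simp add: time_interval_def)
  note z = cot_fam.zeta_pos[OF p t]
  note b = cot_bounds[OF p z]
  show "ca p t > 0" "cx p t > 0" "cu p t > 0" "cv p t > 0" using b cot_size_pos by auto
  note d = DERIV_chain2[where f = "\<lambda>z. cot_x (p, z)", OF cot_xuv_derivatives(1)[OF p z] cot_fam.zeta_derivative[OF p t]]
    DERIV_chain2[where f = "\<lambda>z. cot_u (p, z)", OF cot_xuv_derivatives(2)[OF p z] cot_fam.zeta_derivative[OF p t]]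
    DERIV_chain2[where f = "\<lambda>z. cot_v (p, z)", OF cot_xuv_derivatives(3)[OF p z] cot_fam.zeta_derivative[OF p t]]
  show "(cx p has_real_derivative cx p t * ((cx p t + 1/2) * (cu p t + cv p t) - 3/2) * (2 / (ca p t * sqrt (cu p t * cv p t)))) (at t)"
    by (rule DERIV_cong[OF d(1)]) (use z in \<open>simp add: cot_rate\<close>)
  show "(cu p has_real_derivative cu p t * (2 - 2 * cu p t - cx p t * cv p t - 2 * cx p t * cu p t * cv p t) * (2 / (ca p t * sqrt (cu p t * cv p t)))) (at t)"
    by (rule DERIV_cong[OF d(2)]) (use z in \<open>simp add: cot_rate\<close>)
  show "(cv p has_real_derivative cv p t * (2 - 2 * cv p t - cx p t * cu p t - 2 * cx p t * cu p t * cv p t) * (2 / (ca p t * sqrt (cu p t * cv p t)))) (at t)"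
    by (rule DERIV_cong[OF d(3)]) (use z in \<open>simp add: cot_rate\<close>)
  have "s * (2 / (s * r) * (A / 2)) = A / r" if "s > 0" for s r A :: real using that by (simp add: divide_simps)
  from this[OF cot_size_pos]
  show "(ca p has_real_derivative (cu p t + cv p t - 1 + 2 * cx p t * cu p t * cv p t) / sqrt (cu p t * cv p t)) (at t)"
    by (intro DERIV_cong[OF cot_fam.size_t_derivative[OF p t]]) (simp only: cot_rate cot_traj_values)
qed

lemma cot_gamma_spin7: "p \<in> P1 \<Longrightarrow> spin7_metric (- 1) T (cot_gamma p)"
  unfolding cot_gamma_def by (rule cot_metric_spin7[OF cot_reduced_family])

text \<open>The jet in terms of \<open>V = v/z\<close> and \<open>R = (u + v - 1)/z\<close>, which is regular at \<open>z = 0\<close>.\<close>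

definition cot_jet :: "vec3 \<Rightarrow> real \<Rightarrow> real \<times> real \<times> real \<times> real \<times> real \<times> real \<times> real \<times> real" where
  "cot_jet p t =
    (let z = cot_fam.zeta p t; q = (p, z); x = cot_x q; u = cot_u q; v = cot_v q; w = sqrt (cot_V q) in
      (cot_size q, cot_size q * sqrt u, cot_size q * sqrt v, 6 * x * (cot_size q * (sqrt u * sqrt v)),
       sqrt z * (cot_R q + 2 * x * u * cot_V q) / (sqrt u * w), sqrt z * (w * (2 - x) - cot_R q / w),
       (1 + u - v - x * u) / sqrt u, 12 * x\<^sup>2 * ((u + v) / 2 - u * v)))"

lemma cot_gamma_jet:
  assumes p: "p \<in> P1" and t: "t > 0"
  shows "jet1 (cot_gamma p) t = cot_jet p t"
proof -
  have "t \<in> time_interval \<infinity>" using t by (simp add: time_interval_def)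
  note d = cot_metric_derivatives[OF cot_reduced_family[OF p] this, THEN DERIV_imp_deriv]
  define z where "z = cot_fam.zeta p t"
  have z: "z > 0" unfolding z_def by (rule cot_fam.zeta_pos[OF p t])
  have V: "cot_V (p, z) > 0" and u: "cot_u (p, z) > 0" using cot_bounds[OF p z] by auto
  define r w where "r = sqrt z" and "w = sqrt (cot_V (p, z))"
  have r: "r > 0" "z = r * r" "w > 0" "cot_V (p, z) = w * w" using z V by (simp_all add: r_def w_def)
  have v: "cot_v (p, z) = z * cot_V (p, z)" "sqrt (cot_v (p, z)) = r * w"
    by (simp_all add: cot_v_def r_def w_def real_sqrt_mult)
  have s: "cot_u (p, z) + cot_v (p, z) = 1 + z * cot_R (p, z)" by (simp add: cot_u_def cot_v_def algebra_simps)
  have e1: "(cot_u (p, z) + cot_v (p, z) - 1 + 2 * cot_x (p, z) * cot_u (p, z) * cot_v (p, z)) / sqrt (cot_u (p, z) * cot_v (p, z))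
     = r * (cot_R (p, z) + 2 * cot_x (p, z) * cot_u (p, z) * cot_V (p, z)) / (sqrt (cot_u (p, z)) * w)"
    unfolding s real_sqrt_mult v(2) unfolding v(1) using r u by (simp add: r(2) field_simps)
  have e0: "1 + cot_v (p, z) - cot_u (p, z) - cot_x (p, z) * cot_v (p, z) = r * w * (r * (w * (2 - cot_x (p, z)) - cot_R (p, z) / w))"
  proof -
    have "1 + cot_v (p, z) - cot_u (p, z) - cot_x (p, z) * cot_v (p, z) = 2 * cot_v (p, z) - z * cot_R (p, z) - cot_x (p, z) * cot_v (p, z)"
      using s by simp
    note e = this
    show ?thesis unfolding e unfolding v(1) r(4) using r(1,3) by (simp add: r(2) field_simps)
  qed
  have e2: "(1 + cot_v (p, z) - cot_u (p, z) - cot_x (p, z) * cot_v (p, z)) / sqrt (cot_v (p, z))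
     = r * (w * (2 - cot_x (p, z)) - cot_R (p, z) / w)"
    unfolding v(2) e0 using r(1,3) by simp
  show ?thesis
    unfolding cot_gamma_def cot_metric_def jet1.simps d z_def[symmetric] e1 e2
    unfolding cot_jet_def Let_def z_def[symmetric] r_def w_def by simp
qed

lemma cot_zeta_cont: "continuous_on (P1 \<times> {0..}) (\<lambda>q. cot_fam.zeta (fst q) (snd q))"
  using continuous_on_power[OF cot_fam.\<sigma>_cont, of 2]
  unfolding cot_fam.zeta_def prod.collapse .

lemma cot_jet_cont: "continuous_on (P1 \<times> {0..}) (\<lambda>q. cot_jet (fst q) (snd q))"
proof -
  note [continuous_intros] = cot_zeta_cont
  have nonneg: "0 \<le> cot_fam.zeta p t" for p t by (simp add: cot_fam.zeta_def)
  have size: "continuous_on (P1 \<times> {0..}) (\<lambda>q. cot_size (fst q, cot_fam.zeta (fst q) (snd q)))"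
    by (rule continuous_on_compose2[OF cot_size_cont])
      (auto intro!: continuous_intros nonneg)
  have V: "cot_V (fst q, cot_fam.zeta (fst q) (snd q)) \<noteq> 0" "cot_u (fst q, cot_fam.zeta (fst q) (snd q)) \<noteq> 0"
    if "q \<in> P1 \<times> {0..}" for q
    using cot_V_pos[of "fst q" "cot_fam.zeta (fst q) (snd q)"] cot_u_pos[of "fst q" "cot_fam.zeta (fst q) (snd q)"] that nonneg
    by auto
  show ?thesis
    unfolding cot_jet_def Let_def
    using V by (intro continuous_intros size) auto
qed

lemma cot_jet_0:
  assumes p: "p \<in> P1"
  shows "cot_jet p 0 = (1, 1, 0, 0, 0, 0, 1, 6)"
proof -
  have z0: "cot_fam.zeta p 0 = 0" by (simp add: cot_fam.zeta_def cot_fam.\<sigma>_0[OF p])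
  have "cot_size (p, 0) = 1" "cot_x (p, 0) = 1" "cot_u (p, 0) = 1" "cot_v (p, 0) = 0"
    by (simp_all add: cot_size_def cot_x_def cot_u_def cot_v_def)
  then show ?thesis unfolding cot_jet_def Let_def z0 by simp
qed

lemmas cot_singular_orbit = jet_at_singular_orbit[where J = cot_jet, OF cot_jet_cont _ cot_gamma_jet]

lemma cot_closes_up:
  assumes p: "p \<in> P1"
  shows "closes_up_on_M 1 (cot_gamma p)"
  unfolding closes_up_on_M_def
  using cot_singular_orbit(1)[OF p p] cot_jet_0[OF p] by (intro exI[of _ 1]) simp

context expansion_scale
begin

lemma cot_XZ_expands:
  assumes x: "expands x 1 n" and u: "expands u 1 (- q)" and v: "expands v 0 q"
  defines "\<Lambda> \<equiv> \<lambda>t. cot_Lam (x t) (u t) (v t)"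
  shows "expands (\<lambda>t. 1/2 * (u t + v t - 1 + 2 * x t * u t * v t) / \<Lambda> t) 0 (2/3 * q)"
    "expands (\<lambda>t. 1/2 * (1 + v t - u t - x t * v t) / \<Lambda> t) 0 (q / 3)"
    "expands (\<lambda>t. 1/2 * (1 + u t - v t - x t * u t) / \<Lambda> t) (1/3) (- 5/9 * q - 2/9 * n)"
    "expands (\<lambda>t. x t * ((u t + v t) / 2 - u t * v t) / \<Lambda> t) (1/3) (4/9 * n - 8/9 * q)"
    "expands (\<lambda>t. 1/2 / \<Lambda> t) (1/3) (n / 9 - 2/9 * q)"
    "expands (\<lambda>t. 1/2 * u t / \<Lambda> t) (1/3) (n / 9 - 5/9 * q)"
    "expands (\<lambda>t. 1/2 * v t / \<Lambda> t) 0 (q / 3)"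
    "expands (\<lambda>t. 12 * x t * \<Lambda> t) 18 (12 * q + 12 * n)"
proof -
  have L: "expands \<Lambda> (3/2) (q - n / 2)"
    unfolding \<Lambda>_def cot_Lam_def
    by (rule expands_eq) (rule expands_divide expands_add expands_diff expands_mult expands_const x u v | simp)+
  show "expands (\<lambda>t. 1/2 * (u t + v t - 1 + 2 * x t * u t * v t) / \<Lambda> t) 0 (2/3 * q)"
    "expands (\<lambda>t. 1/2 * (1 + v t - u t - x t * v t) / \<Lambda> t) 0 (q / 3)"
    "expands (\<lambda>t. 1/2 * (1 + u t - v t - x t * u t) / \<Lambda> t) (1/3) (- 5/9 * q - 2/9 * n)"
    "expands (\<lambda>t. x t * ((u t + v t) / 2 - u t * v t) / \<Lambda> t) (1/3) (4/9 * n - 8/9 * q)"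
    "expands (\<lambda>t. 1/2 / \<Lambda> t) (1/3) (n / 9 - 2/9 * q)"
    "expands (\<lambda>t. 1/2 * u t / \<Lambda> t) (1/3) (n / 9 - 5/9 * q)"
    "expands (\<lambda>t. 1/2 * v t / \<Lambda> t) 0 (q / 3)"
    "expands (\<lambda>t. 12 * x t * \<Lambda> t) 18 (12 * q + 12 * n)"
    by (rule expands_eq, (rule expands_divide expands_add expands_diff expands_mult expands_const x u v L | simp; fail)+, (simp_all add: field_simps; fail)?)+
qed

end

lemma cot_gamma_expansion:
  assumes s: "s \<in> parameters 1"
  shows "gamma_expansion 1 s \<infinity> (cot_gamma (cot_params s))"
proof -
  define p where "p = cot_params s"
  have p: "p \<in> P1" using s by (simp add: p_def)
  interpret es: expansion_scale "at_right 0" "\<lambda>t. exp (2 / 3 * cot_fam.eta p t)" "\<lambda>t. exp ((2 / 3 + 2 / 3) * cot_fam.eta p t)"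
    by (rule cot_fam.expansion_scale_eta[OF p])
  have zpos: "\<forall>\<^sub>F t in at_right 0. cot_fam.zeta p t > 0"
    using eventually_at_right_less[of "0::real"] by eventually_elim (rule cot_fam.zeta_pos[OF p])
  note tr = cot_fam.expands_traj[OF p es.expansion_scale_axioms cot_fam.expands_zeta[OF p] zpos, unfolded cot_traj fst_conv snd_conv]
  define n where "n = fst p"
  define q where "q = fst (snd p)"
  have p3: "snd (snd p) = 0" by (simp add: p_def cot_params_def)
  have v: "es.expands (cv p) 0 q" using tr(2) by (simp add: q_def)
  \<comment> \<open>The contracting coordinate \<open>r\<close> has no linear term, as the third
    component of \<open>p\<close> is 0. Hence \<open>u\<close> and \<open>v\<close> have opposite
    linear terms and \<open>x\<close> keeps that of the first coordinate.\<close>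
  have sum: "es.expands (\<lambda>t. cu p t + cv p t - 1) 0 0" using tr(3) by (simp add: p3)
  have u: "es.expands (cu p) 1 (- q)"
    using es.expands_diff[OF es.expands_add[OF sum es.expands_const[of 1]] v] by simp
  have x: "es.expands (cx p) 1 n"
    using es.expands_add[OF es.expands_diff[OF tr(1) es.expands_mult[OF es.expands_const[of "1/2"] sum]] es.expands_const[of 1]]
    by (simp add: n_def)
  note E = es.cot_XZ_expands[OF x u v]
  have t_in: "t \<in> time_interval \<infinity>" if "t > 0" for t using that by (simp add: time_interval_def)
  have Lam_pos: "cot_Lam (cx p t) (cu p t) (cv p t) > 0" if t: "t > 0" for t
  proof -
    note b = cot_bounds[OF p cot_fam.zeta_pos[OF p t]]
    have "cx p t * cu p t * cv p t > 0" using b by simp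
    moreover have "cx p t * (cu p t + cv p t) \<le> 1 * (cu p t + cv p t)" using b by (intro mult_right_mono) auto
    moreover have "0 < 1 + (c + d) + i - j / 2" if "0 < i" "j \<le> 1 * (c + d)" "0 < c" "0 < d" for c d i j :: real
      using that by simp
    ultimately show ?thesis using b(3,5) unfolding cot_Lam_def add.assoc[symmetric] by blast
  qed
  have nq: "n = - 9 * fst s - 9 * snd s" "q = 9 * snd s" by (simp_all add: n_def q_def p_def cot_params_def)
  show ?thesis
    unfolding p_def[symmetric]
  proof (rule cot_fam.gamma_expansionI[OF p _ _ _ _ E])
    fix t :: real assume t: "t > 0"
    show "XZ (cot_gamma p) t =
      (1/2 * (cu p t + cv p t - 1 + 2 * cx p t * cu p t * cv p t) / cot_Lam (cx p t) (cu p t) (cv p t),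
       1/2 * (1 + cv p t - cu p t - cx p t * cv p t) / cot_Lam (cx p t) (cu p t) (cv p t),
       1/2 * (1 + cu p t - cv p t - cx p t * cu p t) / cot_Lam (cx p t) (cu p t) (cv p t),
       cx p t * ((cu p t + cv p t) / 2 - cu p t * cv p t) / cot_Lam (cx p t) (cu p t) (cv p t),
       1/2 / cot_Lam (cx p t) (cu p t) (cv p t), 1/2 * cu p t / cot_Lam (cx p t) (cu p t) (cv p t),
       1/2 * cv p t / cot_Lam (cx p t) (cu p t) (cv p t), 12 * cx p t * cot_Lam (cx p t) (cu p t) (cv p t))"
      unfolding cot_gamma_def
      by (rule cot_metric_XZ[OF cot_reduced_family[OF p] t_in[OF t]]) (use Lam_pos[OF t] in simp)
    show "trL (cot_gamma p) t = 3 / 2 * cot_fam.rate p t * cot_lam (cot.traj p (cot_fam.zeta p t))"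
      using cot_metric_trL[OF cot_reduced_family[OF p] t_in[OF t]]
      unfolding cot_traj_values cot_rate cot_gamma_def by simp
  next
    show "P0 1 = (0, 0, 1/3, 1/3, 1/3, 1/3, 0, 18)" by (simp add: P0_def)
    show "fst s *\<^sub>R v1 1 + snd s *\<^sub>R v2 1 = (2/3 * q, q / 3, - 5/9 * q - 2/9 * n, 4/9 * n - 8/9 * q,
      n / 9 - 2/9 * q, n / 9 - 5/9 * q, q / 3, 12 * q + 12 * n)"
      by (simp add: v1_def v2_def nq algebra_simps)
  qed
qed

section \<open>Asymptotics on \<open>M\<^sup>(\<^sup>1\<^sup>)\<close>\<close>

lemma cot_exp_bounds:
  assumes p: "p \<in> P1"
  shows "0 < cot_x (p, exp s)" "cot_x (p, exp s) \<le> 1" "0 < cot_u (p, exp s)" "cot_u (p, exp s) < 1"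
    "0 < cot_v (p, exp s)" "cot_v (p, exp s) < 1" "1 \<le> cot_u (p, exp s) + cot_v (p, exp s)"
  by (rule cot_bounds[OF p exp_gt_zero])+

text \<open>The counterpart of the identity for \<open>H\<close> in the time \<open>ln z\<close>:
  here \<open>e = z H\<close> is the exponential decay rate of \<open>x\<close>. Writing
  \<open>P\<close> for \<open>1/p\<close> again keeps the verification polynomial.\<close>

lemma cot_eta_derivative_identity:
  fixes x u v :: real
  assumes "u + v \<noteq> 0"
  defines "p \<equiv> u + v" and "e \<equiv> 3/2 - (x + 1/2) * (u + v)"
  shows "- (x * ((x + 1/2) * p - 3/2) * p + (u * (2 - 2 * u - x * v - 2 * x * u * v) + v * (2 - 2 * v - x * u - 2 * x * u * v)) * (x + 1/2))
    = (p * x - 2 * u * v * (x + 1/2) * (1 + p) / p) * e + (x + 1/2) * (2 * p - u * v * (p + 3) / p) * (p - 1)"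
proof -
  define P where "P = 1 / p"
  have P: "p * P = 1" using assms(1) by (simp add: P_def p_def)
  have e: "e = 3/2 - (x + 1/2) * p" by (simp add: e_def p_def)
  have "(p * x - 2 * u * v * (x + 1/2) * (1 + p) / p) * e + (x + 1/2) * (2 * p - u * v * (p + 3) / p) * (p - 1)
    = (p * x - 2 * u * v * (x + 1/2) * (1 + p) * P) * (3/2 - (x + 1/2) * p) + (x + 1/2) * (2 * p - u * v * (p + 3) * P) * (p - 1)"
    unfolding e P_def by simp
  also have "\<dots> = p * x * (3/2 - (x + 1/2) * p) + (x + 1/2) * 2 * p * (p - 1)
      + (x + 1/2) * u * v * (2 * (1 + p) * (x + 1/2) - p - 5) * (p * P)"
    by algebra
  also have "\<dots> = p * x * (3/2 - (x + 1/2) * p) + (x + 1/2) * 2 * p * (p - 1) + (x + 1/2) * u * v * (2 * (1 + p) * (x + 1/2) - p - 5)"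
    unfolding P by simp
  finally have "(p * x - 2 * u * v * (x + 1/2) * (1 + p) / p) * e + (x + 1/2) * (2 * p - u * v * (p + 3) / p) * (p - 1)
    = p * x * (3/2 - (x + 1/2) * p) + (x + 1/2) * 2 * p * (p - 1) + (x + 1/2) * u * v * (2 * (1 + p) * (x + 1/2) - p - 5)" .
  then show ?thesis unfolding p_def by algebra
qed

text \<open>Positivity of the decay rate \<open>e\<close> is not enough; a uniform bound is wanted.
  With \<open>q = u + v\<close> one has \<open>1 - x - e = (x + 1/2)(q - 1)\<close>, and
  \<open>1 - x\<close> stays above \<open>D\<close>. So where \<open>e\<close> is small,
  \<open>q\<close> exceeds 1 by a definite amount, and the source term in \<open>e'\<close> pushes
  \<open>e\<close> back up.\<close>

lemma cot_x_decay:
  assumes p: "p \<in> P1" and neg: "fst p < 0"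
  obtains c where "c > 0" "\<And>s. s \<ge> 0 \<Longrightarrow> c \<le> 3/2 - (cot_x (p, exp s) + 1/2) * (cot_u (p, exp s) + cot_v (p, exp s))"
proof -
  define x u v where "x s = cot_x (p, exp s)" and "u s = cot_u (p, exp s)" and "v s = cot_v (p, exp s)" for s
  define e where "e s = 3/2 - (x s + 1/2) * (u s + v s)" for s
  note d = cot_exp_derivatives[OF p, folded x_def u_def v_def]
  note b = cot_exp_bounds[OF p, folded x_def u_def v_def]
  have e_pos: "e s > 0" for s
    using cot_bounds(10)[OF p exp_gt_zero neg, of s] by (simp add: e_def x_def u_def v_def)
  define e' where "e' s = ((u s + v s) * x s - 2 * u s * v s * (x s + 1/2) * (1 + (u s + v s)) / (u s + v s)) * e s
      + (x s + 1/2) * (2 * (u s + v s) - u s * v s * ((u s + v s) + 3) / (u s + v s)) * (u s + v s - 1)" for s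
  have e_der: "(e has_real_derivative e' s) (at s)" for s
  proof -
    have n: "u s + v s \<noteq> 0" using b(7)[of s] by simp
    have "(e has_real_derivative 0 - ((x s * ((x s + 1/2) * (u s + v s) - 3/2) + 0) * (u s + v s)
      + (u s * (2 - 2 * u s - x s * v s - 2 * x s * u s * v s) + v s * (2 - 2 * v s - x s * u s - 2 * x s * u s * v s)) * (x s + 1/2))) (at s)"
      unfolding e_def by (intro DERIV_diff DERIV_mult DERIV_add DERIV_const d)
    then show ?thesis using cot_eta_derivative_identity[OF n, of "x s"] by (simp only: e_def e'_def add_0_right diff_0)
  qed
  have x_mono: "x s \<le> x 0" if "s \<ge> 0" for s
  proof (rule DERIV_nonpos_imp_nonincreasing[OF that])
    fix r
    have "x r * ((x r + 1/2) * (u r + v r) - 3/2) \<le> 0"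
      using b(1)[of r] e_pos[of r] by (intro mult_nonneg_nonpos) (auto simp: e_def)
    then show "\<exists>y. (x has_real_derivative y) (at r) \<and> y \<le> 0" using d(1)[of r] by blast
  qed
  define D where "D = 1 - x 0"
  have D: "D > 0" using cot_bounds(9)[OF p exp_gt_zero neg, of 0] by (simp add: D_def x_def)
  \<comment> \<open>\<open>D/21\<close> is the equilibrium of the comparison equation
    \<open>e' = D/4 - 21/4 e\<close>. The coefficient 21/4 is 5, from the linear term of
    \<open>e'\<close>, plus 1/4, from rewriting the source term by means of
    \<open>D - e \<le> 3/2 (q - 1)\<close>.\<close>
  define c where "c = min (e 0) (D / 21)"
  have lower: "D / 4 - 21/4 * e s \<le> e' s" if s: "s \<ge> 0" for s
  proof -
    define q where "q = u s + v s"
    have q: "1 \<le> q" "q < 2" using b[of s] by (auto simp: q_def)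
    have xb: "0 < x s" "x s \<le> 1" by (rule b)+
    have "u s * v s \<le> u s * 1" "u s * v s \<le> 1 * v s"
      using b(3-6)[of s] by (intro mult_left_mono mult_right_mono; simp)+
    from add_mono[OF this] have "2 * (u s * v s) \<le> 1 * q"
      unfolding q_def mult_2 mult_1_left mult_1_right .
    then have "2 * u s * v s \<le> 1 * q" by (simp only: mult.assoc)
    then have "2 * u s * v s / q \<le> 1" using q by (simp add: divide_le_eq)
    then have "(2 * u s * v s / q) * ((x s + 1/2) * (1 + q)) \<le> 1 * (3/2 * 3)"
      using xb q b(3,5)[of s] by (intro mult_mono) auto
    moreover have "0 \<le> q * x s" using xb q by simp
    ultimately have l: "0 - 1 * (3/2 * 3) \<le> q * x s - (2 * u s * v s / q) * ((x s + 1/2) * (1 + q))" by (intro diff_mono)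
    have e: "(2 * u s * v s / q) * ((x s + 1/2) * (1 + q)) = 2 * u s * v s * (x s + 1/2) * (1 + q) / q" by simp
    have "(- 5 :: real) \<le> 0 - 1 * (3/2 * 3)" by simp
    from order_trans[OF this l[unfolded e]] have "- 5 \<le> q * x s - 2 * u s * v s * (x s + 1/2) * (1 + q) / q" .
    then have 1: "- 5 * e s \<le> (q * x s - 2 * u s * v s * (x s + 1/2) * (1 + q) / q) * e s"
      using e_pos[of s] by (intro mult_right_mono) auto
    have "1 * 3 / 4 \<le> q * (5 - q) / 4" using q by (intro divide_right_mono mult_mono) auto
    also have "\<dots> \<le> 2 * q - u s * v s * (q + 3) / q"
      unfolding q_def by (rule cot_quotient_bound) (rule b)+
    finally have "1/2 * (3/4) \<le> (x s + 1/2) * (2 * q - u s * v s * (q + 3) / q)"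
      using xb by (intro mult_mono) auto
    then have 2: "3/8 * (q - 1) \<le> (x s + 1/2) * (2 * q - u s * v s * (q + 3) / q) * (q - 1)"
      using q by (intro mult_right_mono) auto
    have "x s * (q - 1) \<le> 1 * (q - 1)" using xb q by (intro mult_right_mono) auto
    then have "D - e s \<le> 3/2 * (q - 1)"
      using x_mono[OF s] by (simp add: D_def e_def q_def[symmetric] algebra_simps)
    then have "D / 4 - e s / 4 \<le> 3/8 * (q - 1)" by simp
    then show ?thesis using 1 2 unfolding e'_def q_def[symmetric] by linarith
  qed
  have "c \<le> e s" if s: "s \<ge> 0" for s
  proof -
    have "(\<lambda>s. e s - c) 0 * exp (integral {0..s} (\<lambda>s. - (21/4))) \<le> (\<lambda>s. e s - c) s"
    proof (rule linear_lower_bound[OF _ _ _ _ s])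
      have "continuous_on {0..s} e" by (rule DERIV_continuous_on) (rule DERIV_subset[OF e_der], simp)
      then show "continuous_on {0..s} (\<lambda>s. e s - c)" by (intro continuous_intros)
      fix r assume r: "0 < r" "r < s"
      show "((\<lambda>s. e s - c) has_real_derivative e' r) (at r)"
        by (rule DERIV_cong[OF DERIV_diff[OF e_der DERIV_const]]) simp
      have "c \<le> D / 21" by (simp add: c_def)
      then have "21/4 * c - 21/4 * e r \<le> D / 4 - 21/4 * e r" by (intro diff_right_mono) simp
      moreover have "- (21/4) * (e r - c) = 21/4 * c - 21/4 * e r" by algebra
      ultimately have "- (21/4) * (e r - c) \<le> D / 4 - 21/4 * e r" by simp
      also note lower[OF less_imp_le[OF r(1)]]
      finally show "- (21/4) * (e r - c) \<le> e' r" .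
    qed (intro continuous_intros)
    moreover have "0 \<le> (e 0 - c) * exp (integral {0..s} (\<lambda>s. - (21/4)))" by (intro mult_nonneg_nonneg) (auto simp: c_def)
    ultimately have "0 \<le> e s - c" using order_trans by blast
    then show ?thesis by simp
  qed
  moreover have "c > 0" using D e_pos[of 0] by (simp add: c_def)
  ultimately show thesis using that[of c] unfolding e_def x_def u_def v_def by blast
qed

lemma cot_limits_ALC:
  assumes p: "p \<in> P1" and neg: "fst p < 0"
  shows "((\<lambda>s. cot_x (p, exp s)) \<longlongrightarrow> 0) at_top" "((\<lambda>s. cot_u (p, exp s)) \<longlongrightarrow> 1) at_top"
    "((\<lambda>s. cot_v (p, exp s)) \<longlongrightarrow> 1) at_top"
    "\<exists>l>0. ((\<lambda>s. 6 * cot_x (p, exp s) * (cot_size (p, exp s) * (sqrt (cot_u (p, exp s)) * sqrt (cot_v (p, exp s))))) \<longlongrightarrow> l) at_top"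
proof -
  define x u v where "x s = cot_x (p, exp s)" and "u s = cot_u (p, exp s)" and "v s = cot_v (p, exp s)" for s
  note d = cot_exp_derivatives[OF p, folded x_def u_def v_def]
  note b = cot_exp_bounds[OF p, folded x_def u_def v_def]
  obtain c where c: "c > 0" "\<And>s. s \<ge> 0 \<Longrightarrow> c \<le> 3/2 - (x s + 1/2) * (u s + v s)"
    unfolding x_def u_def v_def by (rule cot_x_decay[OF assms]) blast
  obtain k where k: "k > 0" "\<And>z. z \<ge> 1 \<Longrightarrow> k \<le> cot_u (p, z)" "\<And>z. z \<ge> 1 \<Longrightarrow> k \<le> cot_v (p, z)"
    by (rule cot_uv_lower[OF p]) blast
  have le: "x s * ((x s + 1/2) * (u s + v s) - 3/2) \<le> - c * x s" if s: "s \<ge> 0" for s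
    using mult_left_mono[OF c(2)[OF s] less_imp_le[OF b(1)]] by (simp add: algebra_simps)
  have x: "(x \<longlongrightarrow> 0) at_top"
    by (rule relaxation_tendsto_0[where e = "\<lambda>_. 0" and ?t0.0 = 0, OF d(1) _ c(1)]) (use le b in \<open>auto intro: less_imp_le\<close>)
  \<comment> \<open>Stated for abstract \<open>y\<close> and \<open>w\<close> because
    \<open>u\<close> and \<open>v\<close> satisfy the same equation with the roles exchanged. As
    \<open>x\<close> tends to 0 it approaches \<open>y' = 2 y (1 - y)\<close>.\<close>
  have relax: "(y \<longlongrightarrow> 1) at_top"
    if y: "\<And>s. (y has_real_derivative y s * (2 - 2 * y s - x s * w s - 2 * x s * y s * w s)) (at s)"
      "\<And>s. s \<ge> 0 \<Longrightarrow> k \<le> y s" "\<And>s. 0 < w s" "\<And>s. w s < 1" "\<And>s. y s < 1" for y w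
  proof -
    have "((\<lambda>s. 1 - y s) \<longlongrightarrow> 0) at_top"
    proof (rule relaxation_tendsto_0[where e = "\<lambda>s. 3 * x s" and ?t0.0 = 0 and k = "2 * k"])
      fix s :: real assume s: "s \<ge> 0"
      show "((\<lambda>s. 1 - y s) has_real_derivative 0 - y s * (2 - 2 * y s - x s * w s - 2 * x s * y s * w s)) (at s)"
        by (intro DERIV_diff DERIV_const y)
      have yb: "0 < y s" using y(2)[OF s] k(1) by simp
      have "x s * y s * w s \<le> x s * 1 * 1" using yb y(3-5)[of s] b(1)[of s] by (intro mult_mono) (auto intro: less_imp_le)
      then have "(x s * y s * w s) * (1 + 2 * y s) \<le> x s * 3" using yb y(3-5)[of s] b(1)[of s] by (intro mult_mono) (auto intro: less_imp_le)
      moreover have "k * (1 - y s) \<le> y s * (1 - y s)" using y(2)[OF s] y(5)[of s] by (intro mult_right_mono) auto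
      moreover have "0 - y s * (2 - 2 * y s - x s * w s - 2 * x s * y s * w s) = - (2 * (y s * (1 - y s))) + (x s * y s * w s) * (1 + 2 * y s)"
        by (simp add: algebra_simps)
      ultimately show "0 - y s * (2 - 2 * y s - x s * w s - 2 * x s * y s * w s) \<le> - (2 * k) * (1 - y s) + 3 * x s"
      proof -
        assume *: "(x s * y s * w s) * (1 + 2 * y s) \<le> x s * 3" "k * (1 - y s) \<le> y s * (1 - y s)"
          and eq: "0 - y s * (2 - 2 * y s - x s * w s - 2 * x s * y s * w s) = - (2 * (y s * (1 - y s))) + (x s * y s * w s) * (1 + 2 * y s)"
        have "- (2 * (y s * (1 - y s))) + (x s * y s * w s) * (1 + 2 * y s) \<le> - (2 * (k * (1 - y s))) + x s * 3"
          using * by (intro add_mono) auto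
        then show ?thesis unfolding eq by (simp add: mult_ac)
      qed
      show "0 \<le> 1 - y s" using y(5)[of s] by simp
    next
      show "((\<lambda>s. 3 * x s) \<longlongrightarrow> 0) at_top" by (rule tendsto_mult_right_zero[OF x])
    qed (use k in auto)
    from tendsto_diff[OF tendsto_const[of 1] this] show ?thesis by simp
  qed
  show "((\<lambda>s. cot_x (p, exp s)) \<longlongrightarrow> 0) at_top" using x by (simp add: x_def[abs_def])
  show "((\<lambda>s. cot_u (p, exp s)) \<longlongrightarrow> 1) at_top"
    unfolding u_def[symmetric] by (rule relax[OF d(2)]) (use b k(2) in \<open>auto simp: u_def\<close>)
  show "((\<lambda>s. cot_v (p, exp s)) \<longlongrightarrow> 1) at_top"
    unfolding v_def[symmetric]
  proof (rule relax[of _ u])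
    show "(v has_real_derivative v s * (2 - 2 * v s - x s * u s - 2 * x s * v s * u s)) (at s)" for s
      using d(3)[of s] by (simp add: mult_ac)
  qed (use b k(3) in \<open>auto simp: v_def\<close>)
  define a where "a s = cot_size (p, exp s)" for s
  have a_pos: "a s > 0" for s by (simp add: a_def cot_size_pos)
  have a_der: "(a has_real_derivative a s * ((u s + v s - 1 + 2 * x s * u s * v s) / 2)) (at s)" for s
    unfolding a_def
    by (rule DERIV_cong[OF DERIV_chain2[where f = "\<lambda>z. cot_size (p, z)", OF cot_size_derivative[OF p exp_gt_zero] DERIV_exp]])
      (simp add: cot_traj_values u_def v_def x_def)
  \<comment> \<open>The logarithm of \<open>f/6\<close>. Its derivative lies between 0 and
    \<open>x\<close>, while \<open>x' \<le> - c x\<close>; so \<open>F\<close> increases and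
    \<open>F + x/c\<close> decreases, which makes \<open>f\<close> converge to a positive
    limit.\<close>
  define F where "F s = ln (x s) + ln (a s) + (ln (u s) + ln (v s)) / 2" for s
  have F: "(F has_real_derivative x s * ((u s + v s) / 2 - u s * v s)) (at s)" for s
  proof -
    have quot: "1 / y * (y * w) = w" if "y > 0" for y w :: real using that by simp
    have "(F has_real_derivative 1 / x s * (x s * ((x s + 1/2) * (u s + v s) - 3/2)) + 1 / a s * (a s * ((u s + v s - 1 + 2 * x s * u s * v s) / 2))
      + (1 / u s * (u s * (2 - 2 * u s - x s * v s - 2 * x s * u s * v s)) + 1 / v s * (v s * (2 - 2 * v s - x s * u s - 2 * x s * u s * v s))) / 2) (at s)"
      unfolding F_def
      by (intro DERIV_add DERIV_cdivide DERIV_chain2[OF DERIV_ln_divide] d a_der a_pos b)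
    then show ?thesis
      unfolding quot[OF b(1)] quot[OF b(3)] quot[OF b(5)] quot[OF a_pos]
      by (rule DERIV_cong) (simp add: field_simps)
  qed
  have w: "0 \<le> (u s + v s) / 2 - u s * v s" "(u s + v s) / 2 - u s * v s \<le> 1" for s
  proof -
    have "u s * v s \<le> u s * 1" "u s * v s \<le> 1 * v s" using b[of s] by (auto intro!: mult_left_mono mult_right_mono)
    then show "0 \<le> (u s + v s) / 2 - u s * v s" by simp
    have "(u s + v s) / 2 \<le> 1" using b(4,6)[of s] by simp
    moreover have "y - w \<le> y" if "0 \<le> w" for y w :: real using that by simp
    then have "(u s + v s) / 2 - u s * v s \<le> (u s + v s) / 2" using b(3,5)[of s] by (simp only: mult_nonneg_nonneg less_imp_le)
    ultimately show "(u s + v s) / 2 - u s * v s \<le> 1" by (rule order_trans[rotated])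
  qed
  have mono: "F s \<le> F t" if "s \<le> t" for s t
  proof (rule DERIV_nonneg_imp_nondecreasing[OF that])
    fix r
    have "0 \<le> x r * ((u r + v r) / 2 - u r * v r)" using w(1)[of r] b(1)[of r] by simp
    then show "\<exists>y. (F has_real_derivative y) (at r) \<and> 0 \<le> y" using F by blast
  qed
  have bound: "F s \<le> F 0 + x 0 / c" if s: "s \<ge> 0" for s
  proof -
    have "(\<lambda>s. F s + x s / c) s \<le> (\<lambda>s. F s + x s / c) 0"
    proof (rule DERIV_nonpos_imp_nonincreasing[OF s])
      fix r assume r: "0 \<le> r" "r \<le> s"
      have "((\<lambda>s. F s + x s / c) has_real_derivative x r * ((u r + v r) / 2 - u r * v r) + x r * ((x r + 1/2) * (u r + v r) - 3/2) / c) (at r)"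
        by (intro DERIV_add F DERIV_cdivide d)
      moreover have "x r * ((x r + 1/2) * (u r + v r) - 3/2) / c \<le> - c * x r / c"
        using c(1) le[OF r(1)] by (intro divide_right_mono) auto
      then have "x r * ((x r + 1/2) * (u r + v r) - 3/2) / c \<le> - x r" using c(1) by simp
      moreover have "x r * ((u r + v r) / 2 - u r * v r) \<le> x r * 1"
        using b(1)[of r] w(2)[of r] by (intro mult_left_mono) auto
      ultimately show "\<exists>y. ((\<lambda>s. F s + x s / c) has_real_derivative y) (at r) \<and> y \<le> 0"
        by (intro exI conjI) auto
    qed
    moreover have "x s / c \<ge> 0" using b(1)[of s] c(1) by simp
    ultimately show ?thesis by simp
  qed
  obtain L where "(F \<longlongrightarrow> L) at_top"
    using monotone_bounded_limit[of F, OF mono bound] by blast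
  then have "((\<lambda>s. 6 * exp (F s)) \<longlongrightarrow> 6 * exp L) at_top" by (intro tendsto_intros)
  moreover have "6 * exp (F s) = 6 * cot_x (p, exp s) * (cot_size (p, exp s) * (sqrt (cot_u (p, exp s)) * sqrt (cot_v (p, exp s))))" for s
  proof -
    have "exp ((ln (u s) + ln (v s)) / 2) = sqrt (u s) * sqrt (v s)"
      using b(3,5)[of s] by (simp add: add_divide_distrib exp_add ln_sqrt[symmetric])
    then show ?thesis
      using b(1)[of s] a_pos[of s] by (simp add: F_def exp_add x_def u_def v_def a_def mult_ac)
  qed
  ultimately show "\<exists>l>0. ((\<lambda>s. 6 * cot_x (p, exp s) * (cot_size (p, exp s) * (sqrt (cot_u (p, exp s)) * sqrt (cot_v (p, exp s))))) \<longlongrightarrow> l) at_top"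
    by (intro exI[of _ "6 * exp L"]) simp
qed

text \<open>For \<open>x = 1\<close> and \<open>u = 1 - v\<close> the system collapses to
  \<open>v' = v (1 - v)(1 - 2 v)\<close>. The lower bounds on \<open>u\<close> and \<open>v\<close>
  give the squared distance of \<open>v\<close> to 1/2 an exponential rate.\<close>

lemma cot_limits_AC:
  assumes p: "p \<in> P1" and zero: "fst p = 0"
  shows "((\<lambda>s. cot_x (p, exp s)) \<longlongrightarrow> 1) at_top" "((\<lambda>s. cot_u (p, exp s)) \<longlongrightarrow> 1/2) at_top"
    "((\<lambda>s. cot_v (p, exp s)) \<longlongrightarrow> 1/2) at_top"
proof -
  define v where "v s = cot_v (p, exp s)" for s
  have x1: "cot_x (p, exp s) = 1" and u1: "cot_u (p, exp s) = 1 - v s" for s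
    using cot_bounds(11,12)[OF p exp_gt_zero zero, of s] by (auto simp: v_def)
  obtain k where k: "k > 0" "\<And>z. z \<ge> 1 \<Longrightarrow> k \<le> cot_u (p, z)" "\<And>z. z \<ge> 1 \<Longrightarrow> k \<le> cot_v (p, z)"
    by (rule cot_uv_lower[OF p]) blast
  show "((\<lambda>s. cot_x (p, exp s)) \<longlongrightarrow> 1) at_top" by (simp add: x1)
  have "((\<lambda>s. (v s - 1/2)\<^sup>2) \<longlongrightarrow> 0) at_top"
  proof (rule relaxation_tendsto_0[where e = "\<lambda>_. 0" and ?t0.0 = 0 and k = "4 * (k * k)"])
    fix s :: real assume s: "s \<ge> 0"
    have "(v has_real_derivative v s * (2 - 2 * v s - 1 * (1 - v s) - 2 * 1 * (1 - v s) * v s)) (at s)"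
      using cot_exp_derivatives(3)[OF p, of s] unfolding x1 u1 v_def[symmetric] .
    from DERIV_power[OF DERIV_diff[OF this DERIV_const[of "1/2"]], of 2]
    show "((\<lambda>s. (v s - 1/2)\<^sup>2) has_real_derivative - 4 * ((1 - v s) * v s) * (v s - 1/2)\<^sup>2) (at s)"
      by (rule DERIV_cong) (simp add: field_simps power2_eq_square)
    have "k \<le> 1 - v s" "k \<le> v s" using k(2,3)[of "exp s"] s u1[of s] by (auto simp: v_def)
    then have "4 * (k * k) * (v s - 1/2)\<^sup>2 \<le> 4 * ((1 - v s) * v s) * (v s - 1/2)\<^sup>2"
      using k(1) by (intro mult_right_mono mult_left_mono mult_mono) auto
    then show "- 4 * ((1 - v s) * v s) * (v s - 1/2)\<^sup>2 \<le> - (4 * (k * k)) * (v s - 1/2)\<^sup>2 + 0" by simp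
  qed (use k in auto)
  from tendsto_real_sqrt[OF this] have "((\<lambda>s. \<bar>v s - 1/2\<bar>) \<longlongrightarrow> 0) at_top" by simp
  then have "((\<lambda>s. v s - 1/2) \<longlongrightarrow> 0) at_top" by (rule tendsto_rabs_zero_cancel)
  from tendsto_add[OF this tendsto_const[of "1/2"]] have v: "(v \<longlongrightarrow> 1/2) at_top" by simp
  then show "((\<lambda>s. cot_v (p, exp s)) \<longlongrightarrow> 1/2) at_top" by (simp add: v_def[abs_def])
  from tendsto_diff[OF tendsto_const[of 1] v] show "((\<lambda>s. cot_u (p, exp s)) \<longlongrightarrow> 1/2) at_top"
    unfolding u1 by simp
qed

lemma cot_gamma_sq_length:
  assumes p: "p \<in> P1" and t: "t > 0"
  shows "k \<in> {1, 2} \<Longrightarrow> sq_length (cot_gamma p) t k = (ca p t)\<^sup>2"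
    "k \<in> {3, 4} \<Longrightarrow> sq_length (cot_gamma p) t k = (ca p t)\<^sup>2 * cu p t"
    "k \<in> {5, 6} \<Longrightarrow> sq_length (cot_gamma p) t k = (ca p t)\<^sup>2 * cv p t"
    "sq_length (cot_gamma p) t 7 = (6 * cx p t * (ca p t * (sqrt (cu p t) * sqrt (cv p t))))\<^sup>2"
  using cot_bounds(3,5)[OF p cot_fam.zeta_pos[OF p t]]
  by (auto simp: cot_gamma_def cot_metric_def power_mult_distrib)

lemma cot_asymptotics:
  assumes p: "p \<in> P1" and x: "((\<lambda>s. cot_x (p, exp s)) \<longlongrightarrow> X) at_top" and u: "((\<lambda>s. cot_u (p, exp s)) \<longlongrightarrow> U) at_top"
    and v: "((\<lambda>s. cot_v (p, exp s)) \<longlongrightarrow> V) at_top" and pos: "U > 0" "V > 0"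
  defines "A \<equiv> (U + V - 1 + 2 * X * U * V) / sqrt (U * V)"
  shows "k \<in> {1, 2} \<Longrightarrow> ((\<lambda>t. sq_length (cot_gamma p) t k / t\<^sup>2) \<longlongrightarrow> A\<^sup>2) at_top"
    "k \<in> {3, 4} \<Longrightarrow> ((\<lambda>t. sq_length (cot_gamma p) t k / t\<^sup>2) \<longlongrightarrow> A\<^sup>2 * U) at_top"
    "k \<in> {5, 6} \<Longrightarrow> ((\<lambda>t. sq_length (cot_gamma p) t k / t\<^sup>2) \<longlongrightarrow> A\<^sup>2 * V) at_top"
    "((\<lambda>t. sq_length (cot_gamma p) t 7 / t\<^sup>2) \<longlongrightarrow> (6 * X * (A * (sqrt U * sqrt V)))\<^sup>2) at_top"
proof -
  note zx = cot_fam.tendsto_zeta[OF p x]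
  note zu = cot_fam.tendsto_zeta[OF p u]
  note zv = cot_fam.tendsto_zeta[OF p v]
  have a: "((\<lambda>t. ca p t / t) \<longlongrightarrow> A) at_top"
  proof (rule derivative_limit_imp_slope_limit)
    fix t :: real assume "t > 0"
    then show "(ca p has_real_derivative (cu p t + cv p t - 1 + 2 * cx p t * cu p t * cv p t) / sqrt (cu p t * cv p t)) (at t)"
      using cot_reduced_family[OF p, of \<infinity>] by (auto simp: cot_reduced_def time_interval_def)
  next
    show "((\<lambda>t. (cu p t + cv p t - 1 + 2 * cx p t * cu p t * cv p t) / sqrt (cu p t * cv p t)) \<longlongrightarrow> A) at_top"
      unfolding A_def using pos by (intro tendsto_intros zx zu zv) auto
  qed
  have ev: "\<forall>\<^sub>F t::real in at_top. t > 0" by (rule eventually_gt_at_top)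
  note sq = cot_gamma_sq_length[OF p]
  have "((\<lambda>t. (ca p t / t)\<^sup>2) \<longlongrightarrow> A\<^sup>2) at_top" by (intro tendsto_intros a)
  then show "((\<lambda>t. sq_length (cot_gamma p) t k / t\<^sup>2) \<longlongrightarrow> A\<^sup>2) at_top" if "k \<in> {1, 2}"
    by (rule Lim_transform_eventually) (use ev in eventually_elim, use sq(1)[OF _ that] in \<open>simp add: power_divide\<close>)
  have "((\<lambda>t. (ca p t / t)\<^sup>2 * cu p t) \<longlongrightarrow> A\<^sup>2 * U) at_top" by (intro tendsto_intros a zu)
  then show "((\<lambda>t. sq_length (cot_gamma p) t k / t\<^sup>2) \<longlongrightarrow> A\<^sup>2 * U) at_top" if "k \<in> {3, 4}"
    by (rule Lim_transform_eventually) (use ev in eventually_elim, use sq(2)[OF _ that] in \<open>simp add: power_divide\<close>)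
  have "((\<lambda>t. (ca p t / t)\<^sup>2 * cv p t) \<longlongrightarrow> A\<^sup>2 * V) at_top" by (intro tendsto_intros a zv)
  then show "((\<lambda>t. sq_length (cot_gamma p) t k / t\<^sup>2) \<longlongrightarrow> A\<^sup>2 * V) at_top" if "k \<in> {5, 6}"
    by (rule Lim_transform_eventually) (use ev in eventually_elim, use sq(3)[OF _ that] in \<open>simp add: power_divide\<close>)
  have "((\<lambda>t. (6 * cx p t * (ca p t / t * (sqrt (cu p t) * sqrt (cv p t))))\<^sup>2) \<longlongrightarrow> (6 * X * (A * (sqrt U * sqrt V)))\<^sup>2) at_top"
    by (intro tendsto_intros a zx zu zv)
  then show "((\<lambda>t. sq_length (cot_gamma p) t 7 / t\<^sup>2) \<longlongrightarrow> (6 * X * (A * (sqrt U * sqrt V)))\<^sup>2) at_top"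
    by (rule Lim_transform_eventually) (use ev in eventually_elim, use sq(4) in \<open>simp add: power_divide power_mult_distrib\<close>)
qed

lemma cot_ALC:
  assumes p: "p \<in> P1" and neg: "fst p < 0"
  shows "asymptotic_to_cone 6 (cot_gamma p) (\<lambda>_. 1)"
    "\<exists>l>0. ((\<lambda>t. sqrt (sq_length (cot_gamma p) t 7)) \<longlongrightarrow> l) at_top"
proof -
  note L = cot_limits_ALC[OF assms]
  note A = cot_asymptotics[OF p L(1,2,3) zero_less_one zero_less_one]
  show "asymptotic_to_cone 6 (cot_gamma p) (\<lambda>_. 1)"
  proof (rule asymptotic_to_coneI)
    fix k :: nat assume "k \<in> {1..6}"
    then have "k \<in> {1, 2} \<or> k \<in> {3, 4} \<or> k \<in> {5, 6}" by auto
    then show "((\<lambda>t. sq_length (cot_gamma p) t k / t\<^sup>2) \<longlongrightarrow> 1) at_top"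
      using A(1)[of k] A(2)[of k] A(3)[of k] by auto
  qed simp
  obtain l where l: "l > 0"
    "((\<lambda>s. 6 * cot_x (p, exp s) * (cot_size (p, exp s) * (sqrt (cot_u (p, exp s)) * sqrt (cot_v (p, exp s))))) \<longlongrightarrow> l) at_top"
    using L(4) by blast
  from cot_fam.tendsto_zeta[OF p, where F = "\<lambda>z. 6 * cot_x (p, z) * (cot_size (p, z) * (sqrt (cot_u (p, z)) * sqrt (cot_v (p, z))))", OF this(2)]
  have "((\<lambda>t. sqrt (sq_length (cot_gamma p) t 7)) \<longlongrightarrow> l) at_top"
  proof (rule Lim_transform_eventually)
    show "\<forall>\<^sub>F t in at_top. 6 * cx p t * (ca p t * (sqrt (cu p t) * sqrt (cv p t))) = sqrt (sq_length (cot_gamma p) t 7)"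
      using eventually_gt_at_top[of 0]
    proof eventually_elim
      case (elim t)
      have "6 * cx p t * (ca p t * (sqrt (cu p t) * sqrt (cv p t))) > 0"
        using cot_bounds(1,3,5)[OF p cot_fam.zeta_pos[OF p elim]] cot_size_pos by simp
      then show ?case unfolding cot_gamma_sq_length(4)[OF p elim] by (simp only: real_sqrt_abs abs_of_pos)
    qed
  qed
  with l(1) show "\<exists>l>0. ((\<lambda>t. sqrt (sq_length (cot_gamma p) t 7)) \<longlongrightarrow> l) at_top" by blast
qed

lemma cot_AC:
  assumes p: "p \<in> P1" and zero: "fst p = 0"
    and q: "\<And>k. k \<in> {1, 2} \<Longrightarrow> q k = 1" "\<And>k. k \<in> {3, 4, 5, 6} \<Longrightarrow> q k = 1/2" "q 7 = 9"
  shows "asymptotic_to_cone 7 (cot_gamma p) q"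
proof -
  note L = cot_limits_AC[OF p zero]
  have half: "(0::real) < 1/2" by simp
  have sqrt: "sqrt (1/2 * (1/2)) = (1/2 :: real)" "sqrt (1/2) * sqrt (1/2) = (1/2 :: real)"
    by (simp_all only: real_sqrt_mult real_sqrt_mult_self abs_divide abs_one abs_numeral)
  have slope: "(1/2 + 1/2 - 1 + 2 * 1 * (1/2) * (1/2)) / (1/2) = (1 :: real)" by simp
  note A = cot_asymptotics[OF p L half half, unfolded sqrt slope]
  show ?thesis
  proof (rule asymptotic_to_coneI)
    fix k :: nat assume "k \<in> {1..7}"
    then have k: "k \<in> {1, 2} \<or> k \<in> {3, 4} \<or> k \<in> {5, 6} \<or> k = 7" by auto
    then show "q k > 0" using q(1)[of k] q(2)[of k] q(3) by auto
    from k show "((\<lambda>t. sq_length (cot_gamma p) t k / t\<^sup>2) \<longlongrightarrow> q k) at_top"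
    proof (elim disjE)
      assume k: "k \<in> {1, 2}"
      show ?thesis unfolding q(1)[OF k] using A(1)[OF k] by simp
    next
      assume k: "k \<in> {3, 4}"
      then have "q k = 1/2" by (intro q(2)) auto
      then show ?thesis using A(2)[OF k] by (simp only: power_one mult_1_left)
    next
      assume k: "k \<in> {5, 6}"
      then have "q k = 1/2" by (intro q(2)) auto
      then show ?thesis using A(3)[OF k] by (simp only: power_one mult_1_left)
    next
      assume k: "k = 7"
      show ?thesis unfolding k q(3) using A(4) by (simp add: power2_eq_square)
    qed
  qed
qed

section \<open>Uniqueness on \<open>M\<^sup>(\<^sup>1\<^sup>)\<close>\<close>

text \<open>Now \<open>c\<close> is the function that tends to 0, so the term with
  \<open>1/c^2\<close> dominates and the bracket multiplying \<open>\<epsilon>\<close> is negative,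
  while \<open>f'\<close> tends to 6. The condition \<open>2 c < a\<close> makes the dominance
  explicit: the positive term is then less than half of the \<open>1/c^2\<close> term.\<close>

lemma cot_chirality:
  assumes sp: "spin7_metric \<epsilon> T (a, b, c, f)" and T: "T > 0" and cl: "closes_up_on_M 1 (a, b, c, f)"
  shows "\<epsilon> = -1"
proof -
  obtain r where r: "r > 0" "(jet1 (a, b, c, f) \<longlongrightarrow> (r, r, 0, 0, 0, 0, 1, 6)) (at_right 0)"
    using cl by (auto simp: closes_up_on_M_def)
  note l0 = tendsto_fst[OF r(2)] tendsto_snd[OF r(2)]
  note l1 = tendsto_fst[OF l0(2)] tendsto_snd[OF l0(2)]
  note l2 = tendsto_fst[OF l1(2)] tendsto_snd[OF l1(2)]
  note l7 = tendsto_snd[OF tendsto_snd[OF tendsto_snd[OF tendsto_snd[OF l2(2)]]]]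
  have lim: "(a \<longlongrightarrow> r) (at_right 0)" "(c \<longlongrightarrow> 0) (at_right 0)" "(deriv f \<longlongrightarrow> 6) (at_right 0)"
    using l0 l1 l2 l7 by simp_all
  have "\<forall>\<^sub>F t in at_right 0. deriv f t > 0" using lim(3) by (rule order_tendstoD) simp
  moreover have "\<forall>\<^sub>F t in at_right 0. a t - c t > 0"
    using order_tendstoD(1)[OF tendsto_diff[OF lim(1,2)], of 0] r(1) by simp
  moreover have "\<forall>\<^sub>F t in at_right 0. t \<in> time_interval T"
    using time_interval_initial[OF T] by (auto simp: eventually_at_right_field)
  moreover have "\<forall>\<^sub>F t in at_right 0. c t * 2 < a t"
    using order_tendstoD(1)[OF tendsto_diff[OF lim(1) tendsto_mult[OF lim(2) tendsto_const[of 2]]], of 0] r(1)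
    by (auto elim: eventually_mono)
  ultimately have "\<forall>\<^sub>F t in at_right (0::real). deriv f t > 0 \<and> a t - c t > 0 \<and> t \<in> time_interval T \<and> c t * 2 < a t"
    by eventually_elim simp
  then obtain t where t: "deriv f t > 0" "c t < a t" "t \<in> time_interval T" "c t * 2 < a t"
    using eventually_happens'[OF trivial_limit_at_right_real] by force
  note D = spin7_metricD[OF sp t(3)]
  have "0 < f t * (\<epsilon> * (1/3 * (f t / (a t)\<^sup>2) - 1/6 * (f t / (b t)\<^sup>2) - 1/6 * (f t / (c t)\<^sup>2)))"
    using t(1) DERIV_imp_deriv[OF D(8)] by simp
  moreover have "1/3 * (f t / (a t)\<^sup>2) - 1/6 * (f t / (b t)\<^sup>2) - 1/6 * (f t / (c t)\<^sup>2) < 0"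
  proof -
    have "(c t * 2)\<^sup>2 < (a t)\<^sup>2" using t(4) D(3) by (intro power_strict_mono) auto
    then have "f t / (a t)\<^sup>2 < f t / (c t * 2)\<^sup>2" using D(1,3,4) by (intro divide_strict_left_mono) auto
    moreover have "f t / (c t * 2)\<^sup>2 = f t / (c t)\<^sup>2 / 4" by (simp add: power_mult_distrib)
    moreover have "f t / (b t)\<^sup>2 > 0" "f t / (c t)\<^sup>2 > 0" using D(2-4) by auto
    moreover have "1/3 * A - 1/6 * B - 1/6 * C < 0" if "A < C / 4" "0 < B" "0 < C" for A B C :: real
      using that by simp
    ultimately show ?thesis by (simp only:)
  qed
  ultimately have "\<epsilon> < 0" using D(4) by (simp add: zero_less_mult_iff)
  then show ?thesis using sp by auto
qed

lemma cot_reducedI: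
  assumes sp: "spin7_metric (- 1) T (a, b, c, f)"
  shows "cot_reduced T (\<lambda>t. f t * a t / (6 * (b t * c t))) (\<lambda>t. (b t / a t)\<^sup>2) (\<lambda>t. (c t / a t)\<^sup>2) a"
  unfolding cot_reduced_def
proof (intro ballI conjI)
  fix t assume t: "t \<in> time_interval T"
  note D = spin7_metricD[OF sp t]
  note pos = D(1-4)
  show "a t > 0" "f t * a t / (6 * (b t * c t)) > 0" "(b t / a t)\<^sup>2 > 0" "(c t / a t)\<^sup>2 > 0" using pos by auto
  have s: "sqrt ((b t / a t)\<^sup>2 * (c t / a t)\<^sup>2) = b t / a t * (c t / a t)"
    using pos by (simp add: real_sqrt_mult)
  have w: "2 / (a t * (b t / a t * (c t / a t))) = 2 * a t / (b t * c t)" using pos by (simp add: field_simps)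
  define A B C F where "A = b t / (a t * c t) + c t / (a t * b t) - a t / (b t * c t) - - 1 / 3 * (f t / (a t)\<^sup>2)"
    and "B = c t / (a t * b t) + a t / (b t * c t) - b t / (a t * c t) + - 1 / 6 * (f t / (b t)\<^sup>2)"
    and "C = a t / (b t * c t) + b t / (a t * c t) - c t / (a t * b t) + - 1 / 6 * (f t / (c t)\<^sup>2)"
    and "F = - 1 * (1/3 * (f t / (a t)\<^sup>2) - 1/6 * (f t / (b t)\<^sup>2) - 1/6 * (f t / (c t)\<^sup>2))"
  have d: "(a has_real_derivative a t * A) (at t)" "(b has_real_derivative b t * B) (at t)"
    "(c has_real_derivative c t * C) (at t)" "(f has_real_derivative f t * F) (at t)"
    unfolding A_def B_def C_def F_def by (rule D)+
  show "(a has_real_derivative ((b t / a t)\<^sup>2 + (c t / a t)\<^sup>2 - 1 + 2 * (f t * a t / (6 * (b t * c t))) * (b t / a t)\<^sup>2 * (c t / a t)\<^sup>2)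
      / sqrt ((b t / a t)\<^sup>2 * (c t / a t)\<^sup>2)) (at t)"
    unfolding s by (rule DERIV_cong[OF d(1)]) (use pos in \<open>simp add: A_def field_simps power2_eq_square\<close>)
  have quot: "((\<lambda>t. (g t / a t)\<^sup>2) has_real_derivative (g t / a t)\<^sup>2 * (2 * (G - A))) (at t)"
    if "(g has_real_derivative g t * G) (at t)" for g G
    by (rule DERIV_cong[OF DERIV_power[OF DERIV_divide[OF that d(1)], of 2]])
      (use pos in \<open>simp_all add: field_simps power2_eq_square\<close>)
  show "((\<lambda>t. (b t / a t)\<^sup>2) has_real_derivative (b t / a t)\<^sup>2 * (2 - 2 * (b t / a t)\<^sup>2 - f t * a t / (6 * (b t * c t)) * (c t / a t)\<^sup>2
      - 2 * (f t * a t / (6 * (b t * c t))) * (b t / a t)\<^sup>2 * (c t / a t)\<^sup>2) * (2 / (a t * sqrt ((b t / a t)\<^sup>2 * (c t / a t)\<^sup>2)))) (at t)"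
    unfolding s w mult.assoc[of "(b t / a t)\<^sup>2"]
    by (rule DERIV_cong[OF quot[OF d(2)] arg_cong[where f = "(*) ((b t / a t)\<^sup>2)"]])
      (use pos in \<open>simp add: A_def B_def field_simps power2_eq_square\<close>)
  show "((\<lambda>t. (c t / a t)\<^sup>2) has_real_derivative (c t / a t)\<^sup>2 * (2 - 2 * (c t / a t)\<^sup>2 - f t * a t / (6 * (b t * c t)) * (b t / a t)\<^sup>2
      - 2 * (f t * a t / (6 * (b t * c t))) * (b t / a t)\<^sup>2 * (c t / a t)\<^sup>2) * (2 / (a t * sqrt ((b t / a t)\<^sup>2 * (c t / a t)\<^sup>2)))) (at t)"
    unfolding s w mult.assoc[of "(c t / a t)\<^sup>2"]
    by (rule DERIV_cong[OF quot[OF d(3)] arg_cong[where f = "(*) ((c t / a t)\<^sup>2)"]])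
      (use pos in \<open>simp add: A_def C_def field_simps power2_eq_square\<close>)
  have x: "((\<lambda>t. f t * a t / (6 * (b t * c t))) has_real_derivative f t * a t / (6 * (b t * c t)) * (F + A - B - C)) (at t)"
    by (rule DERIV_cong[OF DERIV_divide[OF DERIV_mult[OF d(4,1)] DERIV_cmult[OF DERIV_mult[OF d(2,3)]]]])
      (use pos in \<open>simp_all add: field_simps\<close>)
  show "((\<lambda>t. f t * a t / (6 * (b t * c t))) has_real_derivative f t * a t / (6 * (b t * c t)) *
      ((f t * a t / (6 * (b t * c t)) + 1/2) * ((b t / a t)\<^sup>2 + (c t / a t)\<^sup>2) - 3/2) * (2 / (a t * sqrt ((b t / a t)\<^sup>2 * (c t / a t)\<^sup>2)))) (at t)"
    unfolding s w mult.assoc[of "f t * a t / (6 * (b t * c t))"]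
    by (rule DERIV_cong[OF x arg_cong[where f = "(*) (f t * a t / (6 * (b t * c t)))"]])
      (use pos in \<open>simp add: A_def B_def C_def F_def field_simps power2_eq_square\<close>)
qed

text \<open>Translates the field back to \<open>x, u, v\<close>: its components are
  \<open>x' + r'/2\<close>, \<open>v'\<close> and \<open>r' = u' + v'\<close>. This is how a given
  metric is recognised as a trajectory.\<close>

lemma cot_field_point:
  "cot.field (x - 1 + (u + v - 1) / 2, v, u + v - 1) =
    (x * ((x + 1/2) * (u + v) - 3/2)
       + (u * (2 - 2 * u - x * v - 2 * x * u * v) + v * (2 - 2 * v - x * u - 2 * x * u * v)) / 2,
     v * (2 - 2 * v - x * u - 2 * x * u * v),
     u * (2 - 2 * u - x * v - 2 * x * u * v) + v * (2 - 2 * v - x * u - 2 * x * u * v))"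
proof -
  define r where "r = u + v - 1"
  have u: "u = 1 + r - v" by (simp add: r_def)
  have X: "cot_X (x - 1 + r / 2, v, r) = x - 1" "cot_U (x - 1 + r / 2, v, r) = r - v" by (simp_all add: cot_X_def cot_U_def)
  have G: "cot_G3 1 (x - 1 + r / 2, v, r) = u * (2 - 2 * u - x * v - 2 * x * u * v) + v * (2 - 2 * v - x * u - 2 * x * u * v) + 2 * r"
    unfolding cot_G3_def X fst_conv snd_conv u by algebra
  have V: "v + fst (snd (cotangent_field 1 (x - 1 + r / 2, v, r))) = v * (2 - 2 * v - x * u - 2 * x * u * v)"
    unfolding cotangent_field_def X fst_conv snd_conv u by algebra
  have N: "(x - 1 + r / 2) + fst (cotangent_field 1 (x - 1 + r / 2, v, r)) = x * ((x + 1/2) * (u + v) - 3/2)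
       + (u * (2 - 2 * u - x * v - 2 * x * u * v) + v * (2 - 2 * v - x * u - 2 * x * u * v)) / 2"
  proof -
    have "(x - 1 + r / 2) + fst (cotangent_field 1 (x - 1 + r / 2, v, r)) =
      (x - 1) + r / 2 + ((x - 1) * r + (x - 1) * (x - 1) + (x - 1) * (r * (1 * (x - 1) + 3/2))
        + (u * (2 - 2 * u - x * v - 2 * x * u * v) + v * (2 - 2 * v - x * u - 2 * x * u * v) + 2 * r) * (1/2))"
      unfolding cotangent_field_def X G fst_conv snd_conv by (rule refl)
    also have "\<dots> = (x - 1) + (x - 1) * r + (x - 1) * (x - 1) + (x - 1) * (r * (x - 1 + 3/2)) + 3/2 * r
        + (u * (2 - 2 * u - x * v - 2 * x * u * v) + v * (2 - 2 * v - x * u - 2 * x * u * v)) / 2"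
    proof -
      have "y + r / 2 + (A + B + C + (K + 2 * r) * (1/2)) = y + A + B + C + 3/2 * r + K / 2" for y A B C K :: real
        by (simp add: field_simps)
      then show ?thesis unfolding mult_1_left .
    qed
    also have "(x - 1) + (x - 1) * r + (x - 1) * (x - 1) + (x - 1) * (r * (x - 1 + 3/2)) + 3/2 * r = x * ((x + 1/2) * (1 + r) - 3/2)"
      by algebra
    finally show ?thesis by (simp add: r_def)
  qed
  show ?thesis
    using V N G by (simp add: cot.field_def cotangent_field_def r_def)
qed

text \<open>The reduced data are recovered from the given expansions:
  \<open>x = Z_1 Z_4 / 6\<close>, \<open>u = Z_2 / Z_1\<close>, \<open>v = Z_3 / Z_1\<close>, and
  the ratio of the time rates \<open>2a/(bc)\<close> and \<open>trL\<close> is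
  \<open>2 Z_1\<close>.\<close>

theorem cot_unique:
  assumes s: "s \<in> parameters 1" and T: "T > 0" and h: "is_gamma 1 s T h"
  shows "homothetic_on T (cot_gamma (cot_params s)) h"
proof -
  define p where "p = cot_params s"
  have p: "p \<in> P1" using s by (simp add: p_def)
  obtain a b c f where h_eq: "h = (a, b, c, f)" by (cases h) auto
  obtain \<epsilon> where sp\<epsilon>: "spin7_metric \<epsilon> T (a, b, c, f)" and cl: "closes_up_on_M 1 (a, b, c, f)"
    and ge: "gamma_expansion 1 s T (a, b, c, f)" using h by (auto simp: is_gamma_def h_eq)
  have sp: "spin7_metric (- 1) T (a, b, c, f)" using cot_chirality[OF sp\<epsilon> T cl] sp\<epsilon> by simp
  note D = spin7_metricD(1-4)[OF sp]
  define x where "x t = f t * a t / (6 * (b t * c t))" for t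
  define u where "u t = (b t / a t)\<^sup>2" for t
  define v where "v t = (c t / a t)\<^sup>2" for t
  have red: "cot_reduced T x u v a"
    using cot_reducedI[OF sp] by (simp only: x_def[abs_def] u_def[abs_def] v_def[abs_def])
  have m: "sqrt (u t * v t) = b t / a t * (c t / a t)" if "t \<in> time_interval T" for t
    using D[OF that] by (simp add: u_def v_def real_sqrt_mult)
  define L where "L = trL (a, b, c, f)"
  obtain \<eta> \<delta> where e: "0 < \<delta>" "\<delta> \<le> 2 / 3" "\<And>t. t \<in> time_interval T \<Longrightarrow> (\<eta> has_real_derivative L t) (at t)"
    "filterlim \<eta> at_bot (at_right 0)"
    "(\<lambda>t. norm (XZ (a, b, c, f) t - (P0 1 + exp (2 / 3 * \<eta> t) *\<^sub>R (fst s *\<^sub>R v1 1 + snd s *\<^sub>R v2 1)))) \<in> O[at_right 0](\<lambda>t. exp ((2 / 3 + \<delta>) * \<eta> t))"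
    unfolding L_def by (rule gamma_expansion_weaken[OF ge]) blast
  interpret es: expansion_scale "at_right 0" "\<lambda>t. exp (2 / 3 * \<eta> t)" "\<lambda>t. exp ((2 / 3 + \<delta>) * \<eta> t)"
    by (rule expansion_scale_exp[OF e(4,1,2)])
  have lin: "fst s *\<^sub>R v1 1 + snd s *\<^sub>R v2 1 = (6 * snd s, 3 * snd s, 2 * fst s - 3 * snd s, - 4 * fst s - 12 * snd s,
      - fst s - 3 * snd s, - fst s - 6 * snd s, 3 * snd s, - 108 * fst s)"
    by (simp add: v1_def v2_def)
  have P0: "P0 1 = (0, 0, 1/3, 1/3, 1/3, 1/3, 0, 18)" by (simp add: P0_def)
  have "es.expands (\<lambda>t. a t / (b t * c t) / L t) (1/3) (- fst s - 3 * snd s) \<and> es.expands (\<lambda>t. b t / (a t * c t) / L t) (1/3) (- fst s - 6 * snd s)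
      \<and> es.expands (\<lambda>t. c t / (a t * b t) / L t) 0 (3 * snd s) \<and> es.expands (\<lambda>t. f t * L t) 18 (- 108 * fst s)"
    using e(5) unfolding lin P0 XZ.simps Let_def norm_expansion_iff es.expands_def L_def[symmetric] by blast
  then have Z1: "es.expands (\<lambda>t. a t / (b t * c t) / L t) (1/3) (- fst s - 3 * snd s)"
    and Z2: "es.expands (\<lambda>t. b t / (a t * c t) / L t) (1/3) (- fst s - 6 * snd s)"
    and Z3: "es.expands (\<lambda>t. c t / (a t * b t) / L t) 0 (3 * snd s)"
    and Z4: "es.expands (\<lambda>t. f t * L t) 18 (- 108 * fst s)" by blast+
  have in_T: "\<forall>\<^sub>F t in at_right 0. t \<in> time_interval T"
    using time_interval_initial[OF T] by (auto simp: eventually_at_right_field)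
  have "\<forall>\<^sub>F t in at_right 0. b t / (a t * c t) / L t \<noteq> 0"
    by (rule tendsto_imp_eventually_ne[OF es.expands_tendsto[OF Z2]]) simp
  then have L0: "\<forall>\<^sub>F t in at_right 0. L t \<noteq> 0" by eventually_elim auto
  have p_eq: "fst p = - 9 * fst s - 9 * snd s" "fst (snd p) = 9 * snd s" "snd (snd p) = 0"
    by (simp_all add: p_def cot_params_def)
  have "\<forall>\<^sub>F t in at_right 0. (1/6) * ((f t * L t) * (a t / (b t * c t) / L t)) = x t"
    using in_T L0
  proof eventually_elim
    case (elim t)
    then show ?case using D[OF elim(1)] by (simp add: x_def field_simps)
  qed
  then have x_exp: "es.expands x 1 (fst p)"
    using es.expands_eq[OF es.expands_mult[OF es.expands_const[of "1/6"] es.expands_mult[OF Z4 Z1]], of 1 "fst p"] es.expands_cong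
    by (auto simp: p_eq)
  have "\<forall>\<^sub>F t in at_right 0. (b t / (a t * c t) / L t) / (a t / (b t * c t) / L t) = u t"
    using in_T L0
  proof eventually_elim
    case (elim t)
    then show ?case using D[OF elim(1)] by (simp add: u_def field_simps power2_eq_square)
  qed
  then have u_exp: "es.expands u 1 (- fst (snd p))"
    using es.expands_eq[OF es.expands_divide[OF Z2 Z1], of 1 "- fst (snd p)"] es.expands_cong
    by (auto simp: p_eq)
  have "\<forall>\<^sub>F t in at_right 0. (c t / (a t * b t) / L t) / (a t / (b t * c t) / L t) = v t"
    using in_T L0
  proof eventually_elim
    case (elim t)
    then show ?case using D[OF elim(1)] by (simp add: v_def field_simps power2_eq_square)
  qed
  then have v_exp: "es.expands v 0 (fst (snd p))"
    using es.expands_eq[OF es.expands_divide[OF Z3 Z1], of 0 "fst (snd p)"] es.expands_cong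
    by (auto simp: p_eq)
  define V where "V t = (x t - 1 + (u t + v t - 1) / 2, v t, u t + v t - 1)" for t
  have pt: "pt_x (V t) = x t" "pt_u (V t) = u t" "cot_m (V t) = sqrt (u t * v t)"
    "cot_g (V t) = (u t + v t - 1 + 2 * x t * u t * v t) / 2" for t
    by (simp_all add: V_def pt_x_def pt_u_def cot_m_def cot_g_def)
  have "\<forall>\<^sub>F t in at_right 0. 2 * (a t / (b t * c t) / L t) = 2 / (a t * cot_m (V t)) / L t"
    using in_T
  proof eventually_elim
    case (elim t)
    then show ?case unfolding pt m[OF elim] using D[OF elim] by (simp add: field_simps)
  qed
  then have w_exp: "es.expands (\<lambda>t. 2 / (a t * cot_m (V t)) / L t) (2/3) (2 * (- fst s - 3 * snd s))"
    using es.expands_eq[OF es.expands_mult[OF es.expands_const[of 2] Z1], of "2/3" "2 * (- fst s - 3 * snd s)"] es.expands_cong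
    by auto
  have "\<exists>\<mu>>0. \<forall>t\<in>time_interval T. a t = \<mu> * cot_size (p, cot_fam.zeta p (t / \<mu>)) \<and> V t = cot.traj p (cot_fam.zeta p (t / \<mu>))"
  proof (rule cot_fam.homothetic_to_family[OF p T e(1,2,3,4)])
    fix t assume t: "t \<in> time_interval T"
    have pos: "a t > 0" "x t > 0" "u t > 0" "v t > 0" using red t by (auto simp: cot_reduced_def)
    let ?w = "2 / (a t * sqrt (u t * v t))"
    have d: "(x has_real_derivative x t * ((x t + 1/2) * (u t + v t) - 3/2) * ?w) (at t)"
      "(u has_real_derivative u t * (2 - 2 * u t - x t * v t - 2 * x t * u t * v t) * ?w) (at t)"
      "(v has_real_derivative v t * (2 - 2 * v t - x t * u t - 2 * x t * u t * v t) * ?w) (at t)"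
      "(a has_real_derivative (u t + v t - 1 + 2 * x t * u t * v t) / sqrt (u t * v t)) (at t)"
      using red t unfolding cot_reduced_def by blast+
    let ?X = "x t * ((x t + 1/2) * (u t + v t) - 3/2)" and ?U = "u t * (2 - 2 * u t - x t * v t - 2 * x t * u t * v t)"
      and ?V = "v t * (2 - 2 * v t - x t * u t - 2 * x t * u t * v t)"
    have "((\<lambda>t. x t - 1 + (u t + v t - 1) / 2) has_real_derivative ?X * ?w - 0 + (?U * ?w + ?V * ?w - 0) / 2) (at t)"
      "((\<lambda>t. u t + v t - 1) has_real_derivative ?U * ?w + ?V * ?w - 0) (at t)"
      by (intro DERIV_add DERIV_diff DERIV_cdivide DERIV_const d)+
    then have "(V has_vector_derivative (?X * ?w - 0 + (?U * ?w + ?V * ?w - 0) / 2, ?V * ?w, ?U * ?w + ?V * ?w - 0)) (at t)"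
      unfolding V_def has_real_derivative_iff_has_vector_derivative
      by (intro has_vector_derivative_Pair d(3)[unfolded has_real_derivative_iff_has_vector_derivative])
    moreover have "(X * w - 0 + (U * w + W * w - 0) / 2, W * w, U * w + W * w - 0) = w *\<^sub>R (X + (U + W) / 2, W, U + W)" for X U W w :: real
      by (simp add: field_simps)
    ultimately show "(V has_vector_derivative (2 / (a t * cot_m (V t))) *\<^sub>R cot.field (V t)) (at t)"
      unfolding pt unfolding V_def[of t] cot_field_point by (simp only:)
    have "A / r = 2 / r * (A / 2)" for A r :: real by simp
    from DERIV_cong[OF d(4) this]
    show "(a has_real_derivative 2 / cot_m (V t) * cot_g (V t)) (at t)" unfolding pt .
    show "a t > 0" by (rule pos)
    show "cot_m (V t) > 0" unfolding pt using pos by simp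
    show "isCont (\<lambda>t. cot_m (V t)) t"
      unfolding pt by (intro continuous_intros DERIV_isCont[OF d(2)] DERIV_isCont[OF d(3)])
  next
    show "es.expands (\<lambda>t. 2 / (a t * cot_m (V t)) / L t) (2/3) (2 * (- fst s - 3 * snd s))" by (rule w_exp)
    have r: "es.expands (\<lambda>t. u t + v t - 1) 0 0"
      using es.expands_diff[OF es.expands_add[OF u_exp v_exp] es.expands_const[of 1]] by simp
    then show "es.expands (\<lambda>t. snd (snd (V t))) 0 (snd (snd p))" by (simp add: V_def p_eq)
    show "es.expands (\<lambda>t. fst (V t)) 0 (fst p)"
      using es.expands_add[OF es.expands_diff[OF x_exp es.expands_const[of 1]] es.expands_mult[OF es.expands_const[of "1/2"] r]]
      by (simp add: V_def)
    show "es.expands (\<lambda>t. fst (snd (V t))) 0 (fst (snd p))" using v_exp by (simp add: V_def)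
  qed
  then obtain \<mu> where mu: "\<mu> > 0" "\<And>t. t \<in> time_interval T \<Longrightarrow> a t = \<mu> * ca p (t / \<mu>)"
    "\<And>t. t \<in> time_interval T \<Longrightarrow> V t = cot.traj p (cot_fam.zeta p (t / \<mu>))" by blast
  show ?thesis
    unfolding homothetic_on_def p_def[symmetric]
  proof (intro exI[of _ \<mu>] conjI ballI mu)
    fix t assume t: "t \<in> time_interval T"
    have xuv: "x t = cx p (t / \<mu>)" "u t = cu p (t / \<mu>)" "v t = cv p (t / \<mu>)"
    proof -
      show x: "x t = cx p (t / \<mu>)" and u: "u t = cu p (t / \<mu>)"
        using pt(1,2)[of t] unfolding mu(3)[OF t] cot_traj_values by simp_all
      show "v t = cv p (t / \<mu>)" using mu(3)[OF t] unfolding cot_traj V_def by simp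
    qed
    note Dt = D[OF t]
    have sq: "sqrt (u t) = b t / a t" "sqrt (v t) = c t / a t" using Dt by (simp_all add: u_def v_def)
    have "b t = a t * sqrt (u t)" "c t = a t * sqrt (v t)" "f t = 6 * x t * (a t * (sqrt (u t) * sqrt (v t)))"
      using Dt unfolding sq by (simp_all add: x_def)
    then show "metric_at h t = \<mu> *\<^sub>R metric_at (cot_gamma p) (t / \<mu>)"
      using mu(2)[OF t] by (simp add: h_eq cot_gamma_def cot_metric_def xuv)
  qed
qed

section \<open>The main theorem\<close>

lemma parameters_params_cont:
  "continuous_on S spinor_params" "continuous_on S cot_params"
  unfolding spinor_params_def[abs_def] cot_params_def[abs_def] by (intro continuous_intros)+

text \<open>The limit inside \<open>extended_jet1\<close> is replaced by an explicit jet that is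
  continuous up to \<open>t = 0\<close>; the dependence on the parameters then enters through the
  continuous map \<open>c\<close>.\<close>

lemma extended_jet_cont:
  assumes jet: "\<And>p t. p \<in> P \<Longrightarrow> t \<ge> 0 \<Longrightarrow> extended_jet1 (G p) t = J p t"
    and J: "continuous_on (P \<times> {0..}) (\<lambda>q. J (fst q) (snd q))"
    and c: "continuous_on S c" "c ` S \<subseteq> P"
  shows "continuous_on (S \<times> {0..}) (\<lambda>(s, t). extended_jet1 (G (c s)) t)"
proof -
  have "continuous_on (S \<times> {0..}) (\<lambda>q. c (fst q))"
    by (rule continuous_on_compose2[OF c(1)]) (auto intro!: continuous_intros)
  then have pair: "continuous_on (S \<times> {0..}) (\<lambda>q. (c (fst q), snd q))"
    by (intro continuous_intros)
  have "continuous_on (S \<times> {0..}) (\<lambda>q. J (c (fst q)) (snd q))"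
    by (rule continuous_on_compose2[OF J pair, unfolded fst_conv snd_conv]) (use c(2) in auto)
  then show ?thesis
    by (rule continuous_on_cong[THEN iffD1, OF refl, rotated]) (use jet c(2) in auto)
qed

lemma ALC_nearly_kaehler_flagI:
  assumes "asymptotic_to_cone 6 g (\<lambda>_. 1)" "\<exists>l>0. ((\<lambda>t. sqrt (sq_length g t 7)) \<longlongrightarrow> l) at_top"
  shows "ALC_nearly_kaehler_flag g"
  unfolding ALC_nearly_kaehler_flag_def
proof
  show "\<exists>r>0. homogeneous_nearly_kaehler 6 (\<lambda>_. r) \<and> cone_has_holonomy_G2 (\<lambda>_. r) \<and> asymptotic_to_cone 6 g (\<lambda>_. r)"
    using assms(1) flag_nearly_kaehler flag_cone_holonomy zero_less_one by blast
qed (rule assms(2))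

theorem theorem1p2:
  shows "\<exists>(\<gamma> :: nat \<Rightarrow> real \<times> real \<Rightarrow> coh1_metric) (\<epsilon> :: real).
    (\<forall>i\<in>{1, 2}.
        (\<forall>s\<in>parameters i.
            is_gamma i s \<infinity> (\<gamma> i s)
          \<and> (\<forall>T h. T > 0 \<and> is_gamma i s T h \<longrightarrow> homothetic_on T (\<gamma> i s) h))
      \<and> continuous_on (parameters i \<times> {0..}) (\<lambda>(s, t). extended_jet1 (\<gamma> i s) t))
  \<and> (\<forall>s\<in>parameters 2. spin7_metric \<epsilon> \<infinity> (\<gamma> 2 s))
  \<and> (\<forall>s\<in>parameters 1. spin7_metric (- \<epsilon>) \<infinity> (\<gamma> 1 s))
  \<and> (\<forall>i\<in>{1, 2}. \<forall>s\<in>parameters i.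
        (fst s > s_star i \<longrightarrow> ALC_nearly_kaehler_flag (\<gamma> i s))
      \<and> (fst s = s_star i \<longrightarrow> (\<exists>q. AC_over (\<gamma> i s) q \<and> homogeneous_einstein 7 q)))"
proof -
  define \<gamma> where "\<gamma> i s = (if i = 2 then spinor_gamma (spinor_params s) else cot_gamma (cot_params s))" for i :: nat and s
  have g: "\<gamma> 2 = (\<lambda>s. spinor_gamma (spinor_params s))" "\<gamma> 1 = (\<lambda>s. cot_gamma (cot_params s))"
    by (simp_all add: \<gamma>_def fun_eq_iff)
  have p2: "spinor_params s \<in> P2" if "s \<in> parameters 2" for s using that by (rule imageI)
  have p1: "cot_params s \<in> P1" if "s \<in> parameters 1" for s using that by (rule imageI)
  have two: "is_gamma 2 s \<infinity> (\<gamma> 2 s)" if "s \<in> parameters 2" for s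
    unfolding is_gamma_def g
    using spinor_gamma_spin7[OF p2[OF that]] spinor_closes_up[OF p2[OF that]] spinor_gamma_expansion[OF that] by blast
  have one: "is_gamma 1 s \<infinity> (\<gamma> 1 s)" if "s \<in> parameters 1" for s
    unfolding is_gamma_def g
    using cot_gamma_spin7[OF p1[OF that]] cot_closes_up[OF p1[OF that]] cot_gamma_expansion[OF that] by blast
  have unique2: "homothetic_on T (\<gamma> 2 s) h" if "s \<in> parameters 2" "T > 0 \<and> is_gamma 2 s T h" for s T h
    unfolding g using spinor_unique that by blast
  have unique1: "homothetic_on T (\<gamma> 1 s) h" if "s \<in> parameters 1" "T > 0 \<and> is_gamma 1 s T h" for s T h
    unfolding g using cot_unique that by blast
  have cont2: "continuous_on (parameters 2 \<times> {0..}) (\<lambda>(s, t). extended_jet1 (\<gamma> 2 s) t)"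
    unfolding g by (rule extended_jet_cont[OF _ spinor_jet_cont parameters_params_cont(1) order_refl])
      (rule spinor_singular_orbit(2); assumption)
  have cont1: "continuous_on (parameters 1 \<times> {0..}) (\<lambda>(s, t). extended_jet1 (\<gamma> 1 s) t)"
    unfolding g by (rule extended_jet_cont[OF _ cot_jet_cont parameters_params_cont(2) order_refl])
      (rule cot_singular_orbit(2); assumption)
  have ALC2: "ALC_nearly_kaehler_flag (\<gamma> 2 s)" if s: "s \<in> parameters 2" "fst s > s_star 2" for s
  proof -
    have "fst (spinor_params s) < 0"
      using spinor_threshold[OF s(1)] s(2) by (simp add: spinor_params_def)
    from spinor_ALC[OF p2[OF s(1)] this] show ?thesis unfolding g by (rule ALC_nearly_kaehler_flagI)
  qed
  have ALC1: "ALC_nearly_kaehler_flag (\<gamma> 1 s)" if s: "s \<in> parameters 1" "fst s > s_star 1" for s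
  proof -
    have "fst (cot_params s) < 0"
      using cot_threshold[OF s(1)] s(2) by (simp add: cot_params_def)
    from cot_ALC[OF p1[OF s(1)] this] show ?thesis unfolding g by (rule ALC_nearly_kaehler_flagI)
  qed
  have AC2: "\<exists>q. AC_over (\<gamma> 2 s) q \<and> homogeneous_einstein 7 q" if s: "s \<in> parameters 2" "fst s = s_star 2" for s
  proof -
    have "fst (spinor_params s) = 0"
      using spinor_threshold(2)[OF s(1)] s(2) by (simp add: spinor_params_def)
    then have "asymptotic_to_cone 7 (\<gamma> 2 s) squashed_metric"
      unfolding g by (rule spinor_AC[OF p2[OF s(1)]]) (auto simp: squashed_metric_def)
    then show ?thesis
      unfolding AC_over_def using invariant_squashed einstein_squashed by blast
  qed
  have AC1: "\<exists>q. AC_over (\<gamma> 1 s) q \<and> homogeneous_einstein 7 q" if s: "s \<in> parameters 1" "fst s = s_star 1" for s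
  proof -
    have "fst (cot_params s) = 0"
      using cot_threshold(2)[OF s(1)] s(2) by (simp add: cot_params_def)
    then have "asymptotic_to_cone 7 (\<gamma> 1 s) three_sasakian_metric"
      unfolding g by (rule cot_AC[OF p1[OF s(1)]]) (auto simp: three_sasakian_metric_def)
    then show ?thesis
      unfolding AC_over_def using invariant_three_sasakian einstein_three_sasakian by blast
  qed
  have spin2: "spin7_metric 1 \<infinity> (\<gamma> 2 s)" if "s \<in> parameters 2" for s
    unfolding g by (rule spinor_gamma_spin7[OF p2[OF that]])
  have spin1: "spin7_metric (- 1) \<infinity> (\<gamma> 1 s)" if "s \<in> parameters 1" for s
    unfolding g by (rule cot_gamma_spin7[OF p1[OF that]])
  show ?thesis
    \<comment> \<open>The witness 1 for \<open>\<epsilon>\<close> is the chirality on the bundle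
      with index 2, as forced by \<open>spinor_chirality\<close>.\<close>
    by (intro exI[of _ \<gamma>] exI[of _ "1::real"])
      (use two one unique2 unique1 cont2 cont1 ALC2 ALC1 AC2 AC1 spin2 spin1 in blast)
qed

end
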